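(* Let $d\ge1$, $1\le p\le\infty$, $u\in L^p(\mathbb{R}^d)$ and $r>0$. With $L_p(s,u,r)$ and $T_p(s,u,r)$ ($s\in[0,1]$) the short- and long-range interactions defined in the context, the following hold. (A) The map $s\mapsto L_p(s,u,r)$ is continuous and increasing; namely $L_p(\eta,u,r)\le L_p(s,u,r)$ for $0\le\eta<s\le1$. In fact, for $p=\infty$ one has the better estimate $2^{-\eta}L_\infty(\eta,u,r)\le 2^{-s}L_\infty(s,u,r)$. (B) The map $s\mapsto T_p(s,u,r)$ is continuous, and for $0\le\sigma<\eta\le1$ $$T_p(\eta,u,r)\le 2^{1+\frac1p}\sigma^{\frac1p}r^\sigma\Big(\int_0^\infty\frac{U(t)}{t^{1+\sigma p}}\,dt\Big)^{\frac1p}=2^{1+\frac1p}r^\sigma(1-\sigma)^{-\frac1p}[u]_{W^{\sigma,p}(\mathbb{R}^d)}.$$ (C) If $d\ge2$, then the map $s\mapsto T_p(s,u,r)$ is $2$-almost decreasing, that is, $$T_p(\eta,u,r)\le 2\,T_p(\sigma,u,r)\qquad\text{for }0\le\sigma<\eta\le1.$$ In fact, this estimate remains true provided that $d\ge2$ or $\sigma=0$ or $p=2$ or $p=\infty$.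
   Context: Conventions: $1/p=0$ for $p=\infty$. $|\mathbb{S}^{d-1}|=2\pi^{d/2}/\Gamma(d/2)$, $K_{d,p}=\frac{\Gamma(d/2)\Gamma((p+1)/2)}{\Gamma((d+p)/2)\Gamma(1/2)}$, and $\sigma_{d-1}$ is the surface measure on $\mathbb{S}^{d-1}$. For $1\le p<\infty$, $[u]^p_{W^{s,p}(\mathbb{R}^d)}$ is $\frac{2|\mathbb{S}^{d-1}|}{p}\|u\|^p_{L^p(\mathbb{R}^d)}$ if $s=0$; $s(1-s)\iint_{\mathbb{R}^d\times\mathbb{R}^d}\frac{|u(x)-u(y)|^p}{|x-y|^{d+sp}}\,dy\,dx$ if $0<s<1$; $K_{d,p}\frac{|\mathbb{S}^{d-1}|}{p}\|\nabla u\|^p_{L^p(\mathbb{R}^d)}$ if $s=1$ (value $+\infty$ if $u\notin W^{s,p}(\mathbb{R}^d)$). For $p=\infty$, $[u]_{W^{s,\infty}(\mathbb{R}^d)}$ is $\|u\|_{L^\infty}$ if $s=0$; $\sup_{x\ne y}\frac{|u(x)-u(y)|}{|x-y|^s}$ if $0<s<1$; $\|\nabla u\|_{L^\infty}$ if $s=1$. For $1\le p<\infty$ set $U(t)=\int_{\mathbb{S}^{d-1}}\int_{\mathbb{R}^d}|u(x+t\omega)-u(x)|^p\,dx\,d\sigma_{d-1}(\omega)$ and $$L_p(s,u,r)=\frac{(1-s)^{1/p}}{(2r)^{1-s}}\Big(\int_0^r\frac{U(t)}{t^{1+sp}}\,dt\Big)^{1/p}\ (0\le s<1),\qquad L_p(1,u,r)=[u]_{W^{1,p}(\mathbb{R}^d)},$$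 $$T_p(s,u,r)=s^{1/p}r^s\Big(\int_r^\infty\frac{U(t)}{t^{1+sp}}\,dt\Big)^{1/p}\ (0<s\le1),\qquad T_p(0,u,r)=[u]_{W^{0,p}(\mathbb{R}^d)}.$$ For $p=\infty$: $$L_\infty(s,u,r)=(2r)^{-(1-s)}\sup_{0<|x-y|\le r}\frac{|u(x)-u(y)|}{|x-y|^s}\ (0\le s<1),\quad L_\infty(1,u,r)=[u]_{W^{1,\infty}(\mathbb{R}^d)},$$ $$T_\infty(s,u,r)=r^s\sup_{|x-y|\ge r}\frac{|u(x)-u(y)|}{|x-y|^s}\ (0<s\le1),\quad T_\infty(0,u,r)=[u]_{W^{0,\infty}(\mathbb{R}^d)}.$$ $L_p(\cdot,u,r)$ takes values in $[0,\infty]$. In (B), when $\sigma=0$ or $p=\infty$, the middle expression is to be read as the right-hand one, $2^{1+\frac1p}r^\sigma(1-\sigma)^{-\frac1p}[u]_{W^{\sigma,p}(\mathbb{R}^d)}$.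
   Formalization: Continuity of L_p is stated where L_p is finite, plus left-continuity on (0,1] except at s=1 for p=1, u in BV but not W^{1,1}; continuity of T_p for p=∞ only on (0,1]. It can fail otherwise (|x|^a cut off; u=1). Suprema for p=∞ are essential suprema. *)

theory Defs
  imports "HOL-Analysis.Analysis" "HOL-Probability.Essential_Supremum"
begin

text \<open>The space $\mathbb{R}^d$ is an arbitrary \<^class>\<open>euclidean_space\<close>, with $d$ its dimension.
  An exponent $p \in [1,\infty]$ has type \<^typ>\<open>ennreal\<close>. Since \<^prop>\<open>inverse top = (0::ennreal)\<close>,
  the convention $1/\infty = 0$ is built into \<open>recip\<close>.\<close>

definition recip :: "ennreal \<Rightarrow> real" where
  "recip p = enn2real (inverse p)"

text \<open>Powers of extended nonnegative reals, only used for exponents $a > 0$.\<close>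

definition rpow :: "ennreal \<Rightarrow> real \<Rightarrow> ennreal" where
  "rpow x a = (if x = \<infinity> then \<infinity> else ennreal (enn2real x powr a))"


subsection \<open>Lebesgue spaces\<close>

definition Lp_norm :: "ennreal \<Rightarrow> ('a::euclidean_space \<Rightarrow> 'b::euclidean_space) \<Rightarrow> ennreal" where
  "Lp_norm p f =
     (if p = \<infinity> then esssup lebesgue (\<lambda>x. ennreal (norm (f x)))
      else rpow (\<integral>\<^sup>+x. ennreal (norm (f x) powr enn2real p) \<partial>lebesgue) (recip p))"

definition Lp_space :: "ennreal \<Rightarrow> ('a::euclidean_space \<Rightarrow> 'b::euclidean_space) set" where
  "Lp_space p = {f. f \<in> borel_measurable lebesgue \<and> Lp_norm p f < \<infinity>}"


subsection \<open>Weak gradients and first order Sobolev spaces\<close>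

fun Ck :: "nat \<Rightarrow> ('a::euclidean_space \<Rightarrow> real) \<Rightarrow> bool" where
  "Ck 0 f \<longleftrightarrow> continuous_on UNIV f"
| "Ck (Suc k) f \<longleftrightarrow> (\<forall>x. f differentiable (at x)) \<and>
     (\<forall>i\<in>Basis. Ck k (\<lambda>x. frechet_derivative f (at x) i))"

definition test_function :: "('a::euclidean_space \<Rightarrow> real) \<Rightarrow> bool" where
  "test_function \<phi> \<longleftrightarrow> (\<forall>k. Ck k \<phi>) \<and> compact (closure {x. \<phi> x \<noteq> 0})"

definition weak_gradient :: "('a::euclidean_space \<Rightarrow> real) \<Rightarrow> ('a \<Rightarrow> 'a) \<Rightarrow> bool" where
  "weak_gradient u g \<longleftrightarrow>
     (\<forall>K. compact K \<longrightarrow> set_integrable lebesgue K g) \<and>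
     (\<forall>\<phi>. test_function \<phi> \<longrightarrow> (\<forall>i\<in>Basis.
        (LINT x|lebesgue. u x * frechet_derivative \<phi> (at x) i) =
        - (LINT x|lebesgue. (g x \<bullet> i) * \<phi> x)))"

definition sobolev_space1 :: "ennreal \<Rightarrow> ('a::euclidean_space \<Rightarrow> real) set" where
  "sobolev_space1 p = {u. u \<in> Lp_space p \<and> (\<exists>g. weak_gradient u g \<and> g \<in> Lp_space p)}"

text \<open>Weak gradients are unique up to null sets, so the choice below is immaterial.\<close>

definition weak_grad :: "('a::euclidean_space \<Rightarrow> real) \<Rightarrow> 'a \<Rightarrow> 'a" where
  "weak_grad u = (SOME g. weak_gradient u g)"

text \<open>The space $BV$: each distributional partial derivative is a finite signed measure.\<close>

definition BV_space :: "('a::euclidean_space \<Rightarrow> real) set" where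
  "BV_space = {u. u \<in> Lp_space 1 \<and>
     (\<exists>C. \<forall>\<phi>. test_function \<phi> \<and> (\<forall>x. \<bar>\<phi> x\<bar> \<le> 1) \<longrightarrow>
        (\<forall>i\<in>Basis. (LINT x|lebesgue. u x * frechet_derivative \<phi> (at x) i) \<le> C))}"


subsection \<open>The seminorms\<close>

definition sphere_area :: "nat \<Rightarrow> real" where
  "sphere_area d = 2 * pi powr (real d / 2) / Gamma (real d / 2)"

definition K_const :: "nat \<Rightarrow> real \<Rightarrow> real" where
  "K_const d q = Gamma (real d / 2) * Gamma ((q + 1) / 2) / (Gamma ((real d + q) / 2) * Gamma (1 / 2))"

text \<open>Surface measure on the unit sphere, as a Borel measure on the whole space:
  $\sigma_{d-1}(A) = d\,|\{t\omega : 0 < t \le 1,\ \omega \in A\}|$ for Borel subsets $A$ of the sphere.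
  For $d = 1$ this is counting measure on $\{-1, 1\}$. (\<^term>\<open>sgn x\<close> is $x/|x|$.)\<close>

definition sphere_measure :: "'a::euclidean_space measure" where
  "sphere_measure =
     scale_measure (ennreal (real DIM('a)))
       (distr (restrict_space lborel (cball 0 1 - {0})) borel sgn)"

text \<open>The supremum of $|u(x)-u(y)|/|x-y|^s$ over a set $A$ of pairs. Elements of $L^\infty$ are
  defined up to null sets, hence this is an essential supremum. On the sets
  used below it agrees with the ordinary supremum when $u$ is continuous.\<close>

definition holder_sup :: "real \<Rightarrow> ('a::euclidean_space \<Rightarrow> real) \<Rightarrow> ('a \<times> 'a) set \<Rightarrow> ennreal" where
  "holder_sup s u A =
     esssup (restrict_space (lebesgue \<Otimes>\<^sub>M lebesgue) A)
       (\<lambda>(x, y). ennreal (\<bar>u x - u y\<bar> / norm (x - y) powr s))"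

definition sobolev_seminorm :: "real \<Rightarrow> ennreal \<Rightarrow> ('a::euclidean_space \<Rightarrow> real) \<Rightarrow> ennreal" where
  "sobolev_seminorm s p u =
     (let q = enn2real p; d = DIM('a) in
      if p = \<infinity> then
        (if s = 0 then Lp_norm \<infinity> u
         else if s = 1 then
           (if u \<in> sobolev_space1 \<infinity> then Lp_norm \<infinity> (weak_grad u) else \<infinity>)
         else holder_sup s u {(x, y). x \<noteq> y})
      else rpow
        (if s = 0 then ennreal (2 * sphere_area d / q) * rpow (Lp_norm p u) q
         else if s = 1 then
           (if u \<in> sobolev_space1 p
            then ennreal (K_const d q * sphere_area d / q) * rpow (Lp_norm p (weak_grad u)) q
            else \<infinity>)
         else ennreal (s * (1 - s)) *
           (\<integral>\<^sup>+(x, y). ennreal (\<bar>u x - u y\<bar> powr q / norm (x - y) powr (real d + s * q))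
              \<partial>(lebesgue \<Otimes>\<^sub>M lebesgue)))
        (recip p))"


subsection \<open>Short- and long-range interactions\<close>

definition U_fun :: "real \<Rightarrow> ('a::euclidean_space \<Rightarrow> real) \<Rightarrow> real \<Rightarrow> ennreal" where
  "U_fun q u t =
     (\<integral>\<^sup>+\<omega>. (\<integral>\<^sup>+x. ennreal (\<bar>u (x + t *\<^sub>R \<omega>) - u x\<bar> powr q) \<partial>lebesgue) \<partial>sphere_measure)"

definition U_integral :: "real \<Rightarrow> ennreal \<Rightarrow> ('a::euclidean_space \<Rightarrow> real) \<Rightarrow> real set \<Rightarrow> ennreal" where
  "U_integral s p u I =
     (\<integral>\<^sup>+t\<in>I. U_fun (enn2real p) u t / ennreal (t powr (1 + s * enn2real p)) \<partial>lborel)"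

definition short_range ::
  "ennreal \<Rightarrow> real \<Rightarrow> ('a::euclidean_space \<Rightarrow> real) \<Rightarrow> real \<Rightarrow> ennreal" where
  "short_range p s u r =
     (if s = 1 then sobolev_seminorm 1 p u
      else if p = \<infinity> then
        ennreal ((2 * r) powr (- (1 - s))) * holder_sup s u {(x, y). 0 < norm (x - y) \<and> norm (x - y) \<le> r}
      else
        ennreal ((1 - s) powr recip p / (2 * r) powr (1 - s)) *
        rpow (U_integral s p u {0<..<r}) (recip p))"

definition long_range ::
  "ennreal \<Rightarrow> real \<Rightarrow> ('a::euclidean_space \<Rightarrow> real) \<Rightarrow> real \<Rightarrow> ennreal" where
  "long_range p s u r =
     (if s = 0 then sobolev_seminorm 0 p u
      else if p = \<infinity> then
        ennreal (r powr s) * holder_sup s u {(x, y). norm (x - y) \<ge> r}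
      else
        ennreal (s powr recip p * r powr s) * rpow (U_integral s p u {r<..}) (recip p))"

end

theory Submission imports Defs "HOL-Probability.Probability_Measure" begin

text \<open>For finite \<open>p\<close>, splitting \<open>(0, r)\<close> dyadically turns \<open>L\<^sub>p(s,u,r)\<^sup>p\<close> into
 \<open>\<kappa>(a)/p\<close> times an integral over \<open>(r/2, r)\<close> of \<open>\<Sum>\<^sub>j (t/(2\<^sup>j r))\<^sup>a \<delta>\<^sub>j(t)/t\<close>, where \<open>a = (1-s)p\<close>,
 \<open>\<kappa>(a) = a/(2\<^sup>a-1)\<close> is decreasing, and \<open>\<delta>\<^sub>j \<ge> 0\<close> is the increment of \<open>U(t)/t\<^sup>p\<close> between \<open>t/2\<^sup>j\<^sup>-\<^sup>1\<close>
 and \<open>t/2\<^sup>j\<close>; it is nonnegative since \<open>U(2t) \<le> 2\<^sup>p U(t)\<close>. Monotonicity and continuity in \<open>a\<close> are then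
 visible, also at \<open>a = 0\<close>, where the series telescopes to the limit of \<open>U(t)/t\<^sup>p\<close>. That limit is the
 gradient seminorm: bounded dyadic difference quotients have a weak limit, for \<open>p > 1\<close> by uniform
 convexity, while for \<open>p = 1\<close> they only give \<open>u \<in> BV\<close>.

 The long-range term is an average of \<open>U\<close> against a Pareto law on \<open>(r, \<infinity>)\<close> that decreases stochastically
 in \<open>s\<close>. For (B) one dominates \<open>U(\<tau>)\<close>, \<open>\<tau> \<le> t\<close>, by the mean of \<open>U\<close> over \<open>(0, t)\<close>. For (C) with \<open>d \<ge> 2\<close>,
 a vector of length \<open>t\<close> is a difference of two vectors of length \<open>\<tau> \<ge> t\<close>, whence \<open>U(t) \<le> 2\<^sup>p U(\<tau>)\<close>; for \<open>p = 2\<close>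
 the identity \<open>E W\<^sup>2 = (E W)\<^sup>2 + Var W\<close>, for \<open>W\<close> the increment of \<open>u\<close> translated by a Pareto multiple of
 itself, bounds \<open>U(t)\<close> by \<open>(4 + O(s))\<close> times the average. For \<open>p = \<infinity>\<close> everything follows from log-convexity
 of \<open>s \<mapsto> D w\<^sup>s\<close> and from the equivalence of Lipschitz bounds with bounded weak gradients.\<close>

text \<open>The factor 2 in \<open>(2r)^(1-s)\<close> decides the monotonicity in (A). Summation
  over the dyadic scales gives \<open>1/(1 - 2^(-a))\<close>, and it is the \<open>2^(-a)\<close>
  hidden in \<open>(2r)^(-a)\<close> that turns the constant into \<open>a/(2^a - 1)\<close>, which
  decreases in \<open>a\<close>, instead of \<open>a/(1 - 2^(-a))\<close>, which increases. At
  \<open>s = 1\<close> the obstacle is that finiteness of an averaged limit controls the difference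
  quotients only in almost every direction of an annulus. The good directions are stable under
  differences and under doubling, and this makes them all directions. For \<open>p = 2\<close> the
  bound on \<open>U(t)\<close> is averaged once more over a Pareto law. The product of independent
  Pareto variables with exponents \<open>b < a\<close> has a law whose mixture with the
  \<open>a\<close>-law is the \<open>b\<close>-law, and the weight of the \<open>a\<close>-law in
  this mixture is large enough to absorb the surplus \<open>O(s)\<close>, so that exactly 4 remains,
  hence 2 after the square root. Everything is proved for a Borel representative, where Fubini
  applies directly, and carried over to \<open>u\<close> at the end.\<close>

abbreviation nn_lborel :: "('a::euclidean_space \<Rightarrow> ennreal) \<Rightarrow> ennreal" (binder "NN " 10)
 where "nn_lborel f \<equiv> \<integral>\<^sup>+x. f x \<partial>lborel"

abbreviation nn_sphere :: "('a::euclidean_space \<Rightarrow> ennreal) \<Rightarrow> ennreal" (binder "SS " 10)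
 where "nn_sphere f \<equiv> \<integral>\<^sup>+x. f x \<partial>sphere_measure"

abbreviation integral_lborel :: "('a::euclidean_space \<Rightarrow> real) \<Rightarrow> real" (binder "LL " 10)
 where "integral_lborel f \<equiv> \<integral>x. f x \<partial>lborel"

abbreviation Borel :: "('a::topological_space \<Rightarrow> 'b::topological_space) set"
 where "Borel \<equiv> borel_measurable borel"

abbreviation Borel2 :: "('a::topological_space \<times> 'b::topological_space \<Rightarrow> 'c::topological_space) set"
 where "Borel2 \<equiv> borel_measurable (borel \<Otimes>\<^sub>M borel)"

abbreviation apow :: "real \<Rightarrow> real \<Rightarrow> ennreal"
 where "apow q y \<equiv> ennreal (\<bar>y\<bar> powr q)"

abbreviation lebesgue2 :: "('a::euclidean_space \<times> 'b::euclidean_space) measure"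
 where "lebesgue2 \<equiv> lebesgue \<Otimes>\<^sub>M lebesgue"

abbreviation tendsto_abbrev :: "('a \<Rightarrow> 'b::topological_space) \<Rightarrow> 'b \<Rightarrow> 'a filter \<Rightarrow> bool" (infixr "--->" 55)
 where "f ---> l \<equiv> tendsto f l"

abbreviation LIMSEQ_abbrev :: "(nat \<Rightarrow> 'b::topological_space) \<Rightarrow> 'b \<Rightarrow> bool" ("((_)/ ----> (_))" [60, 60] 60)
 where "f ----> l \<equiv> tendsto f l sequentially"



section \<open>Powers and monotone limits\<close>

lemma rpow_ennreal: "0 <= x ==> rpow (ennreal x) a = ennreal (x powr a)"
 by (simp add: rpow_def)

lemma rpow_top [simp]: "rpow \<infinity> a = \<infinity>" "rpow top a = top"
 by (simp_all add: rpow_def)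

lemma rpow_0 [simp]: "rpow 0 a = 0"
 by (simp add: rpow_def)

lemma rpow_rpow: "rpow (rpow x a) b = rpow x (a * b)"
 by (cases x) (simp_all add: rpow_ennreal powr_powr)

lemma rpow_one [simp]: "rpow x 1 = x"
 by (cases x) (simp_all add: rpow_ennreal)

lemma rpow_mono:
 assumes "x <= y" "0 < a" shows "rpow x a <= rpow y a"
 using assms by (cases x; cases y) (auto simp: rpow_ennreal powr_mono2 top_unique)

lemma rpow_mult:
 assumes "0 < a" shows "rpow (x * y) a = rpow x a * rpow y a"
proof (cases x; cases y)
 fix r s assume "x = ennreal r" "0 <= r" "y = ennreal s" "0 <= s"
 thus ?thesis by (simp add: rpow_ennreal powr_mult ennreal_mult [symmetric])
qed (auto simp: ennreal_mult_top ennreal_top_mult rpow_ennreal powr_eq_0_iff)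

lemma rpow_cmult:
 assumes "0 < a" "0 <= c" shows "rpow (ennreal c * y) a = ennreal (c powr a) * rpow y a"
 using assms by (simp add: rpow_mult rpow_ennreal)

lemma rpow_eq_top_iff [simp]: "rpow x a = top \<longleftrightarrow> x = top"
 by (cases x) (simp_all add: rpow_ennreal)

text \<open>A monotone function with open range is continuous, and the range is everything since the
  power \<open>1 / a\<close> provides preimages. Finite and infinite points are treated at
  once.\<close>

lemma continuous_on_rpow:
 assumes "0 < a" shows "continuous_on UNIV (%x. rpow x a)"
proof (rule continuous_onI_mono)
 have "x \<in> range (%x. rpow x a)" for x
  using assms rpow_rpow [of x "1 / a" a] by (metis nonzero_eq_divide_eq order_less_irrefl rangeI rpow_one)
 hence "range (%x. rpow x a) = UNIV" by blast
 thus "open (range (%x. rpow x a))" by simp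
qed (use assms in \<open>auto intro: rpow_mono\<close>)

lemma tendsto_rpow:
 assumes "(f ---> x) F" "0 < a" shows "((%z. rpow (f z) a) ---> rpow x a) F"
 using continuous_on_tendsto_compose [OF continuous_on_rpow [OF assms(2)] assms(1)] by simp

text \<open>The positive finite limit of the first factor excludes the product of 0 and infinity,
  where multiplication is discontinuous.\<close>

lemma tendsto_mult_ennreal_pos:
 fixes f g :: "'a => ennreal"
 assumes f: "(f ---> ennreal c) F" and g: "(g ---> x) F" and "0 < c"
 shows "((%z. f z * g z) ---> ennreal c * x) F"
 by (rule tendsto_mult_ennreal [OF f g]) (use assms in auto)

text \<open>Convexity of the power at the point
  \<open>(1 - l) * (a / (1 - l)) + l * (b / l)\<close>. The weight \<open>l\<close> stays free
  because the coefficient of \<open>a powr q\<close> tends to 1 as \<open>l\<close> tends to 0; the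
  limit of \<open>shift_diff\<close> at infinity and the constant in
  \<open>U_fun_almost_increasing\<close> depend on this.\<close>

lemma powr_add_le:
 fixes a b :: real
 assumes "1 <= q" "0 <= a" "0 <= b" "0 < l" "l < 1"
 shows "(a + b) powr q <= (1 - l) powr (1 - q) * a powr q + l powr (1 - q) * b powr q"
proof -
 show ?thesis
 proof (cases "a = 0 \<or> b = 0")
  \<comment> \<open>Separate because convexity is used on the open half-line only.\<close>
  case True
  have "1 <= (1 - l) powr (1 - q)" "1 <= l powr (1 - q)"
   using assms powr_mono' [of "1 - q" 0 "1 - l"] powr_mono' [of "1 - q" 0 l] by auto
  from mult_right_mono [OF this(1), of "a powr q"] mult_right_mono [OF this(2), of "b powr q"] True
  show ?thesis by auto
 next
  case False
 have conv: "convex_on {0<..} (%x::real. x powr q)"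
  using assms by (intro powr_convex)
 have "((1 - l) * (a / (1 - l)) + l * (b / l)) powr q
   <= (1 - l) * (a / (1 - l)) powr q + l * (b / l) powr q"
  using convex_onD [OF conv, of l "a / (1 - l)" "b / l"] assms False by auto
 also have "(1 - l) * (a / (1 - l)) + l * (b / l) = a + b"
  using assms by simp
 also have "(1 - l) * (a / (1 - l)) powr q = (1 - l) powr (1 - q) * a powr q"
  using assms by (simp add: powr_divide powr_diff)
 also have "l * (b / l) powr q = l powr (1 - q) * b powr q"
  using assms by (simp add: powr_divide powr_diff)
 finally show ?thesis .
 qed
qed

lemma powr_abs_add_le:
 fixes a b :: real
 assumes "1 <= q"
 shows "\<bar>a + b\<bar> powr q <= 2 powr (q - 1) * (\<bar>a\<bar> powr q + \<bar>b\<bar> powr q)"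
proof -
 have "\<bar>a + b\<bar> powr q <= (\<bar>a\<bar> + \<bar>b\<bar>) powr q"
  using assms by (intro powr_mono2) auto
 also have "... <= (1 / 2) powr (1 - q) * (\<bar>a\<bar> powr q + \<bar>b\<bar> powr q)"
  using powr_add_le [of q "\<bar>a\<bar>" "\<bar>b\<bar>" "1/2"] assms by (simp add: distrib_left)
 also have "(1 / 2::real) powr (1 - q) = 2 powr (q - 1)"
  by (simp add: powr_divide powr_diff)
 finally show ?thesis .
qed

text \<open>As the exponent decreases to \<open>c\<close> the integrands increase, because
  \<open>w <= 1\<close>, and monotone convergence covers infinite values as well.\<close>

lemma powr_Lim_nn_integral_right:
 fixes w :: "'a => real" and f :: "'a => ennreal"
 assumes [measurable]: "w \<in> borel_measurable M" "f \<in> borel_measurable M"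
  and w: "!!x. 0 < w x" "!!x. w x <= 1"
 shows "((%a. \<integral>\<^sup>+x. ennreal (w x powr a) * f x \<partial>M) ---> (\<integral>\<^sup>+x. ennreal (w x powr c) * f x \<partial>M)) (at_right c)"
proof (rule tendsto_at_right_sequentially [where b = "c + 1"])
 fix S :: "nat => real"
 assume S: "decseq S" "S ----> c"
 have "incseq (%n x. ennreal (w x powr S n) * f x)"
  using S(1) w by (auto simp: incseq_def le_fun_def decseq_def less_imp_le intro!: mult_right_mono ennreal_leI powr_mono')
 moreover have "(%n. ennreal (w x powr S n) * f x) ----> ennreal (w x powr c) * f x" for x
  using w S(2) by (intro tendsto_mult_ennreal_pos tendsto_ennrealI tendsto_powr tendsto_const) (auto simp: less_imp_neq [symmetric])
 ultimately show "(%n. \<integral>\<^sup>+x. ennreal (w x powr S n) * f x \<partial>M) ----> (\<integral>\<^sup>+x. ennreal (w x powr c) * f x \<partial>M)"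
  by (intro nn_integral_LIMSEQ) (auto simp: incseq_def le_fun_def)
qed simp

text \<open>Here the integrands decrease as the exponent grows to \<open>c\<close>; the one at the
  smaller exponent \<open>b\<close>, whose integral is finite, dominates all those in
  between.\<close>

lemma powr_Lim_nn_integral_left:
 fixes w :: "'a => real" and f :: "'a => ennreal"
 assumes [measurable]: "w \<in> borel_measurable M" "f \<in> borel_measurable M"
  and w: "!!x. 0 < w x" "!!x. w x <= 1"
  and fin: "(\<integral>\<^sup>+x. ennreal (w x powr b) * f x \<partial>M) < \<infinity>" "b < c"
 shows "((%a. \<integral>\<^sup>+x. ennreal (w x powr a) * f x \<partial>M) ---> (\<integral>\<^sup>+x. ennreal (w x powr c) * f x \<partial>M)) (at_left c)"
proof (rule tendsto_at_left_sequentially [where b = b])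
 fix S :: "nat => real"
 assume S: "!!n. b < S n" "incseq S" "S ----> c"
 have "(%n. ennreal (w x powr S n) * f x) ----> ennreal (w x powr c) * f x" for x
  using w S(3) by (intro tendsto_mult_ennreal_pos tendsto_ennrealI tendsto_powr tendsto_const) (auto simp: less_imp_neq [symmetric])
 moreover have "ennreal (w x powr S n) * f x <= ennreal (w x powr b) * f x" for n x
  using w S(1)[of n] by (intro mult_right_mono ennreal_leI powr_mono') (auto intro: less_imp_le)
 ultimately show "(%n. \<integral>\<^sup>+x. ennreal (w x powr S n) * f x \<partial>M) ----> (\<integral>\<^sup>+x. ennreal (w x powr c) * f x \<partial>M)"
  using fin(1) by (intro nn_integral_dominated_convergence [where w = "%x. ennreal (w x powr b) * f x"]) auto
qed (use fin in simp)

text \<open>Summation by parts: \<open>f k\<close> is the sum of its increments, and the two sums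
  are interchanged. The resulting series still makes sense at \<open>x = 1\<close>, where it
  telescopes to the supremum; this is how the endpoint \<open>s = 1\<close> joins the scale.\<close>

lemma geometric_average_eq:
 fixes f :: "nat => ennreal"
 assumes mono: "incseq f" and x: "0 <= x" "x < 1"
 defines "\<delta> \<equiv> %j. f j - (if j = 0 then 0 else f (j - 1))"
 shows "ennreal (1 - x) * (\<Sum>k. ennreal (x ^ k) * f k) = (\<Sum>j. ennreal (x ^ j) * \<delta> j)"
  and "f k = (\<Sum>j\<le>k. \<delta> j)"
  and "(SUP k. f k) = (\<Sum>j. \<delta> j)"
proof -
 have sum: "f k = (\<Sum>j\<le>k. \<delta> j)" for k
 proof (induction k)
  case (Suc k)
  have "f (Suc k) = f k + \<delta> (Suc k)"
   using mono by (simp add: \<delta>_def incseq_SucD add_diff_inverse_ennreal)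
  with Suc show ?case by simp
 qed (simp add: \<delta>_def)
 thus "f k = (\<Sum>j\<le>k. \<delta> j)" .
 show "(SUP k. f k) = (\<Sum>j. \<delta> j)"
 proof (rule LIMSEQ_unique)
  show "f ----> (SUP k. f k)" using mono by (rule LIMSEQ_SUP)
  show "f ----> (\<Sum>j. \<delta> j)"
   unfolding sum using summable_LIMSEQ' [of \<delta>] by simp
 qed
 have "(\<Sum>k. ennreal (x ^ k) * f k) = (\<Sum>k. \<Sum>j. ennreal (x ^ k) * \<delta> j * indicator {..k} j)"
 proof (rule suminf_cong)
  fix k
  have "(\<Sum>j. ennreal (x ^ k) * \<delta> j * indicator {..k} j) = (\<Sum>j\<le>k. ennreal (x ^ k) * \<delta> j * indicator {..k} j)"
   by (intro suminf_finite) auto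
  also have "... = ennreal (x ^ k) * f k"
   by (simp add: sum sum_distrib_left)
  finally show "ennreal (x ^ k) * f k = (\<Sum>j. ennreal (x ^ k) * \<delta> j * indicator {..k} j)" ..
 qed
 also have "... = (\<Sum>j. \<Sum>k. ennreal (x ^ k) * \<delta> j * indicator {..k} j)"
  using nn_integral_suminf [of "%j k. ennreal (x ^ k) * \<delta> j * indicator {..k} j" "count_space UNIV"]
  by (simp add: nn_integral_count_space_nat)
 also have "... = (\<Sum>j. \<delta> j * ennreal (x ^ j / (1 - x)))"
 proof (rule suminf_cong)
  fix j
  have "(\<Sum>k. ennreal (x ^ k) * \<delta> j * indicator {..k} j) = (\<Sum>k. \<delta> j * (ennreal (x ^ k) * indicator {j..} k))"
   by (intro suminf_cong) (auto simp: indicator_def mult.commute)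
  also have "... = \<delta> j * (\<Sum>k. ennreal (x ^ k) * indicator {j..} k)"
   by simp
  also have "(\<Sum>k. ennreal (x ^ k) * indicator {j..} k) = (\<Sum>k. ennreal (x ^ (k + j)))"
   using suminf_offset [of "%k. ennreal (x ^ k) * indicator {j..} k" j] by simp
  also have "... = ennreal (x ^ j / (1 - x))"
  proof (rule suminf_ennreal_eq)
   show "(%k. x ^ (k + j)) sums (x ^ j / (1 - x))"
    using sums_mult [OF geometric_sums [of x], of "x ^ j"] x by (simp add: power_add mult.commute)
  qed (use x in simp)
  finally show "(\<Sum>k. ennreal (x ^ k) * \<delta> j * indicator {..k} j) = \<delta> j * ennreal (x ^ j / (1 - x))" .
 qed
 finally have "ennreal (1 - x) * (\<Sum>k. ennreal (x ^ k) * f k) = (\<Sum>j. ennreal (1 - x) * (\<delta> j * ennreal (x ^ j / (1 - x))))"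
  by simp
 also have "... = (\<Sum>j. ennreal (x ^ j) * \<delta> j)"
 proof (rule suminf_cong)
  fix j
  have "ennreal (1 - x) * ennreal (x ^ j / (1 - x)) = ennreal (x ^ j)"
   using x by (simp add: ennreal_mult' [symmetric])
  thus "ennreal (1 - x) * (\<delta> j * ennreal (x ^ j / (1 - x))) = ennreal (x ^ j) * \<delta> j"
   by (metis mult.assoc mult.commute)
 qed
 finally show "ennreal (1 - x) * (\<Sum>k. ennreal (x ^ k) * f k) = (\<Sum>j. ennreal (x ^ j) * \<delta> j)" .
qed

section \<open>Polar coordinates\<close>

lemma nn_integral_lborel_shift:
 fixes f :: "'a::euclidean_space => ennreal"
 assumes [measurable]: "f \<in> Borel"
 shows "(NN x. f (x + c)) = (NN x. f x)"
proof -
 have "(\<integral>\<^sup>+x. f x \<partial>distr lborel borel ((+) c)) = (NN x. f (x + c))"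
  by (subst nn_integral_distr) (auto simp: add.commute)
 thus ?thesis by (simp add: lborel_distr_plus)
qed

lemma nn_integral_lborel_scale:
 fixes f :: "'a::euclidean_space => ennreal"
 assumes [measurable]: "f \<in> Borel" and "c ~= 0"
 shows "(NN x. f x) = ennreal (\<bar>c\<bar> ^ DIM('a)) * (NN x. f (c *\<^sub>R x))"
 by (subst lborel_affine [OF \<open>c \<noteq> 0\<close>, of 0])
   (simp add: nn_integral_density nn_integral_distr nn_integral_cmult)

text \<open>A Fubini argument that replaces determinants: \<open>h (f y)\<close> is integrated
  against the indicator of the unit ball in \<open>x - f y\<close>. After writing
  \<open>x = f z\<close> and shifting \<open>y\<close> by \<open>z\<close>, only the invariance of
  the ball under the isometry is used, and the volume of the ball cancels.\<close>

lemma nn_integral_lborel_isometry: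
 fixes f :: "'a::euclidean_space => 'a" and h :: "'a => ennreal"
 assumes lin: "linear f" and iso: "!!x. norm (f x) = norm x"
  and [measurable]: "h \<in> Borel"
 shows "(NN x. h (f x)) = (NN x. h x)"
proof -
 have [measurable]: "f \<in> Borel"
  using lin by (intro borel_measurable_continuous_onI linear_continuous_on linear_conv_bounded_linear [THEN iffD1])
 have "inj f"
  using iso linear_injective_0 [OF lin] by (metis norm_eq_zero)
 hence surj: "surj f" using lin by (rule linear_inj_imp_surj [rotated])
 define B where "B = ball (0::'a) 1"
 have [measurable]: "B \<in> sets borel" by (simp add: B_def)
 have "(NN y. h (f y)) * emeasure lborel B
   = (NN y. NN x. h (f y) * indicator B (x - f y))"
 proof (subst nn_integral_multc [symmetric])
  have "(NN x. indicator B (x - f y)) = emeasure lborel B" for y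
   using nn_integral_lborel_shift [of "indicator B" "- f y"] by simp
  thus "(NN y. h (f y) * emeasure lborel B)
    = (NN y. NN x. h (f y) * indicator B (x - f y))"
   by (simp add: nn_integral_cmult)
 qed simp
 also have "... = (NN x. NN y. h (f y) * indicator B (x - f y))"
  by (rule lborel_pair.Fubini') simp
 also have "... = (NN x. NN y. h (x + f y) * indicator B y)"
 proof (rule nn_integral_cong)
  fix x
  obtain z where z: "x = f z" using surj by blast
  have "(NN y. h (f y) * indicator B (x - f y)) = (NN y. h (f (y + z)) * indicator B (x - f (y + z)))"
   by (rule nn_integral_lborel_shift [symmetric]) simp
  also have "... = (NN y. h (x + f y) * indicator B y)"
   by (intro nn_integral_cong) (simp add: z linear_add [OF lin] B_def indicator_def iso add.commute)
  finally show "(NN y. h (f y) * indicator B (x - f y)) = (NN y. h (x + f y) * indicator B y)" .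
 qed
 also have "... = (NN y. NN x. h (x + f y) * indicator B y)"
  by (rule lborel_pair.Fubini') simp
 also have "... = (NN x. h x) * emeasure lborel B"
  by (simp add: nn_integral_multc nn_integral_lborel_shift nn_integral_cmult)
 finally have eq: "(NN y. h (f y)) * emeasure lborel B = (NN x. h x) * emeasure lborel B" .
 moreover have "emeasure lborel B ~= 0" "emeasure lborel B ~= \<infinity>"
  using emeasure_lborel_ball_finite [of "0::'a" 1] by (simp_all add: B_def emeasure_ball less_imp_neq [THEN not_sym])
 ultimately show ?thesis
  by (simp add: ennreal_mult_cancel_left mult.commute [of _ "emeasure lborel B"])
qed

text \<open>Reflection in the hyperplane orthogonal to \<open>n\<close>, with \<open>n\<close> not
  normalised. Division by 0 yields 0, so it is the identity for \<open>n = 0\<close> and the lemmas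
  about it hold for every \<open>n\<close>.\<close>

definition reflect :: "'a::euclidean_space => 'a => 'a" where
 "reflect n x = x - (2 * (x \<bullet> n) / (n \<bullet> n)) *\<^sub>R n"

lemma linear_reflect: "linear (reflect n)"
 by (rule linearI) (simp_all add: reflect_def inner_add_left algebra_simps add_divide_distrib)

lemma norm_reflect [simp]: "norm (reflect n x) = norm x"
proof (cases "n = 0")
 case False
 hence "reflect n x \<bullet> reflect n x = x \<bullet> x"
  by (simp add: reflect_def inner_diff_left inner_diff_right inner_commute power2_eq_square field_simps)
 thus ?thesis by (simp add: norm_eq_sqrt_inner)
qed (simp add: reflect_def)

text \<open>The hyperplane orthogonal to \<open>v - w\<close> is the perpendicular bisector of two
  points at equal distance from the origin. Hence reflections act transitively on spheres, and
  spherical integrals depend on a parameter vector only through its norm.\<close>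

lemma reflect_swap:
 assumes "norm v = norm w" shows "reflect (v - w) v = w"
proof (cases "v = w")
 case False
 have vw: "v \<bullet> v = w \<bullet> w"
  using assms by (simp add: norm_eq_sqrt_inner)
 hence "(v - w) \<bullet> (v - w) = 2 * (v \<bullet> (v - w))"
  by (simp add: inner_diff_left inner_diff_right inner_commute)
 moreover have "(v - w) \<bullet> (v - w) ~= 0" using False by simp
 ultimately have "2 * (v \<bullet> (v - w)) / ((v - w) \<bullet> (v - w)) = 1" by (metis divide_self)
 hence "reflect (v - w) v = v - 1 *\<^sub>R (v - w)" by (simp only: reflect_def)
 thus ?thesis by (simp add: reflect_def)
qed (simp add: reflect_def)

lemma inner_reflect: "reflect n x \<bullet> y = x \<bullet> reflect n y"
 by (simp add: reflect_def inner_diff_left inner_diff_right inner_commute)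

lemma reflect_reflect [simp]: "reflect n (reflect n x) = x"
 by (cases "n = 0") (simp_all add: reflect_def inner_diff_left algebra_simps)

lemma borel_measurable_reflect [measurable]: "reflect n \<in> Borel"
 by (intro borel_measurable_continuous_onI linear_continuous_on linear_conv_bounded_linear [THEN iffD1] linear_reflect)

section \<open>The surface measure on the unit sphere and its invariance\<close>

lemma sets_sphere_measure [simp, measurable_cong]: "sets sphere_measure = sets borel"
 by (simp add: sphere_measure_def)

lemma space_sphere_measure [simp]: "space sphere_measure = UNIV"
 by (simp add: sphere_measure_def space_scale_measure)

lemma nn_integral_sphere:
 fixes h :: "'a::euclidean_space => ennreal"
 assumes [measurable]: "h \<in> Borel"
 shows "(SS \<omega>. h \<omega>)
  = ennreal (real DIM('a)) * (NN x. h (sgn x) * indicator (cball 0 1 - {0}) x)"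
proof -
 have [measurable]: "sgn \<in> restrict_space lborel (cball 0 1 - {0}) \<rightarrow>\<^sub>M (borel :: 'a measure)"
  by (intro measurable_restrict_space1) simp
 show ?thesis
  by (simp add: sphere_measure_def nn_integral_scale_measure nn_integral_distr nn_integral_restrict_space)
qed

lemma norm_sphere_AE: "AE \<omega> in sphere_measure. norm (\<omega> :: 'a::euclidean_space) = 1"
proof -
 have "(SS \<omega>. indicator {\<omega>::'a. norm \<omega> ~= 1} \<omega>) = 0"
 proof (subst nn_integral_sphere)
  have "indicator {\<omega>. norm \<omega> ~= 1} (sgn x) * indicator (cball 0 1 - {0}) x = (0::ennreal)" for x :: 'a
   by (simp add: indicator_def norm_sgn)
  thus "ennreal (real DIM('a)) * (NN x. indicator {\<omega>. norm \<omega> ~= 1} (sgn x) * indicator (cball 0 1 - {0}) (x::'a)) = 0"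
   by (simp only: nn_integral_const mult_zero_right mult_zero_left)
 qed measurable
 thus ?thesis
  by (subst AE_iff_nn_integral [where P = "%\<omega>. norm \<omega> = 1"]) auto
qed

lemma sphere_area_pos: "0 < d ==> 0 < sphere_area d"
 by (simp add: sphere_area_def Gamma_real_pos)

lemma emeasure_sphere: "emeasure (sphere_measure :: 'a::euclidean_space measure) UNIV = ennreal (sphere_area DIM('a))"
proof -
 have "emeasure (sphere_measure :: 'a measure) UNIV = (\<integral>\<^sup>+\<omega>. 1 \<partial>(sphere_measure :: 'a measure))"
  by simp
 also have "... = ennreal (real DIM('a)) * emeasure lborel (cball (0::'a) 1 - {0})"
  by (subst nn_integral_sphere) auto
 also have "emeasure lborel (cball (0::'a) 1 - {0}) = emeasure lborel (cball (0::'a) 1)"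
  by (rule emeasure_Diff_null_set) auto
 also have "ennreal (real DIM('a)) * ... = ennreal (sphere_area DIM('a))"
 proof -
  have "real DIM('a) / 2 \<notin> \<int>\<^sub>\<le>\<^sub>0"
   using nonpos_Ints_nonpos [of "real DIM('a) / 2"] by auto
  hence "Gamma (real DIM('a) / 2 + 1) = real DIM('a) / 2 * Gamma (real DIM('a) / 2)"
   by (rule Gamma_plus1)
  hence "real DIM('a) * unit_ball_vol (real DIM('a)) = sphere_area DIM('a)"
   unfolding unit_ball_vol_def sphere_area_def \<open>Gamma (real DIM('a) / 2 + 1) = _\<close> by simp
  thus ?thesis by (simp add: emeasure_cball ennreal_mult' [symmetric])
 qed
 finally show ?thesis .
qed

lemma finite_measure_sphere: "finite_measure (sphere_measure :: 'a::euclidean_space measure)"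
 by (rule finite_measureI) (simp add: emeasure_sphere)

interpretation sphere: finite_measure "sphere_measure :: 'a::euclidean_space measure"
 by (rule finite_measure_sphere)

interpretation lborel_sphere: pair_sigma_finite "lborel :: 'b::euclidean_space measure" "sphere_measure :: 'a::euclidean_space measure" ..

interpretation sphere_sphere: pair_sigma_finite "sphere_measure :: 'a::euclidean_space measure" "sphere_measure :: 'a measure" ..

lemma nn_integral_sphere_isometry:
 fixes f :: "'a::euclidean_space => 'a" and h :: "'a => ennreal"
 assumes lin: "linear f" and iso: "!!x. norm (f x) = norm x"
  and [measurable]: "h \<in> Borel"
 shows "(SS \<omega>. h (f \<omega>)) = (SS \<omega>. h \<omega>)"
proof -
 have [measurable]: "f \<in> Borel"
  using lin by (intro borel_measurable_continuous_onI linear_continuous_on linear_conv_bounded_linear [THEN iffD1])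
 have [measurable]: "cball 0 1 - {0::'a} \<in> sets borel" by auto
 have eq: "f (sgn x) = sgn (f x)" "f x = 0 \<longleftrightarrow> x = 0" for x
  by (simp add: sgn_div_norm linear_scale [OF lin] iso) (metis iso norm_eq_zero)
 have "(SS \<omega>. h (f \<omega>))
   = ennreal (real DIM('a)) * (NN x. h (sgn (f x)) * indicator (cball 0 1 - {0}) (f x))"
  by (subst nn_integral_sphere) (auto simp: eq iso indicator_def intro!: arg_cong2 [where f = "(*)"] nn_integral_cong)
 also have "... = (SS \<omega>. h \<omega>)"
  by (subst nn_integral_lborel_isometry [OF lin iso, of "%x. h (sgn x) * indicator (cball 0 1 - {0}) x"])
    (simp_all add: nn_integral_sphere)
 finally show ?thesis .
qed

lemma nn_integral_powr_tail:
 assumes "0 < a" "0 < r"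
 shows "(NN t. ennreal (t powr (- 1 - a)) * indicator {r..} t) = ennreal (r powr (- a) / a)"
proof -
 have "(NN t. ennreal (t powr (- 1 - a)) * indicator {r..} t) = ennreal (0 - (- (r powr (- a)) / a))"
 proof (rule nn_integral_FTC_atLeast)
  fix t assume "r <= t"
  thus "DERIV (%t. - (t powr (- a)) / a) t :> t powr (- 1 - a)"
   using assms by (auto intro!: derivative_eq_intros simp: minus_diff_commute)
 next
  show "((%t. - (t powr (- a)) / a) ---> 0) at_top"
   using tendsto_divide [OF tendsto_minus [OF tendsto_neg_powr [of "- a" "%x. x" at_top]] tendsto_const [of a]] assms
   by (simp add: filterlim_ident)
 qed auto
 thus ?thesis by simp
qed

text \<open>The surface measure is the image of the unit ball, so the right-hand side is a double
  integral over \<open>t\<close> and a point \<open>y\<close> of the ball. Scaling \<open>t\<close>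
  by the norm of \<open>y\<close> turns \<open>sgn y\<close> into \<open>y\<close>; then
  \<open>z = t *\<^sub>R y\<close> for fixed \<open>t\<close> moves all dependence on
  \<open>F\<close> to \<open>z\<close>, and what remains is the integral of
  \<open>t powr (- 1 - d)\<close> over \<open>t >= norm z\<close>, which is
  \<open>norm z powr (- d) / d\<close>.\<close>

lemma nn_integral_polar:
 fixes F :: "'a::euclidean_space => ennreal"
 assumes [measurable]: "F \<in> Borel"
 shows "(NN x. F x)
  = (\<integral>\<^sup>+t\<in>{0<..}. ennreal (t powr (real DIM('a) - 1)) * (SS \<omega>. F (t *\<^sub>R \<omega>)) \<partial>lborel)"
proof -
 let ?d = "DIM('a)"
 let ?p = "%t. ennreal (t powr (real ?d - 1))"
 let ?B = "cball 0 1 - {0} :: 'a set"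
 \<comment> \<open>The integrand after the substitution in \<open>t\<close> (\<open>?K\<close>),
   after the substitution in space (\<open>?L\<close>), and before both (\<open>?M\<close>).\<close>
 let ?K = "%t y. ennreal (norm y powr ?d) * (?p t * F (t *\<^sub>R y) * indicator ?B y * indicator {0<..} t)"
 let ?L = "%t z. ennreal (norm z powr ?d) * (ennreal (t powr (- 1 - real ?d)) * F z * (if norm z <= t then 1 else 0) * indicator (- {0}) z)"
 let ?M = "%t y. ?p t * F (t *\<^sub>R sgn y) * indicator ?B y * indicator {0<..} t"
 have [measurable]: "?B \<in> sets borel" by auto
 have "(\<integral>\<^sup>+t\<in>{0<..}. ?p t * (SS \<omega>. F (t *\<^sub>R \<omega>)) \<partial>lborel)
   = (NN t. NN y. ennreal ?d * (?M t y))"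
 proof (rule nn_integral_cong)
  fix t :: real
  have "(NN y. ennreal ?d * (?M t y))
    = (NN y. (ennreal ?d * ?p t * indicator {0<..} t) * (F (t *\<^sub>R sgn y) * indicator ?B y))"
   by (simp only: ac_simps)
  also have "... = (ennreal ?d * ?p t * indicator {0<..} t) * (NN y. F (t *\<^sub>R sgn y) * indicator ?B y)"
   by (rule nn_integral_cmult) measurable
  finally show "?p t * (SS \<omega>. F (t *\<^sub>R \<omega>)) * indicator {0<..} t
    = (NN y. ennreal ?d * (?M t y))"
   by (simp add: nn_integral_sphere ac_simps)
 qed
 also have "... = (NN y. NN t. ennreal ?d * (?M t y))"
  by (rule lborel_pair.Fubini') simp
 also have "... = (NN y. NN t. ennreal ?d * (?K t y))"
 proof (rule nn_integral_cong)
  fix y :: 'a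
  show "(NN t. ennreal ?d * (?M t y))
    = (NN t. ennreal ?d * (?K t y))"
  proof (cases "y \<in> ?B")
   case True
   hence y: "0 < norm y" by simp
   have "(NN t. ennreal ?d * (?M t y))
     = ennreal \<bar>norm y\<bar> * (NN t. ennreal ?d * (?p (0 + norm y * t) * F ((0 + norm y * t) *\<^sub>R sgn y) * indicator ?B y * indicator {0<..} (0 + norm y * t)))"
    by (rule nn_integral_real_affine) (use y in auto)
   also have "... = (NN t. ennreal ?d * (?K t y))"
   proof (subst nn_integral_cmult [symmetric], simp, rule nn_integral_cong)
    fix t :: real
    have "(norm y * t) *\<^sub>R sgn y = t *\<^sub>R y" using y by (simp add: sgn_div_norm)
    moreover have "indicator {0<..} (norm y * t) = (indicator {0<..} t :: ennreal)"
     using y by (simp add: indicator_def zero_less_mult_iff)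
    moreover have "ennreal (norm y) * (?p (norm y * t) * c) = ennreal (norm y powr ?d) * (?p t * c)" if "0 < t" for c
     unfolding mult.assoc [symmetric]
     using y that by (simp add: ennreal_mult' [symmetric] powr_mult powr_diff)
    ultimately show "ennreal \<bar>norm y\<bar> * (ennreal ?d * (?p (0 + norm y * t) * F ((0 + norm y * t) *\<^sub>R sgn y) * indicator ?B y * indicator {0<..} (0 + norm y * t)))
      = ennreal ?d * (?K t y)"
     by (cases "0 < t") (auto simp: indicator_def mult.left_commute [of "ennreal (norm y)" "ennreal ?d"] mult.assoc)
   qed
   finally show ?thesis .
  qed simp
 qed
 also have "... = (NN t. NN y. ennreal ?d * (?K t y))"
  by (rule lborel_pair.Fubini') simp
 also have "... = (NN t. NN z. ennreal ?d * (?L t z))"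
 proof (rule nn_integral_cong)
  fix t :: real
  let ?k = "%z. ennreal ?d * (?L t z)"
  show "(NN y. ennreal ?d * (?K t y)) = (NN z. ?k z)"
  proof (cases "0 < t")
   case True
   have "(NN z. ?k z) = ennreal (\<bar>t\<bar> ^ ?d) * (NN y. ?k (t *\<^sub>R y))"
    by (rule nn_integral_lborel_scale) (measurable, use True in simp)
   also have "... = (NN y. ennreal ?d * (?K t y))"
   proof (subst nn_integral_cmult [symmetric], simp, rule nn_integral_cong)
    fix y :: 'a
    have ind: "(if norm (t *\<^sub>R y) <= t then 1 else 0) * indicator (- {0}) (t *\<^sub>R y) = (indicator ?B y * indicator {0<..} t :: ennreal)"
     using True by (auto simp: indicator_def)
    have "t ^ ?d * ((t * norm y) powr ?d * t powr (- 1 - real ?d)) = norm y powr ?d * t powr (real ?d - 1)"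
     using True by (simp add: powr_mult powr_diff powr_minus powr_realpow field_simps)
    hence "ennreal (t ^ ?d) * (ennreal ((t * norm y) powr ?d) * ennreal (t powr (- 1 - real ?d))) = ennreal (norm y powr ?d) * ?p t"
     using True by (simp add: ennreal_mult' [symmetric])
    moreover have "ennreal (\<bar>t\<bar> ^ ?d) * ?k (t *\<^sub>R y) = ennreal (t ^ ?d) * (ennreal ((t * norm y) powr ?d) * ennreal (t powr (- 1 - real ?d)))
      * (ennreal ?d * F (t *\<^sub>R y) * ((if norm (t *\<^sub>R y) <= t then 1 else 0) * indicator (- {0}) (t *\<^sub>R y)))"
     using True by (simp add: ac_simps)
    ultimately show "ennreal (\<bar>t\<bar> ^ ?d) * ?k (t *\<^sub>R y) = ennreal ?d * (?K t y)"
     unfolding ind by (simp add: ac_simps)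
   qed
   finally show ?thesis ..
  next
   case False
   hence "\<not> norm z <= t" if "z ~= 0" for z :: 'a
    using that norm_ge_zero [of z] zero_less_norm_iff [of z] by linarith
   hence k0: "?k z = 0" for z
    by (auto simp: indicator_def)
   have "(NN z. ?k z) = (\<integral>\<^sup>+z. 0 \<partial>(lborel :: 'a measure))"
    by (rule nn_integral_cong) (rule k0)
   with False show ?thesis by simp
  qed
 qed
 also have "... = (NN z. NN t. ennreal ?d * (?L t z))"
  by (rule lborel_pair.Fubini') simp
 also have "... = (NN z. F z)"
 proof (rule nn_integral_cong_AE)
  have "AE z in lborel. z ~= (0::'a)" by (rule AE_lborel_singleton)
  thus "AE z in lborel. (NN t. ennreal ?d * (?L t z)) = F z"
  proof eventually_elim
   case (elim z)
   have "(NN t. ennreal ?d * (?L t z))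
     = (NN t. (ennreal ?d * ennreal (norm z powr ?d) * F z) * (ennreal (t powr (- 1 - real ?d)) * (if norm z <= t then 1 else 0)))"
    using elim by (intro nn_integral_cong) (simp add: indicator_def ac_simps)
   also have "... = (ennreal ?d * ennreal (norm z powr ?d) * F z) * ennreal (norm z powr (- real ?d) / ?d)"
    using elim nn_integral_powr_tail [of "real ?d" "norm z"]
    by (subst nn_integral_cmult) (simp_all add: indicator_def of_bool_def cong: if_cong)
   also have "... = ennreal (?d * norm z powr ?d * (norm z powr (- real ?d) / ?d)) * F z"
    by (subst ennreal_mult', simp, subst ennreal_mult', simp) (simp only: mult_ac)
   also have "?d * norm z powr ?d * (norm z powr (- real ?d) / ?d) = 1"
    using elim by (simp add: powr_minus field_simps)
   finally show ?case by simp
  qed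
 qed
 finally show ?thesis ..
qed

text \<open>The substitution rule is applied on the compact intervals from \<open>exp (- n)\<close>
  to \<open>exp n\<close> and extended by monotone convergence. Stating it first for measures, with
  indicators as integrands, gives it for all Borel functions.\<close>

lemma nn_integral_exp_substitution:
 fixes f :: "real => ennreal"
 assumes [measurable]: "f \<in> Borel"
 shows "(\<integral>\<^sup>+t\<in>{0<..}. f t \<partial>lborel) = (NN x. f (exp x) * ennreal (exp x))"
proof -
 have "density lborel (indicator {0<..}) = distr (density lborel (%x. ennreal (exp x))) borel (exp :: real => real)"
 proof (rule measure_eqI)
  fix A :: "real set" assume "A \<in> sets (density lborel (indicator {0<..}))"
  hence [measurable]: "A \<in> sets borel" by simp
  have "(%n. NN t. indicator A t * indicator {exp (- real n)..exp (real n)} t)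
    ----> (NN t. indicator {0<..} t * indicator A t)"
  proof (rule nn_integral_LIMSEQ)
   show "incseq (%n t. indicator A t * indicator {exp (- real n)..exp (real n)} t :: ennreal)"
   proof (intro incseq_SucI le_funI mult_left_mono)
    fix n t
    have "exp (- real (Suc n)) <= exp (- real n)" "exp (real n) <= exp (real (Suc n))" by simp_all
    hence "{exp (- real n)..exp (real n)} \<subseteq> {exp (- real (Suc n))..exp (real (Suc n))}"
     by (rule atLeastatMost_subset_iff [THEN iffD2, OF disjI2, OF conjI])
    thus "indicator {exp (- real n)..exp (real n)} t <= (indicator {exp (- real (Suc n))..exp (real (Suc n))} t :: ennreal)"
     unfolding indicator_def by (metis (no_types, lifting) subsetD of_bool_eq_iff order_refl of_bool_eq(1) zero_le)
   qed simp
   fix t :: real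
   show "(%n. indicator A t * indicator {exp (- real n)..exp (real n)} t :: ennreal) ----> indicator {0<..} t * indicator A t"
   proof (cases "0 < t")
    case True
    have "exp (- real n) <= t & t <= exp (real n)" if "nat \<lceil>\<bar>ln t\<bar>\<rceil> <= n" for n
    proof -
     have "\<bar>ln t\<bar> <= real n" using that by linarith
     hence "- real n <= ln t" "ln t <= real n" by linarith+
     thus ?thesis using True by (metis exp_le_cancel_iff exp_ln)
    qed
    thus ?thesis
     using True by (intro tendsto_eventually eventually_sequentiallyI [of "nat \<lceil>\<bar>ln t\<bar>\<rceil>"]) (simp add: indicator_def)
   next
    case False
    hence "\<not> exp (- real n) <= t" for n using exp_gt_zero [of "- real n"] by linarith
    with False show ?thesis by (simp add: indicator_def)
   qed
  qed simp
  moreover have "(%n. NN x. ennreal (exp x) * indicator A (exp x) * indicator {- real n..real n} x)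
    ----> (NN x. ennreal (exp x) * indicator A (exp x))"
  proof (rule nn_integral_LIMSEQ)
   fix x :: real
   show "(%n. ennreal (exp x) * indicator A (exp x) * indicator {- real n..real n} x) ----> ennreal (exp x) * indicator A (exp x)"
    by (intro tendsto_eventually eventually_sequentiallyI [of "nat \<lceil>\<bar>x\<bar>\<rceil>"]) (auto simp: indicator_def)
  qed (auto simp: incseq_def le_fun_def indicator_def)
  moreover have "(NN t. indicator A t * indicator {exp (- real n)..exp (real n)} t)
    = (NN x. ennreal (exp x) * indicator A (exp x) * indicator {- real n..real n} x)" for n
  proof -
   have "(NN t. ennreal (indicator A t * indicator {exp (- real n)..exp (real n)} t))
    = (NN x. ennreal (indicator A (exp x) * exp x * indicator {- real n..real n} x))"
    by (rule nn_integral_substitution [where g = exp])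
      (auto simp: set_borel_measurable_def intro!: derivative_eq_intros continuous_intros)
   thus ?thesis
    by (simp add: ennreal_mult' ennreal_indicator mult.commute)
  qed
  ultimately have "(NN t. indicator {0<..} t * indicator A t) = (NN x. ennreal (exp x) * indicator A (exp x))"
   by (simp only:) (rule LIMSEQ_unique)
  thus "emeasure (density lborel (indicator {0<..})) A = emeasure (distr (density lborel (%x. ennreal (exp x))) borel exp) A"
  proof -
   have [measurable]: "exp -` A \<in> sets (borel :: real measure)"
    using measurable_sets [of exp borel borel A] by simp
   show ?thesis
    using \<open>_ = (\<integral>\<^sup>+x. ennreal (exp x) * indicator A (exp x) \<partial>lborel)\<close>
    by (simp add: emeasure_density emeasure_distr indicator_vimage)
  qed
 qed simp
 hence "(\<integral>\<^sup>+t. f t \<partial>density lborel (indicator {0<..})) = (\<integral>\<^sup>+t. f t \<partial>distr (density lborel (%x. ennreal (exp x))) borel exp)"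
  by simp
 thus ?thesis
  by (simp add: nn_integral_density nn_integral_distr mult.commute)
qed


section \<open>Gaussian integrals and the constant K_{d,p}\<close>

lemma nn_integral_gaussian_radial:
 assumes "0 < z"
 shows "(\<integral>\<^sup>+t\<in>{0<..}. ennreal (t powr (2 * z - 1) * exp (- t\<^sup>2)) \<partial>lborel) = ennreal (Gamma z / 2)"
proof -
 let ?h = "%x. ennreal (exp (z * x) * exp (- exp x))"
 have "(\<integral>\<^sup>+t\<in>{0<..}. ennreal (t powr (2 * z - 1) * exp (- t\<^sup>2)) \<partial>lborel) = (NN x. ?h (2 * x))"
 proof (subst nn_integral_exp_substitution, simp, rule nn_integral_cong)
  fix x :: real
  have "exp x powr (2 * z - 1) * exp x = exp (z * (2 * x))" "(exp x)\<^sup>2 = exp (2 * x)"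
   by (simp_all add: powr_def mult_exp_exp algebra_simps exp_double [symmetric])
  thus "ennreal (exp x powr (2 * z - 1) * exp (- (exp x)\<^sup>2)) * ennreal (exp x) = ?h (2 * x)"
   by (simp add: ennreal_mult' [symmetric] mult.commute mult.left_commute)
 qed
 also have "... = ennreal (1 / 2) * (ennreal \<bar>2\<bar> * (NN x. ?h (0 + 2 * x)))"
  by (subst mult.assoc [symmetric], subst ennreal_mult' [symmetric]) simp_all
 also have "ennreal \<bar>2\<bar> * (NN x. ?h (0 + 2 * x)) = (NN x. ?h x)"
  by (rule nn_integral_real_affine [symmetric]) simp_all
 also have "... = (\<integral>\<^sup>+t\<in>{0<..}. ennreal (t powr (z - 1) / exp t) \<partial>lborel)"
  by (subst nn_integral_exp_substitution)
    (auto simp: powr_def exp_minus exp_diff field_simps ennreal_mult' [symmetric] mult_exp_exp intro!: nn_integral_cong)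
 also have "... = (NN t. ennreal (indicator {0..} t * t powr (z - 1) / exp t))"
  by (intro nn_integral_cong) (auto simp: indicator_def)
 also have "... = ennreal (Gamma z)"
  by (rule Gamma_conv_nn_integral_real [OF assms, symmetric])
 finally show ?thesis
  by (simp add: ennreal_mult' [symmetric] del: ennreal_half)
qed

lemma nn_integral_gaussian_moment:
 assumes "0 <= q"
 shows "(NN s. ennreal (\<bar>s\<bar> powr q * exp (- s\<^sup>2))) = ennreal (Gamma ((q + 1) / 2))"
proof -
 let ?f = "%s::real. ennreal (\<bar>s\<bar> powr q * exp (- s\<^sup>2))"
 have "(NN s. ?f s) = (NN s. ?f s * indicator {0<..} s + ?f s * indicator {..<0} s)"
  by (rule nn_integral_cong_AE, rule eventually_mono [OF AE_lborel_singleton [of 0]]) (auto simp: indicator_def)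
 also have "... = (NN s. ?f s * indicator {0<..} s) + (NN s. ?f s * indicator {..<0} s)"
  by (rule nn_integral_add) auto
 also have "(NN s. ?f s * indicator {..<0} s) = (NN s. ?f s * indicator {0<..} s)"
  by (subst nn_integral_real_affine [of _ "-1" 0]) (auto simp: indicator_def intro!: nn_integral_cong)
 also have "(NN s. ?f s * indicator {0<..} s) = ennreal (Gamma ((q + 1) / 2) / 2)"
 proof -
  have "2 * ((q + 1) / 2) - 1 = q" by (simp add: field_simps)
  thus ?thesis
   using nn_integral_gaussian_radial [of "(q + 1) / 2"] assms
   by (simp only:) (auto simp: indicator_def cong: nn_integral_cong intro!: nn_integral_cong elim!: trans [rotated])
 qed
 finally show ?thesis
  using assms by (simp add: ennreal_plus [symmetric] Gamma_real_nonneg del: ennreal_plus)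
qed

text \<open>The origin of \<open>K_const\<close>: the integral of
  \<open>|e . x|^q exp (- |x|^2)\<close> over the whole space is computed once as a product over the
  coordinates and once in polar coordinates, and the radial factor
  \<open>Gamma ((d + q) / 2) / 2\<close> is cancelled.\<close>

lemma nn_integral_sphere_inner_Basis:
 fixes e :: "'a::euclidean_space"
 assumes "e \<in> Basis" "0 <= q"
 shows "(SS \<omega>. apow q (e \<bullet> \<omega>)) = ennreal (K_const DIM('a) q * sphere_area DIM('a))"
proof -
 let ?d = "DIM('a)" and ?I = "SS \<omega>. apow q (e \<bullet> \<omega>)"
 let ?f = "%b s. ennreal ((if b = e then \<bar>s\<bar> powr q else 1) * exp (- s\<^sup>2))"
 have g0: "(NN s. ennreal (exp (- s\<^sup>2))) = ennreal (Gamma (1/2))"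
 proof -
  \<comment> \<open>\<open>0 powr 0\<close> is 0, so the two integrands agree only off the
    origin.\<close>
  have "(NN s. ennreal (exp (- s\<^sup>2))) = (NN s. ennreal (\<bar>s\<bar> powr 0 * exp (- s\<^sup>2)))"
   by (rule nn_integral_cong_AE, rule eventually_mono [OF AE_lborel_singleton [of 0]]) auto
  thus ?thesis using nn_integral_gaussian_moment [of 0] by simp
 qed
 have "(NN x. (\<Prod>b\<in>(Basis::'a set). ?f b (x \<bullet> b))) = (\<Prod>b\<in>(Basis::'a set). (NN s. ?f b s))"
  by (rule nn_integral_lborel_prod) auto
 also have "... = (\<Prod>b\<in>(Basis::'a set). ennreal (if b = e then Gamma ((q + 1) / 2) else Gamma (1/2)))"
  using nn_integral_gaussian_moment [OF assms(2)] g0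
  by (intro prod.cong) auto
 also have "... = ennreal (Gamma ((q + 1) / 2) * Gamma (1/2) ^ (?d - 1))"
  using assms by (subst prod_ennreal) (auto simp: Gamma_real_nonneg prod.remove [of Basis e] card_Diff_singleton intro!: arg_cong [where f = ennreal])
 also have "(NN x. (\<Prod>b\<in>(Basis::'a set). ?f b (x \<bullet> b))) = (NN x. ennreal (\<bar>e \<bullet> x\<bar> powr q * exp (- (norm x)\<^sup>2)))"
 proof (rule nn_integral_cong)
  fix x :: 'a
  have "(\<Prod>b\<in>Basis. ?f b (x \<bullet> b)) = ennreal ((\<Prod>b\<in>(Basis::'a set). if b = e then \<bar>x \<bullet> b\<bar> powr q else 1) * (\<Prod>b\<in>Basis. exp (- (x \<bullet> b)\<^sup>2)))"
   by (subst prod_ennreal) (auto simp: prod.distrib)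
  moreover have "(\<Prod>b\<in>(Basis::'a set). if b = e then \<bar>x \<bullet> b\<bar> powr q else 1) = \<bar>e \<bullet> x\<bar> powr q"
   using assms by (simp add: prod.delta inner_commute)
  moreover have "(\<Prod>b\<in>Basis. exp (- (x \<bullet> b)\<^sup>2)) = exp (- (norm x)\<^sup>2)"
   by (subst euclidean_inner [of x x, folded power2_norm_eq_inner]) (simp add: exp_sum [symmetric] sum_negf power2_eq_square)
  ultimately show "(\<Prod>b\<in>Basis. ?f b (x \<bullet> b)) = ennreal (\<bar>e \<bullet> x\<bar> powr q * exp (- (norm x)\<^sup>2))" by simp
 qed
 also have "... = (\<integral>\<^sup>+t\<in>{0<..}. ennreal (t powr (real ?d - 1)) * (SS \<omega>. ennreal (\<bar>e \<bullet> (t *\<^sub>R \<omega>)\<bar> powr q * exp (- (norm (t *\<^sub>R \<omega>))\<^sup>2))) \<partial>lborel)"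
  by (rule nn_integral_polar) simp
 also have "... = (\<integral>\<^sup>+t\<in>{0<..}. ennreal (t powr (2 * ((real ?d + q) / 2) - 1) * exp (- t\<^sup>2)) * ?I \<partial>lborel)"
 proof (rule nn_integral_cong)
  fix t :: real
  show "ennreal (t powr (real ?d - 1)) * (SS \<omega>. ennreal (\<bar>e \<bullet> (t *\<^sub>R \<omega>)\<bar> powr q * exp (- (norm (t *\<^sub>R \<omega>))\<^sup>2))) * indicator {0<..} t
   = ennreal (t powr (2 * ((real ?d + q) / 2) - 1) * exp (- t\<^sup>2)) * ?I * indicator {0<..} t"
  proof (cases "0 < t")
   case True
   have "(SS \<omega>. ennreal (\<bar>e \<bullet> (t *\<^sub>R \<omega>)\<bar> powr q * exp (- (norm (t *\<^sub>R \<omega>))\<^sup>2)))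
     = (SS \<omega>. ennreal (t powr q * exp (- t\<^sup>2)) * apow q (e \<bullet> \<omega>))"
   proof (rule nn_integral_cong_AE, rule eventually_mono [OF norm_sphere_AE])
    fix \<omega> :: 'a assume "norm \<omega> = 1"
    with True show "ennreal (\<bar>e \<bullet> (t *\<^sub>R \<omega>)\<bar> powr q * exp (- (norm (t *\<^sub>R \<omega>))\<^sup>2)) = ennreal (t powr q * exp (- t\<^sup>2)) * apow q (e \<bullet> \<omega>)"
     by (simp add: ennreal_mult' [symmetric] abs_mult powr_mult mult_ac)
   qed
   also have "... = ennreal (t powr q * exp (- t\<^sup>2)) * ?I"
    by (rule nn_integral_cmult) simp
   moreover have "2 * ((real ?d + q) / 2) - 1 = (real ?d - 1) + q" by simp
   ultimately show ?thesis
    using True by (simp only: powr_add) (simp add: mult.assoc [symmetric] ennreal_mult' [symmetric])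
  qed simp
 qed
 also have "... = ennreal (Gamma ((real ?d + q) / 2) / 2) * ?I"
 proof -
  have "(\<integral>\<^sup>+t\<in>{0<..}. ennreal (t powr (2 * ((real ?d + q) / 2) - 1) * exp (- t\<^sup>2)) * ?I \<partial>lborel)
    = (NN t. ennreal (t powr (2 * ((real ?d + q) / 2) - 1) * exp (- t\<^sup>2)) * indicator {0<..} t * ?I)"
   by (simp only: mult_ac)
  also have "... = (\<integral>\<^sup>+t\<in>{0<..}. ennreal (t powr (2 * ((real ?d + q) / 2) - 1) * exp (- t\<^sup>2)) \<partial>lborel) * ?I"
   by (rule nn_integral_multc) simp
  finally show ?thesis
   using assms by (subst (asm) nn_integral_gaussian_radial) (simp_all add: add_pos_nonneg)
 qed
 finally have "ennreal (Gamma ((real ?d + q) / 2) / 2) * ?I = ennreal (Gamma ((q + 1) / 2) * Gamma (1/2) ^ (?d - 1))" .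
 moreover have pos: "0 < Gamma ((real ?d + q) / 2)" "Gamma (real ?d / 2) ~= 0"
  using assms by (intro Gamma_real_pos less_imp_neq [THEN not_sym]; simp add: add_pos_nonneg)+
 moreover have "ennreal (Gamma ((real ?d + q) / 2) / 2) * ennreal (K_const ?d q * sphere_area ?d) = ennreal (Gamma ((q + 1) / 2) * Gamma (1/2) ^ (?d - 1))"
 proof -
  have "pi powr (real ?d / 2) = sqrt pi ^ ?d"
   by (simp add: powr_half_sqrt [symmetric] powr_realpow [symmetric] powr_powr mult.commute)
  also have "... = sqrt pi * sqrt pi ^ (?d - 1)"
   by (metis DIM_positive Suc_diff_1 power_Suc)
  finally show ?thesis
   using pos(1) pos(2) by (simp add: ennreal_mult' [symmetric] K_const_def sphere_area_def Gamma_one_half_real)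
 qed
 ultimately show ?thesis
  by (metis (no_types, lifting) ennreal_mult_cancel_left divide_pos_pos zero_less_numeral ennreal_neq_top ennreal_eq_0_iff not_le)
qed

text \<open>A reflection carries \<open>v\<close> to \<open>norm v *\<^sub>R e\<close>, which
  reduces the claim to a basis vector by invariance and homogeneity.\<close>

lemma nn_integral_sphere_inner:
 fixes v :: "'a::euclidean_space"
 assumes "1 <= q"
 shows "(SS \<omega>. apow q (v \<bullet> \<omega>)) = ennreal (K_const DIM('a) q * sphere_area DIM('a)) * ennreal (norm v powr q)"
proof -
 obtain e :: 'a where e: "e \<in> Basis" using nonempty_Basis by blast
 let ?n = "v - norm v *\<^sub>R e"
 have "v = reflect ?n (norm v *\<^sub>R e)"
  using reflect_swap [of v "norm v *\<^sub>R e"] e by (metis abs_norm_cancel mult.right_neutral norm_Basis norm_scaleR reflect_reflect)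
 hence "v \<bullet> \<omega> = norm v * (e \<bullet> reflect ?n \<omega>)" for \<omega>
  by (metis inner_reflect inner_scaleR_left)
 hence "(SS \<omega>. apow q (v \<bullet> \<omega>)) = (SS \<omega>. ennreal (norm v powr q) * apow q (e \<bullet> reflect ?n \<omega>))"
  by (simp add: abs_mult powr_mult ennreal_mult)
 also have "... = ennreal (norm v powr q) * (SS \<omega>. apow q (e \<bullet> reflect ?n \<omega>))"
  by (rule nn_integral_cmult) measurable
 also have "(SS \<omega>. apow q (e \<bullet> reflect ?n \<omega>)) = (SS \<omega>. apow q (e \<bullet> \<omega>))"
  by (rule nn_integral_sphere_isometry [OF linear_reflect]) simp_all
 finally show ?thesis
  using nn_integral_sphere_inner_Basis [OF e, of q] assms by (simp add: mult.commute)
qed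

section \<open>Differences of translates\<close>

text \<open>Integrates against \<open>lborel\<close> rather than \<open>lebesgue\<close>: for a
  Borel \<open>u\<close> the integrand is jointly measurable in \<open>x\<close> and
  \<open>h\<close>, which the later uses of Fubini rely on.\<close>

definition shift_diff :: "real => ('a::euclidean_space => real) => 'a => ennreal" where
 "shift_diff q u h = (NN x. apow q (u (x + h) - u x))"

lemma sets_borel_cball [measurable]: "cball (c::'a::euclidean_space) r \<in> sets borel"
 by simp

lemma tendsto_ennreal_0_le:
 fixes f g :: "'b => ennreal"
 assumes "(g ---> 0) F" "!!x. f x <= g x"
 shows "(f ---> 0) F"
 by (rule tendsto_sandwich [where f = "%x. 0" and h = g]) (use assms in auto)

lemma U_fun_eq: "U_fun q u t = (SS \<omega>. shift_diff q u (t *\<^sub>R \<omega>))"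
 by (simp add: U_fun_def shift_diff_def nn_integral_completion)

lemma borel_measurable_shift_diff [measurable]:
 assumes [measurable]: "u \<in> Borel"
 shows "shift_diff q u \<in> Borel"
 unfolding shift_diff_def by measurable

lemma borel_measurable_U_fun [measurable]:
 assumes [measurable]: "u \<in> Borel"
 shows "U_fun q u \<in> Borel"
 unfolding U_fun_eq by measurable

lemma shift_diff_0 [simp]: "shift_diff q u 0 = 0"
 by (simp add: shift_diff_def)

lemma nn_integral_powr_add_le:
 fixes f g :: "'a => real"
 assumes [measurable]: "f \<in> borel_measurable M" "g \<in> borel_measurable M"
  and "1 <= q" "0 < l" "l < 1"
 shows "(\<integral>\<^sup>+x. apow q (f x + g x) \<partial>M)
  <= ennreal ((1 - l) powr (1 - q)) * (\<integral>\<^sup>+x. apow q (f x) \<partial>M)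
   + ennreal (l powr (1 - q)) * (\<integral>\<^sup>+x. apow q (g x) \<partial>M)"
proof -
 have "\<bar>f x + g x\<bar> powr q <= (1 - l) powr (1 - q) * \<bar>f x\<bar> powr q + l powr (1 - q) * \<bar>g x\<bar> powr q" for x
  by (rule order_trans [OF powr_mono2 powr_add_le]) (use assms in auto)
 hence "(\<integral>\<^sup>+x. apow q (f x + g x) \<partial>M)
   <= (\<integral>\<^sup>+x. ennreal ((1 - l) powr (1 - q)) * apow q (f x) + ennreal (l powr (1 - q)) * (apow q (g x)) \<partial>M)"
  by (intro nn_integral_mono) (simp add: ennreal_mult' [symmetric] ennreal_plus [symmetric] ennreal_leI del: ennreal_plus)
 also have "... = ennreal ((1 - l) powr (1 - q)) * (\<integral>\<^sup>+x. apow q (f x) \<partial>M)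
   + ennreal (l powr (1 - q)) * (\<integral>\<^sup>+x. apow q (g x) \<partial>M)"
  by (simp add: nn_integral_add nn_integral_cmult)
 finally show ?thesis .
qed

lemma nn_integral_powr_add_le_half:
 fixes f g :: "'a => real"
 assumes "f \<in> borel_measurable M" "g \<in> borel_measurable M" "1 <= q"
 shows "(\<integral>\<^sup>+x. apow q (f x + g x) \<partial>M)
  <= ennreal (2 powr (q - 1)) * ((\<integral>\<^sup>+x. apow q (f x) \<partial>M) + (\<integral>\<^sup>+x. apow q (g x) \<partial>M))"
proof -
 have "(1 / 2::real) powr (1 - q) = 2 powr (q - 1)"
  by (simp add: powr_divide powr_diff)
 thus ?thesis
  using nn_integral_powr_add_le [OF assms, of "1/2"] by (simp add: distrib_left)
qed

lemma shift_diff_add: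
 assumes [measurable]: "u \<in> Borel" and "1 <= q" "0 < l" "l < 1"
 shows "shift_diff q u (h + k) <= ennreal ((1 - l) powr (1 - q)) * shift_diff q u h + ennreal (l powr (1 - q)) * shift_diff q u k"
proof -
 have "(NN x. apow q (u (x + k + h) - u (x + k))) = shift_diff q u h"
  unfolding shift_diff_def by (rule nn_integral_lborel_shift [of "%x. apow q (u (x + h) - u x)"]) simp
 thus ?thesis
  using nn_integral_powr_add_le [of "%x. u (x + k + h) - u (x + k)" lborel "%x. u (x + k) - u x" q l] assms
  by (simp add: shift_diff_def ac_simps)
qed

lemma shift_diff_add_half:
 assumes [measurable]: "u \<in> Borel" and "1 <= q"
 shows "shift_diff q u (h + k) <= ennreal (2 powr (q - 1)) * (shift_diff q u h + shift_diff q u k)"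
proof -
 have "(1 / 2::real) powr (1 - q) = 2 powr (q - 1)"
  by (simp add: powr_divide powr_diff)
 thus ?thesis
  using shift_diff_add [OF assms, of "1/2" h k] by (simp add: distrib_left)
qed

lemma shift_diff_minus:
 assumes [measurable]: "u \<in> Borel"
 shows "shift_diff q u (- h) = shift_diff q u h"
 unfolding shift_diff_def
 using nn_integral_lborel_shift [of "%x. apow q (u (x + h) - u x)" "- h"]
 by (simp add: abs_minus_commute)

lemma shift_diff_double:
 assumes "u \<in> Borel" "1 <= q"
 shows "shift_diff q u (2 *\<^sub>R h) <= ennreal (2 powr q) * shift_diff q u h"
proof -
 have "shift_diff q u (h + h) <= ennreal (2 powr (q - 1)) * (2 * shift_diff q u h)"
  using shift_diff_add_half [OF assms, of h h] by (simp add: mult_2)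
 also have "... = ennreal (2 powr (q - 1) * 2) * shift_diff q u h"
  by (subst ennreal_mult') (simp_all add: mult.assoc)
 also have "2 powr (q - 1) * 2 = 2 powr q"
  by (simp add: powr_diff)
 finally show ?thesis by (simp add: scaleR_2)
qed

lemma shift_diff_le:
 assumes [measurable]: "u \<in> Borel" and "1 <= q"
 shows "shift_diff q u h <= ennreal (2 powr q) * (NN x. apow q (u x))"
proof -
 have "shift_diff q u h <= ennreal (2 powr (q - 1)) * ((NN x. apow q (u (x + h))) + (NN x. apow q (- u x)))"
  using nn_integral_powr_add_le_half [of "%x. u (x + h)" lborel "%x. - u x" q] assms by (simp add: shift_diff_def)
 also have "(NN x. apow q (u (x + h))) = (NN x. apow q (u x))"
  by (rule nn_integral_lborel_shift [of "%x. apow q (u x)"]) simp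
 also have "ennreal (2 powr (q - 1)) * (... + (NN x. apow q (- u x)))
   = ennreal (2 powr (q - 1) * 2) * (NN x. apow q (u x))"
  by (subst ennreal_mult') (simp_all add: mult.assoc mult_2)
 also have "2 powr (q - 1) * 2 = 2 powr q"
  by (simp add: powr_diff)
 finally show ?thesis .
qed

lemma shift_diff_approx:
 fixes f g :: "'a::euclidean_space => real"
 assumes [measurable]: "f \<in> Borel" "g \<in> Borel" and "1 <= q"
 shows "shift_diff q f h <= ennreal (2 powr (q - 1)) * (shift_diff q g h + ennreal (2 powr q) * (NN x. apow q (f x - g x)))"
proof -
 have "shift_diff q f h <= ennreal (2 powr (q - 1)) * (shift_diff q g h + shift_diff q (%x. f x - g x) h)"
  using nn_integral_powr_add_le_half [of "%x. g (x + h) - g x" lborel "%x. (f (x + h) - g (x + h)) - (f x - g x)" q] assms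
  by (simp add: shift_diff_def)
 also have "... <= ennreal (2 powr (q - 1)) * (shift_diff q g h + ennreal (2 powr q) * (NN x. apow q (f x - g x)))"
  by (intro mult_left_mono add_left_mono shift_diff_le) (use assms in auto)
 finally show ?thesis .
qed

subsection \<open>Continuity of translation\<close>

text \<open>The factor \<open>(1 - l) powr (1 - q)\<close> tends to 1 as \<open>l\<close> tends to
  0, whereas \<open>l powr (1 - q)\<close> may blow up. Hence \<open>l\<close> is fixed first and
  \<open>e\<close> is chosen small depending on it.\<close>

lemma tendsto_ennreal_perturbation:
 fixes F :: "'b => ennreal" and L :: ennreal
 assumes "L < \<infinity>"
  and up: "!!l e::real. 0 < l ==> l < 1 ==> 0 < e ==>
    \<forall>\<^sub>F h in \<F>. F h <= ennreal ((1 - l) powr (1 - q)) * L + ennreal (l powr (1 - q)) * ennreal e"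
  and lo: "!!l e::real. 0 < l ==> l < 1 ==> 0 < e ==>
    \<forall>\<^sub>F h in \<F>. L <= ennreal ((1 - l) powr (1 - q)) * F h + ennreal (l powr (1 - q)) * ennreal e"
 shows "(F ---> L) \<F>"
proof -
 obtain L' where L': "L = ennreal L'" "0 <= L'"
  using \<open>L < \<infinity>\<close> by (cases L) auto
 have lim: "((%l::real. (1 - l) powr (1 - q) * c) ---> c) (at_right 0)" for c :: real
  by (auto intro!: tendsto_eq_intros)
 have small: "\<forall>\<^sub>F l in at_right (0::real). 0 < l & l < 1"
  using eventually_at_right_field [of "%l. 0 < l & l < 1" 0] zero_less_one by blast
 show ?thesis
 proof (rule order_tendstoI)
  fix a assume "L < a"
  then obtain b where b: "L' < b" "ennreal b <= a" "0 <= b"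
  proof (cases a)
   case (real r)
   thus ?thesis using \<open>L < a\<close> L' that [of r] by (simp add: ennreal_less_iff)
  next
   case top
   thus ?thesis using that [of "L' + 1"] L' by simp
  qed
  have "\<forall>\<^sub>F l in at_right 0. (1 - l) powr (1 - q) * L' < b"
   using order_tendstoD(2) [OF lim b(1)] .
  then obtain l :: real where l: "(1 - l) powr (1 - q) * L' < b" "0 < l" "l < 1"
   using eventually_happens [OF eventually_conj [OF _ small]] by fastforce
  define e where "e = (b - (1 - l) powr (1 - q) * L') / 2 / l powr (1 - q)"
  have e: "0 < e" "(1 - l) powr (1 - q) * L' + l powr (1 - q) * e < b"
   using l by (auto simp: e_def field_simps)
  from up [OF l(2,3) e(1)] show "\<forall>\<^sub>F h in \<F>. F h < a"
  proof eventually_elim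
   case (elim h)
   hence "F h <= ennreal ((1 - l) powr (1 - q) * L' + l powr (1 - q) * e)"
    using L' e(1) by (simp add: ennreal_mult')
   also have "... < ennreal b"
    using e b(3) L'(2) by (subst ennreal_less_iff) auto
   finally show ?case using b(2) by simp
  qed
 next
  fix a assume "a < L"
  then obtain b where b: "a = ennreal b" "b < L'" "0 <= b"
   using L' by (cases a) (auto simp: ennreal_less_iff)
  have "\<forall>\<^sub>F l in at_right 0. (1 - l) powr (1 - q) * b < L'"
   using order_tendstoD(2) [OF lim b(2)] .
  then obtain l :: real where l: "(1 - l) powr (1 - q) * b < L'" "0 < l" "l < 1"
   using eventually_happens [OF eventually_conj [OF _ small]] by fastforce
  define e where "e = (L' - (1 - l) powr (1 - q) * b) / 2 / l powr (1 - q)"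
  have e: "0 < e" "(1 - l) powr (1 - q) * b + l powr (1 - q) * e < L'"
   using l by (auto simp: e_def field_simps)
  from lo [OF l(2,3) e(1)] show "\<forall>\<^sub>F h in \<F>. a < F h"
  proof eventually_elim
   case (elim h)
   show ?case
   proof (rule ccontr)
    assume "\<not> a < F h"
    hence "F h <= ennreal b" using b by simp
    have "L <= ennreal ((1 - l) powr (1 - q)) * F h + ennreal (l powr (1 - q)) * ennreal e"
     by (rule elim)
    also have "... <= ennreal ((1 - l) powr (1 - q)) * ennreal b + ennreal (l powr (1 - q)) * ennreal e"
     using \<open>F h \<le> ennreal b\<close> by (intro add_right_mono mult_left_mono) auto
    also have "... = ennreal ((1 - l) powr (1 - q) * b + l powr (1 - q) * e)"
     using b e(1) by (simp add: ennreal_mult')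
    also have "... < L"
     unfolding L'(1) using e b by (subst ennreal_less_iff) auto
    finally show False by simp
   qed
  qed
 qed
qed

lemma shift_diff_tendsto_0_approx:
 fixes f :: "'a::euclidean_space => real"
 assumes [measurable]: "f \<in> Borel" and q: "1 <= q"
  and approx: "!!e::real. 0 < e ==> \<exists>g \<in> Borel. (shift_diff q g ---> 0) (nhds 0) & (NN x. apow q (f x - g x)) <= ennreal e"
 shows "(shift_diff q f ---> 0) (nhds 0)"
proof (rule order_tendstoI)
 fix a :: ennreal assume "0 < a"
 then obtain b where b: "0 < b" "ennreal b <= a"
  by (metis dense ennreal_cases ennreal_less_zero_iff less_imp_le ennreal_top_neq_zero less_top top_greatest order_less_le_trans zero_less_one ennreal_zero_less_one)
 \<comment> \<open>Makes the total error in \<open>shift_diff_approx\<close> equal to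
   \<open>b / 2\<close>.\<close>
 define e where "e = b / (2 powr (q - 1) * (1 + 2 powr q)) / 2"
 have "0 < e" using b by (auto simp: e_def add_pos_pos)
 then obtain g where [measurable]: "g \<in> Borel" and g: "(shift_diff q g ---> 0) (nhds 0)"
  "(NN x. apow q (f x - g x)) <= ennreal e"
  using approx by blast
 have "\<forall>\<^sub>F h in nhds 0. shift_diff q g h < ennreal e"
  using g(1) \<open>0 < e\<close> by (intro order_tendstoD) auto
 thus "\<forall>\<^sub>F h in nhds 0. shift_diff q f h < a"
 proof eventually_elim
  case (elim h)
  have "shift_diff q f h <= ennreal (2 powr (q - 1)) * (shift_diff q g h + ennreal (2 powr q) * (NN x. apow q (f x - g x)))"
   by (rule shift_diff_approx) (use q in auto)
  also have "... <= ennreal (2 powr (q - 1)) * (ennreal e + ennreal (2 powr q) * ennreal e)"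
   using elim g(2) by (intro mult_left_mono add_mono) auto
  also have "... = ennreal (2 powr (q - 1) * (1 + 2 powr q) * e)"
   using \<open>0 < e\<close> by (simp add: ennreal_mult' [symmetric] ennreal_plus [symmetric] distrib_right mult.assoc del: ennreal_plus)
  also have "2 powr (q - 1) * (1 + 2 powr q) * e = b / 2"
  proof -
   have "2 powr (q - 1) * (1 + 2 powr q) ~= 0" by (auto simp: add_nonneg_eq_0_iff)
   thus ?thesis unfolding e_def by simp
  qed
  also have "ennreal (b / 2) < ennreal b" using b by (simp add: ennreal_lessI)
  finally show ?case using b by simp
 qed
qed simp

text \<open>The symmetric difference of \<open>K\<close> and its translate splits into the points
  that enter \<open>K\<close> under the shift by \<open>h\<close>, of measure \<open>P h\<close>,
  and those that leave it, of measure \<open>P (- h)\<close>. A point outside the closed set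
  \<open>K\<close> stays outside for small shifts, so \<open>P\<close> tends to 0 by dominated
  convergence; boundedness of \<open>K\<close> provides the majorant.\<close>

lemma shift_diff_indicator_compact:
 fixes K :: "'a::euclidean_space set"
 assumes "compact K"
 shows "(shift_diff 1 (indicator K) ---> 0) (nhds 0)"
proof -
 have [measurable]: "K \<in> sets borel" using assms by (simp add: compact_imp_closed)
 define P where "P h = (NN x. indicator K (x + h) * indicator (- K) x)" for h
 have lim: "(P ---> 0) (at 0)"
  unfolding tendsto_at_iff_sequentially
 proof (intro allI impI)
  fix X :: "nat => 'a" assume X: "\<forall>i. X i \<in> UNIV - {0}" "X ----> 0"
  obtain B where B: "!!n. norm (X n) <= B"
   using X(2) convergent_imp_Bseq [of X] by (auto simp: convergent_def Bseq_def)
  obtain C where C: "!!x. x \<in> K ==> norm x <= C"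
   using compact_imp_bounded [OF assms] by (auto simp: bounded_iff)
  have "(%n. P (X n)) ----> (\<integral>\<^sup>+x. 0 \<partial>(lborel :: 'a measure))"
   unfolding P_def
  proof (rule nn_integral_dominated_convergence [where w = "indicator (cball 0 (B + C))"])
   show "AE x in lborel. indicator K (x + X n) * indicator (- K) x <= (indicator (cball 0 (B + C)) x :: ennreal)" for n
   proof (rule AE_I2)
    fix x
    have "norm x <= B + C" if "x + X n \<in> K"
     using C [OF that] B [of n] norm_triangle_ineq4 [of "x + X n" "X n"] by simp
    thus "indicator K (x + X n) * indicator (- K) x <= (indicator (cball 0 (B + C)) x :: ennreal)"
     by (auto simp: indicator_def)
   qed
   show "(NN x. indicator (cball (0::'a) (B + C)) x) < \<infinity>"
    using emeasure_lborel_cball_finite [of "0::'a" "B + C"] by simp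
   show "AE x in lborel. (%n. indicator K (x + X n) * indicator (- K) x :: ennreal) ----> 0"
   proof (rule AE_I2)
    fix x
    show "(%n. indicator K (x + X n) * indicator (- K) x :: ennreal) ----> 0"
    proof (cases "x \<in> K")
     case False
     have "(%n. x + X n) ----> x + 0" by (intro tendsto_intros X)
     hence "\<forall>\<^sub>F n in sequentially. x + X n \<in> - K"
      using False compact_imp_closed [OF assms] by (intro topological_tendstoD) auto
     thus ?thesis
      by (intro tendsto_eventually) (auto elim!: eventually_mono)
    qed simp
   qed
  qed auto
  thus "(P \<circ> X) ----> 0" by (simp add: comp_def)
 qed
 have "P 0 = (\<integral>\<^sup>+x. 0 \<partial>(lborel :: 'a measure))"
  unfolding P_def by (intro nn_integral_cong) (simp add: indicator_def)
 hence "P 0 = 0" by simp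
 hence lim: "(P ---> 0) (nhds 0)"
  using lim tendsto_at_iff_tendsto_nhds [of P 0] by simp
 moreover have "((%h. P (- h)) ---> 0) (nhds 0)"
  by (rule filterlim_compose [OF lim]) (auto intro!: tendsto_eq_intros filterlim_ident)
 ultimately have "((%h. P h + P (- h)) ---> 0 + 0) (nhds 0)"
  by (rule tendsto_add)
 moreover have "shift_diff 1 (indicator K) h = P h + P (- h)" for h
 proof -
  have "P (- h) = (NN x. indicator K x * indicator (- K) (x + h))"
   unfolding P_def using nn_integral_lborel_shift [of "%x. indicator K (x - h) * indicator (- K) x" h] by simp
  moreover have "shift_diff 1 (indicator K) h = (NN x. indicator K (x + h) * indicator (- K) x + indicator K x * indicator (- K) (x + h))"
   unfolding shift_diff_def by (intro nn_integral_cong) (auto simp: indicator_def)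
  ultimately show ?thesis by (simp add: P_def nn_integral_add)
 qed
 hence "shift_diff 1 (indicator K) = (%h. P h + P (- h))" by (rule ext)
 ultimately show ?thesis by simp
qed

text \<open>Induction over integrable functions. A set of finite measure is exhausted in measure by
  a closed subset, and this by its intersections with balls, so its indicator is approximated by
  those of compact sets; sums use the triangle inequality and limits use approximation in
  \<open>L^1\<close>.\<close>

lemma shift_diff_tendsto_0_integrable:
 fixes f :: "'a::euclidean_space => real"
 assumes "integrable lborel f"
 shows "(shift_diff 1 f ---> 0) (nhds 0)"
 using assms
proof (induction rule: integrable_induct)
 case (base A c)
 hence A [measurable]: "A \<in> sets borel" by simp
 show ?case
 proof (rule shift_diff_tendsto_0_approx)
  fix e :: real assume "0 < e"
  define d where "d = e / (\<bar>c\<bar> + 1)"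
  have "0 < d" using \<open>0 < e\<close> by (simp add: d_def add_nonneg_pos)
  obtain T where T: "closed T" "T \<subseteq> A" "emeasure lebesgue (A - T) < ennreal (d / 2)"
   using sets_lebesgue_inner_closed [of A "d / 2"] \<open>0 < d\<close> A by (metis half_gt_zero sets_completionI_sets sets_lborel)
  have [measurable]: "T \<in> sets borel" using T(1) by simp
  have "(%n::nat. emeasure lborel (T - cball 0 (real n))) ----> emeasure lborel (\<Inter>n::nat. T - cball 0 (real n))"
  proof (rule Lim_emeasure_decseq)
   show "emeasure lborel (T - cball 0 (real n)) ~= \<infinity>" for n
   proof -
    have "emeasure lborel (T - cball 0 (real n)) <= emeasure lborel A"
     using T(2) by (intro emeasure_mono) auto
    with base(2) show ?thesis by (auto simp: top_unique)
   qed
  qed (auto simp: decseq_def)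
  moreover have emp: "(\<Inter>n::nat. T - cball 0 (real n)) = {}"
   by (auto intro: real_arch_simple)
  ultimately have "(%n::nat. emeasure lborel (T - cball 0 (real n))) ----> 0"
   by (simp only: emeasure_empty)
  hence "\<forall>\<^sub>F n in sequentially. emeasure lborel (T - cball 0 (real n)) < ennreal (d / 2)"
   using \<open>0 < d\<close> by (intro order_tendstoD) (auto simp: zero_less_iff_neq_zero)
  then obtain n where n: "emeasure lborel (T - cball 0 (real n)) < ennreal (d / 2)"
   using eventually_happens' [OF sequentially_bot] by blast
  define K where "K = T \<inter> cball 0 (real n)"
  have "compact K" unfolding K_def using T(1) by (intro closed_Int_compact) auto
  have [measurable]: "K \<in> sets borel" by (simp add: K_def)
  have "emeasure lborel (A - K) <= emeasure lborel (A - T) + emeasure lborel (T - cball 0 (real n))"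
   by (rule order_trans [OF emeasure_mono emeasure_subadditive]) (auto simp: K_def)
  also have "... <= ennreal (d / 2) + ennreal (d / 2)"
   using T(3) n by (intro add_mono) (auto simp: less_imp_le)
  also have "... = ennreal d" using \<open>0 < d\<close> by (simp add: ennreal_plus [symmetric] del: ennreal_plus)
  finally have AK: "emeasure lborel (A - K) <= ennreal d" .
  have "(NN x. apow 1 (indicator A x *\<^sub>R c - indicator K x *\<^sub>R c)) = (NN x. ennreal \<bar>c\<bar> * indicator (A - K) x)"
   using T(2) by (intro nn_integral_cong) (auto simp: indicator_def K_def)
  also have "... = ennreal \<bar>c\<bar> * emeasure lborel (A - K)"
   by (simp add: nn_integral_cmult_indicator)
  also have "... <= ennreal \<bar>c\<bar> * ennreal d" using AK by (rule mult_left_mono) simp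
  also have "... <= ennreal e"
   using \<open>0 < e\<close> by (simp add: ennreal_mult' [symmetric] d_def divide_simps ennreal_leI)
  finally have "(NN x. apow 1 (indicator A x *\<^sub>R c - indicator K x *\<^sub>R c)) <= ennreal e" .
  moreover have "shift_diff 1 (%x. indicator K x *\<^sub>R c) h = ennreal \<bar>c\<bar> * shift_diff 1 (indicator K) h" for h
   unfolding shift_diff_def by (subst nn_integral_cmult [symmetric]) (auto simp: ennreal_mult' [symmetric] abs_mult [symmetric] algebra_simps)
  hence "shift_diff 1 (%x. indicator K x *\<^sub>R c) = (%h. ennreal \<bar>c\<bar> * shift_diff 1 (indicator K) h)"
   by (rule ext)
  hence "(shift_diff 1 (%x. indicator K x *\<^sub>R c) ---> 0) (nhds 0)"
   using tendsto_mult_ennreal [OF tendsto_const shift_diff_indicator_compact [OF \<open>compact K\<close>], of "ennreal \<bar>c\<bar>"] by simp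
  ultimately show "\<exists>g\<in>Borel. (shift_diff 1 g ---> 0) (nhds 0) & (NN x. apow 1 (indicator A x *\<^sub>R c - g x)) <= ennreal e"
   by (intro bexI [of _ "%x. indicator K x *\<^sub>R c"]) auto
 qed auto
next
 case (add f g)
 hence [measurable]: "f \<in> Borel" "g \<in> Borel"
  by auto
 have le: "shift_diff 1 (%x. f x + g x) h <= shift_diff 1 f h + shift_diff 1 g h" for h
  unfolding shift_diff_def
  using nn_integral_powr_add_le_half [of "%x. f (x + h) - f x" lborel "%x. g (x + h) - g x" 1] by (simp add: algebra_simps)
 have "((%h. shift_diff 1 f h + shift_diff 1 g h) ---> 0 + 0) (nhds 0)"
  by (intro tendsto_add add.IH)
 thus ?case
  by (intro tendsto_ennreal_0_le [OF _ le]) simp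
next
 case (lim f s)
 hence [measurable]: "f \<in> Borel" "!!i. s i \<in> Borel"
  by auto
 have "(%i. NN x. ennreal (norm (f x - s i x))) ----> 0"
 proof (rule Bochner_Integration.nn_integral_dominated_convergence_norm [where w = "%x. 2 * norm (f x)"])
  show "AE x in lborel. norm (s i x) <= 2 * norm (f x)" for i
   using lim(3) by simp
  show "(NN x. ennreal (2 * norm (f x))) < \<infinity>"
   using lim(4) by (simp add: ennreal_mult nn_integral_cmult integrable_iff_bounded ennreal_mult_less_top)
 qed (use lim in auto)
 thus ?case
 proof (intro shift_diff_tendsto_0_approx)
  fix e :: real assume "0 < e"
  assume "(%i. NN x. ennreal (norm (f x - s i x))) ----> 0"
  hence "\<forall>\<^sub>F i in sequentially. (NN x. ennreal (norm (f x - s i x))) < ennreal e"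
   using \<open>0 < e\<close> by (intro order_tendstoD) auto
  then obtain i where "(NN x. ennreal (norm (f x - s i x))) < ennreal e"
   using eventually_happens' [OF sequentially_bot] by blast
  thus "\<exists>g\<in>Borel. (shift_diff 1 g ---> 0) (nhds 0) & (NN x. apow 1 (f x - g x)) <= ennreal e"
   using lim(5) by (intro bexI [of _ "s i"]) auto
 qed auto
qed


text \<open>Cutting off large arguments and large values gives an integrable function bounded by
  \<open>n\<close>. For it \<open>q - 1\<close> of the \<open>q\<close> powers of an increment may
  be replaced by \<open>2 * n\<close>, which reduces the claim to the exponent 1.\<close>

lemma shift_diff_tendsto_0:
 fixes f :: "'a::euclidean_space => real"
 assumes [measurable]: "f \<in> Borel" and q: "1 <= q"
  and fin: "(NN x. apow q (f x)) < \<infinity>"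
 shows "(shift_diff q f ---> 0) (nhds 0)"
proof (rule shift_diff_tendsto_0_approx)
 define g where "g n x = (if norm x <= real n & \<bar>f x\<bar> <= real n then f x else 0)" for n :: nat and x
 have [measurable]: "g n \<in> Borel" for n
  unfolding g_def by measurable
 have "(%n. NN x. apow q (f x - g n x)) ----> (\<integral>\<^sup>+x. 0 \<partial>(lborel :: 'a measure))"
 proof (rule nn_integral_dominated_convergence [where w = "%x. apow q (f x)"])
  show "AE x in lborel. (%n. apow q (f x - g n x)) ----> 0"
  proof (rule AE_I2)
   fix x
   have "\<forall>\<^sub>F n in sequentially. norm x <= real n & \<bar>f x\<bar> <= real n"
    using eventually_ge_at_top [of "nat \<lceil>max (norm x) \<bar>f x\<bar>\<rceil>"] by eventually_elim linarith
   hence "\<forall>\<^sub>F n in sequentially. (apow q (f x - g n x)) = 0"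
    by eventually_elim (simp add: g_def)
   thus "(%n. apow q (f x - g n x)) ----> 0" by (rule tendsto_eventually)
  qed
  show "AE x in lborel. (apow q (f x - g n x)) <= apow q (f x)" for n
   by (auto simp: g_def)
 qed (use fin in auto)
 hence lim: "(%n. NN x. apow q (f x - g n x)) ----> 0" by simp
 fix e :: real assume "0 < e"
 hence "\<forall>\<^sub>F n in sequentially. (NN x. apow q (f x - g n x)) < ennreal e"
  using lim by (intro order_tendstoD) auto
 then obtain n where n: "(NN x. apow q (f x - g n x)) < ennreal e"
  using eventually_happens' [OF sequentially_bot] by blast
 have gn: "\<bar>g n x\<bar> <= real n" for x by (simp add: g_def)
 have "integrable lborel (g n)"
 proof (rule Bochner_Integration.integrable_bound)
  show "integrable lborel (%x. real n * indicator (cball (0::'a) (real n)) x)"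
   using emeasure_lborel_cball_finite [of "0::'a" "real n"] by (intro integrable_mult_right) (simp add: integrable_indicator_iff)
  show "AE x in lborel. norm (g n x) <= norm (real n * indicator (cball 0 (real n)) x)"
   by (auto simp: g_def indicator_def)
 qed simp
 hence lim1: "(shift_diff 1 (g n) ---> 0) (nhds 0)"
  by (rule shift_diff_tendsto_0_integrable)
 have le: "shift_diff q (g n) h <= ennreal ((2 * real n) powr (q - 1)) * shift_diff 1 (g n) h" for h
 proof -
  have "(apow q (g n (x + h) - g n x)) <= ennreal ((2 * real n) powr (q - 1)) * apow 1 (g n (x + h) - g n x)" for x
  proof (cases "g n (x + h) - g n x = 0")
   case False
   have "\<bar>g n (x + h) - g n x\<bar> powr q = \<bar>g n (x + h) - g n x\<bar> powr (q - 1) * \<bar>g n (x + h) - g n x\<bar> powr 1"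
    by (subst powr_add [symmetric]) simp
   also have "... <= (2 * real n) powr (q - 1) * \<bar>g n (x + h) - g n x\<bar> powr 1"
    using gn [of "x + h"] gn [of x] q by (intro mult_right_mono powr_mono2) auto
   finally show ?thesis by (simp add: ennreal_mult' [symmetric] ennreal_leI)
  qed simp
  thus ?thesis
   unfolding shift_diff_def by (subst nn_integral_cmult [symmetric]) (auto intro: nn_integral_mono)
 qed
 have "((%h. ennreal ((2 * real n) powr (q - 1)) * shift_diff 1 (g n) h) ---> 0) (nhds 0)"
  using tendsto_mult_ennreal [OF tendsto_const lim1, of "ennreal ((2 * real n) powr (q - 1))"] by simp
 hence "(shift_diff q (g n) ---> 0) (nhds 0)"
  by (rule tendsto_ennreal_0_le) (rule le)
 thus "\<exists>g\<in>Borel. (shift_diff q g ---> 0) (nhds 0) & (NN x. apow q (f x - g x)) <= ennreal e"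
  using n by (intro bexI [of _ "g n"]) auto
qed (use q in auto)

text \<open>For a function supported in a ball and a shift longer than the diameter, the two terms
  of the increment have disjoint supports, and \<open>shift_diff\<close> equals twice the integral
  exactly. Truncation to balls passes to the limit because the triangle inequality with weight
  \<open>l\<close> has leading coefficient close to 1.\<close>

lemma shift_diff_at_infinity:
 fixes f :: "'a::euclidean_space => real"
 assumes [measurable]: "f \<in> Borel" and q: "1 <= q"
  and fin: "(NN x. apow q (f x)) < \<infinity>"
 shows "(shift_diff q f ---> 2 * (NN x. apow q (f x))) at_infinity"
proof -
 define N where "N g = (NN x. apow q (g x))" for g :: "'a => real"
 define v where "v n x = f x * indicator (cball 0 (real n)) x" for n :: nat and x
 have [measurable]: "v n \<in> Borel" for n
  unfolding v_def by measurable
 have "(%n. NN x. apow q (f x - v n x)) ----> (\<integral>\<^sup>+x. 0 \<partial>(lborel :: 'a measure))"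
 proof (rule nn_integral_dominated_convergence [where w = "%x. apow q (f x)"])
  show "AE x in lborel. (%n. apow q (f x - v n x)) ----> 0"
  proof (rule AE_I2)
   fix x :: 'a
   have "\<forall>\<^sub>F n in sequentially. norm x <= real n"
    using eventually_ge_at_top [of "nat \<lceil>norm x\<rceil>"] by eventually_elim linarith
   hence "\<forall>\<^sub>F n in sequentially. (apow q (f x - v n x)) = 0"
    by eventually_elim (simp add: v_def)
   thus "(%n. apow q (f x - v n x)) ----> 0" by (rule tendsto_eventually)
  qed
  show "AE x in lborel. (apow q (f x - v n x)) <= apow q (f x)" for n
   by (auto simp: v_def indicator_def)
 qed (use fin in auto)
 hence lim: "(%n. N (%x. f x - v n x)) ----> 0" by (simp add: N_def)
 have split: "N f = N (v n) + N (%x. f x - v n x)" for n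
  unfolding N_def by (subst nn_integral_add [symmetric]) (auto simp: v_def indicator_def intro!: nn_integral_cong)
 have far: "shift_diff q (v n) h = 2 * N (v n)" if "2 * real n < norm h" for n h
 proof -
  have "\<bar>v n (x + h) - v n x\<bar> powr q = \<bar>v n (x + h)\<bar> powr q + \<bar>v n x\<bar> powr q" for x
  proof -
   have "v n (x + h) = 0 \<or> v n x = 0"
    using that norm_triangle_ineq4 [of "x + h" x] by (auto simp: v_def indicator_def)
   thus ?thesis by auto
  qed
  hence "shift_diff q (v n) h = (NN x. apow q (v n (x + h))) + N (v n)"
   unfolding shift_diff_def N_def by (simp add: nn_integral_add)
  also have "(NN x. apow q (v n (x + h))) = N (v n)"
   unfolding N_def by (rule nn_integral_lborel_shift [of "%x. apow q (v n x)"]) simp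
  finally show ?thesis by (simp add: mult_2)
 qed
 have choose: "\<exists>n. ennreal (2 powr q) * N (%x. f x - v n x) < ennreal e & 2 * N (%x. f x - v n x) < ennreal e" if "0 < e" for e :: real
 proof -
  have "(%n. ennreal (2 powr q) * N (%x. f x - v n x)) ----> ennreal (2 powr q) * 0" "(%n. 2 * N (%x. f x - v n x)) ----> 2 * 0"
   by (intro tendsto_mult_ennreal tendsto_const lim; simp)+
  hence "\<forall>\<^sub>F n in sequentially. ennreal (2 powr q) * N (%x. f x - v n x) < ennreal e & 2 * N (%x. f x - v n x) < ennreal e"
   using that by (intro eventually_conj order_tendstoD) auto
  thus ?thesis using eventually_happens' [OF sequentially_bot] by blast
 qed
 have pert: "shift_diff q g h <= ennreal ((1 - l) powr (1 - q)) * shift_diff q g' h + ennreal (l powr (1 - q)) * (ennreal (2 powr q) * N (%x. g x - g' x))"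
  if [measurable]: "g \<in> Borel" "g' \<in> Borel" and l: "0 < l" "l < 1" for g g' h l
 proof -
  have "shift_diff q g h <= ennreal ((1 - l) powr (1 - q)) * shift_diff q g' h + ennreal (l powr (1 - q)) * shift_diff q (%x. g x - g' x) h"
   using nn_integral_powr_add_le [of "%x. g' (x + h) - g' x" lborel "%x. (g (x + h) - g' (x + h)) - (g x - g' x)" q l] q l
   by (simp add: shift_diff_def)
  also have "... <= ennreal ((1 - l) powr (1 - q)) * shift_diff q g' h + ennreal (l powr (1 - q)) * (ennreal (2 powr q) * N (%x. g x - g' x))"
   unfolding N_def by (intro add_left_mono mult_left_mono shift_diff_le) (use q in auto)
  finally show ?thesis .
 qed
 have sub: "N (%x. g x - g' x) = N (%x. g' x - g x)" for g g'
  by (simp add: N_def abs_minus_commute)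
 have ev: "\<forall>\<^sub>F h in at_infinity. 2 * real n < norm (h :: 'a)" for n
  unfolding eventually_at_infinity by (rule exI [of _ "2 * real n + 1"]) auto
 have "(shift_diff q f ---> 2 * N f) at_infinity"
 proof (rule tendsto_ennreal_perturbation [where q = q])
  show "2 * N f < \<infinity>" using fin by (simp add: N_def ennreal_mult_less_top)
  fix l e :: real assume l: "0 < l" "l < 1" and "0 < e"
  obtain n where n: "ennreal (2 powr q) * N (%x. f x - v n x) < ennreal e" "2 * N (%x. f x - v n x) < ennreal e"
   using choose [OF \<open>0 < e\<close>] by blast
  show "\<forall>\<^sub>F h in at_infinity. shift_diff q f h <= ennreal ((1 - l) powr (1 - q)) * (2 * N f) + ennreal (l powr (1 - q)) * ennreal e"
   using ev [of n]
  proof eventually_elim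
   case (elim h)
   have "shift_diff q f h <= ennreal ((1 - l) powr (1 - q)) * (2 * N (v n)) + ennreal (l powr (1 - q)) * (ennreal (2 powr q) * N (%x. f x - v n x))"
    using pert [of f "v n" l h] l far [OF elim] by simp
   also have "... <= ennreal ((1 - l) powr (1 - q)) * (2 * N f) + ennreal (l powr (1 - q)) * ennreal e"
    using n split [of n] by (intro add_mono mult_left_mono) auto
   finally show ?case .
  qed
  obtain n where n: "ennreal (2 powr q) * N (%x. f x - v n x) < ennreal (e / 2)" "2 * N (%x. f x - v n x) < ennreal (e / 2)"
   using choose [of "e / 2"] \<open>0 < e\<close> by auto
  show "\<forall>\<^sub>F h in at_infinity. 2 * N f <= ennreal ((1 - l) powr (1 - q)) * shift_diff q f h + ennreal (l powr (1 - q)) * ennreal e"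
   using ev [of n]
  proof eventually_elim
   case (elim h)
   \<comment> \<open>The error of truncation enters the lower bound twice, once without the factor
     \<open>l powr (1 - q)\<close>; as this factor is at least 1 the two halves of \<open>e\<close>
     can be added.\<close>
   have l1: "1 <= l powr (1 - q)" using powr_mono' [of "1 - q" 0 l] l q by simp
   have "2 * N f = shift_diff q (v n) h + 2 * N (%x. f x - v n x)"
    using split [of n] far [OF elim] by (simp add: distrib_left)
   also have "... <= (ennreal ((1 - l) powr (1 - q)) * shift_diff q f h + ennreal (l powr (1 - q)) * ennreal (e / 2)) + ennreal (l powr (1 - q)) * ennreal (e / 2)"
   proof (rule add_mono)
    show "shift_diff q (v n) h <= ennreal ((1 - l) powr (1 - q)) * shift_diff q f h + ennreal (l powr (1 - q)) * ennreal (e / 2)"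
     by (rule order_trans [OF pert [of "v n" f l h]])
       (use l n in \<open>auto simp: sub [of "v n" f] intro!: add_left_mono mult_left_mono\<close>)
    have "ennreal (1 * (e / 2)) <= ennreal (l powr (1 - q) * (e / 2))"
     using l1 \<open>0 < e\<close> by (intro ennreal_leI mult_right_mono) auto
    with n(2) have "2 * N (%x. f x - v n x) <= ennreal (l powr (1 - q) * (e / 2))"
     by (simp add: less_imp_le order_trans)
    thus "2 * N (%x. f x - v n x) <= ennreal (l powr (1 - q)) * ennreal (e / 2)"
     using \<open>0 < e\<close> by (simp only: ennreal_mult' powr_ge_zero)
   qed
   also have "... = ennreal ((1 - l) powr (1 - q)) * shift_diff q f h + ennreal (l powr (1 - q)) * ennreal e"
    using \<open>0 < e\<close> by (simp add: add.assoc distrib_left [symmetric] ennreal_plus [symmetric] del: ennreal_plus)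
   finally show ?case .
  qed
 qed
 thus ?thesis by (simp add: N_def)
qed


subsection \<open>Spherical averages\<close>

text \<open>\<open>shift_diff\<close> is even, so the spherical average is unaffected by the sign of
  the radius and the triangle inequality may be applied to radii of either sign;
  \<open>U_fun_le_mean\<close> uses it with a difference of radii.\<close>

lemma U_fun_diff_le:
 fixes u :: "'a::euclidean_space => real"
 assumes [measurable]: "u \<in> Borel" and "1 <= q"
 shows "U_fun q u \<bar>s + t\<bar> <= ennreal (2 powr (q - 1)) * (U_fun q u \<bar>s\<bar> + U_fun q u \<bar>t\<bar>)"
proof -
 have ab: "shift_diff q u (\<bar>t\<bar> *\<^sub>R \<omega>) = shift_diff q u (t *\<^sub>R \<omega>)" for t and \<omega> :: 'a
  using shift_diff_minus [of u q "t *\<^sub>R \<omega>"] by (cases "0 <= t") auto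
 have "U_fun q u \<bar>s + t\<bar> <= (SS \<omega>. ennreal (2 powr (q - 1)) * (shift_diff q u (\<bar>s\<bar> *\<^sub>R \<omega>) + shift_diff q u (\<bar>t\<bar> *\<^sub>R \<omega>)))"
  unfolding U_fun_eq ab scaleR_add_left by (intro nn_integral_mono shift_diff_add_half assms)
 also have "... = ennreal (2 powr (q - 1)) * (U_fun q u \<bar>s\<bar> + U_fun q u \<bar>t\<bar>)"
  by (simp add: U_fun_eq nn_integral_cmult nn_integral_add)
 finally show ?thesis .
qed

lemma U_fun_double:
 assumes [measurable]: "u \<in> Borel" and "1 <= q"
 shows "U_fun q u (2 * t) <= ennreal (2 powr q) * U_fun q u t"
proof -
 have "shift_diff q u ((2 * t) *\<^sub>R \<omega>) <= ennreal (2 powr q) * shift_diff q u (t *\<^sub>R \<omega>)" for \<omega>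
  using shift_diff_double [OF assms, of "t *\<^sub>R \<omega>"] by simp
 thus ?thesis
  unfolding U_fun_eq by (subst nn_integral_cmult [symmetric]) (auto intro: nn_integral_mono)
qed

lemma U_fun_le:
 fixes u :: "'a::euclidean_space => real"
 assumes [measurable]: "u \<in> Borel" and "1 <= q"
 shows "U_fun q u t <= ennreal (2 powr q * sphere_area DIM('a)) * (NN x. apow q (u x))"
proof -
 have "U_fun q u t <= (\<integral>\<^sup>+\<omega>. ennreal (2 powr q) * (NN x. apow q (u x)) \<partial>(sphere_measure :: 'a measure))"
  unfolding U_fun_eq by (intro nn_integral_mono shift_diff_le assms)
 also have "... = ennreal (2 powr q * sphere_area DIM('a)) * (NN x. apow q (u x))"
  by (subst ennreal_mult') (simp_all add: emeasure_sphere ac_simps)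
 finally show ?thesis .
qed

text \<open>Dominated convergence over the sphere; in each direction the increments have the limit
  computed in \<open>shift_diff_at_infinity\<close>.\<close>

lemma U_fun_at_top:
 fixes u :: "'a::euclidean_space => real"
 assumes [measurable]: "u \<in> Borel" and "1 <= q"
  and fin: "(NN x. apow q (u x)) < \<infinity>"
 shows "(U_fun q u ---> ennreal (2 * sphere_area DIM('a)) * (NN x. apow q (u x))) at_top"
proof (rule tendsto_at_topI_sequentially)
 fix X :: "nat => real" assume X: "filterlim X at_top sequentially"
 let ?N = "NN x. apow q (u x)"
 have "(%n. U_fun q u (X n)) ----> (\<integral>\<^sup>+\<omega>. 2 * ?N \<partial>(sphere_measure :: 'a measure))"
  unfolding U_fun_eq
 proof (rule nn_integral_dominated_convergence [where w = "%\<omega>. ennreal (2 powr q) * ?N"])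
  show "(\<integral>\<^sup>+\<omega>. ennreal (2 powr q) * ?N \<partial>(sphere_measure :: 'a measure)) < \<infinity>"
   using fin by (simp add: emeasure_sphere ennreal_mult_less_top)
  show "AE \<omega> in sphere_measure. (%n. shift_diff q u (X n *\<^sub>R \<omega>)) ----> 2 * ?N"
   using norm_sphere_AE
  proof eventually_elim
   case (elim \<omega>)
   have "filterlim (%n. X n *\<^sub>R \<omega>) at_infinity sequentially"
    unfolding filterlim_at_infinity_conv_norm_at_top using filterlim_at_top_imp_at_infinity [OF X] elim
    by (simp add: filterlim_at_infinity_conv_norm_at_top)
   thus ?case
    by (rule filterlim_compose [OF shift_diff_at_infinity [OF assms]])
  qed
 qed (auto intro!: AE_I2 shift_diff_le assms)
 also have "(\<integral>\<^sup>+\<omega>. 2 * ?N \<partial>(sphere_measure :: 'a measure)) = ennreal (2 * sphere_area DIM('a)) * ?N"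
  by (subst ennreal_mult') (simp_all add: emeasure_sphere ac_simps)
 finally show "(%n. U_fun q u (X n)) ----> ennreal (2 * sphere_area DIM('a)) * ?N" .
qed

text \<open>Indicator of a spherical band: on the unit sphere, the vectors whose angle with
  \<open>\<omega>\<close> has cosine within \<open>e\<close> of \<open>c\<close>. It thickens the
  set of exact cosine \<open>c\<close>, which is too small to be seen by the surface
  measure.\<close>

definition cap :: "real => real => 'a::euclidean_space => 'a => ennreal" where
 "cap c e \<omega> \<omega>' = indicator {x. \<bar>x - c\<bar> < e} (\<omega> \<bullet> \<omega>')"

lemma borel_measurable_cap [measurable]:
 "(%z. cap c e (fst z) (snd z)) \<in> borel_measurable (borel \<Otimes>\<^sub>M (borel :: 'a::euclidean_space measure))"
 "cap c e \<omega> \<in> borel_measurable (borel :: 'a::euclidean_space measure)"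
 unfolding cap_def by measurable

lemma cap_commute: "cap c e \<omega> \<omega>' = cap c e \<omega>' \<omega>"
 by (simp add: cap_def inner_commute)

lemma nn_integral_cap_eq:
 fixes v w :: "'a::euclidean_space"
 assumes "norm v = norm w"
 shows "(SS \<omega>. cap c e v \<omega>) = (SS \<omega>. cap c e w \<omega>)"
proof -
 have "cap c e w \<omega> = cap c e v (reflect (v - w) \<omega>)" for \<omega>
  using inner_reflect [of "v - w" v \<omega>] by (simp add: cap_def reflect_swap [OF assms])
 thus ?thesis
  using nn_integral_sphere_isometry [OF linear_reflect norm_reflect, of "cap c e v" "v - w"] by simp
qed

text \<open>A second basis vector \<open>f\<close> yields the unit vector with
  \<open>b\<close>-component \<open>c\<close> and \<open>f\<close>-component
  \<open>sqrt (1 - c^2)\<close>, which lies in the band together with a neighbourhood. On the line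
  the unit sphere is just two points and the band can be empty; this is where the dimension
  enters.\<close>

lemma nn_integral_cap_pos:
 fixes v :: "'a::euclidean_space"
 assumes dim: "2 <= DIM('a)" and "norm v = 1" "\<bar>c\<bar> < 1" "0 < e"
 shows "0 < (SS \<omega>. cap c e v \<omega>)"
proof -
 obtain b :: 'a where b: "b \<in> Basis" using nonempty_Basis by blast
 have "\<exists>f\<in>Basis. f ~= b"
 proof (rule ccontr)
  assume "\<not> ?thesis"
  hence "Basis \<subseteq> {b}" by blast
  hence "card (Basis :: 'a set) <= 1" using card_mono [of "{b}" Basis] by simp
  with dim show False by simp
 qed
 then obtain f where f: "f \<in> Basis" "f ~= b" by blast
 define W where "W = {x :: 'a. x ~= 0 & norm x < 1 & \<bar>b \<bullet> sgn x - c\<bar> < e}"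
 define x0 where "x0 = (1 / 2) *\<^sub>R (c *\<^sub>R b + sqrt (1 - c\<^sup>2) *\<^sub>R f)"
 have c2: "c\<^sup>2 < 1" using assms by (simp add: abs_square_less_1)
 have bf: "b \<bullet> b = 1" "f \<bullet> f = 1" "b \<bullet> f = 0" "f \<bullet> b = 0"
  using b f by (simp_all add: inner_Basis)
 have "(norm (c *\<^sub>R b + sqrt (1 - c\<^sup>2) *\<^sub>R f))\<^sup>2 = 1"
  using c2 by (simp add: power2_norm_eq_inner inner_add_left inner_add_right bf power2_eq_square [symmetric])
 hence n1: "norm (c *\<^sub>R b + sqrt (1 - c\<^sup>2) *\<^sub>R f) = 1"
  by (metis abs_norm_cancel power2_eq_1_iff abs_1 norm_ge_zero abs_of_nonneg one_neq_neg_one order.trans less_eq_real_def neg_0_le_iff_le not_one_le_zero)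
 hence "norm x0 = 1 / 2" "sgn x0 = c *\<^sub>R b + sqrt (1 - c\<^sup>2) *\<^sub>R f"
  by (simp_all add: x0_def sgn_div_norm)
 hence "x0 \<in> W"
  using \<open>0 < e\<close> by (auto simp: W_def inner_add_right bf)
 moreover have "open W"
 proof -
  have "open ((- {0}) \<inter> (%x. \<bar>b \<bullet> sgn x - c\<bar>) -` {..<e})"
   by (intro continuous_open_preimage continuous_intros) auto
  moreover have "W = ((- {0}) \<inter> (%x. \<bar>b \<bullet> sgn x - c\<bar>) -` {..<e}) \<inter> ball 0 1"
   by (auto simp: W_def)
  ultimately show ?thesis by (metis open_Int open_ball)
 qed
 ultimately obtain d where d: "0 < d" "ball x0 d \<subseteq> W"
  using open_contains_ball by blast
 have "0 < emeasure lborel (ball x0 d)"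
  using d(1) by (simp add: emeasure_ball less_imp_le)
 also have "... = (NN x. indicator (ball x0 d) x)" by simp
 also have "... <= (NN x. cap c e b (sgn x) * indicator (cball 0 1 - {0}) x)"
 proof (rule nn_integral_mono)
  fix x
  show "indicator (ball x0 d) x <= cap c e b (sgn x) * indicator (cball 0 1 - {0}) x"
  proof (cases "x \<in> ball x0 d")
   case True
   hence "x \<in> W" using d(2) by blast
   thus ?thesis by (simp add: W_def cap_def indicator_def)
  qed simp
 qed
 finally have "0 < (SS \<omega>. cap c e b \<omega>)"
  by (subst nn_integral_sphere) (auto simp: ennreal_zero_less_mult_iff)
 thus ?thesis
  using nn_integral_cap_eq [of v b c e] assms b by simp
qed

text \<open>\<open>- reflect \<omega>\<close> is the mirror image in the line through
  \<open>\<omega>\<close>: it keeps the component along \<open>\<omega>\<close> and reverses the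
  orthogonal ones. So a vector and its image add up to a multiple of \<open>\<omega>\<close>, and
  both lie in the same band around \<open>\<omega>\<close>.\<close>

lemma reflect_line:
 fixes \<omega> \<omega>' :: "'a::euclidean_space"
 assumes "norm \<omega> = 1"
 shows "\<omega>' - reflect \<omega> \<omega>' = (2 * (\<omega> \<bullet> \<omega>')) *\<^sub>R \<omega>" "\<omega> \<bullet> (- reflect \<omega> \<omega>') = \<omega> \<bullet> \<omega>'"
proof -
 have "\<omega> \<bullet> \<omega> = 1" using assms by (simp add: norm_eq_1)
 thus "\<omega>' - reflect \<omega> \<omega>' = (2 * (\<omega> \<bullet> \<omega>')) *\<^sub>R \<omega>" "\<omega> \<bullet> (- reflect \<omega> \<omega>') = \<omega> \<bullet> \<omega>'"
  by (simp_all add: reflect_def inner_commute inner_diff_right)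
qed

text \<open>In dimension at least two, \<open>t\<omega>\<close> is, up to an error controlled by \<open>e\<close>, the sum of two
 vectors of length \<open>\<tau>\<close>, namely \<open>\<tau>\<omega>'\<close> and its mirror image with respect to the line through \<open>\<omega>\<close>,
 where \<open>\<omega> \<bullet> \<omega>'\<close> is close to \<open>t / (2\<tau>)\<close>. Averaging over such pairs keeps both marginals uniform.\<close>

lemma U_fun_almost_increasing:
 fixes u :: "'a::euclidean_space => real"
 assumes dim: "2 <= DIM('a)" and [measurable]: "u \<in> Borel" and q: "1 <= q"
  and fin: "(NN x. apow q (u x)) < \<infinity>"
  and t: "0 < t" "t <= \<tau>"
 shows "U_fun q u t <= ennreal (2 powr q) * U_fun q u \<tau>"
proof -
 let ?D = "%w. shift_diff q u (\<tau> *\<^sub>R w)"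
 let ?S = "sphere_measure :: 'a measure"
 define c where "c = t / (2 * \<tau>)"
 have c: "\<bar>c\<bar> < 1" using t by (simp add: c_def)
 \<comment> \<open>Two error parameters: \<open>d\<close> bounds the increment along the small
   remainder, and \<open>l\<close> is the weight given to it. At the end \<open>d\<close> tends to 0
   for fixed \<open>l\<close>, and then \<open>l\<close> tends to 0.\<close>
 have key: "U_fun q u t <= ennreal ((1 - l) powr (1 - q)) * (ennreal (2 powr q) * U_fun q u \<tau>) + ennreal (l powr (1 - q)) * ennreal (sphere_area DIM('a) * d)"
  if l: "0 < l" "l < 1" and d: "0 < d" for l d
 proof -
  have "\<forall>\<^sub>F h in nhds 0. shift_diff q u h < ennreal d"
   using shift_diff_tendsto_0 [OF _ q fin] d by (intro order_tendstoD) auto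
  then obtain e0 where e0: "0 < e0" "!!h. norm h < e0 ==> shift_diff q u h < ennreal d"
   unfolding eventually_nhds_metric by (auto simp: dist_norm)
  \<comment> \<open>The remainder \<open>h\<close> below has norm \<open>2 * \<tau>\<close> times
    the distance of \<open>\<omega> \<bullet> \<omega>'\<close> to \<open>c\<close>, hence less than
    \<open>e0\<close> on the band.\<close>
  define e where "e = e0 / (2 * \<tau>)"
  have e: "0 < e" using e0 t by (simp add: e_def)
  define A where "A = ennreal ((1 - l) powr (1 - q) * 2 powr (q - 1))"
  define B where "B = ennreal (l powr (1 - q)) * ennreal d"
  define C where "C \<omega> = (\<integral>\<^sup>+\<omega>'. cap c e \<omega> \<omega>' \<partial>?S)" for \<omega>
  obtain b :: 'a where b: "b \<in> Basis" using nonempty_Basis by blast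
  have C: "C \<omega> = C b" if "norm \<omega> = 1" for \<omega>
   unfolding C_def using that b by (intro nn_integral_cap_eq) simp
  have Cpos: "0 < C b" unfolding C_def using dim c e b by (intro nn_integral_cap_pos) auto
  have "C b <= (\<integral>\<^sup>+\<omega>'. 1 \<partial>?S)"
   unfolding C_def by (intro nn_integral_mono) (simp add: cap_def indicator_def)
  hence Cfin: "C b < \<infinity>" by (simp add: emeasure_sphere le_less_trans)
  have pw: "cap c e \<omega> \<omega>' * shift_diff q u (t *\<^sub>R \<omega>)
    <= cap c e \<omega> \<omega>' * (A * ?D \<omega>') + cap c e \<omega> (- reflect \<omega> \<omega>') * (A * ?D (- reflect \<omega> \<omega>')) + cap c e \<omega> \<omega>' * B"
   if n: "norm \<omega> = 1" for \<omega> \<omega>' :: 'a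
  proof (cases "\<bar>\<omega> \<bullet> \<omega>' - c\<bar> < e")
   case True
   let ?k1 = "\<tau> *\<^sub>R \<omega>'" and ?k2 = "\<tau> *\<^sub>R (- reflect \<omega> \<omega>')"
   define h where "h = (t - 2 * \<tau> * (\<omega> \<bullet> \<omega>')) *\<^sub>R \<omega>"
   have "?k1 + ?k2 = \<tau> *\<^sub>R (\<omega>' - reflect \<omega> \<omega>')"
    by (simp add: algebra_simps)
   hence dec: "t *\<^sub>R \<omega> = (?k1 + ?k2) + h"
    unfolding reflect_line(1) [OF n] by (simp add: h_def algebra_simps)
   have "norm h = 2 * \<tau> * \<bar>\<omega> \<bullet> \<omega>' - c\<bar>"
   proof -
    have "t - 2 * \<tau> * (\<omega> \<bullet> \<omega>') = - (2 * \<tau>) * (\<omega> \<bullet> \<omega>' - c)"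
     using t by (simp add: c_def field_simps)
    thus ?thesis using t n by (simp add: h_def abs_mult)
   qed
   also have "... < 2 * \<tau> * e" using True t by (intro mult_strict_left_mono) auto
   also have "... = e0" using t by (simp add: e_def)
   finally have hd: "shift_diff q u h <= ennreal d" using e0(2) by (simp add: less_imp_le)
   have "shift_diff q u (t *\<^sub>R \<omega>) <= ennreal ((1 - l) powr (1 - q)) * shift_diff q u (?k1 + ?k2) + ennreal (l powr (1 - q)) * shift_diff q u h"
    unfolding dec by (rule shift_diff_add) (use q l in auto)
   also have "... <= ennreal ((1 - l) powr (1 - q)) * (ennreal (2 powr (q - 1)) * (shift_diff q u ?k1 + shift_diff q u ?k2)) + B"
    unfolding B_def by (intro add_mono mult_left_mono shift_diff_add_half hd) (use q in auto)
   also have "... = A * shift_diff q u ?k1 + A * shift_diff q u ?k2 + B"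
    by (simp add: A_def ennreal_mult' distrib_left mult.assoc)
   finally show ?thesis
    using True reflect_line(2) [OF n, of \<omega>'] by (simp add: cap_def)
  qed (simp add: cap_def)
  have meas [measurable]: "(%z. cap c e (fst z) (snd z)) \<in> borel_measurable (borel \<Otimes>\<^sub>M (borel :: 'a measure))"
   by (rule borel_measurable_cap)
  have meas' [measurable]: "(%\<omega>. cap c e \<omega> \<omega>') \<in> Borel" for \<omega>' :: 'a
   unfolding cap_commute [of c e _ \<omega>'] by measurable
  have mr [measurable]: "(%z. reflect (fst z) (snd z)) \<in> borel_measurable (borel \<Otimes>\<^sub>M (borel :: 'a measure))"
   unfolding reflect_def by measurable
  have [measurable]: "(%z. cap c e (snd z) (fst z)) \<in> borel_measurable (borel \<Otimes>\<^sub>M (borel :: 'a measure))"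
   by (subst cap_commute) (rule meas)
  have sets_SS: "sets (?S \<Otimes>\<^sub>M ?S) = sets (borel \<Otimes>\<^sub>M borel)"
   by (intro sets_pair_measure_cong) simp_all
  \<comment> \<open>When \<open>\<omega>\<close> is integrated first, the symmetry of the band makes
    its measure around every unit vector equal to \<open>C b\<close>, so the marginal of
    \<open>\<omega>'\<close> is uniform up to this factor.\<close>
  define T where "T = (\<integral>\<^sup>+\<omega>. \<integral>\<^sup>+\<omega>'. cap c e \<omega> \<omega>' * (A * ?D \<omega>') \<partial>?S \<partial>?S)"
  have T: "T = C b * (A * U_fun q u \<tau>)"
  proof -
   have "T = (\<integral>\<^sup>+\<omega>'. \<integral>\<^sup>+\<omega>. cap c e \<omega> \<omega>' * (A * ?D \<omega>') \<partial>?S \<partial>?S)"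
    unfolding T_def by (rule sphere_sphere.Fubini') (simp add: measurable_cong_sets [OF sets_SS refl])
   also have "... = (\<integral>\<^sup>+\<omega>'. C \<omega>' * (A * ?D \<omega>') \<partial>?S)"
   proof (rule nn_integral_cong)
    fix \<omega>'
    have "(\<integral>\<^sup>+\<omega>. cap c e \<omega> \<omega>' * (A * ?D \<omega>') \<partial>?S) = (\<integral>\<^sup>+\<omega>. cap c e \<omega> \<omega>' \<partial>?S) * (A * ?D \<omega>')"
     by (rule nn_integral_multc) measurable
    thus "(\<integral>\<^sup>+\<omega>. cap c e \<omega> \<omega>' * (A * ?D \<omega>') \<partial>?S) = C \<omega>' * (A * ?D \<omega>')"
     by (simp add: C_def cap_commute [of c e \<omega>'])
   qed
   also have "... = (\<integral>\<^sup>+\<omega>'. C b * (A * ?D \<omega>') \<partial>?S)"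
    by (rule nn_integral_cong_AE, rule eventually_mono [OF norm_sphere_AE]) (simp add: C)
   finally show ?thesis by (simp add: nn_integral_cmult U_fun_eq)
  qed
  have "C b * U_fun q u t = (\<integral>\<^sup>+\<omega>. C \<omega> * shift_diff q u (t *\<^sub>R \<omega>) \<partial>?S)"
   unfolding U_fun_eq by (subst nn_integral_cmult [symmetric], simp, rule nn_integral_cong_AE, rule eventually_mono [OF norm_sphere_AE]) (simp add: C)
  also have "... = (\<integral>\<^sup>+\<omega>. \<integral>\<^sup>+\<omega>'. cap c e \<omega> \<omega>' * shift_diff q u (t *\<^sub>R \<omega>) \<partial>?S \<partial>?S)"
  proof (rule nn_integral_cong)
   fix \<omega>
   have "(\<integral>\<^sup>+\<omega>'. cap c e \<omega> \<omega>' * shift_diff q u (t *\<^sub>R \<omega>) \<partial>?S) = (\<integral>\<^sup>+\<omega>'. cap c e \<omega> \<omega>' \<partial>?S) * shift_diff q u (t *\<^sub>R \<omega>)"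
    by (rule nn_integral_multc) measurable
   thus "C \<omega> * shift_diff q u (t *\<^sub>R \<omega>) = (\<integral>\<^sup>+\<omega>'. cap c e \<omega> \<omega>' * shift_diff q u (t *\<^sub>R \<omega>) \<partial>?S)"
    by (simp add: C_def)
  qed
  also have "... <= (\<integral>\<^sup>+\<omega>. (\<integral>\<^sup>+\<omega>'. cap c e \<omega> \<omega>' * (A * ?D \<omega>') \<partial>?S)
    + (\<integral>\<^sup>+\<omega>'. cap c e \<omega> \<omega>' * (A * ?D \<omega>') \<partial>?S) + C b * B \<partial>?S)"
  proof (rule nn_integral_mono_AE, rule eventually_mono [OF norm_sphere_AE])
   fix \<omega> :: 'a assume n: "norm \<omega> = 1"
   \<comment> \<open>The mirror image is a linear isometry and preserves the surface measure, so the
     second of the two vectors contributes as much as the first.\<close>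
   have lin: "linear (%x. - reflect \<omega> x)"
    using linear_compose_neg [OF linear_reflect] .
   have "(\<integral>\<^sup>+\<omega>'. cap c e \<omega> \<omega>' * shift_diff q u (t *\<^sub>R \<omega>) \<partial>?S)
     <= (\<integral>\<^sup>+\<omega>'. cap c e \<omega> \<omega>' * (A * ?D \<omega>') + cap c e \<omega> (- reflect \<omega> \<omega>') * (A * ?D (- reflect \<omega> \<omega>')) + cap c e \<omega> \<omega>' * B \<partial>?S)"
    by (intro nn_integral_mono pw n)
   also have "... = (\<integral>\<^sup>+\<omega>'. cap c e \<omega> \<omega>' * (A * ?D \<omega>') \<partial>?S)
     + (\<integral>\<^sup>+\<omega>'. cap c e \<omega> (- reflect \<omega> \<omega>') * (A * ?D (- reflect \<omega> \<omega>')) \<partial>?S) + C \<omega> * B"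
    unfolding C_def by (subst nn_integral_add, measurable)+ (simp add: nn_integral_multc)
   also have "(\<integral>\<^sup>+\<omega>'. cap c e \<omega> (- reflect \<omega> \<omega>') * (A * ?D (- reflect \<omega> \<omega>')) \<partial>?S)
     = (\<integral>\<^sup>+\<omega>'. cap c e \<omega> \<omega>' * (A * ?D \<omega>') \<partial>?S)"
    by (rule nn_integral_sphere_isometry [OF lin, of "%\<omega>'. cap c e \<omega> \<omega>' * (A * ?D \<omega>')"]) simp_all
   finally show "(\<integral>\<^sup>+\<omega>'. cap c e \<omega> \<omega>' * shift_diff q u (t *\<^sub>R \<omega>) \<partial>?S)
     <= (\<integral>\<^sup>+\<omega>'. cap c e \<omega> \<omega>' * (A * ?D \<omega>') \<partial>?S)
      + (\<integral>\<^sup>+\<omega>'. cap c e \<omega> \<omega>' * (A * ?D \<omega>') \<partial>?S) + C b * B"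
    unfolding C [OF n] .
  qed
  also have "... = T + T + C b * B * ennreal (sphere_area DIM('a))"
   unfolding T_def by (subst nn_integral_add, measurable)+ (simp add: emeasure_sphere)
  also have "... = C b * (2 * (A * U_fun q u \<tau>) + B * ennreal (sphere_area DIM('a)))"
   unfolding T by (simp add: distrib_left mult_2 mult.assoc)
  finally have "U_fun q u t <= 2 * (A * U_fun q u \<tau>) + B * ennreal (sphere_area DIM('a))"
   using Cpos Cfin by (simp add: ennreal_mult_le_mult_iff)
  also have "2 * (A * U_fun q u \<tau>) = ennreal ((1 - l) powr (1 - q)) * (ennreal (2 powr q) * U_fun q u \<tau>)"
  proof -
   have "2 * A = ennreal ((1 - l) powr (1 - q) * (2 * 2 powr (q - 1)))"
    unfolding A_def by (subst ennreal_numeral [symmetric], subst ennreal_mult' [symmetric]) (simp_all add: mult_ac)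
   also have "2 * 2 powr (q - 1) = (2::real) powr q" by (simp add: powr_diff)
   finally show ?thesis by (simp add: mult.assoc [symmetric] ennreal_mult')
  qed
  also have "B * ennreal (sphere_area DIM('a)) = ennreal (l powr (1 - q)) * ennreal (sphere_area DIM('a) * d)"
   unfolding B_def using d by (subst ennreal_mult'') (simp_all add: ac_simps)
  finally show ?thesis .
 qed
 define V where "V = ennreal (2 powr q) * U_fun q u \<tau>"
 have "V < \<infinity>"
  using le_less_trans [OF U_fun_le [OF _ q, of u \<tau>]] fin by (simp add: V_def ennreal_mult_less_top)
 moreover have "U_fun q u t < \<infinity>"
  using le_less_trans [OF U_fun_le [OF _ q, of u t]] fin by (simp add: ennreal_mult_less_top)
 ultimately obtain v x where v: "V = ennreal v" "0 <= v" "U_fun q u t = ennreal x" "0 <= x"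
  by (metis ennreal_cases infinity_ennreal_def less_irrefl)
 have le: "x <= (1 - l) powr (1 - q) * v" if l: "0 < l" "l < 1" for l
 proof (rule field_le_epsilon)
  fix e :: real assume "0 < e"
  define d where "d = e / (l powr (1 - q) * sphere_area DIM('a))"
  have "0 < d" using \<open>0 < e\<close> l sphere_area_pos [of "DIM('a)"] by (simp add: d_def)
  from key [OF l this] have "ennreal x <= ennreal ((1 - l) powr (1 - q) * v + l powr (1 - q) * (sphere_area DIM('a) * d))"
   using v \<open>0 < d\<close> sphere_area_pos [of "DIM('a)"] by (simp add: V_def [symmetric] ennreal_mult' [symmetric] ennreal_plus [symmetric] del: ennreal_plus)
  also have "l powr (1 - q) * (sphere_area DIM('a) * d) = e"
   using l sphere_area_pos [of "DIM('a)"] by (simp add: d_def)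
  finally show "x <= (1 - l) powr (1 - q) * v + e"
   using v \<open>0 < e\<close> by (subst (asm) ennreal_le_iff) (auto intro: add_nonneg_nonneg)
 qed
 have "x <= v"
 proof (rule tendsto_lowerbound)
  show "((%l::real. (1 - l) powr (1 - q) * v) ---> v) (at_right 0)"
   by (auto intro!: tendsto_eq_intros)
  show "\<forall>\<^sub>F l in at_right 0. x <= (1 - l) powr (1 - q) * v"
   using eventually_at_right_field [of "%l. x <= (1 - l) powr (1 - q) * v" 0] le zero_less_one by blast
 qed simp
 thus ?thesis using v by (simp add: V_def [symmetric] ennreal_leI)
qed

section \<open>Test functions\<close>

lemma power_div_fact_le_exp: "0 <= x ==> x ^ n / fact n <= exp (x::real)"
 using sum_le_suminf [OF summable_exp_generic [of x], of "{n}"]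
 by (simp add: exp_def scaleR_conv_of_real divide_inverse mult.commute)

text \<open>The negative powers of \<open>t\<close> are included to close the family under
  differentiation: the derivative of member \<open>m\<close> is a combination of members
  \<open>m + 1\<close> and \<open>m + 2\<close>.\<close>

definition flat_exp :: "nat => real => real" where
 "flat_exp m t = (if 0 < t then inverse t ^ m * exp (- inverse t) else 0)"

text \<open>The exponential of \<open>1 / t\<close> exceeds a single term of its series, the one of
  order \<open>m + 2\<close>. The quadratic bound gives the derivative 0 at the origin.\<close>

lemma flat_exp_le: "\<bar>flat_exp m t\<bar> <= fact (m + 2) * t\<^sup>2"
proof (cases "0 < t")
 case True
 have "inverse t ^ (m + 2) * exp (- inverse t) <= fact (m + 2)"
 proof -
  define y where "y = inverse t"
  have "y ^ (m + 2) <= exp y * fact (m + 2)"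
   using power_div_fact_le_exp [of y "m + 2"] True by (simp add: y_def pos_divide_le_eq del: fact_Suc power_Suc)
  hence "y ^ (m + 2) * exp (- y) <= exp y * fact (m + 2) * exp (- y)"
   by (rule mult_right_mono) simp
  also have "exp y * fact (m + 2) * exp (- y) = fact (m + 2)"
   by (simp add: exp_minus del: fact_Suc)
  finally show ?thesis by (simp only: y_def)
 qed
 hence "t\<^sup>2 * (inverse t ^ (m + 2) * exp (- inverse t)) <= t\<^sup>2 * fact (m + 2)"
  by (rule mult_left_mono) simp
 moreover have "t\<^sup>2 * (inverse t ^ (m + 2) * exp (- inverse t)) = inverse t ^ m * exp (- inverse t)"
  using True by (simp add: power_add power2_eq_square field_simps)
 ultimately have "inverse t ^ m * exp (- inverse t) <= fact (m + 2) * t\<^sup>2"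
  by (metis mult.commute)
 thus ?thesis using True by (simp add: flat_exp_def del: fact_Suc)
qed (simp add: flat_exp_def)

lemma flat_exp_deriv:
 "(flat_exp m has_real_derivative (- real m * flat_exp (m + 1) t + flat_exp (m + 2) t)) (at t)"
proof -
 consider "0 < t" | "t < 0" | "t = 0" by linarith
 thus ?thesis
 proof cases
  case 1
  have D: "(inverse has_real_derivative - (inverse t ^ 2)) (at t)"
   using 1 DERIV_inverse [of t UNIV] by (simp add: numeral_2_eq_2)
  have "((%t. inverse t ^ m) has_real_derivative - real m * inverse t ^ (m + 1)) (at t)"
   by (rule DERIV_cong [OF DERIV_power [OF D, of m]]) (cases m; simp add: power2_eq_square algebra_simps)
  moreover have "((%t. exp (- inverse t)) has_real_derivative exp (- inverse t) * inverse t ^ 2) (at t)"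
   by (rule DERIV_cong [OF DERIV_fun_exp [OF DERIV_minus [OF D]]]) simp
  ultimately have "((%t. inverse t ^ m * exp (- inverse t)) has_real_derivative (- real m * flat_exp (m + 1) t + flat_exp (m + 2) t)) (at t)"
   using 1 by (auto intro!: DERIV_cong [OF DERIV_mult] simp: flat_exp_def power2_eq_square algebra_simps)
  thus ?thesis
  proof (rule has_field_derivative_transform_within_open)
   show "open {0::real<..}" by simp
  qed (use 1 in \<open>auto simp: flat_exp_def\<close>)
 next
  case 2
  have "((%t. 0) has_real_derivative (- real m * flat_exp (m + 1) t + flat_exp (m + 2) t)) (at t)"
   using 2 by (simp add: flat_exp_def)
  thus ?thesis
  proof (rule has_field_derivative_transform_within_open)
   show "open {..<0::real}" by simp
  qed (use 2 in \<open>auto simp: flat_exp_def\<close>)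
 next
  case 3
  have "((%h. flat_exp m h / h) ---> 0) (at 0)"
  proof (rule Lim_null_comparison)
   show "((%h. fact (m + 2) * \<bar>h\<bar>) ---> 0) (at (0::real))"
    by (auto intro!: tendsto_eq_intros)
   show "\<forall>\<^sub>F h in at (0::real). norm (flat_exp m h / h) <= fact (m + 2) * \<bar>h\<bar>"
   proof (rule eventually_at_filter [THEN iffD2], rule always_eventually, intro allI impI)
    fix h :: real assume "h ~= 0"
    have "norm (flat_exp m h / h) <= fact (m + 2) * h\<^sup>2 / \<bar>h\<bar>"
     using flat_exp_le [of m h] by (simp add: divide_right_mono)
    also have "... = fact (m + 2) * \<bar>h\<bar>"
     using \<open>h \<noteq> 0\<close> by (simp add: power2_eq_square abs_if)
    finally show "norm (flat_exp m h / h) <= fact (m + 2) * \<bar>h\<bar>" .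
   qed
  qed
  thus ?thesis using 3 by (simp add: DERIV_def flat_exp_def)
 qed
qed

text \<open>The algebra generated by flat functions of affine forms. Its directional derivatives
  stay in the algebra, so one differentiation step proves all orders of smoothness by
  induction.\<close>

inductive flat_gen :: "('a::euclidean_space => real) => bool" where
 const: "flat_gen (%x. c)"
| flat: "flat_gen (%x. flat_exp m (x \<bullet> v + d))"
| add: "flat_gen f ==> flat_gen g ==> flat_gen (%x. f x + g x)"
| mult: "flat_gen f ==> flat_gen g ==> flat_gen (%x. f x * g x)"

lemma flat_gen_derivative:
 "flat_gen f ==> \<exists>f'. (\<forall>x. (f has_derivative f' x) (at x)) & (\<forall>i. flat_gen (%x. f' x i))"
proof (induction rule: flat_gen.induct)
 case (const c)
 show ?case by (intro exI [of _ "%x i. 0"]) (auto intro: flat_gen.const)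
next
 case (flat m v d)
 let ?f' = "%x i. (- real m * flat_exp (m + 1) (x \<bullet> v + d) + flat_exp (m + 2) (x \<bullet> v + d)) * (i \<bullet> v)"
 have "((%x. flat_exp m (x \<bullet> v + d)) has_derivative ?f' x) (at x)" for x
 proof -
  have "((%x. x \<bullet> v + d) has_derivative (%i. i \<bullet> v)) (at x)"
   by (auto intro!: derivative_eq_intros)
  from has_derivative_compose [OF this flat_exp_deriv [unfolded has_field_derivative_def]]
  show ?thesis by simp
 qed
 thus ?case
  by (intro exI [of _ ?f'] conjI allI flat_gen.intros) auto
next
 case (add f g)
 then obtain f' g' where "!!x. (f has_derivative f' x) (at x)" "!!i. flat_gen (%x. f' x i)"
  "!!x. (g has_derivative g' x) (at x)" "!!i. flat_gen (%x. g' x i)"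
  by blast
 thus ?case
  by (intro exI [of _ "%x i. f' x i + g' x i"]) (auto intro: flat_gen.add has_derivative_add)
next
 case (mult f g)
 then obtain f' g' where "!!x. (f has_derivative f' x) (at x)" "!!i. flat_gen (%x. f' x i)"
  "!!x. (g has_derivative g' x) (at x)" "!!i. flat_gen (%x. g' x i)"
  by blast
 note D = this
 show ?case
 proof (intro exI [of _ "%x i. f x * g' x i + f' x i * g x"] conjI allI)
  fix x show "((%x. f x * g x) has_derivative (%i. f x * g' x i + f' x i * g x)) (at x)"
   by (rule has_derivative_mult [OF D(1,3)])
 next
  fix i
  have "flat_gen (%x. f x * g' x i)" "flat_gen (%x. f' x i * g x)"
   using flat_gen.mult [OF mult.hyps(1) D(4)] flat_gen.mult [OF D(2) mult.hyps(2)] by auto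
  thus "flat_gen (%x. f x * g' x i + f' x i * g x)" by (rule flat_gen.add)
 qed
qed

lemma flat_gen_Ck: "flat_gen f ==> Ck k f"
proof (induction k arbitrary: f)
 case 0
 obtain f' where "!!x. (f has_derivative f' x) (at x)"
  using flat_gen_derivative [OF 0] by blast
 thus ?case
  by (auto intro!: continuous_at_imp_continuous_on has_derivative_continuous)
next
 case (Suc k)
 obtain f' where f': "!!x. (f has_derivative f' x) (at x)" "!!i. flat_gen (%x. f' x i)"
  using flat_gen_derivative [OF Suc.prems] by blast
 hence "frechet_derivative f (at x) = f' x" for x
  using frechet_derivative_at by metis
 with f' Suc.IH show ?case by (auto simp: differentiable_def)
qed

lemma flat_gen_prod:
 assumes "!!i. i \<in> I ==> flat_gen (f i)"
 shows "flat_gen (%x. \<Prod>i\<in>I. f i x)"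
 using assms
proof (induction I rule: infinite_finite_induct)
 case (insert i I)
 hence "flat_gen (%x. f i x * (\<Prod>i\<in>I. f i x))" by (intro flat_gen.mult) auto
 with insert show ?case by simp
qed (simp_all add: flat_gen.const)

text \<open>Vanishes outside the open box and tends to its indicator, since inside each factor has
  the form \<open>exp (- 1 / (n * s))\<close> with \<open>s > 0\<close>.\<close>

definition bump :: "'a::euclidean_space => 'a => nat => 'a => real" where
 "bump a b n x = (\<Prod>i\<in>Basis. flat_exp 0 (real n * (x \<bullet> i - a \<bullet> i)) * flat_exp 0 (real n * (b \<bullet> i - x \<bullet> i)))"

lemma flat_exp_0_bounds: "0 <= flat_exp 0 t" "flat_exp 0 t <= 1"
 by (simp_all add: flat_exp_def)

lemma bump_bounds: "0 <= bump a b n x" "bump a b n x <= 1"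
proof -
 have "0 <= flat_exp 0 s * flat_exp 0 t & flat_exp 0 s * flat_exp 0 t <= 1" for s t
  by (simp add: flat_exp_0_bounds mult_le_one)
 thus "0 <= bump a b n x" "bump a b n x <= 1"
  unfolding bump_def by (simp_all add: prod_nonneg prod_le_1)
qed

lemma bump_outside: "x \<notin> box a b ==> bump a b n x = 0"
proof -
 assume "x \<notin> box a b"
 then obtain i where i: "i \<in> Basis" "x \<bullet> i - a \<bullet> i <= 0 \<or> b \<bullet> i - x \<bullet> i <= 0"
  by (auto simp: mem_box not_less)
 hence "flat_exp 0 (real n * (x \<bullet> i - a \<bullet> i)) * flat_exp 0 (real n * (b \<bullet> i - x \<bullet> i)) = 0"
  by (auto simp: flat_exp_def zero_less_mult_iff)
 with i(1) show ?thesis unfolding bump_def by (intro prod_zero) auto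
qed

lemma test_function_bump: "test_function (bump a b n)"
proof -
 have "flat_gen (bump a b n)"
  unfolding bump_def
 proof (intro flat_gen_prod flat_gen.mult)
  fix i :: 'a
  have "real n * (x \<bullet> i - a \<bullet> i) = x \<bullet> (real n *\<^sub>R i) + (- real n * (a \<bullet> i))"
   "real n * (b \<bullet> i - x \<bullet> i) = x \<bullet> (- real n *\<^sub>R i) + real n * (b \<bullet> i)" for x
   by (simp_all add: algebra_simps)
  thus "flat_gen (%x. flat_exp 0 (real n * (x \<bullet> i - a \<bullet> i)))" "flat_gen (%x. flat_exp 0 (real n * (b \<bullet> i - x \<bullet> i)))"
   by (simp_all only: flat_gen.flat)
 qed
 moreover have "compact (closure {x. bump a b n x ~= 0})"
 proof -
  have "bounded {x. bump a b n x ~= 0}"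
   by (rule bounded_subset [OF bounded_box [of a b]]) (use bump_outside in blast)
  thus ?thesis by (simp add: compact_closure)
 qed
 ultimately show ?thesis by (simp add: test_function_def flat_gen_Ck)
qed

lemma bump_tendsto: "(%n. bump a b n x) ----> indicator (box a b) x"
proof (cases "x \<in> box a b")
 case True
 have "(%n. flat_exp 0 (real n * s)) ----> 1" if "0 < s" for s
 proof -
  have "(%n. exp (- (inverse s * inverse (real n)))) ----> exp (- (inverse s * 0))"
   by (intro tendsto_intros lim_inverse_n)
  moreover have "\<forall>\<^sub>F n in sequentially. exp (- (inverse s * inverse (real n))) = flat_exp 0 (real n * s)"
   using eventually_gt_at_top [of 0] by eventually_elim (use that in \<open>simp add: flat_exp_def mult.commute\<close>)
  ultimately show ?thesis by (simp add: Lim_transform_eventually)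
 qed
 hence "(%n. bump a b n x) ----> (\<Prod>i\<in>(Basis::'a set). 1 * 1)"
  unfolding bump_def using True by (intro tendsto_prod tendsto_mult) (auto simp: mem_box)
 thus ?thesis using True by simp
qed (simp add: bump_outside)

section \<open>Directional derivatives and translates of test functions\<close>

definition dir_deriv :: "'a::euclidean_space => ('a => real) => 'a => real" where
 "dir_deriv h \<phi> x = frechet_derivative \<phi> (at x) h"

lemma test_function_differentiable: "test_function \<phi> ==> \<phi> differentiable (at x)"
proof -
 assume "test_function \<phi>"
 hence "Ck (Suc 0) \<phi>" unfolding test_function_def by blast
 thus ?thesis by simp
qed

lemma test_function_has_derivative:
 "test_function \<phi> ==> (\<phi> has_derivative (%h. dir_deriv h \<phi> x)) (at x)"
 unfolding dir_deriv_def by (rule frechet_derivative_works [THEN iffD1, OF test_function_differentiable])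

lemma test_function_continuous: "test_function \<phi> ==> continuous_on UNIV \<phi>"
proof -
 assume "test_function \<phi>"
 hence "Ck 0 \<phi>" unfolding test_function_def by blast
 thus ?thesis by simp
qed

lemma dir_deriv_linear:
 assumes "test_function \<phi>" shows "dir_deriv h \<phi> x = (\<Sum>i\<in>Basis. (h \<bullet> i) * dir_deriv i \<phi> x)"
proof -
 have lin: "linear (frechet_derivative \<phi> (at x))"
  by (intro linear_frechet_derivative test_function_differentiable assms)
 have "dir_deriv h \<phi> x = frechet_derivative \<phi> (at x) (\<Sum>i\<in>Basis. (h \<bullet> i) *\<^sub>R i)"
  by (simp add: dir_deriv_def euclidean_representation)
 thus ?thesis
  by (simp add: linear_sum [OF lin] linear_scale [OF lin] dir_deriv_def)
qed

lemma dir_deriv_scale: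
 assumes "test_function \<phi>" shows "dir_deriv (c *\<^sub>R h) \<phi> x = c * dir_deriv h \<phi> x"
 using linear_scale [OF linear_frechet_derivative [OF test_function_differentiable [OF assms]]]
 by (simp add: dir_deriv_def)

lemma dir_deriv_continuous:
 assumes "test_function \<phi>" shows "continuous_on UNIV (dir_deriv h \<phi>)"
proof -
 have "continuous_on UNIV (dir_deriv i \<phi>)" if "i \<in> Basis" for i
 proof -
  have "Ck (Suc 0) \<phi>" using assms unfolding test_function_def by blast
  with that show ?thesis by (simp add: dir_deriv_def [abs_def])
 qed
 hence "continuous_on UNIV (%x. \<Sum>i\<in>Basis. (h \<bullet> i) * dir_deriv i \<phi> x)"
  by (intro continuous_intros) auto
 thus ?thesis by (simp add: dir_deriv_linear [OF assms, symmetric])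
qed

lemma test_function_bounds:
 assumes "test_function \<phi>"
 obtains R B where "0 < R" "0 < B" "!!x. R <= norm x ==> \<phi> x = 0" "!!x. R <= norm x ==> dir_deriv h \<phi> x = 0"
  "!!x. \<bar>\<phi> x\<bar> <= B" "!!x. \<bar>dir_deriv h \<phi> x\<bar> <= B"
proof -
 let ?S = "closure {x. \<phi> x ~= 0}"
 have "compact ?S" using assms by (simp add: test_function_def)
 then obtain R where R: "0 < R" "!!x. x \<in> ?S ==> norm x < R"
  using bounded_pos_less [of ?S] compact_imp_bounded by blast
 have \<phi>0: "\<phi> x = 0" if "R <= norm x" for x
  using R(2) [of x] that closure_subset [of "{x. \<phi> x ~= 0}"] by fastforce
 have D0: "dir_deriv h \<phi> x = 0" if "R <= norm x" for x
 proof -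
  have x: "open (- ?S)" "x \<in> - ?S" using R(2) [of x] that by auto
  have "(\<phi> has_derivative (%h. 0)) (at x)"
   using closure_subset [of "{x. \<phi> x ~= 0}"]
   by (intro has_derivative_transform_within_open [OF has_derivative_const x, of 0]) (metis (mono_tags, lifting) ComplD mem_Collect_eq subsetD)
  from frechet_derivative_at [OF this] show ?thesis by (metis dir_deriv_def)
 qed
 have "\<exists>B>0. \<forall>x. \<bar>f x\<bar> <= B" if f: "continuous_on UNIV f" "!!x. R <= norm x ==> f x = 0" for f :: "'a => real"
 proof -
  have "compact (f ` cball 0 R)"
   using f(1) by (intro compact_continuous_image) (auto intro: continuous_on_subset)
  then obtain B where B: "0 < B" "!!y. y \<in> f ` cball 0 R ==> norm y <= B"
   using compact_imp_bounded [of "f ` cball 0 R"] unfolding bounded_pos by metis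
  have "\<bar>f x\<bar> <= B" for x
   using B(1) B(2) [of "f x"] f(2) [of x] by (cases "R <= norm x") auto
  with B(1) show ?thesis by blast
 qed
 from this [OF test_function_continuous [OF assms] \<phi>0] this [OF dir_deriv_continuous [OF assms] D0]
 obtain B1 B2 where B: "0 < B1" "!!x. \<bar>\<phi> x\<bar> <= B1" "0 < B2" "!!x. \<bar>dir_deriv h \<phi> x\<bar> <= B2"
  by metis
 have "\<bar>\<phi> x\<bar> <= max B1 B2" "\<bar>dir_deriv h \<phi> x\<bar> <= max B1 B2" for x
  using B(2) [of x] B(4) [of x] by auto
 with B(1) R(1) \<phi>0 D0 show ?thesis by (intro that [of R "max B1 B2"]) auto
qed

lemma test_function_measurable:
 "test_function \<phi> ==> \<phi> \<in> Borel" "test_function \<phi> ==> dir_deriv h \<phi> \<in> Borel"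
 by (simp_all add: borel_measurable_continuous_onI test_function_continuous dir_deriv_continuous)

lemma Ck_translate: "Ck k \<phi> ==> Ck k (%x. \<phi> (x + c))"
proof (induction k arbitrary: \<phi>)
 case 0
 thus ?case
  using continuous_on_compose2 [of UNIV \<phi> UNIV "%x. x + c"] by (simp add: continuous_intros)
next
 case (Suc k)
 have "((%x. \<phi> (x + c)) has_derivative frechet_derivative \<phi> (at (x + c))) (at x)" for x
 proof -
  have "(\<phi> has_derivative frechet_derivative \<phi> (at (x + c))) (at (x + c))"
   using Suc.prems frechet_derivative_works by auto
  moreover have "((%x. x + c) has_derivative (%h. h)) (at x)"
   by (auto intro!: derivative_eq_intros)
  ultimately show ?thesis by (rule has_derivative_compose [rotated])
 qed
 hence "!!x. (%x. \<phi> (x + c)) differentiable (at x)"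
   "!!x. frechet_derivative (%x. \<phi> (x + c)) (at x) = frechet_derivative \<phi> (at (x + c))"
  using frechet_derivative_at differentiable_def by metis+
 with Suc.prems Suc.IH [of "%x. frechet_derivative \<phi> (at x) i" for i] show ?case by auto
qed

lemma test_function_translate:
 assumes "test_function \<phi>" shows "test_function (%x. \<phi> (x + c))"
proof -
 obtain R where R: "!!x. R <= norm x ==> \<phi> x = 0"
  using test_function_bounds [OF assms] by metis
 have "{x. \<phi> (x + c) ~= 0} \<subseteq> cball 0 (R + norm c)"
 proof
  fix x assume "x \<in> {x. \<phi> (x + c) ~= 0}"
  hence "norm (x + c) < R" using R [of "x + c"] by fastforce
  thus "x \<in> cball 0 (R + norm c)" using norm_triangle_ineq4 [of "x + c" c] by simp
 qed
 hence "compact (closure {x. \<phi> (x + c) ~= 0})"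
  using bounded_subset bounded_cball compact_closure by blast
 thus ?thesis using assms by (simp add: test_function_def Ck_translate)
qed

lemma dir_deriv_translate:
 assumes "test_function \<phi>" shows "dir_deriv h (%x. \<phi> (x + c)) x = dir_deriv h \<phi> (x + c)"
proof -
 have "((%x. \<phi> (x + c)) has_derivative (%h. dir_deriv h \<phi> (x + c))) (at x)"
 proof -
  have "((%x. x + c) has_derivative (%h. h)) (at x)"
   by (auto intro!: derivative_eq_intros)
  from has_derivative_compose [OF this test_function_has_derivative [OF assms]] show ?thesis .
 qed
 from frechet_derivative_at [OF this] show ?thesis by (metis dir_deriv_def)
qed

lemma test_function_line_deriv:
 assumes "test_function \<phi>"
 shows "((%t. \<phi> (x + t *\<^sub>R h)) has_real_derivative dir_deriv h \<phi> (x + t *\<^sub>R h)) (at t)"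
proof -
 have "((%t. x + t *\<^sub>R h) has_derivative (%s. s *\<^sub>R h)) (at t)"
  by (auto intro!: derivative_eq_intros)
 from has_derivative_compose [OF this test_function_has_derivative [OF assms]]
 show ?thesis by (simp add: has_field_derivative_def dir_deriv_scale [OF assms] mult_commute_abs)
qed

section \<open>Weak derivatives\<close>

definition loc_int :: "('a::euclidean_space => 'b::euclidean_space) => bool" where
 "loc_int f \<longleftrightarrow> f \<in> Borel & (\<forall>R. integrable lborel (%x. indicator (cball 0 R) x *\<^sub>R f x))"

lemma loc_int_measurable: "loc_int f ==> f \<in> Borel"
 by (simp add: loc_int_def)

lemma loc_int_integrable_mult:
 fixes u :: "'a::euclidean_space => real"
 assumes u: "loc_int u" and [measurable]: "\<psi> \<in> Borel"
  and \<psi>: "!!x. \<bar>\<psi> x\<bar> <= B" "!!x. R <= norm x ==> \<psi> x = 0"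
 shows "integrable lborel (%x. u x * \<psi> x)"
proof (rule Bochner_Integration.integrable_bound)
 have [measurable]: "u \<in> Borel" using u by (rule loc_int_measurable)
 show "integrable lborel (%x. B * (indicator (cball 0 R) x *\<^sub>R u x))"
  using u by (simp add: loc_int_def)
 show "AE x in lborel. norm (u x * \<psi> x) <= norm (B * (indicator (cball 0 R) x *\<^sub>R u x))"
 proof (rule AE_I2)
  fix x
  have "\<bar>\<psi> x\<bar> <= \<bar>B\<bar>" using \<psi>(1) [of x] by linarith
  thus "norm (u x * \<psi> x) <= norm (B * (indicator (cball 0 R) x *\<^sub>R u x))"
   using \<psi>(2) [of x] by (auto simp: indicator_def abs_mult mult.commute intro!: mult_right_mono)
 qed
 show "(%x. u x * \<psi> x) \<in> borel_measurable lborel"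
  using \<open>u \<in> borel_measurable borel\<close> assms(2) by simp
qed

lemma loc_int_test:
 fixes u :: "'a::euclidean_space => real"
 assumes "loc_int u" "test_function \<phi>"
 shows "integrable lborel (%x. u x * \<phi> x)" "integrable lborel (%x. u x * dir_deriv h \<phi> x)"
proof -
 obtain R B where "!!x. R <= norm x ==> \<phi> x = 0" "!!x. R <= norm x ==> dir_deriv h \<phi> x = 0"
  "!!x. \<bar>\<phi> x\<bar> <= B" "!!x. \<bar>dir_deriv h \<phi> x\<bar> <= B"
  using test_function_bounds [OF assms(2)] by metis
 thus "integrable lborel (%x. u x * \<phi> x)" "integrable lborel (%x. u x * dir_deriv h \<phi> x)"
  using test_function_measurable [OF assms(2)] by (auto intro!: loc_int_integrable_mult [OF assms(1)])
qed

text \<open>Bumps tend to indicators of boxes, so the integral of \<open>f\<close> over every box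
  vanishes. Boxes form a generator of the Borel sets stable under intersection, and the Borel sets
  with vanishing integral are closed under complements and disjoint unions.\<close>

lemma fundamental_lemma:
 fixes f :: "'a::euclidean_space => real"
 assumes f: "loc_int f" and zero: "!!\<phi>. test_function \<phi> ==> (LL x. f x * \<phi> x) = 0"
 shows "AE x in lborel. f x = 0"
proof -
 have [measurable]: "f \<in> Borel" using f by (rule loc_int_measurable)
 have box_int: "integrable lborel (%x. indicator (box a b) x *\<^sub>R f x)" for a b :: 'a
 proof -
  obtain R where "!!x. x \<in> box a b ==> norm x <= R"
   using bounded_box [of a b] unfolding bounded_iff by blast
  hence R: "box a b \<subseteq> cball 0 R" by auto
  have "integrable lborel (%x. f x * indicator (box a b) x)"
   by (rule loc_int_integrable_mult [OF f, where B = 1 and R = "R + 1"]) (use R in \<open>auto simp: indicator_def\<close>)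
  thus ?thesis by (simp add: mult.commute)
 qed
 have box0: "(LL x. indicator (box a b) x *\<^sub>R f x) = 0" for a b :: 'a
 proof -
  have [measurable]: "bump a b n \<in> Borel" for n
   by (intro test_function_measurable test_function_bump)
  have "(%n. LL x. f x * bump a b n x) ----> (LL x. f x * indicator (box a b) x)"
  proof (rule integral_dominated_convergence [where w = "%x. norm (indicator (box a b) x *\<^sub>R f x)"])
   show "AE x in lborel. (%n. f x * bump a b n x) ----> f x * indicator (box a b) x"
    by (intro AE_I2 tendsto_intros bump_tendsto)
   show "AE x in lborel. norm (f x * bump a b n x) <= norm (indicator (box a b) x *\<^sub>R f x)" for n
   proof (rule AE_I2)
    fix x show "norm (f x * bump a b n x) <= norm (indicator (box a b) x *\<^sub>R f x)"
     using bump_bounds [of a b n x] bump_outside [of x a b n] by (cases "x \<in> box a b") (auto simp: abs_mult mult_left_le)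
   qed
  qed (use box_int in auto)
  thus ?thesis
   using zero [OF test_function_bump] LIMSEQ_unique [OF _ tendsto_const] by (simp add: mult.commute)
 qed
 \<comment> \<open>\<open>f\<close> is only locally integrable, so the uniqueness of densities is
   applied inside the cubes of half-width \<open>n\<close>.\<close>
 have "AE x in lborel. indicator (box (- real n *\<^sub>R One) (real n *\<^sub>R One)) x *\<^sub>R f x = 0" for n :: nat
 proof (rule sigma_finite_measure.density_zero [OF sigma_finite_lborel])
  let ?B = "box (- real n *\<^sub>R One) (real n *\<^sub>R One) :: 'a set"
  let ?f = "%x. indicator ?B x *\<^sub>R f x"
  show int: "integrable lborel ?f" by (rule box_int)
  fix A :: "'a set" assume "A \<in> sets lborel"
  hence A: "A \<in> sigma_sets UNIV (range (%(a, b). box a b))"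
   by (simp add: borel_eq_box)
  have subset_Pow: "range (%(a, b). box a b :: 'a set) \<subseteq> Pow UNIV"
   by simp
  have stable: "Int_stable (range (%(a, b). box a b :: 'a set))"
   by (auto simp: Int_stable_def box_Int_box)
  show "set_lebesgue_integral lborel A ?f = 0"
   using stable subset_Pow A
  proof (induction rule: sigma_sets_induct_disjoint)
   case (basic A)
   then obtain a b where A: "A = box a b" by auto
   have "\<exists>c d. box a b \<inter> ?B = box c d" unfolding box_Int_box by (intro exI) (rule refl)
   then obtain c d where cd: "A \<inter> ?B = box c d" unfolding A by blast
   have "set_lebesgue_integral lborel A ?f = (LL x. indicator (box c d) x *\<^sub>R f x)"
    unfolding set_lebesgue_integral_def cd [symmetric] by (simp add: indicator_inter_arith mult.assoc)
   thus ?case by (simp only: box0)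
  next
   case (compl A)
   hence [measurable]: "A \<in> sets borel" by (simp add: borel_eq_box)
   have "integrable lborel (%x. indicator A x *\<^sub>R ?f x)" by (rule integrable_mult_indicator [OF _ int]) simp
   hence eq: "set_lebesgue_integral lborel (UNIV - A) ?f = (LL x. ?f x) - set_lebesgue_integral lborel A ?f"
   proof (subst set_lebesgue_integral_def, subst set_lebesgue_integral_def, subst Bochner_Integration.integral_diff [symmetric])
    show "(LL x. indicator (UNIV - A) x *\<^sub>R ?f x) = (LL x. ?f x - indicator A x *\<^sub>R ?f x)"
     by (rule Bochner_Integration.integral_cong) (simp_all add: indicator_def)
   qed (rule int)
   show ?case unfolding eq box0 compl(2) by simp
  next
   case (union A)
   hence "A i \<in> sets lborel" for i by (simp add: borel_eq_box range_subsetD)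
   hence "set_lebesgue_integral lborel (\<Union>i. A i) ?f = (\<Sum>i. set_lebesgue_integral lborel (A i) ?f)"
   proof (intro lebesgue_integral_countable_add)
    show "set_integrable lborel (\<Union>i. A i) ?f"
     unfolding set_integrable_def by (rule integrable_mult_indicator [OF _ int]) (use \<open>\<And>i. A i \<in> sets lborel\<close> in auto)
   qed (use union(1) in \<open>auto simp: disjoint_family_on_def\<close>)
   thus ?case using union by simp
  qed (simp add: set_lebesgue_integral_def)
 qed
 hence "AE x in lborel. \<forall>n::nat. indicator (box (- real n *\<^sub>R One) (real n *\<^sub>R One)) x *\<^sub>R f x = 0"
  unfolding AE_all_countable by blast
 thus ?thesis
 proof eventually_elim
  case (elim x)
  have "x \<in> (\<Union>n::nat. box (- real n *\<^sub>R One) (real n *\<^sub>R One))"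
   using UN_box_eq_UNIV by auto
  then obtain n :: nat where "x \<in> box (- real n *\<^sub>R One) (real n *\<^sub>R One)" by blast
  moreover have "indicator (box (- real n *\<^sub>R One) (real n *\<^sub>R One)) x *\<^sub>R f x = 0" using elim by blast
  ultimately show ?case by simp
 qed
qed


text \<open>A weak derivative along an arbitrary vector rather than a full gradient: increments
  along \<open>h\<close> involve this derivative only, and weak limits can be taken one direction at
  a time.\<close>

definition weak_dir :: "('a::euclidean_space => real) => 'a => ('a => real) => bool" where
 "weak_dir u h v \<longleftrightarrow> loc_int u & loc_int v \<and>
  (\<forall>\<phi>. test_function \<phi> --> (LL x. u x * dir_deriv h \<phi> x) = - (LL x. v x * \<phi> x))"

lemma loc_int_diff:
 fixes f g :: "'a::euclidean_space => 'b::euclidean_space"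
 assumes "loc_int f" "loc_int g" shows "loc_int (%x. f x - g x)"
 using assms loc_int_measurable [OF assms(1)] loc_int_measurable [OF assms(2)]
 by (auto simp: loc_int_def scaleR_diff_right intro!: borel_measurable_diff Bochner_Integration.integrable_diff)

lemma loc_int_cmult:
 fixes f :: "'a::euclidean_space => real"
 assumes "loc_int f" shows "loc_int (%x. c * f x)"
proof -
 have "integrable lborel (%x. c * (indicator (cball 0 R) x *\<^sub>R f x))" for R
  using assms by (simp add: loc_int_def)
 moreover have "(%x. c * f x) \<in> Borel"
  using loc_int_measurable [OF assms] by simp
 ultimately show ?thesis by (simp add: loc_int_def mult.left_commute)
qed

lemma weak_dir_scale:
 assumes "weak_dir u h v" shows "weak_dir u (c *\<^sub>R h) (%x. c * v x)"
 unfolding weak_dir_def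
proof (intro conjI allI impI)
 fix \<phi> :: "'a => real" assume \<phi>: "test_function \<phi>"
 have "(LL x. u x * dir_deriv (c *\<^sub>R h) \<phi> x) = (LL x. c * (u x * dir_deriv h \<phi> x))"
  by (simp add: dir_deriv_scale [OF \<phi>] mult.left_commute)
 also have "... = - (LL x. c * (v x * \<phi> x))"
  using assms \<phi> by (simp add: weak_dir_def)
 finally show "(LL x. u x * dir_deriv (c *\<^sub>R h) \<phi> x) = - (LL x. c * v x * \<phi> x)"
  by (simp add: mult.assoc)
qed (use assms in \<open>simp_all add: weak_dir_def loc_int_cmult\<close>)

section \<open>Increments as means of weak derivatives along segments\<close>

lemma integral_lborel_shift:
 fixes f :: "'a::euclidean_space => real"
 assumes [measurable]: "f \<in> Borel"
 shows "(LL x. f (x + c)) = (LL x. f x)"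
proof -
 have "(\<integral>x. f x \<partial>distr lborel borel ((+) c)) = (LL x. f (x + c))"
  by (subst integral_distr) (auto simp: add.commute)
 thus ?thesis by (simp add: lborel_distr_plus)
qed

lemma integrable_pairI:
 fixes f :: "'a::euclidean_space \<times> 'b::euclidean_space => real"
 assumes [measurable]: "f \<in> Borel2"
  and "(NN x. NN y. ennreal \<bar>f (x, y)\<bar>) < \<infinity>"
 shows "integrable (lborel \<Otimes>\<^sub>M lborel) f"
proof (rule integrableI_bounded)
 show [measurable]: "f \<in> borel_measurable (lborel \<Otimes>\<^sub>M lborel)" by measurable
 show "(\<integral>\<^sup>+z. ennreal (norm (f z)) \<partial>(lborel \<Otimes>\<^sub>M lborel)) < \<infinity>"
  using assms(2) by (subst lborel.nn_integral_fst [symmetric]) auto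
qed

text \<open>The mean of \<open>v\<close> over the segment from \<open>x\<close> to
  \<open>x + h\<close>; for the weak derivative \<open>v\<close> along \<open>h\<close> it equals
  the increment of \<open>u\<close>, see \<open>weak_dir_line_mean\<close>.\<close>

definition line_mean :: "'a::euclidean_space => ('a => real) => 'a => real" where
 "line_mean h v x = (LL \<tau>. indicator {0..1} \<tau> * v (x + \<tau> *\<^sub>R h))"

lemma borel_measurable_line_mean [measurable]:
 assumes [measurable]: "v \<in> Borel"
 shows "line_mean h v \<in> Borel"
 unfolding line_mean_def by measurable

text \<open>For each fixed position on the segment the integral over \<open>x\<close> is translation
  invariant, and the positions have total mass 1.\<close>

lemma nn_integral_line_shift:
 fixes f :: "'a::euclidean_space => ennreal"
 assumes [measurable]: "f \<in> Borel"
 shows "(NN x. NN \<tau>. indicator {0..1::real} \<tau> * f (x + \<tau> *\<^sub>R h)) = (NN x. f x)"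
proof -
 have "(NN x. NN \<tau>. indicator {0..1::real} \<tau> * f (x + \<tau> *\<^sub>R h))
   = (NN \<tau>. NN x. indicator {0..1::real} \<tau> * f (x + \<tau> *\<^sub>R h))"
  by (rule lborel_pair.Fubini') simp
 also have "... = (NN \<tau>. indicator {0..1::real} \<tau> * (NN x. f x))"
  by (simp add: nn_integral_cmult nn_integral_lborel_shift)
 also have "... = (NN x. f x)"
  by (simp add: nn_integral_multc)
 finally show ?thesis .
qed

lemma nn_integral_line_local:
 fixes v :: "'a::euclidean_space => real"
 assumes "loc_int v"
 shows "(NN x. NN \<tau>. indicator {0..1::real} \<tau> * (ennreal \<bar>v (x + \<tau> *\<^sub>R h)\<bar> * indicator (cball 0 R) x)) < \<infinity>"
proof -
 have [measurable]: "v \<in> Borel" using assms by (rule loc_int_measurable)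
 have "(NN x. NN \<tau>. indicator {0..1::real} \<tau> * (ennreal \<bar>v (x + \<tau> *\<^sub>R h)\<bar> * indicator (cball 0 R) x))
   <= (NN x. NN \<tau>. indicator {0..1::real} \<tau> * (ennreal \<bar>v (x + \<tau> *\<^sub>R h)\<bar> * indicator (cball 0 (R + norm h)) (x + \<tau> *\<^sub>R h)))"
 proof (intro nn_integral_mono)
  fix x :: 'a and \<tau> :: real
  have "norm (x + \<tau> *\<^sub>R h) <= R + norm h" if "norm x <= R" "0 <= \<tau>" "\<tau> <= 1"
   using norm_triangle_ineq [of x "\<tau> *\<^sub>R h"] that mult_left_le_one_le [of "norm h" \<tau>] by simp
  thus "indicator {0..1::real} \<tau> * (ennreal \<bar>v (x + \<tau> *\<^sub>R h)\<bar> * indicator (cball 0 R) x)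
    <= indicator {0..1::real} \<tau> * (ennreal \<bar>v (x + \<tau> *\<^sub>R h)\<bar> * indicator (cball 0 (R + norm h)) (x + \<tau> *\<^sub>R h))"
   by (auto simp: indicator_def)
 qed
 also have "... = (NN x. ennreal \<bar>v x\<bar> * indicator (cball 0 (R + norm h)) x)"
  by (rule nn_integral_line_shift) measurable
 also have "... = (NN x. ennreal (norm (indicator (cball 0 (R + norm h)) x *\<^sub>R v x)))"
  by (intro nn_integral_cong) (auto simp: indicator_def)
 also have "... < \<infinity>"
  using assms by (auto simp: loc_int_def integrable_iff_bounded)
 finally show ?thesis .
qed

lemma abs_line_mean_le:
 "ennreal \<bar>line_mean h v x\<bar> <= (NN \<tau>. indicator {0..1::real} \<tau> * ennreal \<bar>v (x + \<tau> *\<^sub>R h)\<bar>)"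
proof -
 have "ennreal (norm (line_mean h v x)) <= (NN \<tau>. ennreal (norm (indicator {0..1::real} \<tau> * v (x + \<tau> *\<^sub>R h))))"
 proof (cases "integrable lborel (%\<tau>. indicator {0..1} \<tau> * v (x + \<tau> *\<^sub>R h))")
  case True
  thus ?thesis unfolding line_mean_def by (rule integral_norm_bound_ennreal)
 next
  \<comment> \<open>A non-integrable integrand has integral 0 by convention.\<close>
  case False
  thus ?thesis by (simp add: line_mean_def not_integrable_integral_eq)
 qed
 also have "... = (NN \<tau>. indicator {0..1::real} \<tau> * ennreal \<bar>v (x + \<tau> *\<^sub>R h)\<bar>)"
  by (intro nn_integral_cong) (auto simp: indicator_def)
 finally show ?thesis by simp
qed

lemma loc_int_line_mean:
 fixes v :: "'a::euclidean_space => real"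
 assumes "loc_int v" shows "loc_int (line_mean h v)"
proof -
 have [measurable]: "v \<in> Borel" using assms by (rule loc_int_measurable)
 have "integrable lborel (%x. indicator (cball 0 R) x *\<^sub>R line_mean h v x)" for R
 proof (rule integrableI_bounded)
  have "(NN x. ennreal (norm (indicator (cball 0 R) x *\<^sub>R line_mean h v x)))
    <= (NN x. NN \<tau>. indicator {0..1::real} \<tau> * (ennreal \<bar>v (x + \<tau> *\<^sub>R h)\<bar> * indicator (cball 0 R) x))"
  proof (intro nn_integral_mono)
   fix x show "ennreal (norm (indicator (cball 0 R) x *\<^sub>R line_mean h v x))
     <= (NN \<tau>. indicator {0..1::real} \<tau> * (ennreal \<bar>v (x + \<tau> *\<^sub>R h)\<bar> * indicator (cball 0 R) x))"
    using abs_line_mean_le [of h v x] by (cases "x \<in> cball 0 R") auto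
  qed
  also have "... < \<infinity>" by (rule nn_integral_line_local [OF assms])
  finally show "(NN x. ennreal (norm (indicator (cball 0 R) x *\<^sub>R line_mean h v x))) < \<infinity>" .
 qed measurable
 thus ?thesis by (simp add: loc_int_def)
qed

lemma loc_int_shift:
 fixes u :: "'a::euclidean_space => real"
 assumes "loc_int u" shows "loc_int (%x. u (x + h))"
proof -
 have [measurable]: "u \<in> Borel" using assms by (rule loc_int_measurable)
 have "integrable lborel (%x. indicator (cball 0 R) x *\<^sub>R u (x + h))" for R
 proof (rule integrableI_bounded)
  have "(NN x. ennreal (norm (indicator (cball 0 R) x *\<^sub>R u (x + h))))
    <= (NN x. ennreal (norm (indicator (cball 0 (R + norm h)) (x + h) *\<^sub>R u (x + h))))"
  proof (intro nn_integral_mono ennreal_leI)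
   fix x
   have "norm (x + h) <= R + norm h" if "norm x <= R"
    using norm_triangle_ineq [of x h] that by simp
   thus "norm (indicator (cball 0 R) x *\<^sub>R u (x + h)) <= norm (indicator (cball 0 (R + norm h)) (x + h) *\<^sub>R u (x + h))"
    by (auto simp: indicator_def)
  qed
  also have "... = (NN x. ennreal (norm (indicator (cball 0 (R + norm h)) x *\<^sub>R u x)))"
   by (rule nn_integral_lborel_shift [of "%x. ennreal (norm (indicator (cball 0 (R + norm h)) x *\<^sub>R u x))"]) measurable
  also have "... < \<infinity>"
   using assms by (auto simp: loc_int_def integrable_iff_bounded)
  finally show "(NN x. ennreal (norm (indicator (cball 0 R) x *\<^sub>R u (x + h)))) < \<infinity>" .
 qed measurable
 thus ?thesis by (simp add: loc_int_def)
qed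

text \<open>Tested against \<open>\<phi>\<close>: the shift is moved from \<open>u\<close> to
  \<open>\<phi>\<close>, the increment of \<open>\<phi>\<close> is written as an integral of its
  derivative along the segment, and Fubini reduces the claim to the weak identity for each translate
  of \<open>\<phi>\<close>. The fundamental lemma removes \<open>\<phi>\<close>.\<close>

lemma weak_dir_line_mean:
 fixes u :: "'a::euclidean_space => real"
 assumes "weak_dir u h v"
 shows "AE x in lborel. u (x + h) - u x = line_mean h v x"
proof -
 have u: "loc_int u" and v: "loc_int v"
  and weak: "!!\<phi>. test_function \<phi> ==> (LL x. u x * dir_deriv h \<phi> x) = - (LL x. v x * \<phi> x)"
  using assms by (auto simp: weak_dir_def)
 have [measurable]: "u \<in> Borel" "v \<in> Borel"
  using u v by (auto intro: loc_int_measurable)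
 let ?I = "indicator {0..1} :: real => real"
 have "AE x in lborel. (u (x + h) - u x) - line_mean h v x = 0"
 proof (rule fundamental_lemma)
  show "loc_int (%x. (u (x + h) - u x) - line_mean h v x)"
   by (intro loc_int_diff loc_int_shift u loc_int_line_mean v)
  fix \<phi> :: "'a => real" assume \<phi>: "test_function \<phi>"
  note [measurable] = test_function_measurable [OF \<phi>]
  obtain R B where RB: "0 < R" "0 < B" "!!x. R <= norm x ==> \<phi> x = 0" "!!x. R <= norm x ==> dir_deriv h \<phi> x = 0"
   "!!x. \<bar>\<phi> x\<bar> <= B" "!!x. \<bar>dir_deriv h \<phi> x\<bar> <= B"
   using test_function_bounds [OF \<phi>, of h] by blast
  have int_u: "integrable lborel (%x. u x * \<phi> (x + c))" "integrable lborel (%x. v x * \<phi> (x + c))" for c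
   using loc_int_test [OF u test_function_translate [OF \<phi>]] loc_int_test [OF v test_function_translate [OF \<phi>]] by auto
  have int_sh: "integrable lborel (%x. u (x + h) * \<phi> x)" "integrable lborel (%x. line_mean h v x * \<phi> x)"
   by (intro loc_int_test loc_int_shift loc_int_line_mean u v \<phi>)+
  have FTC: "\<phi> (x - h) - \<phi> x = - (LL \<tau>. ?I \<tau> * dir_deriv h \<phi> (x - \<tau> *\<^sub>R h))" for x
  proof -
   have "(LL \<tau>. - dir_deriv h \<phi> (x + \<tau> *\<^sub>R (- h)) * indicator {0..1} \<tau>) = \<phi> (x + 1 *\<^sub>R (- h)) - \<phi> (x + 0 *\<^sub>R (- h))"
   proof (rule integral_FTC_Icc_real)
    fix t :: real
    show "DERIV (%t. \<phi> (x + t *\<^sub>R (- h))) t :> - dir_deriv h \<phi> (x + t *\<^sub>R (- h))"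
     using test_function_line_deriv [OF \<phi>, of x "- h" t] dir_deriv_scale [OF \<phi>, of "-1" h] by simp
    have "continuous_on UNIV (%t. dir_deriv h \<phi> (x + t *\<^sub>R (- h)))"
     by (rule continuous_on_compose2 [OF dir_deriv_continuous [OF \<phi>, of h]]) (auto intro!: continuous_intros)
    thus "isCont (%t. - dir_deriv h \<phi> (x + t *\<^sub>R (- h))) t"
     by (intro isCont_minus) (simp add: continuous_on_eq_continuous_at)
   qed simp
   thus ?thesis by (simp add: mult.commute)
  qed
  have pair1: "integrable (lborel \<Otimes>\<^sub>M lborel) (%(x, \<tau>). u x * (?I \<tau> * dir_deriv h \<phi> (x - \<tau> *\<^sub>R h)))"
  proof (rule integrable_pairI)
   have "(NN x. NN \<tau>. ennreal \<bar>u x * (?I \<tau> * dir_deriv h \<phi> (x - \<tau> *\<^sub>R h))\<bar>)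
     <= (NN x. NN \<tau>. ennreal (B * norm (indicator (cball 0 (R + norm h)) x *\<^sub>R u x)) * indicator {0..1::real} \<tau>)"
   proof (intro nn_integral_mono)
    fix x :: 'a and \<tau> :: real
    have "dir_deriv h \<phi> (x - \<tau> *\<^sub>R h) = 0" if "0 <= \<tau>" "\<tau> <= 1" "R + norm h < norm x"
     using norm_triangle_ineq2 [of x "\<tau> *\<^sub>R h"] that mult_left_le_one_le [of "norm h" \<tau>]
     by (intro RB(4)) simp
    thus "ennreal \<bar>u x * (?I \<tau> * dir_deriv h \<phi> (x - \<tau> *\<^sub>R h))\<bar> <= ennreal (B * norm (indicator (cball 0 (R + norm h)) x *\<^sub>R u x)) * indicator {0..1} \<tau>"
     using RB(2) RB(6) [of "x - \<tau> *\<^sub>R h"]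
     by (auto simp: indicator_def abs_mult mult.commute [of B] not_le intro!: ennreal_leI mult_left_mono)
   qed
   also have "... = (NN x. ennreal (norm (B * (indicator (cball 0 (R + norm h)) x *\<^sub>R u x))))"
    using RB(2) by (simp add: nn_integral_cmult abs_mult)
   also have "... < \<infinity>"
   proof -
    have "integrable lborel (%x. B * (indicator (cball 0 (R + norm h)) x *\<^sub>R u x))"
     using u by (simp add: loc_int_def)
    thus ?thesis unfolding integrable_iff_bounded by blast
   qed
   finally show "(NN x. NN \<tau>. ennreal \<bar>case (x, \<tau>) of (x, \<tau>) => u x * (?I \<tau> * dir_deriv h \<phi> (x - \<tau> *\<^sub>R h))\<bar>) < \<infinity>"
    by simp
  qed measurable
  have pair2: "integrable (lborel \<Otimes>\<^sub>M lborel) (%(x, \<tau>). ?I \<tau> * v (x + \<tau> *\<^sub>R h) * \<phi> x)"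
  proof (rule integrable_pairI)
   have "(NN x. NN \<tau>. ennreal \<bar>?I \<tau> * v (x + \<tau> *\<^sub>R h) * \<phi> x\<bar>)
     <= (NN x. NN \<tau>. ennreal B * (indicator {0..1::real} \<tau> * (ennreal \<bar>v (x + \<tau> *\<^sub>R h)\<bar> * indicator (cball 0 R) x)))"
   proof (intro nn_integral_mono)
    fix x :: 'a and \<tau> :: real
    show "ennreal \<bar>?I \<tau> * v (x + \<tau> *\<^sub>R h) * \<phi> x\<bar> <= ennreal B * (indicator {0..1::real} \<tau> * (ennreal \<bar>v (x + \<tau> *\<^sub>R h)\<bar> * indicator (cball 0 R) x))"
     using RB(2) RB(3) [of x] RB(5) [of x]
     by (auto simp: indicator_def abs_mult mult.commute ennreal_mult' [symmetric] intro!: ennreal_leI mult_right_mono)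
   qed
   also have "... = ennreal B * (NN x. NN \<tau>. indicator {0..1::real} \<tau> * (ennreal \<bar>v (x + \<tau> *\<^sub>R h)\<bar> * indicator (cball 0 R) x))"
    by (simp add: nn_integral_cmult)
   also have "... < \<infinity>"
    using nn_integral_line_local [OF v, of h R] by (simp add: ennreal_mult_less_top)
   finally show "(NN x. NN \<tau>. ennreal \<bar>case (x, \<tau>) of (x, \<tau>) => ?I \<tau> * v (x + \<tau> *\<^sub>R h) * \<phi> x\<bar>) < \<infinity>"
    by simp
  qed measurable
  have slice: "(LL x. u x * dir_deriv h \<phi> (x - \<tau> *\<^sub>R h)) = - (LL x. v (x + \<tau> *\<^sub>R h) * \<phi> x)" for \<tau> :: real
  proof -
   have "(LL x. u x * dir_deriv h (%x. \<phi> (x + (- (\<tau> *\<^sub>R h)))) x) = - (LL x. v x * \<phi> (x + (- (\<tau> *\<^sub>R h))))"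
    by (rule weak [OF test_function_translate [OF \<phi>]])
   moreover have "(LL x. v x * \<phi> (x + (- (\<tau> *\<^sub>R h)))) = (LL x. v (x + \<tau> *\<^sub>R h) * \<phi> x)"
    using integral_lborel_shift [of "%x. v x * \<phi> (x + (- (\<tau> *\<^sub>R h)))" "\<tau> *\<^sub>R h"] by simp
   ultimately show ?thesis by (simp only: dir_deriv_translate [OF \<phi>] diff_conv_add_uminus)
  qed
  have "(LL x. (u (x + h) - u x) * \<phi> x) = (LL x. u (x + h) * \<phi> x) - (LL x. u x * \<phi> x)"
   using int_sh int_u(1) [of 0] by (simp add: left_diff_distrib)
  also have "(LL x. u (x + h) * \<phi> x) = (LL x. u x * \<phi> (x - h))"
   using integral_lborel_shift [of "%x. u x * \<phi> (x - h)" h] by simp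
  also have "... - (LL x. u x * \<phi> x) = (LL x. u x * (\<phi> (x - h) - \<phi> x))"
   using int_u(1) [of 0] int_u(1) [of "- h"] by (simp add: right_diff_distrib)
  also have "... = - (LL x. (LL \<tau>. u x * (?I \<tau> * dir_deriv h \<phi> (x - \<tau> *\<^sub>R h))))"
   by (simp add: FTC)
  also have "(LL x. (LL \<tau>. u x * (?I \<tau> * dir_deriv h \<phi> (x - \<tau> *\<^sub>R h))))
    = (LL \<tau>. (LL x. u x * (?I \<tau> * dir_deriv h \<phi> (x - \<tau> *\<^sub>R h))))"
   by (rule lborel_pair.Fubini_integral [OF pair1, symmetric])
  also have "... = - (LL \<tau>. (LL x. ?I \<tau> * v (x + \<tau> *\<^sub>R h) * \<phi> x))"
   by (simp add: slice mult.assoc mult.left_commute [of _ "?I _"])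
  also have "(LL \<tau>. (LL x. ?I \<tau> * v (x + \<tau> *\<^sub>R h) * \<phi> x))
    = (LL x. (LL \<tau>. ?I \<tau> * v (x + \<tau> *\<^sub>R h) * \<phi> x))"
   by (rule lborel_pair.Fubini_integral [OF pair2])
  also have "... = (LL x. line_mean h v x * \<phi> x)"
   by (simp add: line_mean_def)
  finally have "(LL x. (u (x + h) - u x) * \<phi> x) = (LL x. line_mean h v x * \<phi> x)" by simp
  moreover have "integrable lborel (%x. (u (x + h) - u x) * \<phi> x)"
   using int_sh int_u(1) [of 0] by (simp add: left_diff_distrib)
  ultimately show "(LL x. ((u (x + h) - u x) - line_mean h v x) * \<phi> x) = 0"
   using int_sh(2) by (subst left_diff_distrib) simp
 qed
 thus ?thesis by simp
qed


section \<open>Jensen's inequality and the size of increments\<close>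

lemma powr_tangent_le:
 fixes t m :: real
 assumes "1 <= q" "0 <= t" "0 < m"
 shows "q * m powr (q - 1) * t <= t powr q + (q - 1) * m powr q"
proof (cases "t = 0")
 case True
 thus ?thesis using assms by simp
next
 case False
 have "(%x. x powr q) t - m powr q \<ge> (q * m powr (q - 1)) * (t - m)"
 proof (rule convex_on_imp_above_tangent)
  show "convex_on {0<..} (%x. x powr q)" by (rule powr_convex) (rule assms)
  show "((%x. x powr q) has_field_derivative q * m powr (q - 1)) (at m within {0<..})"
   using assms by (auto intro!: derivative_eq_intros)
 qed (use assms False in \<open>auto simp: interior_open\<close>)
 moreover have "m powr q = m powr (q - 1) * m"
  using assms powr_add [of m "q - 1" 1] by simp
 ultimately show ?thesis by (simp add: algebra_simps)
qed

text \<open>The tangent inequality at the absolute value \<open>m\<close> of the mean, integrated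
  over the probability space. In the remaining cases the claim is trivial; in particular a
  non-integrable \<open>f\<close> has mean 0 by convention.\<close>

lemma jensen_powr:
 fixes f :: "'b => real"
 assumes "prob_space M" and [measurable]: "f \<in> borel_measurable M" and "1 <= q"
 shows "(apow q (\<integral>x. f x \<partial>M)) <= (\<integral>\<^sup>+x. apow q (f x) \<partial>M)"
proof (cases "integrable M f & (\<integral>x. f x \<partial>M) ~= 0 & (\<integral>\<^sup>+x. apow q (f x) \<partial>M) ~= \<infinity>")
 case True
 interpret prob_space M by fact
 define m where "m = \<bar>\<integral>x. f x \<partial>M\<bar>"
 have m: "0 < m" using True by (simp add: m_def)
 have int: "integrable M (%x. \<bar>f x\<bar> powr q)"
  using True by (intro integrableI_bounded) (auto simp: less_top)
 have "q * m powr (q - 1) * m <= q * m powr (q - 1) * (\<integral>x. \<bar>f x\<bar> \<partial>M)"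
  unfolding m_def using assms(3) by (intro mult_left_mono integral_abs_bound) auto
 also have "... = (\<integral>x. q * m powr (q - 1) * \<bar>f x\<bar> \<partial>M)" by simp
 also have "... <= (\<integral>x. \<bar>f x\<bar> powr q + (q - 1) * m powr q \<partial>M)"
  using True int m assms(3) by (intro integral_mono powr_tangent_le) auto
 also have "... = (\<integral>x. \<bar>f x\<bar> powr q \<partial>M) + (q - 1) * m powr q"
  using int by (simp add: prob_space)
 also have "q * m powr (q - 1) * m = q * m powr q"
  using m powr_add [of m "q - 1" 1] by simp
 finally have "m powr q <= (\<integral>x. \<bar>f x\<bar> powr q \<partial>M)" by (simp add: algebra_simps)
 thus ?thesis
  using int by (simp add: m_def nn_integral_eq_integral ennreal_leI)
qed (auto simp: not_integrable_integral_eq)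

lemma prob_space_unit_interval: "prob_space (restrict_space lborel {0..1::real})"
 by (rule prob_spaceI) (simp add: emeasure_restrict_space space_restrict_space)

lemma line_mean_eq:
 "line_mean h v x = (\<integral>\<tau>. v (x + \<tau> *\<^sub>R h) \<partial>restrict_space lborel {0..1})"
 by (simp add: line_mean_def integral_restrict_space)

lemma nn_integral_line_mean_le:
 fixes v :: "'a::euclidean_space => real"
 assumes [measurable]: "v \<in> Borel" and "1 <= q"
 shows "(NN x. apow q (line_mean h v x)) <= (NN x. apow q (v x))"
proof -
 have "(NN x. apow q (line_mean h v x))
   <= (NN x. NN \<tau>. indicator {0..1::real} \<tau> * apow q (v (x + \<tau> *\<^sub>R h)))"
 proof (rule nn_integral_mono)
  fix x
  have "(apow q (line_mean h v x)) <= (\<integral>\<^sup>+\<tau>. apow q (v (x + \<tau> *\<^sub>R h)) \<partial>restrict_space lborel {0..1})"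
   unfolding line_mean_eq by (rule jensen_powr [OF prob_space_unit_interval]) (use assms in \<open>auto intro: measurable_restrict_space1\<close>)
  thus "(apow q (line_mean h v x)) <= (NN \<tau>. indicator {0..1::real} \<tau> * apow q (v (x + \<tau> *\<^sub>R h)))"
   by (simp add: nn_integral_restrict_space mult.commute)
 qed
 also have "... = (NN x. apow q (v x))"
  by (rule nn_integral_line_shift) simp
 finally show ?thesis .
qed

lemma shift_diff_le_weak_dir:
 assumes "weak_dir u h v" "1 <= q"
 shows "shift_diff q u h <= (NN x. apow q (v x))"
proof -
 have "shift_diff q u h = (NN x. apow q (line_mean h v x))"
  unfolding shift_diff_def
  by (rule nn_integral_cong_AE, rule eventually_mono [OF weak_dir_line_mean [OF assms(1)]]) simp
 also have "... <= (NN x. apow q (v x))"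
  using assms by (intro nn_integral_line_mean_le loc_int_measurable) (auto simp: weak_dir_def)
 finally show ?thesis .
qed

lemma abs_line_mean_diff_le:
 fixes v :: "'a::euclidean_space => real"
 assumes [measurable]: "v \<in> Borel"
 shows "ennreal \<bar>line_mean h v x - v x\<bar> <= (NN \<tau>. indicator {0..1::real} \<tau> * ennreal \<bar>v (x + \<tau> *\<^sub>R h) - v x\<bar>)"
proof -
 let ?M = "restrict_space lborel {0..1::real}"
 interpret prob_space ?M by (rule prob_space_unit_interval)
 have m [measurable]: "(%\<tau>. v (x + \<tau> *\<^sub>R h)) \<in> borel_measurable ?M"
  by (rule measurable_restrict_space1) measurable
 have eq: "(NN \<tau>. indicator {0..1::real} \<tau> * ennreal \<bar>v (x + \<tau> *\<^sub>R h) - v x\<bar>) = (\<integral>\<^sup>+\<tau>. ennreal (norm (v (x + \<tau> *\<^sub>R h) - v x)) \<partial>?M)"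
  by (simp add: nn_integral_restrict_space mult.commute)
 show ?thesis
 proof (cases "integrable ?M (%\<tau>. v (x + \<tau> *\<^sub>R h) - v x)")
  case True
  hence "integrable ?M (%\<tau>. (v (x + \<tau> *\<^sub>R h) - v x) + v x)"
   by (intro Bochner_Integration.integrable_add) auto
  hence "line_mean h v x - v x = (\<integral>\<tau>. v (x + \<tau> *\<^sub>R h) - v x \<partial>?M)"
   using prob_space by (simp add: line_mean_eq)
  thus ?thesis
   unfolding eq using integral_norm_bound_ennreal [OF True] by simp
 next
  case False
  hence "(\<integral>\<^sup>+\<tau>. ennreal (norm (v (x + \<tau> *\<^sub>R h) - v x)) \<partial>?M) = \<infinity>"
   using m by (simp add: integrable_iff_bounded less_top [symmetric])
  thus ?thesis unfolding eq by simp
 qed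
qed

lemma line_mean_local:
 fixes v :: "'a::euclidean_space => real"
 assumes "norm x <= R" "norm h <= H"
 defines "w \<equiv> %x. indicator (cball 0 (R + H)) x * v x"
 shows "line_mean h v x = line_mean h w x" "v x = w x"
proof -
 have "norm (x + \<tau> *\<^sub>R h) <= R + H" if "0 <= \<tau>" "\<tau> <= 1" for \<tau>
  using norm_triangle_ineq [of x "\<tau> *\<^sub>R h"] that assms(1,2) mult_left_le_one_le [of "norm h" \<tau>] by simp
 thus "line_mean h v x = line_mean h w x"
  unfolding line_mean_def w_def by (intro Bochner_Integration.integral_cong) (auto simp: indicator_def)
 have "0 <= H" using assms(2) norm_ge_zero order_trans by blast
 thus "v x = w x" using assms(1) by (simp add: w_def indicator_def)
qed

text \<open>The dyadic difference quotient is the mean of \<open>v\<close> over a segment shrinking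
  to \<open>x\<close>. By continuity of translation, applied to \<open>v\<close> cut off outside a
  larger ball, these means converge to \<open>v\<close> in \<open>L^1\<close> on the ball of radius
  \<open>R\<close>, hence almost everywhere along a subsequence.\<close>

lemma weak_dir_subseq:
 assumes "weak_dir u h v"
 shows "\<exists>r::nat => nat. strict_mono r & (AE x in lborel. norm x <= R \<longrightarrow>
  (%n. 2 ^ r n * (u (x + (1 / 2 ^ r n) *\<^sub>R h) - u x)) ----> v x)"
proof -
 have u: "loc_int u" and v: "loc_int v" using assms by (auto simp: weak_dir_def)
 have [measurable]: "u \<in> Borel" "v \<in> Borel"
  using u v by (auto intro: loc_int_measurable)
 define c :: "nat => real" where "c n = 1 / 2 ^ n" for n
 define D where "D n x = 2 ^ n * (u (x + c n *\<^sub>R h) - u x)" for n x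
 define w where "w x = indicator (cball 0 (R + norm h)) x * v x" for x
 define E where "E n x = indicator (cball 0 R) x *\<^sub>R (D n x - v x)" for n x
 have [measurable]: "w \<in> Borel" unfolding w_def by measurable
 have c: "0 < c n" "c n <= 1" for n by (simp_all add: c_def)
 have w_int: "integrable lborel w" using v by (simp add: loc_int_def w_def [abs_def])
 have D_loc: "loc_int (D n)" for n
  unfolding D_def by (intro loc_int_cmult loc_int_diff loc_int_shift u)
 have E_int: "integrable lborel (E n)" for n
  using loc_int_diff [OF D_loc v] by (simp add: loc_int_def E_def [abs_def])
 have D_eq: "AE x in lborel. D n x = line_mean (c n *\<^sub>R h) v x" for n
  using weak_dir_line_mean [OF weak_dir_scale [OF assms, of "c n"]]
 proof eventually_elim
  case (elim x)
  have "line_mean (c n *\<^sub>R h) (%x. c n * v x) x = c n * line_mean (c n *\<^sub>R h) v x"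
   unfolding line_mean_def by (simp add: mult.left_commute)
  with elim show ?case by (simp add: D_def c_def)
 qed
 \<comment> \<open>The difference of a mean and its centre is bounded by the mean of the
   differences; Fubini turns this into \<open>L^1\<close> moduli of continuity of
   \<open>w\<close>.\<close>
 have le: "(NN x. ennreal (norm (E n x))) <= (NN \<tau>. indicator {0..1::real} \<tau> * shift_diff 1 w (\<tau> *\<^sub>R c n *\<^sub>R h))" for n
 proof -
  have "(NN x. ennreal (norm (E n x))) <= (NN x. ennreal \<bar>line_mean (c n *\<^sub>R h) w x - w x\<bar>)"
  proof (rule nn_integral_mono_AE, rule eventually_mono [OF D_eq [of n]])
   fix x assume "D n x = line_mean (c n *\<^sub>R h) v x"
   thus "ennreal (norm (E n x)) <= ennreal \<bar>line_mean (c n *\<^sub>R h) w x - w x\<bar>"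
    using line_mean_local [of x R "c n *\<^sub>R h" "norm h" v] c [of n]
    by (auto simp: E_def indicator_def w_def [abs_def] mult_left_le_one_le)
  qed
  also have "... <= (NN x. NN \<tau>. indicator {0..1::real} \<tau> * ennreal \<bar>w (x + \<tau> *\<^sub>R c n *\<^sub>R h) - w x\<bar>)"
   by (intro nn_integral_mono abs_line_mean_diff_le) measurable
  also have "... = (NN \<tau>. NN x. indicator {0..1::real} \<tau> * ennreal \<bar>w (x + \<tau> *\<^sub>R c n *\<^sub>R h) - w x\<bar>)"
   by (rule lborel_pair.Fubini') simp
  also have "... = (NN \<tau>. indicator {0..1::real} \<tau> * shift_diff 1 w (\<tau> *\<^sub>R c n *\<^sub>R h))"
   by (simp add: nn_integral_cmult shift_diff_def)
  finally show ?thesis .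
 qed
 have E_lim: "(%n. NN x. ennreal (norm (E n x))) ----> 0"
 proof (rule order_tendstoI)
  fix a :: ennreal assume "0 < a"
  then obtain b where b: "0 < b" "b < a" by (metis dense)
  have "\<forall>\<^sub>F k in nhds 0. shift_diff 1 w k < b"
   using shift_diff_tendsto_0_integrable [OF w_int] b by (intro order_tendstoD)
  then obtain d where d: "0 < d" "!!k. norm k < d ==> shift_diff 1 w k < b"
   unfolding eventually_nhds_metric by (auto simp: dist_norm)
  have "(%n. norm h * c n) ----> norm h * 0"
   unfolding c_def by (intro tendsto_intros LIMSEQ_divide_realpow_zero) auto
  hence "\<forall>\<^sub>F n in sequentially. norm h * c n < d"
   using d(1) by (intro order_tendstoD) auto
  thus "\<forall>\<^sub>F n in sequentially. (NN x. ennreal (norm (E n x))) < a"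
  proof eventually_elim
   case (elim n)
   have "(NN \<tau>. indicator {0..1::real} \<tau> * shift_diff 1 w (\<tau> *\<^sub>R c n *\<^sub>R h)) <= (NN \<tau>. b * indicator {0..1::real} \<tau>)"
   proof (rule nn_integral_mono)
    fix \<tau> :: real
    have "shift_diff 1 w (\<tau> *\<^sub>R c n *\<^sub>R h) < b" if "0 <= \<tau>" "\<tau> <= 1"
    proof (rule d(2))
     have "norm (\<tau> *\<^sub>R c n *\<^sub>R h) <= norm h * c n"
      using that c [of n] mult_left_le_one_le [of "norm h * c n" \<tau>] by (simp add: abs_mult mult_ac)
     with elim show "norm (\<tau> *\<^sub>R c n *\<^sub>R h) < d" by simp
    qed
    thus "indicator {0..1::real} \<tau> * shift_diff 1 w (\<tau> *\<^sub>R c n *\<^sub>R h) <= b * indicator {0..1::real} \<tau>"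
     by (auto simp: indicator_def less_imp_le)
   qed
   also have "... = b" by (simp add: nn_integral_cmult_indicator)
   finally show ?case using le [of n] b(2) by (meson le_less_trans order_trans)
  qed
 qed simp
 have "(%n. LL x. norm (E n x)) ----> 0"
 proof -
  have "(%n. enn2real (NN x. ennreal (norm (E n x)))) ----> enn2real 0"
   using E_lim by (intro tendsto_enn2real) auto
  moreover have "(LL x. norm (E n x)) = enn2real (NN x. ennreal (norm (E n x)))" for n
   by (rule integral_eq_nn_integral) (use borel_measurable_integrable [OF E_int] in auto)
  ultimately show ?thesis by simp
 qed
 from tendsto_L1_AE_subseq [OF E_int this]
 obtain r where r: "strict_mono r" "AE x in lborel. (%n. E (r n) x) ----> 0" by blast
 from r(2) have "AE x in lborel. norm x <= R --> (%n. 2 ^ r n * (u (x + (1 / 2 ^ r n) *\<^sub>R h) - u x)) ----> v x"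
 proof eventually_elim
  case (elim x)
  show ?case
  proof
   assume "norm x <= R"
   with elim have "(%n. D (r n) x - v x) ----> 0" by (simp add: E_def)
   hence "(%n. D (r n) x) ----> v x" by (simp add: LIM_zero_iff)
   thus "(%n. 2 ^ r n * (u (x + (1 / 2 ^ r n) *\<^sub>R h) - u x)) ----> v x"
    by (simp add: D_def c_def)
  qed
 qed
 with r(1) show ?thesis by blast
qed

text \<open>The \<open>q\<close>-th powers of the \<open>L^q\<close> norms of the dyadic difference
  quotients along \<open>h\<close>. By the doubling inequality they increase with \<open>n\<close>,
  so this supremum is their limit.\<close>

definition dyadic_sup :: "real => ('a::euclidean_space => real) => 'a => ennreal" where
 "dyadic_sup q u h = (SUP n::nat. ennreal (2 powr (real n * q)) * shift_diff q u ((1 / 2 ^ n) *\<^sub>R h))"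

lemma incseq_dyadic:
 assumes "u \<in> Borel" "1 <= q"
 shows "incseq (%n::nat. ennreal (2 powr (real n * q)) * shift_diff q u ((1 / 2 ^ n) *\<^sub>R h))"
proof (rule incseq_SucI)
 fix n :: nat
 have "shift_diff q u (2 *\<^sub>R ((1 / 2 ^ Suc n) *\<^sub>R h)) <= ennreal (2 powr q) * shift_diff q u ((1 / 2 ^ Suc n) *\<^sub>R h)"
  by (rule shift_diff_double) (use assms in auto)
 hence "ennreal (2 powr (real n * q)) * shift_diff q u ((1 / 2 ^ n) *\<^sub>R h)
   <= ennreal (2 powr (real n * q)) * (ennreal (2 powr q) * shift_diff q u ((1 / 2 ^ Suc n) *\<^sub>R h))"
  by (intro mult_left_mono) auto
 also have "... = ennreal (2 powr (real (Suc n) * q)) * shift_diff q u ((1 / 2 ^ Suc n) *\<^sub>R h)"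
  by (simp add: mult.assoc [symmetric] ennreal_mult' [symmetric] powr_add [symmetric] distrib_right add.commute)
 finally show "ennreal (2 powr (real n * q)) * shift_diff q u ((1 / 2 ^ n) *\<^sub>R h) <= ..." .
qed

text \<open>An increment is a mean of \<open>v\<close>, so each quotient has norm at most that of
  \<open>v\<close>. Conversely Fatou's lemma applies along a subsequence converging almost
  everywhere on a ball, and the balls exhaust the space.\<close>

lemma dyadic_sup_weak_dir:
 fixes u :: "'a::euclidean_space => real"
 assumes "weak_dir u h v" "1 <= q"
 shows "dyadic_sup q u h = (NN x. apow q (v x))"
proof (rule antisym)
 have [measurable]: "u \<in> Borel" "v \<in> Borel"
  using assms(1) by (auto simp: weak_dir_def intro: loc_int_measurable)
 show "dyadic_sup q u h <= (NN x. apow q (v x))"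
  unfolding dyadic_sup_def
 proof (rule SUP_least)
  fix n :: nat
  have "ennreal (2 powr (real n * q)) * shift_diff q u ((1 / 2 ^ n) *\<^sub>R h)
    <= ennreal (2 powr (real n * q)) * (NN x. apow q (1 / 2 ^ n * v x))"
   by (intro mult_left_mono shift_diff_le_weak_dir weak_dir_scale assms) auto
  also have "... = (NN x. ennreal (2 powr (real n * q) * \<bar>1 / 2 ^ n * v x\<bar> powr q))"
   by (simp add: nn_integral_cmult [symmetric] ennreal_mult')
  also have "... = (NN x. apow q (v x))"
  proof -
   have "2 powr (real n * q) * \<bar>1 / 2 ^ n * y\<bar> powr q = \<bar>y\<bar> powr q" for y :: real
    by (simp add: abs_mult powr_mult powr_divide powr_realpow [symmetric] powr_powr)
   thus ?thesis by simp
  qed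
  finally show "ennreal (2 powr (real n * q)) * shift_diff q u ((1 / 2 ^ n) *\<^sub>R h) <= (NN x. apow q (v x))" .
 qed
 have ball: "(NN x. apow q (v x) * indicator (cball 0 (real m)) x) <= dyadic_sup q u h" for m :: nat
 proof -
  obtain r where r: "strict_mono r" "AE x in lborel. norm x <= real m \<longrightarrow>
    (%n. 2 ^ r n * (u (x + (1 / 2 ^ r n) *\<^sub>R h) - u x)) ----> v x"
   using weak_dir_subseq [OF assms(1), of "real m"] by blast
  let ?D = "%n x. (apow q (2 ^ n * (u (x + (1 / 2 ^ n) *\<^sub>R h) - u x)))"
  have "(NN x. apow q (v x) * indicator (cball 0 (real m)) x)
    <= (NN x. liminf (%n. ?D (r n) x))"
  proof (rule nn_integral_mono_AE, rule eventually_mono [OF r(2)])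
   fix x assume x: "norm x <= real m --> (%n. 2 ^ r n * (u (x + (1 / 2 ^ r n) *\<^sub>R h) - u x)) ----> v x"
   show "(apow q (v x)) * indicator (cball 0 (real m)) x <= liminf (%n. ?D (r n) x)"
   proof (cases "norm x <= real m")
    case True
    have "(%n. ?D (r n) x) ----> apow q (v x)"
     using x True assms(2) by (intro tendsto_ennrealI tendsto_powr' tendsto_rabs tendsto_const) auto
    from lim_imp_Liminf [OF _ this] show ?thesis using True by simp
   qed simp
  qed
  also have "... <= liminf (%n. NN x. ?D (r n) x)"
   by (rule nn_integral_liminf) measurable
  also have "... <= liminf (%n. dyadic_sup q u h)"
  proof (intro Liminf_mono always_eventually allI)
   fix n
   have "2 powr (real k * q) * \<bar>y\<bar> powr q = \<bar>2 ^ k * y\<bar> powr q" for k :: nat and y :: real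
    by (simp add: abs_mult powr_mult powr_realpow [symmetric] powr_powr)
   hence "(NN x. ?D (r n) x) = ennreal (2 powr (real (r n) * q)) * shift_diff q u ((1 / 2 ^ r n) *\<^sub>R h)"
    unfolding shift_diff_def by (subst nn_integral_cmult [symmetric]) (simp_all add: ennreal_mult' [symmetric])
   also have "... <= dyadic_sup q u h"
    unfolding dyadic_sup_def by (rule SUP_upper) simp
   finally show "(NN x. ?D (r n) x) <= dyadic_sup q u h" .
  qed
  finally show ?thesis by (simp add: Liminf_const)
 qed
 have "(%m. NN x. apow q (v x) * indicator (cball 0 (real m)) x) ----> (NN x. apow q (v x))"
 proof (rule nn_integral_LIMSEQ)
  fix x :: 'a
  have "\<forall>\<^sub>F m in sequentially. norm x <= real m"
   using eventually_ge_at_top [of "nat \<lceil>norm x\<rceil>"] by eventually_elim linarith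
  thus "(%m. apow q (v x) * indicator (cball 0 (real m)) x) ----> apow q (v x)"
   by (intro tendsto_eventually) (auto elim!: eventually_mono)
 qed (auto simp: incseq_def le_fun_def indicator_def)
 thus "(NN x. apow q (v x)) <= dyadic_sup q u h"
  by (rule LIMSEQ_le_const2) (use ball in blast)
qed

section \<open>Weak compactness by uniform convexity\<close>

text \<open>For \<open>0 <= x < y\<close> the mean value theorem on the two halves of the interval
  compares derivatives at two ordered points, and the derivative increases strictly since
  \<open>q > 1\<close>.\<close>

lemma powr_midpoint_less:
 fixes a b :: real
 assumes q: "1 < q" and "a ~= b"
 shows "\<bar>(a + b) / 2\<bar> powr q < (\<bar>a\<bar> powr q + \<bar>b\<bar> powr q) / 2"
proof -
 have pos: "((x + y) / 2) powr q < (x powr q + y powr q) / 2" if xy: "0 <= x" "x < y" for x y :: real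
 proof (cases "x = 0")
  case True
  have "2 powr 1 < (2::real) powr q" using q by (intro powr_less_mono) auto
  hence "y powr q / 2 powr q < y powr q / 2" using xy True by (intro divide_strict_left_mono) auto
  thus ?thesis using True xy by (simp add: powr_divide)
 next
  case False
  with xy have "0 < x" by simp
  define m where "m = (x + y) / 2"
  have m: "x < m" "m < y" using xy by (simp_all add: m_def)
  have D: "((%t. t powr q) has_real_derivative q * t powr (q - 1)) (at t)" if "0 < t" for t
   using that by (auto intro!: derivative_eq_intros)
  obtain z1 where z1: "x < z1" "z1 < m" "m powr q - x powr q = (m - x) * (q * z1 powr (q - 1))"
   using MVT2 [OF m(1), of "%t. t powr q" "%t. q * t powr (q - 1)"] D \<open>0 < x\<close> by auto
  obtain z2 where z2: "m < z2" "z2 < y" "y powr q - m powr q = (y - m) * (q * z2 powr (q - 1))"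
   using MVT2 [OF m(2), of "%t. t powr q" "%t. q * t powr (q - 1)"] D \<open>0 < x\<close> m by auto
  have "z1 powr (q - 1) < z2 powr (q - 1)"
   using z1 z2 \<open>0 < x\<close> q by (intro powr_less_mono2) auto
  hence less: "(m - x) * (q * z1 powr (q - 1)) < (m - x) * (q * z2 powr (q - 1))"
   using q m by (intro mult_strict_left_mono) auto
  have mx: "y - m = m - x" by (simp add: m_def field_simps)
  from less have "m powr q - x powr q < y powr q - m powr q" unfolding z1(3) z2(3) mx .
  thus ?thesis by (simp add: m_def)
 qed
 show ?thesis
 proof (cases "\<bar>a\<bar> = \<bar>b\<bar>")
  \<comment> \<open>Equal absolute values but distinct numbers: the midpoint is 0.\<close>
  case True
  hence "a = - b" "b ~= 0" using assms by (auto simp: abs_if split: if_splits)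
  thus ?thesis by simp
 next
  case False
  have "\<bar>(a + b) / 2\<bar> powr q <= ((\<bar>a\<bar> + \<bar>b\<bar>) / 2) powr q"
   using q by (intro powr_mono2) auto
  also have "... < (\<bar>a\<bar> powr q + \<bar>b\<bar> powr q) / 2"
   using pos [of "\<bar>a\<bar>" "\<bar>b\<bar>"] pos [of "\<bar>b\<bar>" "\<bar>a\<bar>"] False by (cases "\<bar>a\<bar> < \<bar>b\<bar>") (auto simp: add.commute)
  finally show ?thesis .
 qed
qed

text \<open>By homogeneity it is enough to treat the compact set where \<open>\<bar>a\<bar>\<^sup>q + \<bar>b\<bar>\<^sup>q = 1\<close>.\<close>

lemma powr_uniform_convexity:
 assumes q: "1 < q" and "0 < d"
 shows "\<exists>K\<ge>0. \<forall>a b::real. \<bar>a - b\<bar> powr q <= d * (\<bar>a\<bar> powr q + \<bar>b\<bar> powr q)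
   + K * ((\<bar>a\<bar> powr q + \<bar>b\<bar> powr q) / 2 - \<bar>(a + b) / 2\<bar> powr q)"
proof -
 \<comment> \<open>The part of the unit sphere on which the claim does not already follow from its
   term with \<open>d\<close>. There the convexity gap \<open>F\<close> is positive, hence bounded
   below by some \<open>c > 0\<close> by compactness.\<close>
 define S where "S = {z :: real \<times> real. \<bar>fst z\<bar> powr q + \<bar>snd z\<bar> powr q = 1 & d <= \<bar>fst z - snd z\<bar> powr q}"
 define F where "F z = 1 / 2 - \<bar>(fst z + snd z) / 2\<bar> powr q" for z :: "real \<times> real"
 have cont: "continuous_on UNIV (%z. \<bar>f z\<bar> powr q)" if "continuous_on UNIV f" for f :: "real \<times> real => real"
  using that q by (intro continuous_on_powr' continuous_intros) auto
 have "closed S"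
  unfolding S_def
  by (intro closed_Collect_conj closed_Collect_eq closed_Collect_le continuous_on_add cont continuous_intros)
 moreover have "bounded S"
 proof (rule boundedI)
  fix z assume "z \<in> S"
  hence *: "\<bar>fst z\<bar> powr q + \<bar>snd z\<bar> powr q = 1" by (simp add: S_def)
  have le1: "t <= 1" if "0 <= t" "t powr q <= 1" for t :: real
   using that q gr_one_powr [of t q] by (meson linorder_not_le less_trans zero_less_one)
  have "\<bar>fst z\<bar> powr q <= 1" "\<bar>snd z\<bar> powr q <= 1"
   using * powr_ge_zero [of "\<bar>fst z\<bar>" q] powr_ge_zero [of "\<bar>snd z\<bar>" q] by linarith+
  hence "\<bar>fst z\<bar> <= 1" "\<bar>snd z\<bar> <= 1" using le1 by auto
  hence "norm (fst z) + norm (snd z) <= 2" by simp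
  thus "norm z <= 2" using norm_Pair_le [of "fst z" "snd z"] by simp
 qed
 ultimately have "compact S" by (simp add: compact_eq_bounded_closed)
 have contF: "continuous_on S F"
 proof -
  have "continuous_on UNIV (%z :: real \<times> real. (fst z + snd z) / 2)"
   by (intro continuous_intros) auto
  hence "continuous_on UNIV F"
   unfolding F_def by (intro continuous_on_diff continuous_on_const cont)
  thus ?thesis by (rule continuous_on_subset) simp
 qed
 have Fpos: "0 < F z" if "z \<in> S" for z
 proof -
  have "fst z ~= snd z" using that \<open>0 < d\<close> by (auto simp: S_def)
  from powr_midpoint_less [OF q this] show ?thesis using that by (simp add: S_def F_def)
 qed
 obtain c where c: "0 < c" "!!z. z \<in> S ==> c <= F z"
 proof (cases "S = {}")
  case True
  thus ?thesis using that [of 1] by simp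
 next
  case False
  obtain z where "z \<in> S" "\<forall>y\<in>S. F z <= F y"
   using continuous_attains_inf [OF \<open>compact S\<close> False contF] by blast
  with Fpos that [of "F z"] show ?thesis by simp
 qed
 \<comment> \<open>\<open>2 powr (q - 1)\<close> bounds the left-hand side on the unit sphere, and
   the gap there is at least \<open>c\<close>.\<close>
 define K where "K = 2 powr (q - 1) / c"
 have conv: "\<bar>(a + b) / 2\<bar> powr q <= (\<bar>a\<bar> powr q + \<bar>b\<bar> powr q) / 2" for a b :: real
  using powr_midpoint_less [OF q, of a b] by (cases "a = b") auto
 have "\<bar>a - b\<bar> powr q <= d * (\<bar>a\<bar> powr q + \<bar>b\<bar> powr q)
   + K * ((\<bar>a\<bar> powr q + \<bar>b\<bar> powr q) / 2 - \<bar>(a + b) / 2\<bar> powr q)" for a b :: real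
 proof (cases "a = 0 & b = 0")
  case False
  define s where "s = \<bar>a\<bar> powr q + \<bar>b\<bar> powr q"
  have s: "0 < s" using False by (auto simp: s_def intro: add_pos_nonneg add_nonneg_pos)
  define l where "l = s powr (1 / q)"
  have l: "0 < l" "l powr q = s" using s q by (simp_all add: l_def powr_powr)
  have sc: "\<bar>x / l\<bar> powr q = \<bar>x\<bar> powr q / s" for x
   using l s by (simp add: powr_divide)
  have K0: "0 <= K" using c by (simp add: K_def)
  show ?thesis
  proof (cases "(a / l, b / l) \<in> S")
   case True
   have "\<bar>(a / l + b / l) / 2\<bar> powr q = \<bar>(a + b) / 2\<bar> powr q / s"
    using sc [of "(a + b) / 2"] by (simp add: add_divide_distrib mult.commute)
   with c(2) [OF True] have "c <= 1 / 2 - \<bar>(a + b) / 2\<bar> powr q / s" by (simp add: F_def)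
   hence "c * s <= (1 / 2 - \<bar>(a + b) / 2\<bar> powr q / s) * s" using s by (intro mult_right_mono) auto
   also have "... = s / 2 - \<bar>(a + b) / 2\<bar> powr q" using s by (simp add: left_diff_distrib)
   finally have "c * s <= s / 2 - \<bar>(a + b) / 2\<bar> powr q" .
   hence "K * (c * s) <= K * (s / 2 - \<bar>(a + b) / 2\<bar> powr q)" using K0 by (rule mult_left_mono)
   moreover have "K * (c * s) = 2 powr (q - 1) * s" using c by (simp add: K_def)
   moreover have "\<bar>a - b\<bar> powr q <= 2 powr (q - 1) * s"
    unfolding s_def using powr_abs_add_le [of q a "- b"] q by simp
   moreover have "0 <= d * s" using s \<open>0 < d\<close> by simp
   ultimately show ?thesis unfolding s_def [symmetric] by linarith
  next
   case nS: False
   have "\<bar>a / l\<bar> powr q + \<bar>b / l\<bar> powr q = 1"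
    unfolding sc using s by (simp add: s_def add_divide_distrib [symmetric])
   with nS have "\<bar>a / l - b / l\<bar> powr q < d" by (auto simp: S_def)
   hence "\<bar>a - b\<bar> powr q / s < d" using sc [of "a - b"] by (simp add: diff_divide_distrib)
   hence "\<bar>a - b\<bar> powr q <= d * s" using s by (simp add: pos_divide_less_eq)
   moreover have "0 <= K * (s / 2 - \<bar>(a + b) / 2\<bar> powr q)"
    using K0 conv [of a b] unfolding s_def by (intro mult_nonneg_nonneg) auto
   ultimately show ?thesis unfolding s_def [symmetric] by linarith
  qed
 qed simp
 moreover have "0 <= K" using c by (simp add: K_def)
 ultimately show ?thesis by blast
qed

lemma integrable_powr_add:
 fixes f g :: "'b => real"
 assumes [measurable]: "f \<in> borel_measurable M" "g \<in> borel_measurable M" and "1 <= q"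
  and int: "integrable M (%x. \<bar>f x\<bar> powr q)" "integrable M (%x. \<bar>g x\<bar> powr q)"
 shows "integrable M (%x. \<bar>f x + g x\<bar> powr q)"
proof (rule Bochner_Integration.integrable_bound)
 show "integrable M (%x. 2 powr (q - 1) * (\<bar>f x\<bar> powr q + \<bar>g x\<bar> powr q))"
  using int by simp
 show "AE x in M. norm (\<bar>f x + g x\<bar> powr q) <= norm (2 powr (q - 1) * (\<bar>f x\<bar> powr q + \<bar>g x\<bar> powr q))"
  using powr_abs_add_le [OF \<open>1 \<le> q\<close>] by (auto simp: abs_mult)
qed measurable

lemma Lq_uniform_convexity:
 fixes f g :: "'b => real"
 assumes [measurable]: "f \<in> borel_measurable M" "g \<in> borel_measurable M" and q: "1 < q"
  and int: "integrable M (%x. \<bar>f x\<bar> powr q)" "integrable M (%x. \<bar>g x\<bar> powr q)"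
  and K: "\<forall>a b::real. \<bar>a - b\<bar> powr q <= d * (\<bar>a\<bar> powr q + \<bar>b\<bar> powr q)
   + K * ((\<bar>a\<bar> powr q + \<bar>b\<bar> powr q) / 2 - \<bar>(a + b) / 2\<bar> powr q)"
 shows "(\<integral>x. \<bar>f x - g x\<bar> powr q \<partial>M) <= d * ((\<integral>x. \<bar>f x\<bar> powr q \<partial>M) + (\<integral>x. \<bar>g x\<bar> powr q \<partial>M))
  + K * (((\<integral>x. \<bar>f x\<bar> powr q \<partial>M) + (\<integral>x. \<bar>g x\<bar> powr q \<partial>M)) / 2 - (\<integral>x. \<bar>(f x + g x) / 2\<bar> powr q \<partial>M))"
proof -
 have i1: "integrable M (%x. \<bar>f x - g x\<bar> powr q)"
  using integrable_powr_add [of f M "%x. - g x" q] int q by simp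
 have i2: "integrable M (%x. \<bar>(f x + g x) / 2\<bar> powr q)"
 proof -
  have "integrable M (%x. \<bar>f x + g x\<bar> powr q / 2 powr q)"
   using integrable_powr_add [of f M g q] int q by simp
  thus ?thesis by (simp add: powr_divide)
 qed
 have "(\<integral>x. \<bar>f x - g x\<bar> powr q \<partial>M) <= (\<integral>x. d * (\<bar>f x\<bar> powr q + \<bar>g x\<bar> powr q)
   + K * ((\<bar>f x\<bar> powr q + \<bar>g x\<bar> powr q) / 2 - \<bar>(f x + g x) / 2\<bar> powr q) \<partial>M)"
  using i1 i2 int K by (intro integral_mono) auto
 also have "... = d * ((\<integral>x. \<bar>f x\<bar> powr q \<partial>M) + (\<integral>x. \<bar>g x\<bar> powr q \<partial>M))
  + K * (((\<integral>x. \<bar>f x\<bar> powr q \<partial>M) + (\<integral>x. \<bar>g x\<bar> powr q \<partial>M)) / 2 - (\<integral>x. \<bar>(f x + g x) / 2\<bar> powr q \<partial>M))"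
  using i2 int by simp
 finally show ?thesis .
qed

text \<open>The rate \<open>4^(-k)\<close> leaves room for a factor \<open>2^k\<close>: the weighted
  increments have summable integrals, so almost everywhere consecutive terms eventually differ by at
  most \<open>2^(-k)\<close> and the sequence converges. Fatou's lemma transfers the rate to the
  limit.\<close>

lemma Lq_fast_Cauchy_limit:
 fixes h :: "nat => 'b => real"
 assumes [measurable]: "!!k. h k \<in> borel_measurable M" and q: "1 <= q"
  and Cauchy: "!!k j. k <= j ==> (\<integral>\<^sup>+x. apow q (h j x - h k x) \<partial>M) <= ennreal ((1 / 4 ^ k) powr q)"
 obtains g where "g \<in> borel_measurable M"
  "!!k. (\<integral>\<^sup>+x. apow q (g x - h k x) \<partial>M) <= ennreal ((1 / 4 ^ k) powr q)"
proof -
 define g where "g x = lim (%k. h k x)" for x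
 have [measurable]: "g \<in> borel_measurable M" unfolding g_def by measurable
 have step: "(\<integral>\<^sup>+x. apow q (2 ^ k * (h (Suc k) x - h k x)) \<partial>M) <= ennreal ((1 / 2) ^ k)" for k
 proof -
  have "(\<integral>\<^sup>+x. apow q (2 ^ k * (h (Suc k) x - h k x)) \<partial>M) = ennreal ((2 ^ k) powr q) * (\<integral>\<^sup>+x. apow q (h (Suc k) x - h k x) \<partial>M)"
   by (subst nn_integral_cmult [symmetric]) (auto simp: abs_mult powr_mult ennreal_mult')
  also have "... <= ennreal ((2 ^ k) powr q) * ennreal ((1 / 4 ^ k) powr q)"
   by (intro mult_left_mono Cauchy) auto
  also have "... = ennreal ((1 / 2 ^ k) powr q)"
  proof -
   have "(2::real) ^ k * (1 / 4 ^ k) = 1 / 2 ^ k"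
    by (simp add: power_mult_distrib [symmetric] field_simps)
   thus ?thesis by (simp add: ennreal_mult' [symmetric] powr_mult [symmetric])
  qed
  also have "... <= ennreal ((1 / 2) ^ k)"
   using q powr_mono' [of 1 q "1 / 2 ^ k :: real"] by (intro ennreal_leI) (simp add: power_divide)
  finally show ?thesis .
 qed
 have "(\<integral>\<^sup>+x. (\<Sum>k. apow q (2 ^ k * (h (Suc k) x - h k x))) \<partial>M) = (\<Sum>k. \<integral>\<^sup>+x. apow q (2 ^ k * (h (Suc k) x - h k x)) \<partial>M)"
  by (rule nn_integral_suminf) measurable
 also have "... <= (\<Sum>k. ennreal ((1 / 2) ^ k))"
  by (intro suminf_le step) auto
 also have "... = ennreal (\<Sum>k. (1 / 2) ^ k)"
  by (rule suminf_ennreal2) (auto intro: summable_geometric)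
 also have "... < \<infinity>" by simp
 finally have "AE x in M. (\<Sum>k. apow q (2 ^ k * (h (Suc k) x - h k x))) ~= \<infinity>"
  by (intro nn_integral_noteq_infinite) auto
 hence conv: "AE x in M. (%k. h k x) ----> g x"
 proof eventually_elim
  case (elim x)
  have "summable (%k. \<bar>2 ^ k * (h (Suc k) x - h k x)\<bar> powr q)"
   using elim by (intro summable_suminf_not_top) auto
  hence "(%k. \<bar>2 ^ k * (h (Suc k) x - h k x)\<bar> powr q) ----> 0"
   by (rule summable_LIMSEQ_zero)
  hence "\<forall>\<^sub>F k in sequentially. \<bar>2 ^ k * (h (Suc k) x - h k x)\<bar> powr q < 1"
   by (intro order_tendstoD) auto
  hence "\<forall>\<^sub>F k in sequentially. norm (h (Suc k) x - h k x) <= (1 / 2) ^ k"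
  proof eventually_elim
   case (elim k)
   have "\<bar>2 ^ k * (h (Suc k) x - h k x)\<bar> <= 1"
   proof (rule ccontr)
    assume "\<not> ?thesis"
    hence "1 <= \<bar>2 ^ k * (h (Suc k) x - h k x)\<bar> powr q" using q by (intro ge_one_powr_ge_zero) auto
    with elim show False by simp
   qed
   hence "2 ^ k * \<bar>h (Suc k) x - h k x\<bar> <= 1" by (simp only: abs_mult) simp
   thus ?case by (simp add: power_divide pos_le_divide_eq mult.commute)
  qed
  hence "summable (%k. h (Suc k) x - h k x)"
   by (rule summable_comparison_test_ev) (simp add: summable_geometric)
  hence "convergent (%n. \<Sum>k<n. h (Suc k) x - h k x)"
   by (simp add: summable_iff_convergent)
  hence "convergent (%n. (h n x - h 0 x) + h 0 x)"
   unfolding sum_lessThan_telescope [of "%k. h k x"] by (intro convergent_add convergent_const)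
  hence "convergent (%n. h n x)" by simp
  thus ?case unfolding g_def by (simp add: convergent_LIMSEQ_iff)
 qed
 have "(\<integral>\<^sup>+x. apow q (g x - h k x) \<partial>M) <= ennreal ((1 / 4 ^ k) powr q)" for k
 proof -
  have "(\<integral>\<^sup>+x. apow q (g x - h k x) \<partial>M) = (\<integral>\<^sup>+x. liminf (%j. apow q (h j x - h k x)) \<partial>M)"
  proof (rule nn_integral_cong_AE, rule eventually_mono [OF conv])
   fix x assume "(%k. h k x) ----> g x"
   hence "(%j. apow q (h j x - h k x)) ----> apow q (g x - h k x)"
    using q by (intro tendsto_ennrealI tendsto_powr' tendsto_rabs tendsto_diff tendsto_const) auto
   from lim_imp_Liminf [OF _ this] show "(apow q (g x - h k x)) = liminf (%j. apow q (h j x - h k x))" by simp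
  qed
  also have "... <= liminf (%j. \<integral>\<^sup>+x. apow q (h j x - h k x) \<partial>M)"
   by (rule nn_integral_liminf) measurable
  also have "... <= liminf (%j. ennreal ((1 / 4 ^ k) powr q))"
   by (intro Liminf_mono eventually_mono [OF eventually_ge_at_top [of k]] Cauchy)
  finally show ?thesis by (simp add: Liminf_const)
 qed
 with that [of g] show ?thesis by simp
qed

text \<open>Either \<open>t\<close> is at most \<open>e\<close>, or \<open>1 - q\<close> of its
  powers can be replaced by those of \<open>e\<close>. A substitute for Hoelder's inequality on sets
  of finite measure.\<close>

lemma abs_le_powr:
 fixes t e :: real
 assumes "1 <= q" "0 < e"
 shows "\<bar>t\<bar> <= e + e powr (1 - q) * \<bar>t\<bar> powr q"
proof (cases "\<bar>t\<bar> <= e")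
 case True
 thus ?thesis by (simp add: add_increasing2)
next
 case False
 hence t: "0 < \<bar>t\<bar>" using assms by linarith
 have "\<bar>t\<bar> = \<bar>t\<bar> powr (1 - q) * \<bar>t\<bar> powr q" using t by (simp add: powr_add [symmetric])
 also have "... <= e powr (1 - q) * \<bar>t\<bar> powr q"
  using assms False by (intro mult_right_mono powr_mono2') auto
 finally show ?thesis using assms by linarith
qed

text \<open>No duality is used. Let \<open>Cn n\<close> consist of the functions whose pairings are
  as close to \<open>\<Lambda>\<close> as the tail of the sequence from \<open>n\<close> on. These
  sets are stable under midpoints and shrink with \<open>n\<close>, so their least norm powers
  \<open>d n\<close> increase and, being at most \<open>C\<close>, converge. Almost minimisers are
  then Cauchy by uniform convexity, since their midpoint cannot have a much smaller norm, and their
  limit has the pairings \<open>\<Lambda>\<close>.\<close>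

lemma weak_limit_exists:
 fixes f :: "nat => 'b => real" and \<Phi> :: "('b => real) set" and \<Lambda> :: "('b => real) => real"
 assumes q: "1 < q" and [measurable]: "!!n. f n \<in> borel_measurable M"
  and f_int: "!!n. integrable M (%x. \<bar>f n x\<bar> powr q)" and f_le: "!!n. (\<integral>x. \<bar>f n x\<bar> powr q \<partial>M) <= C"
  and \<Phi>_meas [measurable]: "!!\<phi>. \<phi> \<in> \<Phi> ==> \<phi> \<in> borel_measurable M"
  and \<Phi>_bd: "!!\<phi>. \<phi> \<in> \<Phi> ==> \<exists>A B. A \<in> sets M & emeasure M A < \<infinity> & 0 <= B & (\<forall>x. \<bar>\<phi> x\<bar> <= B * indicator A x)"
  and lim: "!!\<phi>. \<phi> \<in> \<Phi> ==> (%n. \<integral>x. f n x * \<phi> x \<partial>M) ----> \<Lambda> \<phi>"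
 obtains g where "g \<in> borel_measurable M" "integrable M (%x. \<bar>g x\<bar> powr q)" "!!\<phi>. \<phi> \<in> \<Phi> ==> (\<integral>x. g x * \<phi> x \<partial>M) = \<Lambda> \<phi>"
proof -
 define I where "I g = (\<integral>x. \<bar>g x\<bar> powr q \<partial>M)" for g
 \<comment> \<open>Every uniform bound \<open>e\<close> on the deviations of the tail is inherited.
   This formulation is visibly stable under midpoints and contains \<open>f n\<close>.\<close>
 define Cn where "Cn n g \<longleftrightarrow> g \<in> borel_measurable M & integrable M (%x. \<bar>g x\<bar> powr q) \<and>
   (\<forall>\<phi>\<in>\<Phi>. \<forall>e. (\<forall>m\<ge>n. \<bar>(\<integral>x. f m x * \<phi> x \<partial>M) - \<Lambda> \<phi>\<bar> <= e) --> \<bar>(\<integral>x. g x * \<phi> x \<partial>M) - \<Lambda> \<phi>\<bar> <= e)" for n g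
 have int\<phi>: "integrable M (%x. g x * \<phi> x)" if [measurable]: "g \<in> borel_measurable M" and g: "integrable M (%x. \<bar>g x\<bar> powr q)" and \<phi>: "\<phi> \<in> \<Phi>" for g \<phi>
 proof -
  obtain A B where AB: "A \<in> sets M" "emeasure M A < \<infinity>" "0 <= B" "\<forall>x. \<bar>\<phi> x\<bar> <= B * indicator A x"
   using \<Phi>_bd [OF \<phi>] by blast
  have [measurable]: "\<phi> \<in> borel_measurable M" using \<phi> by (rule \<Phi>_meas)
  show ?thesis
  proof (rule Bochner_Integration.integrable_bound)
   show "integrable M (%x. B * (indicator A x + \<bar>g x\<bar> powr q))"
    using AB g by (intro integrable_mult_right Bochner_Integration.integrable_add) (auto simp: integrable_indicator_iff)
   show "AE x in M. norm (g x * \<phi> x) <= norm (B * (indicator A x + \<bar>g x\<bar> powr q))"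
   proof (rule AE_I2)
    fix x
    have "\<bar>g x\<bar> * \<bar>\<phi> x\<bar> <= \<bar>g x\<bar> * (B * indicator A x)"
     using AB(4) by (intro mult_left_mono) auto
    also have "... <= B * (indicator A x + \<bar>g x\<bar> powr q)"
     using abs_le_powr [of q 1 "g x"] q AB(3) by (auto simp: indicator_def mult.commute mult_left_mono)
    finally show "norm (g x * \<phi> x) <= norm (B * (indicator A x + \<bar>g x\<bar> powr q))"
     using AB(3) by (simp add: abs_mult)
   qed
  qed measurable
 qed
 have f_Cn: "Cn n (f n)" for n unfolding Cn_def using f_int by auto
 have Cn_mono: "Cn n g" if "Cn m g" "n <= m" for m n g
  using that unfolding Cn_def by (meson order_trans)
 have mid: "Cn n (%x. (g x + g' x) / 2)" if g: "Cn n g" and g': "Cn n g'" for n g g'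
  unfolding Cn_def
 proof (intro conjI ballI allI impI)
  have [measurable]: "g \<in> borel_measurable M" "g' \<in> borel_measurable M" using g g' by (auto simp: Cn_def)
  show "(%x. (g x + g' x) / 2) \<in> borel_measurable M" by measurable
  have "integrable M (%x. \<bar>g x + g' x\<bar> powr q / 2 powr q)"
   using integrable_powr_add [of g M g' q] g g' q by (simp add: Cn_def)
  thus "integrable M (%x. \<bar>(g x + g' x) / 2\<bar> powr q)" by (simp add: powr_divide)
  fix \<phi> e assume \<phi>: "\<phi> \<in> \<Phi>" and e: "\<forall>m\<ge>n. \<bar>(\<integral>x. f m x * \<phi> x \<partial>M) - \<Lambda> \<phi>\<bar> <= e"
  have ints: "integrable M (%x. g x * \<phi> x)" "integrable M (%x. g' x * \<phi> x)"
   using g g' \<phi> by (auto simp: Cn_def intro: int\<phi>)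
  have "(\<integral>x. (g x + g' x) / 2 * \<phi> x \<partial>M) = (\<integral>x. (g x * \<phi> x + g' x * \<phi> x) / 2 \<partial>M)"
   by (simp add: add_divide_distrib distrib_right)
  also have "... = ((\<integral>x. g x * \<phi> x \<partial>M) + (\<integral>x. g' x * \<phi> x \<partial>M)) / 2"
   using ints by simp
  finally have eq: "(\<integral>x. (g x + g' x) / 2 * \<phi> x \<partial>M) = ((\<integral>x. g x * \<phi> x \<partial>M) + (\<integral>x. g' x * \<phi> x \<partial>M)) / 2" .
  have avg: "\<bar>(s + t) / 2 - l\<bar> <= e" if "\<bar>s - l\<bar> <= e" "\<bar>t - l\<bar> <= e" for s t l :: real
   using that by (simp add: abs_le_iff field_simps)
  show "\<bar>(\<integral>x. (g x + g' x) / 2 * \<phi> x \<partial>M) - \<Lambda> \<phi>\<bar> <= e"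
   unfolding eq by (rule avg) (use g g' \<phi> e in \<open>auto simp: Cn_def\<close>)
 qed
 define d where "d n = Inf (I ` {g. Cn n g})" for n
 have I0: "0 <= I g" for g by (simp add: I_def)
 have bdd: "bdd_below (I ` {g. Cn n g})" for n
  by (rule bdd_belowI2 [of _ 0]) (rule I0)
 have d_le: "d n <= I g" if "Cn n g" for n g
  unfolding d_def using that bdd by (intro cInf_lower) auto
 have d_C: "d n <= C" for n
  using d_le [OF f_Cn] f_le by (simp add: I_def) (meson order_trans)
 have d_mono: "d n <= d m" if "n <= m" for n m
  unfolding d_def by (rule cInf_superset_mono) (use f_Cn Cn_mono [OF _ that] bdd in auto)
 have "\<exists>g. Cn n g & I g < d n + 1 / real (Suc n)" for n
 proof -
  have "Inf (I ` {g. Cn n g}) < d n + 1 / real (Suc n)" unfolding d_def by simp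
  thus ?thesis
   using f_Cn by (subst (asm) cInf_less_iff [OF _ bdd]) auto
 qed
 then obtain g where g: "!!n. Cn n (g n)" "!!n. I (g n) < d n + 1 / real (Suc n)" by metis
 have [measurable]: "g n \<in> borel_measurable M" and g_int: "integrable M (%x. \<bar>g n x\<bar> powr q)" for n
  using g(1) by (auto simp: Cn_def)
 have I_le: "I (g n) <= C + 1" for n
 proof -
  have "1 / real (Suc n) <= 1" by simp
  with g(2) [of n] d_C [of n] show ?thesis by linarith
 qed
 have "incseq d" using d_mono by (simp add: incseq_def)
 then obtain L where "d ----> L" using incseq_convergent [of d C] d_C by blast
 hence "convergent d" by (rule convergentI)
 hence dC: "Cauchy d" by (rule convergent_Cauchy)
 have Cauchy: "\<exists>N. \<forall>n\<ge>N. \<forall>m\<ge>n. (\<integral>x. \<bar>g m x - g n x\<bar> powr q \<partial>M) <= e" if "0 < e" for e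
 proof -
  have C0: "0 <= C" using order_trans [OF I0 [of "f 0"]] f_le [of 0] by (simp add: I_def)
  \<comment> \<open>\<open>\<delta>\<close> and, below, \<open>\<eta>\<close> each contribute at
    most \<open>e / 2\<close>: the norm powers add up to at most \<open>2 * (C + 1)\<close>, and the
    convexity gap is at most \<open>2 * \<eta>\<close>.\<close>
  define \<delta> where "\<delta> = e / (4 * (C + 1))"
  have "0 < \<delta>" using that C0 by (simp add: \<delta>_def)
  then obtain K where K: "0 <= K" "\<forall>a b::real. \<bar>a - b\<bar> powr q <= \<delta> * (\<bar>a\<bar> powr q + \<bar>b\<bar> powr q)
   + K * ((\<bar>a\<bar> powr q + \<bar>b\<bar> powr q) / 2 - \<bar>(a + b) / 2\<bar> powr q)"
   using powr_uniform_convexity [OF q] by blast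
  define \<eta> where "\<eta> = e / (4 * (K + 1))"
  have "0 < \<eta>" using that K by (simp add: \<eta>_def)
  obtain N1 where N1: "!!m n. N1 <= m ==> N1 <= n ==> \<bar>d m - d n\<bar> < \<eta>"
   using CauchyD [OF dC \<open>0 < \<eta>\<close>] by auto
  obtain N2 where N2: "inverse (real (Suc N2)) < \<eta>" using reals_Archimedean [OF \<open>0 < \<eta>\<close>] by blast
  have "(\<integral>x. \<bar>g m x - g n x\<bar> powr q \<partial>M) <= e" if "max N1 N2 <= n" "n <= m" for n m
  proof -
   have small: "1 / real (Suc k) < \<eta>" if "N2 <= k" for k
   proof -
    have "1 / real (Suc k) <= 1 / real (Suc N2)" using that by (intro divide_left_mono) auto
    thus ?thesis using N2 by (simp add: inverse_eq_divide)
   qed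
   have "Cn n (%x. (g m x + g n x) / 2)" using g(1) Cn_mono [OF g(1) \<open>n \<le> m\<close>] by (intro mid) auto
   hence "d n <= I (%x. (g m x + g n x) / 2)" by (rule d_le)
   moreover have "I (g m) < d n + 2 * \<eta>" "I (g n) < d n + \<eta>"
    using g(2) [of m] g(2) [of n] small [of m] small [of n] N1 [of m n] that by auto
   moreover note \<open>0 < \<eta>\<close>
   ultimately have gap: "(I (g m) + I (g n)) / 2 - I (%x. (g m x + g n x) / 2) <= 2 * \<eta>" by argo
   have "(\<integral>x. \<bar>g m x - g n x\<bar> powr q \<partial>M) <= \<delta> * (I (g m) + I (g n)) + K * ((I (g m) + I (g n)) / 2 - I (%x. (g m x + g n x) / 2))"
    unfolding I_def by (rule Lq_uniform_convexity) (use g_int K(2) q in auto)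
   also have "... <= \<delta> * (2 * (C + 1)) + K * (2 * \<eta>)"
    using I_le [of m] I_le [of n] gap K(1) \<open>0 < \<delta>\<close> by (intro add_mono mult_left_mono) auto
   also have "\<delta> * (2 * (C + 1)) = e / 2" using C0 by (simp add: \<delta>_def field_simps)
   also have "K * (2 * \<eta>) <= e / 2" using K(1) \<open>0 < e\<close> by (simp add: \<eta>_def field_simps)
   finally show ?thesis by simp
  qed
  thus ?thesis by blast
 qed
 have "\<forall>k::nat. \<exists>N. \<forall>n\<ge>N. \<forall>m\<ge>n. (\<integral>x. \<bar>g m x - g n x\<bar> powr q \<partial>M) <= (1 / 4 ^ k) powr q"
  using Cauchy by simp
 then obtain N where N: "!!k n m. N k <= n ==> n <= m ==> (\<integral>x. \<bar>g m x - g n x\<bar> powr q \<partial>M) <= (1 / 4 ^ k) powr q"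
  by metis
 \<comment> \<open>Monotone, at least \<open>N k\<close> for the rate, and at least \<open>k\<close>
   so that the pairings converge along it.\<close>
 define s where "s k = k + (\<Sum>j\<le>k. N j)" for k
 have s: "N k <= s k" "k <= s k" for k
  using member_le_sum [of k "{..k}" N] by (auto simp: s_def)
 have s_mono: "s k <= s j" if "k <= j" for k j
  unfolding s_def using that by (intro add_mono sum_mono2) auto
 obtain G where [measurable]: "G \<in> borel_measurable M"
  and G: "!!k. (\<integral>\<^sup>+x. apow q (G x - g (s k) x) \<partial>M) <= ennreal ((1 / 4 ^ k) powr q)"
 proof (rule Lq_fast_Cauchy_limit [of "%k. g (s k)" M q])
  fix k j :: nat assume "k <= j"
  have "integrable M (%x. \<bar>g (s j) x - g (s k) x\<bar> powr q)"
   using integrable_powr_add [of "g (s j)" M "%x. - g (s k) x" q] g_int q by simp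
  hence "(\<integral>\<^sup>+x. apow q (g (s j) x - g (s k) x) \<partial>M) = ennreal (\<integral>x. \<bar>g (s j) x - g (s k) x\<bar> powr q \<partial>M)"
   by (intro nn_integral_eq_integral) auto
  also have "... <= ennreal ((1 / 4 ^ k) powr q)"
   by (intro ennreal_leI N s s_mono \<open>k \<le> j\<close>)
  finally show "(\<integral>\<^sup>+x. apow q (g (s j) x - g (s k) x) \<partial>M) <= ennreal ((1 / 4 ^ k) powr q)" .
 qed (use q that in auto)
 have diff_int: "integrable M (%x. \<bar>G x - g (s k) x\<bar> powr q)" for k
  using le_less_trans [OF G [of k]] by (intro integrableI_bounded) auto
 have G_int: "integrable M (%x. \<bar>G x\<bar> powr q)"
  using integrable_powr_add [of "%x. G x - g (s 0) x" M "g (s 0)" q] diff_int [of 0] g_int q by simp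
 have "(\<integral>x. G x * \<phi> x \<partial>M) = \<Lambda> \<phi>" if \<phi>: "\<phi> \<in> \<Phi>" for \<phi>
 proof -
  obtain A B where AB: "A \<in> sets M" "emeasure M A < \<infinity>" "0 <= B" "\<forall>x. \<bar>\<phi> x\<bar> <= B * indicator A x"
   using \<Phi>_bd [OF \<phi>] by blast
  have [measurable]: "\<phi> \<in> borel_measurable M" "A \<in> sets M" using \<phi> AB by auto
  have Aint: "integrable M (indicator A :: 'b => real)" using AB by (simp add: integrable_indicator_iff)
  have "(%k. \<integral>x. g (s k) x * \<phi> x \<partial>M) ----> \<Lambda> \<phi>"
  proof (rule LIMSEQ_I)
   fix e :: real assume "0 < e"
   then obtain n0 where n0: "!!m. n0 <= m ==> \<bar>(\<integral>x. f m x * \<phi> x \<partial>M) - \<Lambda> \<phi>\<bar> < e / 2"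
    using LIMSEQ_D [OF lim [OF \<phi>], of "e / 2"] by auto
   have "\<bar>(\<integral>x. g (s k) x * \<phi> x \<partial>M) - \<Lambda> \<phi>\<bar> <= e / 2" if "n0 <= k" for k
   proof -
    have "Cn n0 (g (s k))" using g(1) s(2) that by (meson Cn_mono order_trans)
    thus ?thesis unfolding Cn_def using \<phi> n0 by (meson less_imp_le)
   qed
   thus "\<exists>n0. \<forall>k\<ge>n0. norm ((\<integral>x. g (s k) x * \<phi> x \<partial>M) - \<Lambda> \<phi>) < e"
    using \<open>0 < e\<close> by (intro exI [of _ n0]) fastforce
  qed
  moreover have "(%k. \<integral>x. g (s k) x * \<phi> x \<partial>M) ----> (\<integral>x. G x * \<phi> x \<partial>M)"
  proof (rule Lim_transform [OF tendsto_const])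
   have bound: "norm ((\<integral>x. g (s k) x * \<phi> x \<partial>M) - (\<integral>x. G x * \<phi> x \<partial>M)) <= B * (measure M A + 1) * (1 / 2) ^ k" for k
   proof -
    have i1: "integrable M (%x. g (s k) x * \<phi> x)" "integrable M (%x. G x * \<phi> x)"
     using g_int G_int \<phi> by (auto intro: int\<phi>)
    have "norm ((\<integral>x. g (s k) x * \<phi> x \<partial>M) - (\<integral>x. G x * \<phi> x \<partial>M)) = norm (\<integral>x. g (s k) x * \<phi> x - G x * \<phi> x \<partial>M)"
     using i1 by simp
    also have "... <= (\<integral>x. norm (g (s k) x * \<phi> x - G x * \<phi> x) \<partial>M)"
     by (rule integral_norm_bound)
    \<comment> \<open>\<open>abs_le_powr\<close> at the level \<open>2^(-k)\<close>: the rate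
      \<open>(4^(-k))^q\<close> compensates \<open>(2^(-k))^(1-q)\<close> and leaves at most
      \<open>2^(-k)\<close>.\<close>
    also have "... <= (\<integral>x. B * ((1 / 2) ^ k * indicator A x + ((1 / 2) ^ k) powr (1 - q) * \<bar>G x - g (s k) x\<bar> powr q) \<partial>M)"
    proof (rule integral_mono)
     show "integrable M (%x. norm (g (s k) x * \<phi> x - G x * \<phi> x))" using i1 by simp
     show "integrable M (%x. B * ((1 / 2) ^ k * indicator A x + ((1 / 2) ^ k) powr (1 - q) * \<bar>G x - g (s k) x\<bar> powr q))"
      using Aint diff_int by simp
     fix x
     have "norm (g (s k) x * \<phi> x - G x * \<phi> x) = \<bar>G x - g (s k) x\<bar> * \<bar>\<phi> x\<bar>"
      by (simp add: left_diff_distrib [symmetric] abs_mult abs_minus_commute)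
     also have "... <= \<bar>G x - g (s k) x\<bar> * (B * indicator A x)"
      using AB(4) by (intro mult_left_mono) auto
     also have "... <= B * ((1 / 2) ^ k * indicator A x + ((1 / 2) ^ k) powr (1 - q) * \<bar>G x - g (s k) x\<bar> powr q)"
      using abs_le_powr [of q "(1 / 2) ^ k" "G x - g (s k) x"] q AB(3)
      by (auto simp: indicator_def mult.commute [of _ B] intro!: mult_left_mono)
     finally show "norm (g (s k) x * \<phi> x - G x * \<phi> x) <= ..." .
    qed
    also have "... = B * ((1 / 2) ^ k * measure M A + ((1 / 2) ^ k) powr (1 - q) * (\<integral>x. \<bar>G x - g (s k) x\<bar> powr q \<partial>M))"
     using Aint diff_int by simp
    also have "... <= B * ((1 / 2) ^ k * measure M A + (1 / 2) ^ k)"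
    proof -
     have "ennreal (\<integral>x. \<bar>G x - g (s k) x\<bar> powr q \<partial>M) <= ennreal ((1 / 4 ^ k) powr q)"
      using G [of k] diff_int [of k] by (simp add: nn_integral_eq_integral)
     hence "(\<integral>x. \<bar>G x - g (s k) x\<bar> powr q \<partial>M) <= (1 / 4 ^ k) powr q"
      by (subst (asm) ennreal_le_iff) auto
     hence "((1 / 2) ^ k) powr (1 - q) * (\<integral>x. \<bar>G x - g (s k) x\<bar> powr q \<partial>M) <= ((1 / 2) ^ k) powr (1 - q) * (1 / 4 ^ k) powr q"
      by (rule mult_left_mono) simp
     also have "... = (1 / 2) ^ k * ((1 / 2) ^ k) powr q"
     proof -
      have "(1 / 4 ^ k :: real) = (1 / 2) ^ k * (1 / 2) ^ k"
       by (simp add: power_divide power_mult_distrib [symmetric])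
      thus ?thesis by (simp only: powr_mult) (simp add: powr_diff)
     qed
     also have "... <= (1 / 2) ^ k * 1"
      using q powr_mono' [of 0 q "(1 / 2) ^ k :: real"] by (intro mult_left_mono) (auto simp: power_le_one)
     finally show ?thesis using AB(3) by (intro mult_left_mono add_left_mono) auto
    qed
    finally show ?thesis by (simp add: algebra_simps)
   qed
   have "(%k. B * (measure M A + 1) * (1 / 2) ^ k) ----> B * (measure M A + 1) * 0"
    by (intro tendsto_mult tendsto_const LIMSEQ_realpow_zero) auto
   hence "(%k. B * (measure M A + 1) * (1 / 2) ^ k) ----> 0" by simp
   thus "(%k. (\<integral>x. g (s k) x * \<phi> x \<partial>M) - (\<integral>x. G x * \<phi> x \<partial>M)) ----> 0"
    by (rule Lim_null_comparison [OF always_eventually, rotated]) (rule allI, rule bound)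
  qed
  ultimately show ?thesis by (rule LIMSEQ_unique [rotated])
 qed
 with G_int that [of G] show ?thesis by auto
qed


section \<open>Existence of weak derivatives\<close>

lemma Lq_loc_int:
 fixes v :: "'a::euclidean_space => real"
 assumes [measurable]: "v \<in> Borel" and q: "1 <= q"
  and fin: "(NN x. apow q (v x)) < \<infinity>"
 shows "loc_int v"
proof -
 have int: "integrable lborel (%x. \<bar>v x\<bar> powr q)"
  using fin by (intro integrableI_bounded) auto
 have "integrable lborel (%x. indicator (cball 0 R) x *\<^sub>R v x)" for R
 proof (rule Bochner_Integration.integrable_bound)
  show "integrable lborel (%x. indicator (cball (0::'a) R) x + \<bar>v x\<bar> powr q)"
   using emeasure_lborel_cball_finite [of "0::'a" R] int
   by (intro Bochner_Integration.integrable_add) (auto simp: integrable_indicator_iff)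
  show "AE x in lborel. norm (indicator (cball 0 R) x *\<^sub>R v x) <= norm (indicator (cball 0 R) x + \<bar>v x\<bar> powr q)"
   using abs_le_powr [of q 1] q by (auto simp: indicator_def)
 qed measurable
 thus ?thesis by (simp add: loc_int_def)
qed

text \<open>A discrete integration by parts moves the difference quotient to \<open>\<phi>\<close>,
  with the opposite direction. The quotients of \<open>\<phi>\<close> are bounded by the maximum of
  its derivative, by the mean value theorem, and supported in a fixed ball.\<close>

lemma diff_quot_tendsto:
 fixes u :: "'a::euclidean_space => real"
 assumes u: "loc_int u" and \<phi>: "test_function \<phi>"
 shows "(%n. LL x. 2 ^ n * (u (x + (1 / 2 ^ n) *\<^sub>R h) - u x) * \<phi> x) ----> - (LL x. u x * dir_deriv h \<phi> x)"
proof -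
 have [measurable]: "u \<in> Borel" using u by (rule loc_int_measurable)
 note [measurable] = test_function_measurable [OF \<phi>]
 obtain R B where RB: "0 < R" "0 < B" "!!x. R <= norm x ==> \<phi> x = 0" "!!x. \<bar>dir_deriv h \<phi> x\<bar> <= B"
  using test_function_bounds [OF \<phi>, of h] by metis
 define c :: "nat => real" where "c n = 1 / 2 ^ n" for n
 have c: "0 < c n" "c n <= 1" for n by (simp_all add: c_def)
 have deriv: "((%t. \<phi> (x + t *\<^sub>R (- h))) has_real_derivative - dir_deriv h \<phi> (x + t *\<^sub>R (- h))) (at t)" for x t
  using test_function_line_deriv [OF \<phi>, of x "- h" t] dir_deriv_scale [OF \<phi>, of "-1" h] by simp
 define \<psi> where "\<psi> n x = 2 ^ n * (\<phi> (x - c n *\<^sub>R h) - \<phi> x)" for n x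
 have [measurable]: "\<psi> n \<in> Borel" for n unfolding \<psi>_def by measurable
 have \<psi>_le: "\<bar>\<psi> n x\<bar> <= B" for n x
 proof -
  obtain z where "0 < z" "z < c n" "\<phi> (x + c n *\<^sub>R (- h)) - \<phi> (x + 0 *\<^sub>R (- h)) = (c n - 0) * (- dir_deriv h \<phi> (x + z *\<^sub>R (- h)))"
   using MVT2 [OF c(1) [of n], of "%t. \<phi> (x + t *\<^sub>R (- h))" "%t. - dir_deriv h \<phi> (x + t *\<^sub>R (- h))"] deriv by blast
  hence "\<psi> n x = - dir_deriv h \<phi> (x + z *\<^sub>R (- h))" by (simp add: \<psi>_def c_def)
  thus ?thesis using RB(4) by simp
 qed
 have \<psi>_0: "\<psi> n x = 0" if "R + norm h <= norm x" for n x
 proof -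
  have "norm (c n *\<^sub>R h) <= norm h" using c [of n] by (simp add: mult_left_le_one_le)
  hence "R <= norm (x - c n *\<^sub>R h)" using that norm_triangle_ineq2 [of x "c n *\<^sub>R h"] by simp
  moreover have "R <= norm x" using that norm_ge_zero [of h] by linarith
  ultimately show ?thesis by (simp add: \<psi>_def RB(3))
 qed
 have "(%n. LL x. u x * \<psi> n x) ----> (LL x. u x * - dir_deriv h \<phi> x)"
 proof (rule integral_dominated_convergence [where w = "%x. norm (B * (indicator (cball 0 (R + norm h)) x *\<^sub>R u x))"])
  show "integrable lborel (%x. norm (B * (indicator (cball 0 (R + norm h)) x *\<^sub>R u x)))"
   using u by (intro integrable_norm integrable_mult_right) (simp add: loc_int_def)
  show "AE x in lborel. norm (u x * \<psi> n x) <= norm (B * (indicator (cball 0 (R + norm h)) x *\<^sub>R u x))" for n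
  proof (rule AE_I2)
   fix x
   show "norm (u x * \<psi> n x) <= norm (B * (indicator (cball 0 (R + norm h)) x *\<^sub>R u x))"
    using \<psi>_le [of n x] \<psi>_0 [of x n] RB(2)
    by (cases "norm x <= R + norm h") (auto simp: abs_mult mult.commute [of B] intro!: mult_left_mono)
  qed
  show "AE x in lborel. (%n. u x * \<psi> n x) ----> u x * - dir_deriv h \<phi> x"
  proof (rule AE_I2)
   fix x
   have "((%t. (\<phi> (x + (0 + t) *\<^sub>R (- h)) - \<phi> (x + 0 *\<^sub>R (- h))) / t) ---> - dir_deriv h \<phi> (x + 0 *\<^sub>R (- h))) (at 0)"
    using deriv [of x 0] unfolding DERIV_def .
   moreover have "filterlim c (at 0) sequentially"
    unfolding filterlim_at using c(1) by (auto simp: c_def [abs_def] less_imp_neq [THEN not_sym] intro!: LIMSEQ_divide_realpow_zero)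
   ultimately have "(%n. (\<phi> (x + (0 + c n) *\<^sub>R (- h)) - \<phi> (x + 0 *\<^sub>R (- h))) / c n) ----> - dir_deriv h \<phi> (x + 0 *\<^sub>R (- h))"
    by (rule filterlim_compose)
   hence "(%n. \<psi> n x) ----> - dir_deriv h \<phi> x"
    by (simp add: \<psi>_def c_def mult.commute)
   thus "(%n. u x * \<psi> n x) ----> u x * - dir_deriv h \<phi> x" by (intro tendsto_intros)
  qed
 qed measurable
 moreover have "(LL x. 2 ^ n * (u (x + (1 / 2 ^ n) *\<^sub>R h) - u x) * \<phi> x) = (LL x. u x * \<psi> n x)" for n
 proof -
  have i: "integrable lborel (%x. u (x + c n *\<^sub>R h) * \<phi> x)" "integrable lborel (%x. u x * \<phi> x)" "integrable lborel (%x. u x * \<phi> (x - c n *\<^sub>R h))"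
   using loc_int_test(1) [OF loc_int_shift [OF u] \<phi>, of "c n *\<^sub>R h"] loc_int_test(1) [OF u \<phi>]
    loc_int_test(1) [OF u test_function_translate [OF \<phi>, of "- (c n *\<^sub>R h)"]] by simp_all
  have "(LL x. 2 ^ n * (u (x + c n *\<^sub>R h) - u x) * \<phi> x) = (LL x. 2 ^ n * (u (x + c n *\<^sub>R h) * \<phi> x - u x * \<phi> x))"
   by (simp add: left_diff_distrib mult.assoc)
  also have "... = 2 ^ n * ((LL x. u (x + c n *\<^sub>R h) * \<phi> x) - (LL x. u x * \<phi> x))"
   using i by simp
  also have "(LL x. u (x + c n *\<^sub>R h) * \<phi> x) = (LL x. u x * \<phi> (x - c n *\<^sub>R h))"
   using integral_lborel_shift [of "%x. u x * \<phi> (x - c n *\<^sub>R h)" "c n *\<^sub>R h"] by simp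
  also have "2 ^ n * (... - (LL x. u x * \<phi> x)) = (LL x. 2 ^ n * (u x * \<phi> (x - c n *\<^sub>R h) - u x * \<phi> x))"
   using i by simp
  also have "... = (LL x. u x * \<psi> n x)"
   by (simp add: \<psi>_def right_diff_distrib mult.left_commute)
  finally show ?thesis by (simp add: c_def)
 qed
 ultimately show ?thesis by simp
qed

text \<open>The difference quotients are bounded in \<open>L^q\<close> by \<open>dyadic_sup\<close>,
  and their pairings with each test function converge along the whole sequence, so
  \<open>weak_limit_exists\<close> produces the weak derivative.\<close>

lemma weak_dir_exists:
 fixes u :: "'a::euclidean_space => real"
 assumes u: "loc_int u" and q: "1 < q" and fin: "dyadic_sup q u h < \<infinity>"
 shows "\<exists>v. weak_dir u h v"
proof -
 have [measurable]: "u \<in> Borel" using u by (rule loc_int_measurable)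
 define f where "f n x = 2 ^ n * (u (x + (1 / 2 ^ n) *\<^sub>R h) - u x)" for n x
 have [measurable]: "f n \<in> Borel" for n unfolding f_def by measurable
 have le: "(NN x. apow q (f n x)) <= dyadic_sup q u h" for n
 proof -
  have "\<bar>2 ^ n * y\<bar> powr q = 2 powr (real n * q) * \<bar>y\<bar> powr q" for y :: real
   by (simp add: abs_mult powr_mult powr_realpow [symmetric] powr_powr)
  hence "(NN x. apow q (f n x)) = ennreal (2 powr (real n * q)) * shift_diff q u ((1 / 2 ^ n) *\<^sub>R h)"
   unfolding shift_diff_def f_def by (subst nn_integral_cmult [symmetric]) (simp_all add: ennreal_mult')
  also have "... <= dyadic_sup q u h" unfolding dyadic_sup_def by (rule SUP_upper) simp
  finally show ?thesis .
 qed
 have int: "integrable lborel (%x. \<bar>f n x\<bar> powr q)" for n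
  using le_less_trans [OF le [of n] fin] by (intro integrableI_bounded) auto
 obtain g where [measurable]: "g \<in> borel_measurable lborel" and g: "integrable lborel (%x. \<bar>g x\<bar> powr q)"
  "!!\<phi>. \<phi> \<in> Collect test_function ==> (LL x. g x * \<phi> x) = - (LL x. u x * dir_deriv h \<phi> x)"
 proof (rule weak_limit_exists [of q f lborel "enn2real (dyadic_sup q u h)" "Collect test_function" "%\<phi>. - (LL x. u x * dir_deriv h \<phi> x)"])
  show "(LL x. \<bar>f n x\<bar> powr q) <= enn2real (dyadic_sup q u h)" for n
   using le [of n] fin int [of n] by (subst integral_eq_nn_integral) (auto intro!: enn2real_mono)
  fix \<phi> :: "'a => real" assume \<phi>: "\<phi> \<in> Collect test_function"
  thus "\<phi> \<in> borel_measurable lborel" using test_function_measurable(1) by simp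
  obtain R B where RB: "0 < B" "!!x. R <= norm x ==> \<phi> x = 0" "!!x. \<bar>\<phi> x\<bar> <= B"
   using test_function_bounds \<phi> by (metis mem_Collect_eq)
  have "\<bar>\<phi> x\<bar> <= B * indicator (cball 0 R) x" for x
   using RB(1) RB(2) [of x] RB(3) [of x] by (cases "norm x <= R") auto
  thus "\<exists>A B. A \<in> sets lborel & emeasure lborel A < \<infinity> & 0 <= B & (\<forall>x. \<bar>\<phi> x\<bar> <= B * indicator A x)"
   using RB(1) emeasure_lborel_cball_finite [of "0::'a" R] by (intro exI [of _ "cball 0 R"] exI [of _ B]) auto
  show "(%n. LL x. f n x * \<phi> x) ----> - (LL x. u x * dir_deriv h \<phi> x)"
   unfolding f_def using \<phi> by (intro diff_quot_tendsto u) simp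
 qed (use q int in auto)
 have "(NN x. apow q (g x)) < \<infinity>"
  using g(1) by (simp add: integrable_iff_bounded)
 hence "loc_int g" using q by (intro Lq_loc_int [of g q]) auto
 thus ?thesis using u g(2) by (intro exI [of _ g]) (auto simp: weak_dir_def)
qed

lemma nn_integral_gaussian: "(\<integral>\<^sup>+x. ennreal (exp (- (norm x)\<^sup>2)) \<partial>(lborel :: 'a::euclidean_space measure)) < \<infinity>"
proof -
 have "(NN s. ennreal (exp (- s\<^sup>2))) = (NN s. ennreal (\<bar>s\<bar> powr 0 * exp (- s\<^sup>2)))"
  by (rule nn_integral_cong_AE, rule eventually_mono [OF AE_lborel_singleton [of 0]]) auto
 hence g0: "(NN s. ennreal (exp (- s\<^sup>2))) = ennreal (Gamma (1/2))"
  using nn_integral_gaussian_moment [of 0] by simp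
 have "(\<integral>\<^sup>+x. ennreal (exp (- (norm x)\<^sup>2)) \<partial>(lborel :: 'a measure)) = (NN x. (\<Prod>b\<in>(Basis::'a set). ennreal (exp (- (x \<bullet> b)\<^sup>2))))"
 proof (rule nn_integral_cong)
  fix x :: 'a
  have "(\<Prod>b\<in>Basis. exp (- (x \<bullet> b)\<^sup>2)) = exp (- (norm x)\<^sup>2)"
   by (subst euclidean_inner [of x x, folded power2_norm_eq_inner]) (simp add: exp_sum [symmetric] sum_negf power2_eq_square)
  thus "ennreal (exp (- (norm x)\<^sup>2)) = (\<Prod>b\<in>Basis. ennreal (exp (- (x \<bullet> b)\<^sup>2)))"
   by (simp add: prod_ennreal)
 qed
 also have "... = (\<Prod>b\<in>(Basis::'a set). (NN s. ennreal (exp (- s\<^sup>2))))"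
  by (rule nn_integral_lborel_prod) auto
 also have "... < \<infinity>" by (simp add: g0 power_less_top_ennreal)
 finally show ?thesis .
qed

text \<open>A Gaussian weight makes a bounded sequence bounded in a weighted \<open>L\<^sup>2\<close> space.\<close>

lemma weak_dir_exists_bounded:
 fixes u :: "'a::euclidean_space => real"
 assumes u: "loc_int u" and bd: "!!n::nat. AE x in lborel. \<bar>2 ^ n * (u (x + (1 / 2 ^ n) *\<^sub>R h) - u x)\<bar> <= C"
 shows "\<exists>v. weak_dir u h v"
proof -
 have [measurable]: "u \<in> Borel" using u by (rule loc_int_measurable)
 define f where "f n x = 2 ^ n * (u (x + (1 / 2 ^ n) *\<^sub>R h) - u x)" for n x
 have [measurable]: "f n \<in> Borel" for n unfolding f_def by measurable
 define w :: "'a => real" where "w x = exp (- (norm x)\<^sup>2)" for x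
 have [measurable]: "w \<in> Borel" unfolding w_def by measurable
 have w: "0 < w x" for x by (simp add: w_def)
 define M where "M = density lborel (%x. ennreal (w x))"
 have sets_M [measurable_cong]: "sets M = sets borel" by (simp add: M_def)
 have M_fin: "emeasure M A < \<infinity>" for A
 proof -
  have "emeasure M A <= emeasure M (space M)" by (rule emeasure_space)
  also have "... = (NN x. ennreal (w x))" by (simp add: M_def emeasure_density)
  also have "... < \<infinity>" unfolding w_def by (rule nn_integral_gaussian)
  finally show ?thesis .
 qed
 have int_M: "(\<integral>x. g x * (\<phi> x / w x) \<partial>M) = (LL x. g x * \<phi> x)"
  if [measurable]: "g \<in> Borel" "\<phi> \<in> Borel" for g \<phi>
 proof -
  have "(\<integral>x. g x * (\<phi> x / w x) \<partial>M) = (LL x. w x *\<^sub>R (g x * (\<phi> x / w x)))"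
   unfolding M_def using w by (intro integral_density) (auto simp: less_imp_le)
  also have "... = (LL x. g x * \<phi> x)"
   using w by (intro Bochner_Integration.integral_cong) (auto simp: less_imp_neq [THEN not_sym])
  finally show ?thesis .
 qed
 have bdM: "AE x in M. \<bar>f n x\<bar> powr 2 <= C\<^sup>2" for n
 proof -
  have "AE x in lborel. \<bar>f n x\<bar> powr 2 <= C\<^sup>2"
   using bd [of n]
  proof eventually_elim
   case (elim x)
   hence "\<bar>f n x\<bar> <= C" by (simp add: f_def)
   hence "\<bar>f n x\<bar>\<^sup>2 <= C\<^sup>2" by (rule power_mono) simp
   thus ?case by (cases "f n x = 0") auto
  qed
  thus ?thesis unfolding M_def by (subst AE_density) (auto elim: eventually_mono)
 qed
 have M_const: "integrable M (%x. C\<^sup>2)"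
 proof -
  have "finite_measure M" by (rule finite_measureI) (use M_fin [of "space M"] in auto)
  thus ?thesis by (rule finite_measure.integrable_const)
 qed
 have int: "integrable M (%x. \<bar>f n x\<bar> powr 2)" for n
  by (rule Bochner_Integration.integrable_bound [OF M_const]) (use bdM in auto)
 \<comment> \<open>The admissible functions are test functions divided by the weight, so that
   pairings in the weighted space are the unweighted pairings with test functions.\<close>
 obtain g where [measurable]: "g \<in> borel_measurable M" and g: "integrable M (%x. \<bar>g x\<bar> powr 2)"
  "!!\<psi>. \<psi> \<in> (%\<phi> x. \<phi> x / w x) ` Collect test_function ==>
   (\<integral>x. g x * \<psi> x \<partial>M) = - (LL x. u x * dir_deriv h (%x. \<psi> x * w x) x)"
 proof (rule weak_limit_exists [of 2 f M "\<integral>x. C\<^sup>2 \<partial>M" "(%\<phi> x. \<phi> x / w x) ` Collect test_function"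
    "%\<psi>. - (LL x. u x * dir_deriv h (%x. \<psi> x * w x) x)"])
  show "(\<integral>x. \<bar>f n x\<bar> powr 2 \<partial>M) <= (\<integral>x. C\<^sup>2 \<partial>M)" for n
   by (rule integral_mono_AE [OF int M_const bdM])
  fix \<psi> assume "\<psi> \<in> (%\<phi> x. \<phi> x / w x) ` Collect test_function"
  then obtain \<phi> where \<phi>: "test_function \<phi>" and \<psi>: "\<psi> = (%x. \<phi> x / w x)" by auto
  note [measurable] = test_function_measurable [OF \<phi>]
  show "\<psi> \<in> borel_measurable M" unfolding \<psi> by measurable
  obtain R B where RB: "0 < R" "0 < B" "!!x. R <= norm x ==> \<phi> x = 0" "!!x. \<bar>\<phi> x\<bar> <= B"
   using test_function_bounds [OF \<phi>] by metis
  have "\<bar>\<psi> x\<bar> <= B * exp (R\<^sup>2) * indicator (cball 0 R) x" for x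
  proof (cases "norm x <= R")
   case True
   have "\<bar>\<psi> x\<bar> = \<bar>\<phi> x\<bar> * exp ((norm x)\<^sup>2)" by (simp add: \<psi> w_def exp_minus abs_mult divide_inverse)
   also have "... <= B * exp (R\<^sup>2)" using RB True by (intro mult_mono) (auto intro: power_mono)
   finally show ?thesis using True by simp
  qed (simp add: \<psi> RB(3))
  thus "\<exists>A B. A \<in> sets M & emeasure M A < \<infinity> & 0 <= B & (\<forall>x. \<bar>\<psi> x\<bar> <= B * indicator A x)"
   using RB(2) M_fin by (intro exI [of _ "cball 0 R"] exI [of _ "B * exp (R\<^sup>2)"]) (auto simp: sets_M)
  have "(%x. \<psi> x * w x) = \<phi>" using w by (auto simp: \<psi> less_imp_neq [THEN not_sym])
  moreover have "(\<integral>x. f n x * \<psi> x \<partial>M) = (LL x. f n x * \<phi> x)" for n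
   unfolding \<psi> by (rule int_M) measurable
  ultimately show "(%n. \<integral>x. f n x * \<psi> x \<partial>M) ----> - (LL x. u x * dir_deriv h (%x. \<psi> x * w x) x)"
   using diff_quot_tendsto [OF u \<phi>, of h] by (simp add: f_def)
 qed (use int in auto)
 have [measurable]: "g \<in> Borel"
  using \<open>g \<in> borel_measurable M\<close> by (simp add: measurable_cong_sets [OF sets_M refl])
 have "integrable lborel (%x. indicator (cball 0 R) x *\<^sub>R g x)" for R
 proof (rule Bochner_Integration.integrable_bound)
  have "integrable M (%x. 1 + \<bar>g x\<bar> powr 2)"
   using g(1) M_fin [of "space M"] by (intro Bochner_Integration.integrable_add) (simp_all add: integrable_iff_bounded)
  hence "integrable lborel (%x. w x *\<^sub>R (1 + \<bar>g x\<bar> powr 2))"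
   unfolding M_def using w by (subst (asm) integrable_density) (auto simp: less_imp_le)
  thus "integrable lborel (%x. exp (R\<^sup>2) * (w x * (1 + \<bar>g x\<bar> powr 2)))" by simp
  show "AE x in lborel. norm (indicator (cball 0 R) x *\<^sub>R g x) <= norm (exp (R\<^sup>2) * (w x * (1 + \<bar>g x\<bar> powr 2)))"
  proof (rule AE_I2)
   fix x
   show "norm (indicator (cball 0 R) x *\<^sub>R g x) <= norm (exp (R\<^sup>2) * (w x * (1 + \<bar>g x\<bar> powr 2)))"
   proof (cases "norm x <= R")
    case True
    have "1 <= exp (R\<^sup>2) * w x"
     using True by (simp add: w_def mult_exp_exp power_mono)
    hence "1 * (1 + \<bar>g x\<bar> powr 2) <= exp (R\<^sup>2) * w x * (1 + \<bar>g x\<bar> powr 2)"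
     by (rule mult_right_mono) (simp add: add_nonneg_nonneg)
    moreover have "\<bar>g x\<bar> <= 1 + \<bar>g x\<bar> powr 2" using abs_le_powr [of 2 1 "g x"] by simp
    ultimately show ?thesis using True w [of x] by (simp add: abs_mult mult.assoc)
   qed simp
  qed
 qed measurable
 hence "loc_int g" by (simp add: loc_int_def)
 moreover have "(LL x. g x * \<phi> x) = - (LL x. u x * dir_deriv h \<phi> x)" if \<phi>: "test_function \<phi>" for \<phi>
 proof -
  note [measurable] = test_function_measurable [OF \<phi>]
  have "(%x. \<phi> x / w x * w x) = \<phi>" using w by (auto simp: less_imp_neq [THEN not_sym])
  moreover have "(\<integral>x. g x * (\<phi> x / w x) \<partial>M) = - (LL x. u x * dir_deriv h (%x. \<phi> x / w x * w x) x)"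
   by (rule g(2)) (use \<phi> in auto)
  moreover have "(\<integral>x. g x * (\<phi> x / w x) \<partial>M) = (LL x. g x * \<phi> x)"
   by (rule int_M) measurable
  ultimately show ?thesis by (simp only:)
 qed
 ultimately show ?thesis using u by (intro exI [of _ g]) (auto simp: weak_dir_def)
qed

section \<open>Dilations and translations of null sets; from almost all to all directions\<close>

lemma AE_lborel_scale:
 fixes P :: "'a::euclidean_space => bool"
 assumes "AE h in lborel. P h" "c ~= 0"
 shows "AE h in lborel. P (c *\<^sub>R h)"
proof -
 obtain N where N: "N \<in> null_sets lborel" "{h. \<not> P h} \<subseteq> N"
  using assms(1) by (auto simp: eventually_ae_filter)
 hence [measurable]: "N \<in> sets borel" by auto
 have "(NN h. indicator N h) = ennreal (\<bar>c\<bar> ^ DIM('a)) * (NN h. indicator N (c *\<^sub>R h))"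
  by (rule nn_integral_lborel_scale) (use assms in auto)
 hence "ennreal (\<bar>c\<bar> ^ DIM('a)) * (NN h. indicator N (c *\<^sub>R h)) = 0"
  using N(1) by (simp add: null_setsD1)
 hence "(NN h. indicator N (c *\<^sub>R h)) = 0" using assms(2) by (simp add: ennreal_eq_0_iff power_le_zero_eq)
 hence "AE h in lborel. indicator N (c *\<^sub>R h) = (0::ennreal)" by (subst (asm) nn_integral_0_iff_AE) auto
 thus ?thesis by eventually_elim (use N(2) in \<open>auto simp: indicator_def split: if_splits\<close>)
qed

lemma AE_lborel_shift:
 fixes P :: "'a::euclidean_space => bool"
 assumes "AE h in lborel. P h"
 shows "AE h in lborel. P (h + c)"
proof -
 obtain N where N: "N \<in> null_sets lborel" "{h. \<not> P h} \<subseteq> N"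
  using assms(1) by (auto simp: eventually_ae_filter)
 hence [measurable]: "N \<in> sets borel" by auto
 have "(NN h. indicator N (h + c)) = (NN h. indicator N h)"
  by (rule nn_integral_lborel_shift) simp
 hence "(NN h. indicator N (h + c)) = 0" using N(1) by (simp add: null_setsD1)
 hence "AE h in lborel. indicator N (h + c) = (0::ennreal)" by (subst (asm) nn_integral_0_iff_AE) auto
 thus ?thesis by eventually_elim (use N(2) in \<open>auto simp: indicator_def split: if_splits\<close>)
qed

text \<open>An argument of Steinhaus type: a short vector \<open>x\<close> is the difference of
  \<open>h + x\<close> and \<open>h\<close> for some \<open>h\<close> such that both avoid the
  exceptional null set and lie in the annulus. Doubling then reaches vectors of any length.\<close>

lemma annulus_group:
 fixes V :: "'a::euclidean_space => bool"
 assumes diff: "!!h k. V h ==> V k ==> V (h - k)" and double: "!!h. V h ==> V (2 *\<^sub>R h)"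
  and ae: "AE h in lborel. r / 2 < norm h & norm h < r --> V h" and r: "0 < r"
 shows "V x"
proof -
 have small: "V x" if "norm x < r / 8" for x
 proof -
  obtain N where N: "N \<in> null_sets lborel" "{h. \<not> (r / 2 < norm h & norm h < r --> V h)} \<subseteq> N"
   using ae by (auto simp: eventually_ae_filter)
  have N_ae: "AE h in lborel. h \<notin> N" using N(1) by (rule AE_not_in)
  have ae2: "AE h in lborel. h \<notin> N & h + x \<notin> N"
   using N_ae AE_lborel_shift [OF N_ae, of x] by simp
  obtain b :: 'a where b: "b \<in> Basis" using nonempty_Basis by blast
  \<comment> \<open>For \<open>h\<close> in this ball the norm lies between \<open>5 * r / 8\<close>
    and \<open>7 * r / 8\<close>, so adding a vector shorter than \<open>r / 8\<close> does not
    leave the annulus.\<close>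
  let ?B = "ball ((3 * r / 4) *\<^sub>R b) (r / 8)"
  have "\<exists>h\<in>?B. h \<notin> N & h + x \<notin> N"
  proof (rule ccontr)
   assume "\<not> ?thesis"
   hence no: "h \<in> ?B ==> h \<in> N \<or> h + x \<in> N" for h by blast
   from ae2 have "AE h in lborel. h \<notin> ?B"
    by eventually_elim (use no in blast)
   hence "?B \<in> null_sets lborel" by (subst AE_iff_null_sets) auto
   hence "emeasure lborel ?B = 0" by (rule null_setsD1)
   thus False using r unit_ball_vol_pos [of "real DIM('a)"] by (simp add: emeasure_ball)
  qed
  then obtain h where h: "h \<in> ?B" "h \<notin> N" "h + x \<notin> N" by blast
  have n: "norm ((3 * r / 4) *\<^sub>R b) = 3 * r / 4" using b r by simp
  have d: "norm ((3 * r / 4) *\<^sub>R b - h) < r / 8" using h(1) by (simp add: dist_norm)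
  hence "norm h < 3 * r / 4 + r / 8" "3 * r / 4 - r / 8 < norm h"
   using n norm_triangle_ineq2 [of h "(3 * r / 4) *\<^sub>R b"] norm_triangle_ineq2 [of "(3 * r / 4) *\<^sub>R b" h]
   by (simp_all add: norm_minus_commute)
  moreover have "norm (h + x) <= norm h + norm x" "norm h - norm x <= norm (h + x)"
   using norm_triangle_ineq [of h x] norm_diff_ineq [of h x] by auto
  ultimately have "r / 2 < norm h" "norm h < r" "r / 2 < norm (h + x)" "norm (h + x) < r"
   using that r by linarith+
  hence "V h" "V (h + x)" using h N(2) by auto
  from diff [OF this(2,1)] show "V x" by simp
 qed
 have pow: "V ((2 ^ n) *\<^sub>R y)" if "V y" for n :: nat and y
  by (induction n) (use that double in \<open>auto simp flip: scaleR_scaleR\<close>)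
 obtain n :: nat where "norm x / (r / 8) < 2 ^ n" using real_arch_pow [of 2] by auto
 hence "norm ((1 / 2 ^ n) *\<^sub>R x) < r / 8" using r by (simp add: field_simps)
 from pow [OF small [OF this], of n] show "V x" by simp
qed

section \<open>The first order seminorm as a limit of difference quotients\<close>

lemma integrable_lebesgue_iff:
 fixes f :: "'a::euclidean_space => 'b::euclidean_space"
 assumes "f \<in> Borel"
 shows "integrable lebesgue f \<longleftrightarrow> integrable lborel f" "integral\<^sup>L lebesgue f = integral\<^sup>L lborel f"
 using assms by (simp_all add: integrable_completion integral_completion)

lemma borel_version:
 fixes g :: "'a::euclidean_space => 'b::euclidean_space"
 assumes "g \<in> borel_measurable lebesgue"
 obtains g' where "g' \<in> Borel" "AE x in lborel. g x = g' x"
proof -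
 have "\<exists>gi. gi \<in> borel_measurable lborel & (AE x in lborel. g x \<bullet> i = gi x)" for i
 proof -
  have "(%x. g x \<bullet> i) \<in> borel_measurable lebesgue" using assms by measurable
  from completion_ex_borel_measurable_real [OF this] show ?thesis by blast
 qed
 then obtain gi where gi: "!!i. gi i \<in> borel_measurable lborel" "!!i. AE x in lborel. g x \<bullet> i = gi i x"
  by metis
 have [measurable]: "gi i \<in> Borel" for i using gi(1) [of i] by simp
 have "AE x in lborel. \<forall>i\<in>Basis. g x \<bullet> i = gi i x"
  using gi(2) by (intro AE_finite_allI) auto
 hence "AE x in lborel. g x = (\<Sum>i\<in>Basis. gi i x *\<^sub>R i)"
 proof eventually_elim
  case (elim x)
  have "g x = (\<Sum>i\<in>Basis. (g x \<bullet> i) *\<^sub>R i)" by (simp add: euclidean_representation)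
  also have "... = (\<Sum>i\<in>Basis. gi i x *\<^sub>R i)" by (intro sum.cong) (simp_all add: elim)
  finally show ?case .
 qed
 thus ?thesis by (intro that [of "%x. \<Sum>i\<in>Basis. gi i x *\<^sub>R i"]) auto
qed

text \<open>The definition only provides integrability on compact sets, so \<open>g\<close> is
  recovered as the limit of its restrictions to balls.\<close>

lemma weak_gradient_measurable:
 fixes u :: "'a::euclidean_space => real"
 assumes "weak_gradient u g"
 shows "g \<in> borel_measurable lebesgue"
proof -
 have [measurable]: "(%x. indicator (cball 0 (real n)) x *\<^sub>R g x) \<in> borel_measurable lebesgue" for n :: nat
  using assms compact_cball [of 0 "real n"] unfolding weak_gradient_def set_integrable_def by (blast intro: borel_measurable_integrable)
 show ?thesis
 proof (rule borel_measurable_LIMSEQ_metric)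
  show "(%x. indicator (cball 0 (real n)) x *\<^sub>R g x) \<in> borel_measurable lebesgue" for n :: nat by measurable
  fix x :: 'a
  have "\<forall>\<^sub>F n in sequentially. norm x <= real n"
   using eventually_ge_at_top [of "nat \<lceil>norm x\<rceil>"] by eventually_elim linarith
  thus "(%n. indicator (cball 0 (real n)) x *\<^sub>R g x) ----> g x"
   by (intro tendsto_eventually) (auto elim!: eventually_mono)
 qed
qed

text \<open>Passes to a Borel version of the gradient and, by linearity of the derivative of a test
  function, from the basis vectors to every direction.\<close>

lemma weak_gradient_imp_weak_dir:
 fixes u :: "'a::euclidean_space => real"
 assumes u: "loc_int u" and g: "weak_gradient u g"
 obtains g' where "g' \<in> Borel" "AE x in lborel. g x = g' x" "!!h. weak_dir u h (%x. g' x \<bullet> h)"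
proof -
 obtain g' where [measurable]: "g' \<in> Borel" and g': "AE x in lborel. g x = g' x"
  using borel_version [OF weak_gradient_measurable [OF g]] .
 have ae: "AE x in lebesgue. g x = g' x" using g' by (simp add: AE_completion)
 have [measurable]: "g \<in> borel_measurable lebesgue" "g' \<in> borel_measurable lebesgue" "u \<in> Borel"
  using g u by (auto intro: weak_gradient_measurable measurable_completion loc_int_measurable)
 have "integrable lborel (%x. indicator (cball 0 R) x *\<^sub>R g' x)" for R
 proof -
  have "integrable lebesgue (%x. indicator (cball 0 R) x *\<^sub>R g x)"
   using g compact_cball [of 0 R] unfolding weak_gradient_def set_integrable_def by blast
  moreover have "integrable lebesgue (%x. indicator (cball 0 R) x *\<^sub>R g x) \<longleftrightarrow> integrable lebesgue (%x. indicator (cball 0 R) x *\<^sub>R g' x)"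
  proof (rule integrable_cong_AE)
   show "AE x in lebesgue. indicator (cball 0 R) x *\<^sub>R g x = indicator (cball 0 R) x *\<^sub>R g' x"
    using ae by eventually_elim simp
   show "(%x. indicator (cball 0 R) x *\<^sub>R g' x) \<in> borel_measurable lebesgue"
    by (rule measurable_completion) measurable
  qed (rule borel_measurable_integrable [OF \<open>integrable lebesgue (\<lambda>x. indicator (cball 0 R) x *\<^sub>R g x)\<close>])
  ultimately have "integrable lebesgue (%x. indicator (cball 0 R) x *\<^sub>R g' x)" by simp
  thus ?thesis by (subst (asm) integrable_lebesgue_iff) auto
 qed
 hence loc: "loc_int g'" by (simp add: loc_int_def)
 have loc_h: "loc_int (%x. g' x \<bullet> h)" for h
 proof -
  have "integrable lborel (%x. (indicator (cball 0 R) x *\<^sub>R g' x) \<bullet> h)" for R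
   using loc unfolding loc_int_def by (intro integrable_inner_left) blast
  thus ?thesis by (simp add: loc_int_def)
 qed
 have weak: "(LL x. u x * dir_deriv i \<phi> x) = - (LL x. (g' x \<bullet> i) * \<phi> x)"
  if i: "i \<in> Basis" and \<phi>: "test_function \<phi>" for i \<phi>
 proof -
  note [measurable] = test_function_measurable [OF \<phi>]
  have [measurable]: "\<phi> \<in> borel_measurable lebesgue"
   by (rule measurable_completion) measurable
  have "(LL x. u x * dir_deriv i \<phi> x) = (LINT x|lebesgue. u x * frechet_derivative \<phi> (at x) i)"
   unfolding dir_deriv_def [symmetric] by (rule integrable_lebesgue_iff(2) [symmetric]) measurable
  also have "... = - (LINT x|lebesgue. (g x \<bullet> i) * \<phi> x)"
   using g i \<phi> by (simp add: weak_gradient_def)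
  also have "(LINT x|lebesgue. (g x \<bullet> i) * \<phi> x) = (LINT x|lebesgue. (g' x \<bullet> i) * \<phi> x)"
  proof (rule integral_cong_AE)
   show "AE x in lebesgue. (g x \<bullet> i) * \<phi> x = (g' x \<bullet> i) * \<phi> x"
    using ae by eventually_elim simp
  qed measurable
  also have "... = (LL x. (g' x \<bullet> i) * \<phi> x)"
   by (rule integrable_lebesgue_iff(2)) measurable
  finally show ?thesis .
 qed
 have "weak_dir u h (%x. g' x \<bullet> h)" for h
  unfolding weak_dir_def
 proof (intro conjI allI impI u loc_h)
  fix \<phi> :: "'a => real" assume \<phi>: "test_function \<phi>"
  have "(LL x. u x * dir_deriv h \<phi> x) = (LL x. (\<Sum>i\<in>Basis. (h \<bullet> i) * (u x * dir_deriv i \<phi> x)))"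
   by (simp add: dir_deriv_linear [OF \<phi>, of h] sum_distrib_left mult.left_commute)
  also have "... = (\<Sum>i\<in>Basis. (h \<bullet> i) * (LL x. u x * dir_deriv i \<phi> x))"
   using loc_int_test(2) [OF u \<phi>] by simp
  also have "... = - (\<Sum>i\<in>Basis. (h \<bullet> i) * (LL x. (g' x \<bullet> i) * \<phi> x))"
   by (simp add: weak [OF _ \<phi>] sum_negf)
  also have "(\<Sum>i\<in>Basis. (h \<bullet> i) * (LL x. (g' x \<bullet> i) * \<phi> x)) = (LL x. (\<Sum>i\<in>Basis. (h \<bullet> i) * ((g' x \<bullet> i) * \<phi> x)))"
   using loc_int_test(1) [OF loc_h \<phi>] by simp
  also have "... = (LL x. (g' x \<bullet> h) * \<phi> x)"
  proof (intro Bochner_Integration.integral_cong refl)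
   fix x
   show "(\<Sum>i\<in>Basis. (h \<bullet> i) * ((g' x \<bullet> i) * \<phi> x)) = (g' x \<bullet> h) * \<phi> x"
    unfolding euclidean_inner [of "g' x" h] sum_distrib_right by (intro sum.cong) auto
  qed
  finally show "(LL x. u x * dir_deriv h \<phi> x) = - (LL x. (g' x \<bullet> h) * \<phi> x)" .
 qed
 with g' that [of g'] show ?thesis by simp
qed

lemma weak_dir_imp_weak_gradient:
 fixes u :: "'a::euclidean_space => real"
 assumes v: "!!i. i \<in> Basis ==> weak_dir u i (v i)"
 shows "weak_gradient u (%x. \<Sum>i\<in>Basis. v i x *\<^sub>R i)"
 unfolding weak_gradient_def
proof (intro conjI allI impI ballI)
 have [measurable]: "v i \<in> Borel" "u \<in> Borel" if "i \<in> Basis" for i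
  using v [OF that] by (auto simp: weak_dir_def intro: loc_int_measurable)
 fix K :: "'a set" assume "compact K"
 then obtain R where R: "K \<subseteq> cball 0 R" and [measurable]: "K \<in> sets borel"
  using compact_imp_bounded bounded_iff [of K] by (auto simp: subset_iff compact_imp_closed)
 have "integrable lborel (%x. indicator K x *\<^sub>R (\<Sum>i\<in>Basis. v i x *\<^sub>R i))"
 proof (rule Bochner_Integration.integrable_bound)
  show "integrable lborel (%x. \<Sum>i\<in>Basis. (indicator (cball 0 R) x *\<^sub>R v i x) *\<^sub>R i)"
   using v by (intro Bochner_Integration.integrable_sum integrable_scaleR_left) (auto simp: weak_dir_def loc_int_def)
  show "AE x in lborel. norm (indicator K x *\<^sub>R (\<Sum>i\<in>Basis. v i x *\<^sub>R i)) <= norm (\<Sum>i\<in>Basis. (indicator (cball 0 R) x *\<^sub>R v i x) *\<^sub>R i)"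
   using R by (intro AE_I2) (auto simp: indicator_def)
 qed measurable
 thus "set_integrable lebesgue K (%x. \<Sum>i\<in>Basis. v i x *\<^sub>R i)"
  unfolding set_integrable_def by (subst integrable_lebesgue_iff) auto
next
 have [measurable]: "v i \<in> Borel" "u \<in> Borel" if "i \<in> Basis" for i
  using v [OF that] by (auto simp: weak_dir_def intro: loc_int_measurable)
 fix \<phi> :: "'a => real" and i :: 'a assume \<phi>: "test_function \<phi>" and i: "i \<in> Basis"
 note [measurable] = test_function_measurable [OF \<phi>]
 have [measurable]: "u \<in> Borel" using i by measurable
 have "(LINT x|lebesgue. u x * frechet_derivative \<phi> (at x) i) = (LL x. u x * dir_deriv i \<phi> x)"
  unfolding dir_deriv_def [symmetric] by (rule integrable_lebesgue_iff(2)) measurable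
 also have "... = - (LL x. v i x * \<phi> x)"
  using v [OF i] \<phi> by (simp add: weak_dir_def)
 also have "(LL x. v i x * \<phi> x) = (LINT x|lebesgue. v i x * \<phi> x)"
  using i by (subst integrable_lebesgue_iff(2)) auto
 finally show "(LINT x|lebesgue. u x * frechet_derivative \<phi> (at x) i) = - (LINT x|lebesgue. (\<Sum>i\<in>Basis. v i x *\<^sub>R i) \<bullet> i * \<phi> x)"
  using i by (simp add: inner_sum_left_Basis)
qed

lemma nn_integral_inner_sphere:
 fixes g :: "'a::euclidean_space => 'a"
 assumes [measurable]: "g \<in> Borel" and q: "1 <= q"
 shows "(SS \<omega>. NN x. apow q (g x \<bullet> \<omega>))
  = ennreal (K_const DIM('a) q * sphere_area DIM('a)) * (NN x. ennreal (norm (g x) powr q))"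
proof -
 have sets: "sets (lborel \<Otimes>\<^sub>M sphere_measure) = sets (borel \<Otimes>\<^sub>M (borel :: 'a measure))"
  by (intro sets_pair_measure_cong) simp_all
 have "(\<integral>\<^sup>+\<omega>. (NN x. apow q (g x \<bullet> \<omega>)) \<partial>(sphere_measure :: 'a measure))
   = (NN x. SS \<omega>. apow q (g x \<bullet> \<omega>))"
  by (rule lborel_sphere.Fubini') (simp add: measurable_cong_sets [OF sets refl])
 also have "... = (NN x. ennreal (K_const DIM('a) q * sphere_area DIM('a)) * ennreal (norm (g x) powr q))"
  by (simp add: nn_integral_sphere_inner [OF q])
 also have "... = ennreal (K_const DIM('a) q * sphere_area DIM('a)) * (NN x. ennreal (norm (g x) powr q))"
  by (rule nn_integral_cmult) measurable
 finally show ?thesis .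
qed

text \<open>The dyadic limit of \<open>U(t) / t^q\<close>; the doubling inequality makes the
  sequence increase. For a weakly differentiable \<open>u\<close> it no longer depends on
  \<open>t\<close>.\<close>

definition U_sup :: "real => ('a::euclidean_space => real) => real => ennreal" where
 "U_sup q u t = (SUP n::nat. ennreal ((t / 2 ^ n) powr (- q)) * U_fun q u (t / 2 ^ n))"

lemma borel_measurable_dyadic_sup [measurable]:
 assumes [measurable]: "u \<in> Borel"
 shows "dyadic_sup q u \<in> Borel"
 unfolding dyadic_sup_def by measurable

lemma U_sup_eq:
 assumes [measurable]: "u \<in> Borel" and q: "1 <= q" and t: "0 < t"
 shows "U_sup q u t = ennreal (t powr (- q)) * (SS \<omega>. dyadic_sup q u (t *\<^sub>R \<omega>))"
proof -
 have eq: "ennreal ((t / 2 ^ n) powr (- q)) * U_fun q u (t / 2 ^ n)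
   = ennreal (t powr (- q)) * (SS \<omega>. ennreal (2 powr (real n * q)) * shift_diff q u ((1 / 2 ^ n) *\<^sub>R (t *\<^sub>R \<omega>)))" for n :: nat
 proof -
  have "(t / 2 ^ n) powr (- q) = t powr (- q) * 2 powr (real n * q)"
   using t by (simp add: powr_divide powr_realpow [symmetric] powr_powr powr_minus_divide)
  moreover have "(SS \<omega>. ennreal (2 powr (real n * q)) * shift_diff q u ((1 / 2 ^ n) *\<^sub>R (t *\<^sub>R \<omega>))) = ennreal (2 powr (real n * q)) * U_fun q u (t / 2 ^ n)"
   by (subst nn_integral_cmult) (simp_all add: U_fun_eq)
  ultimately show ?thesis by (simp add: ennreal_mult' mult.assoc)
 qed
 have "(SS \<omega>. dyadic_sup q u (t *\<^sub>R \<omega>))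
   = (SUP n. (SS \<omega>. ennreal (2 powr (real n * q)) * shift_diff q u ((1 / 2 ^ n) *\<^sub>R (t *\<^sub>R \<omega>))))"
  unfolding dyadic_sup_def
 proof (rule nn_integral_monotone_convergence_SUP)
  show "incseq (%n \<omega>. ennreal (2 powr (real n * q)) * shift_diff q u ((1 / 2 ^ n) *\<^sub>R t *\<^sub>R \<omega>))"
   by (intro monoI le_funI) (rule incseqD [OF incseq_dyadic [OF assms(1) q]])
 qed measurable
 thus ?thesis
  unfolding U_sup_def eq by (simp add: SUP_mult_left_ennreal)
qed

text \<open>In direction \<open>t *\<^sub>R \<omega>\<close> the dyadic limit is the integral of
  \<open>|g . t\<omega>|^q\<close>. Averaging over the sphere produces \<open>K_const\<close>, and
  homogeneity cancels \<open>t powr (- q)\<close>.\<close>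

lemma U_sup_weak_gradient:
 fixes u :: "'a::euclidean_space => real"
 assumes u: "loc_int u" and g: "weak_gradient u g" and q: "1 <= q" and t: "0 < t"
 shows "U_sup q u t = ennreal (K_const DIM('a) q * sphere_area DIM('a)) * (\<integral>\<^sup>+x. ennreal (norm (g x) powr q) \<partial>lebesgue)"
proof -
 obtain g' where [measurable]: "g' \<in> Borel" and g': "AE x in lborel. g x = g' x" "!!h. weak_dir u h (%x. g' x \<bullet> h)"
  using weak_gradient_imp_weak_dir [OF u g] by blast
 have "U_sup q u t = ennreal (t powr (- q)) * (SS \<omega>. NN x. apow q (g' x \<bullet> (t *\<^sub>R \<omega>)))"
  using U_sup_eq [OF loc_int_measurable [OF u] q t] by (simp add: dyadic_sup_weak_dir [OF g'(2) q])
 also have "... = ennreal (t powr (- q)) * (SS \<omega>. NN x. apow q ((t *\<^sub>R g' x) \<bullet> \<omega>))"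
  by simp
 also have "... = ennreal (t powr (- q)) * (ennreal (K_const DIM('a) q * sphere_area DIM('a)) * (NN x. ennreal (norm (t *\<^sub>R g' x) powr q)))"
  by (subst nn_integral_inner_sphere) (use q in auto)
 also have "(NN x. ennreal (norm (t *\<^sub>R g' x) powr q)) = ennreal (t powr q) * (NN x. ennreal (norm (g' x) powr q))"
  using t by (subst nn_integral_cmult [symmetric]) (auto simp: powr_mult ennreal_mult')
 also have "ennreal (t powr (- q)) * (ennreal (K_const DIM('a) q * sphere_area DIM('a)) * ...)
   = (ennreal (t powr (- q)) * ennreal (t powr q)) * (ennreal (K_const DIM('a) q * sphere_area DIM('a)) * (NN x. ennreal (norm (g' x) powr q)))"
  by (simp only: mult_ac)
 also have "ennreal (t powr (- q)) * ennreal (t powr q) = 1"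
  using t by (simp add: ennreal_mult' [symmetric] powr_minus)
 also have "(NN x. ennreal (norm (g' x) powr q)) = (NN x. ennreal (norm (g x) powr q))"
  by (rule nn_integral_cong_AE, rule eventually_mono [OF g'(1)]) simp
 finally show ?thesis by (simp add: nn_integral_completion)
qed

text \<open>The vectors with finite \<open>dyadic_sup\<close> are thereby stable under differences
  and doubling, as \<open>annulus_group\<close> demands.\<close>

lemma dyadic_sup_half:
 assumes u: "u \<in> Borel" and q: "1 <= q"
 shows "dyadic_sup q u (h - k) <= ennreal (2 powr (q - 1)) * (dyadic_sup q u h + dyadic_sup q u k)"
  and "dyadic_sup q u (2 *\<^sub>R h) <= ennreal (2 powr q) * dyadic_sup q u h"
proof -
 let ?a = "%h n. ennreal (2 powr (real n * q)) * shift_diff q u ((1 / 2 ^ n) *\<^sub>R h)"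
 have up: "?a h n <= dyadic_sup q u h" for h and n :: nat
  unfolding dyadic_sup_def by (rule SUP_upper) simp
 show "dyadic_sup q u (h - k) <= ennreal (2 powr (q - 1)) * (dyadic_sup q u h + dyadic_sup q u k)"
  unfolding dyadic_sup_def [of q u "h - k"]
 proof (rule SUP_least)
  fix n :: nat
  have "shift_diff q u ((1 / 2 ^ n) *\<^sub>R (h - k)) <= ennreal (2 powr (q - 1)) * (shift_diff q u ((1 / 2 ^ n) *\<^sub>R h) + shift_diff q u ((1 / 2 ^ n) *\<^sub>R k))"
   using shift_diff_add_half [OF u q, of "(1 / 2 ^ n) *\<^sub>R h" "- ((1 / 2 ^ n) *\<^sub>R k)"] shift_diff_minus [OF u, of q "(1 / 2 ^ n) *\<^sub>R k"]
   by (simp add: scaleR_diff_right)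
  hence "?a (h - k) n <= ennreal (2 powr (real n * q)) * (ennreal (2 powr (q - 1)) * (shift_diff q u ((1 / 2 ^ n) *\<^sub>R h) + shift_diff q u ((1 / 2 ^ n) *\<^sub>R k)))"
   by (rule mult_left_mono) simp
  also have "... = ennreal (2 powr (q - 1)) * (?a h n + ?a k n)"
   by (simp add: distrib_left mult.left_commute)
  also have "... <= ennreal (2 powr (q - 1)) * (dyadic_sup q u h + dyadic_sup q u k)"
   by (intro mult_left_mono add_mono up) simp
  finally show "?a (h - k) n <= ..." .
 qed
 show "dyadic_sup q u (2 *\<^sub>R h) <= ennreal (2 powr q) * dyadic_sup q u h"
  unfolding dyadic_sup_def [of q u "2 *\<^sub>R h"]
 proof (rule SUP_least)
  fix n :: nat
  have "shift_diff q u (2 *\<^sub>R ((1 / 2 ^ n) *\<^sub>R h)) <= ennreal (2 powr q) * shift_diff q u ((1 / 2 ^ n) *\<^sub>R h)"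
   by (rule shift_diff_double [OF u q])
  hence "?a (2 *\<^sub>R h) n <= ennreal (2 powr (real n * q)) * (ennreal (2 powr q) * shift_diff q u ((1 / 2 ^ n) *\<^sub>R h))"
   by (intro mult_left_mono) (simp_all add: mult.commute)
  also have "... = ennreal (2 powr q) * ?a h n" by (simp add: mult.left_commute)
  also have "... <= ennreal (2 powr q) * dyadic_sup q u h" by (intro mult_left_mono up) simp
  finally show "?a (2 *\<^sub>R h) n <= ..." .
 qed
qed

text \<open>In polar coordinates, finiteness of the spherical averages for almost every radius gives
  finiteness in almost every direction of the annulus, and \<open>annulus_group\<close> extends it
  to all vectors.\<close>

lemma dyadic_sup_finite:
 fixes u :: "'a::euclidean_space => real"
 assumes [measurable]: "u \<in> Borel" and q: "1 <= q" and r: "0 < r"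
  and fin: "AE t in lborel. r / 2 < t & t < r --> U_sup q u t < \<infinity>"
 shows "dyadic_sup q u x < \<infinity>"
proof (rule annulus_group [where V = "%h. dyadic_sup q u h < \<infinity>" and r = r])
 fix h k :: 'a
 show "dyadic_sup q u h < \<infinity> ==> dyadic_sup q u k < \<infinity> ==> dyadic_sup q u (h - k) < \<infinity>"
  using le_less_trans [OF dyadic_sup_half(1) [OF assms(1) q, of h k]] by (simp add: ennreal_mult_less_top)
 show "dyadic_sup q u h < \<infinity> ==> dyadic_sup q u (2 *\<^sub>R h) < \<infinity>"
  using le_less_trans [OF dyadic_sup_half(2) [OF assms(1) q, of h]] by (simp add: ennreal_mult_less_top)
next
 let ?A = "%h :: 'a. if r / 2 < norm h & norm h < r & dyadic_sup q u h = \<infinity> then 1 else 0 :: ennreal"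
 have [measurable]: "?A \<in> Borel" by measurable
 have "(NN h. ?A h) = (\<integral>\<^sup>+t\<in>{0<..}. ennreal (t powr (real DIM('a) - 1)) * (SS \<omega>. ?A (t *\<^sub>R \<omega>)) \<partial>lborel)"
  by (rule nn_integral_polar) measurable
 also have "... = (\<integral>\<^sup>+t. 0 \<partial>(lborel :: real measure))"
 proof (rule nn_integral_cong_AE, rule eventually_mono [OF fin])
  fix t :: real assume *: "r / 2 < t & t < r --> U_sup q u t < \<infinity>"
  show "ennreal (t powr (real DIM('a) - 1)) * (SS \<omega>. ?A (t *\<^sub>R \<omega>)) * indicator {0<..} t = 0"
  proof (cases "0 < t")
   case True
   have "AE \<omega> in sphere_measure. ?A (t *\<^sub>R \<omega>) = 0"
   proof (cases "r / 2 < t & t < r")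
    case tr: True
    hence "ennreal (t powr (- q)) * (SS \<omega>. dyadic_sup q u (t *\<^sub>R \<omega>)) < \<infinity>"
     using * U_sup_eq [OF assms(1) q True] by simp
    hence "(SS \<omega>. dyadic_sup q u (t *\<^sub>R \<omega>)) ~= \<infinity>"
     using True by (auto simp: ennreal_mult_less_top)
    hence "AE \<omega> in sphere_measure. dyadic_sup q u (t *\<^sub>R \<omega>) ~= \<infinity>"
     by (intro nn_integral_noteq_infinite) auto
    thus ?thesis by eventually_elim simp
   next
    case False
    thus ?thesis using norm_sphere_AE by (auto elim!: eventually_mono simp: True less_imp_le)
   qed
   hence "(SS \<omega>. ?A (t *\<^sub>R \<omega>)) = 0"
    by (subst nn_integral_0_iff_AE) auto
   thus ?thesis by simp
  qed simp
 qed
 finally have "(NN h. ?A h) = 0" by simp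
 hence "AE h in lborel. ?A h = 0"
  by (subst (asm) nn_integral_0_iff_AE) measurable
 thus "AE h in lborel. r / 2 < norm h & norm h < r --> dyadic_sup q u h < \<infinity>"
  by eventually_elim (auto simp: less_top split: if_splits)
qed (rule r)

text \<open>For exponent 1 the pairing of a difference quotient with a function bounded by 1 is at
  most its \<open>L^1\<close> norm; this survives in the limit and bounds the variation of
  \<open>u\<close>, although no weak derivative need exist.\<close>

lemma dyadic_sup_BV:
 assumes u: "loc_int u" and \<phi>: "test_function \<phi>" "!!x. \<bar>\<phi> x\<bar> <= 1"
 shows "ennreal (LL x. u x * dir_deriv h \<phi> x) <= dyadic_sup 1 u h"
proof (cases "dyadic_sup 1 u h = \<infinity>")
 case False
 have [measurable]: "u \<in> Borel" "\<phi> \<in> Borel"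
  using u \<phi> by (auto intro: loc_int_measurable test_function_measurable)
 have "\<bar>(LL x. 2 ^ n * (u (x + (1 / 2 ^ n) *\<^sub>R h) - u x) * \<phi> x)\<bar> <= enn2real (dyadic_sup 1 u h)" for n
 proof -
  let ?f = "%x. 2 ^ n * (u (x + (1 / 2 ^ n) *\<^sub>R h) - u x) * \<phi> x"
  have int: "integrable lborel ?f"
   using loc_int_test(1) [OF loc_int_cmult [OF loc_int_diff [OF loc_int_shift [OF u] u]] \<phi>(1)] .
  have "ennreal (norm (LL x. ?f x)) <= (NN x. ennreal (norm (?f x)))"
   by (rule integral_norm_bound_ennreal [OF int])
  also have "... <= (NN x. ennreal (2 powr (real n * 1)) * (apow 1 (u (x + (1 / 2 ^ n) *\<^sub>R h) - u x)))"
   using \<phi>(2) by (intro nn_integral_mono) (auto simp: ennreal_mult' [symmetric] abs_mult powr_realpow mult_left_le intro!: ennreal_leI)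
  also have "... = ennreal (2 powr (real n * 1)) * shift_diff 1 u ((1 / 2 ^ n) *\<^sub>R h)"
   unfolding shift_diff_def by (rule nn_integral_cmult) measurable
  also have "... <= dyadic_sup 1 u h" unfolding dyadic_sup_def by (rule SUP_upper) simp
  finally show ?thesis using False by (simp add: ennreal_le_iff2 enn2real_leI) (metis abs_ge_zero enn2real_ennreal enn2real_mono infinity_ennreal_def less_top)
 qed
 hence "\<bar>- (LL x. u x * dir_deriv h \<phi> x)\<bar> <= enn2real (dyadic_sup 1 u h)"
  using tendsto_rabs [OF diff_quot_tendsto [OF u \<phi>(1), of h]] by (intro LIMSEQ_le_const2) auto
 hence "(LL x. u x * dir_deriv h \<phi> x) <= enn2real (dyadic_sup 1 u h)" by linarith
 hence "ennreal (LL x. u x * dir_deriv h \<phi> x) <= ennreal (enn2real (dyadic_sup 1 u h))"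
  by (rule ennreal_leI)
 also have "... = dyadic_sup 1 u h" using False by (simp add: less_top)
 finally show ?thesis .
qed simp

section \<open>Short-range interactions\<close>

lemma recip_ennreal: "0 < q ==> recip (ennreal q) = 1 / q"
 by (simp add: recip_def inverse_ennreal inverse_eq_divide)

lemma rpow_less_top_iff: "rpow x a < top \<longleftrightarrow> x < top"
 by (metis less_top rpow_eq_top_iff)

lemma Lp_norm_ennreal:
 "0 < q ==> Lp_norm (ennreal q) f = rpow (\<integral>\<^sup>+x. ennreal (norm (f x) powr q) \<partial>lebesgue) (1 / q)"
 by (simp add: Lp_norm_def recip_ennreal)

lemma rpow_Lp_norm:
 "0 < q ==> rpow (Lp_norm (ennreal q) f) q = (\<integral>\<^sup>+x. ennreal (norm (f x) powr q) \<partial>lebesgue)"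
 by (simp add: Lp_norm_ennreal rpow_rpow)

lemma divide_ennreal_powr: "0 < t ==> x / ennreal (t powr b) = x * ennreal (t powr (- b))"
 by (simp add: divide_ennreal_def inverse_ennreal powr_minus)

lemma nn_integral_log_interval:
 assumes "0 < r"
 shows "(NN t. ennreal (1 / t) * indicator {r / 2..<r} t) = ennreal (ln 2)"
proof -
 have "(NN t. ennreal (1 / t) * indicator {r / 2..<r} t) = (NN t. ennreal (1 / t) * indicator {r / 2..r} t)"
  by (rule nn_integral_cong_AE, rule eventually_mono [OF AE_lborel_singleton [of r]]) (auto simp: indicator_def)
 also have "... = ennreal (ln r - ln (r / 2))"
  by (rule nn_integral_FTC_Icc) (use assms in \<open>auto intro!: derivative_eq_intros\<close>)
 also have "ln r - ln (r / 2) = ln 2" using assms by (simp add: ln_div)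
 finally show ?thesis .
qed

lemma nn_integral_norm_sum_Basis_finite:
 fixes v :: "'a::euclidean_space => 'a => real"
 assumes meas: "!!i. i \<in> Basis ==> v i \<in> Borel" and q: "1 <= q"
  and fin: "!!i. i \<in> Basis ==> (NN x. apow q (v i x)) < \<infinity>"
 shows "(NN x. ennreal (norm (\<Sum>i\<in>Basis. v i x *\<^sub>R i) powr q)) < \<infinity>"
proof -
 note [measurable] = meas
 have "norm (\<Sum>i\<in>Basis. v i x *\<^sub>R i) powr q <= real DIM('a) powr q * (\<Sum>i\<in>Basis. \<bar>v i x\<bar> powr q)" for x
 proof -
  let ?m = "Max ((%i. \<bar>v i x\<bar>) ` Basis)"
  have "?m \<in> (%i. \<bar>v i x\<bar>) ` Basis" by (rule Max_in) auto
  then obtain j where j: "j \<in> Basis" "?m = \<bar>v j x\<bar>" by (rule imageE) (rule that)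
  have "norm (\<Sum>i\<in>Basis. v i x *\<^sub>R i) <= (\<Sum>i\<in>(Basis::'a set). \<bar>v i x\<bar>)"
   by (rule order_trans [OF norm_sum]) simp
  also have "... <= (\<Sum>i\<in>(Basis::'a set). \<bar>v j x\<bar>)"
   unfolding j(2) [symmetric] by (intro sum_mono Max_ge) auto
  finally have "norm (\<Sum>i\<in>Basis. v i x *\<^sub>R i) powr q <= (real DIM('a) * \<bar>v j x\<bar>) powr q"
   using q by (intro powr_mono2) auto
  also have "... = real DIM('a) powr q * \<bar>v j x\<bar> powr q" by (simp add: powr_mult)
  also have "\<bar>v j x\<bar> powr q <= (\<Sum>i\<in>Basis. \<bar>v i x\<bar> powr q)"
   using j(1) by (intro member_le_sum) auto
  finally show ?thesis by (simp add: mult_left_mono)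
 qed
 hence "(NN x. ennreal (norm (\<Sum>i\<in>Basis. v i x *\<^sub>R i) powr q))
   <= (NN x. ennreal (real DIM('a) powr q) * (\<Sum>i\<in>Basis. apow q (v i x)))"
  by (intro nn_integral_mono) (simp add: sum_ennreal ennreal_mult' [symmetric] ennreal_leI)
 also have "... = ennreal (real DIM('a) powr q) * (\<Sum>i\<in>Basis. (NN x. apow q (v i x)))"
  by (simp add: nn_integral_cmult nn_integral_sum del: sum_ennreal)
 also have "... < \<infinity>" using fin by (auto simp: ennreal_mult_less_top)
 finally show ?thesis .
qed

text \<open>For \<open>q > 1\<close> there are weak derivatives along the basis vectors, with finite
  norms by \<open>dyadic_sup_weak_dir\<close>. For \<open>q = 1\<close> finiteness only puts
  \<open>u\<close> into \<open>BV_space\<close>, and \<open>exc\<close> then leads to the Sobolev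
  space.\<close>

lemma sobolev_space1_iff_dyadic_sup:
 assumes [measurable]: "u \<in> Borel" and q: "1 <= q"
  and Lq: "(NN x. apow q (u x)) < \<infinity>"
  and fin: "!!h. dyadic_sup q u h < \<infinity>" and exc: "\<not> (q = 1 & u \<in> BV_space - sobolev_space1 1)"
 shows "u \<in> sobolev_space1 (ennreal q)"
proof -
 have loc: "loc_int u" by (rule Lq_loc_int [OF assms(1) q Lq])
 have Lp: "u \<in> Lp_space (ennreal q)"
  using Lq q by (simp add: Lp_space_def Lp_norm_ennreal rpow_less_top_iff nn_integral_completion measurable_completion)
 show ?thesis
 proof (cases "q = 1")
  case True
  have "(LL x. u x * dir_deriv i \<phi> x) <= (\<Sum>i\<in>Basis. enn2real (dyadic_sup 1 u i))"
   if "i \<in> Basis" "test_function \<phi>" "\<forall>x. \<bar>\<phi> x\<bar> <= 1" for i \<phi>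
  proof -
   have "ennreal (LL x. u x * dir_deriv i \<phi> x) <= ennreal (enn2real (dyadic_sup 1 u i))"
    using dyadic_sup_BV [OF loc that(2), of i] that(3) fin [of i] True by simp
   hence "(LL x. u x * dir_deriv i \<phi> x) <= enn2real (dyadic_sup 1 u i)" by (simp add: ennreal_le_iff)
   also have "... <= (\<Sum>i\<in>Basis. enn2real (dyadic_sup 1 u i))"
    using that by (intro member_le_sum) auto
   finally show ?thesis .
  qed
  moreover have "(LINT x|lebesgue. u x * frechet_derivative \<phi> (at x) i) = (LL x. u x * dir_deriv i \<phi> x)"
   if "test_function \<phi>" for i \<phi>
  proof -
   note [measurable] = test_function_measurable [OF that]
   show ?thesis unfolding dir_deriv_def [symmetric] by (rule integrable_lebesgue_iff(2)) measurable
  qed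
  ultimately have "u \<in> BV_space" unfolding BV_space_def using Lp True by auto
  thus ?thesis using exc True by simp
 next
  case False
  hence "1 < q" using q by simp
  then obtain v where v: "!!i. weak_dir u i (v i)" using weak_dir_exists [OF loc _ fin] by metis
  have meas: "v i \<in> Borel" for i using v [of i] by (auto simp: weak_dir_def loc_int_def)
  have "(NN x. ennreal (norm (\<Sum>i\<in>Basis. v i x *\<^sub>R i) powr q)) < \<infinity>"
   using fin by (intro nn_integral_norm_sum_Basis_finite meas q) (simp add: dyadic_sup_weak_dir [OF v q])
  moreover have "(%x. \<Sum>i\<in>Basis. v i x *\<^sub>R i) \<in> borel_measurable lborel"
   using meas by simp
  ultimately have "(%x. \<Sum>i\<in>Basis. v i x *\<^sub>R i) \<in> Lp_space (ennreal q)"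
   using q by (simp only: Lp_space_def mem_Collect_eq) (simp add: Lp_norm_ennreal rpow_less_top_iff nn_integral_completion measurable_completion)
  thus ?thesis
   unfolding sobolev_space1_def using Lp weak_dir_imp_weak_gradient [of u v] v by auto
 qed
qed

text \<open>For a Sobolev function \<open>U_sup\<close> is constant and the measure
  \<open>dt / t\<close> on the dyadic interval has mass \<open>ln 2\<close>. For other functions
  both sides are infinite: a finite integral would make \<open>dyadic_sup\<close> finite everywhere.
  The averaged form is the one that continues the formula for \<open>s < 1\<close>.\<close>

lemma sobolev_seminorm_1_eq_U_sup:
 fixes u :: "'a::euclidean_space => real"
 assumes [measurable]: "u \<in> Borel" and q: "1 <= q"
  and Lq: "(NN x. apow q (u x)) < \<infinity>" and r: "0 < r"
  and exc: "\<not> (q = 1 & u \<in> BV_space - sobolev_space1 1)"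
 shows "sobolev_seminorm 1 (ennreal q) u
  = rpow (ennreal (1 / q) * (ennreal (1 / ln 2) * (NN t. U_sup q u t * (ennreal (1 / t) * indicator {r / 2..<r} t)))) (1 / q)"
proof (cases "u \<in> sobolev_space1 (ennreal q)")
 case True
 have loc: "loc_int u" by (rule Lq_loc_int [OF assms(1) q Lq])
 have g: "weak_gradient u (weak_grad u)"
  using True unfolding sobolev_space1_def weak_grad_def by (auto intro: someI [of "weak_gradient u"])
 define C where "C = ennreal (K_const DIM('a) q * sphere_area DIM('a)) * (\<integral>\<^sup>+x. ennreal (norm (weak_grad u x) powr q) \<partial>lebesgue)"
 have "(NN t. U_sup q u t * (ennreal (1 / t) * indicator {r / 2..<r} t))
   = (NN t. C * (ennreal (1 / t) * indicator {r / 2..<r} t))"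
  using r by (intro nn_integral_cong) (auto simp: indicator_def C_def U_sup_weak_gradient [OF loc g q])
 also have "... = C * ennreal (ln 2)"
  by (subst nn_integral_cmult) (simp_all add: nn_integral_log_interval r)
 finally have "ennreal (1 / ln 2) * (NN t. U_sup q u t * (ennreal (1 / t) * indicator {r / 2..<r} t)) = (ennreal (1 / ln 2) * ennreal (ln 2)) * C"
  by (simp only: mult_ac)
 also have "ennreal (1 / ln 2) * ennreal (ln 2) = 1"
  by (simp add: ennreal_mult' [symmetric])
 finally have "ennreal (1 / q) * (ennreal (1 / ln 2) * (NN t. U_sup q u t * (ennreal (1 / t) * indicator {r / 2..<r} t))) = ennreal (1 / q) * C"
  by simp
 also have "... = ennreal (K_const DIM('a) q * sphere_area DIM('a) / q) * (\<integral>\<^sup>+x. ennreal (norm (weak_grad u x) powr q) \<partial>lebesgue)"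
  unfolding C_def mult.assoc [symmetric] using q by (subst ennreal_mult' [symmetric]) simp_all
 finally show ?thesis
  using True q by (simp add: sobolev_seminorm_def Let_def recip_ennreal rpow_Lp_norm)
next
 case False
 let ?F = "NN t. U_sup q u t * (ennreal (1 / t) * indicator {r / 2..<r} t)"
 have [measurable]: "U_sup q u \<in> Borel" unfolding U_sup_def by measurable
 have "?F = \<infinity>"
 proof (rule ccontr)
  assume "?F ~= \<infinity>"
  hence "AE t in lborel. U_sup q u t * (ennreal (1 / t) * indicator {r / 2..<r} t) ~= \<infinity>"
   by (intro nn_integral_PInf_AE) auto
  hence "AE t in lborel. r / 2 < t & t < r --> U_sup q u t < \<infinity>"
  proof eventually_elim
   case (elim t)
   thus ?case using r by (auto simp: less_top [symmetric] ennreal_top_mult split: if_splits)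
  qed
  from sobolev_space1_iff_dyadic_sup [OF assms(1) q Lq dyadic_sup_finite [OF assms(1) q r this] exc] False
  show False by simp
 qed
 thus ?thesis
  using False q by (simp add: sobolev_seminorm_def Let_def ennreal_mult_top)
qed

text \<open>The increments of the sequence in \<open>U_sup\<close>. Subtraction of extended
  nonnegative reals loses nothing, because the sequence increases.\<close>

definition quot_incr :: "real => ('a::euclidean_space => real) => real => nat => ennreal" where
 "quot_incr q u t j = ennreal ((t / 2 ^ j) powr (- q)) * U_fun q u (t / 2 ^ j)
  - (if j = 0 then 0 else ennreal ((t / 2 ^ (j - 1)) powr (- q)) * U_fun q u (t / 2 ^ (j - 1)))"

text \<open>Set to 1 outside the dyadic interval, so that it takes values in \<open>(0, 1]\<close>
  everywhere, as the limit theorems for powers require.\<close>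

definition dyadic_weight :: "real => nat \<times> real => real" where
 "dyadic_weight r z = (if r / 2 <= snd z & snd z < r then snd z / (r * 2 ^ fst z) else 1)"

text \<open>The sum over the scales and the integral over \<open>t\<close> are merged into one
  integral over a product space: a power of a fixed weight against a fixed function, so that only
  the exponent \<open>a\<close> varies.\<close>

definition short_G :: "real => ('a::euclidean_space => real) => real => real => ennreal" where
 "short_G q u r a = (\<integral>\<^sup>+z. ennreal (dyadic_weight r z powr a) *
  (quot_incr q u (snd z) (fst z) * (ennreal (1 / snd z) * indicator {r / 2..<r} (snd z))) \<partial>(count_space UNIV \<Otimes>\<^sub>M lborel))"

lemma dyadic_weight_bounds: "0 < r ==> 0 < dyadic_weight r z" "0 < r ==> dyadic_weight r z <= 1"
proof -
 assume r: "0 < r"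
 show "0 < dyadic_weight r z" using r by (auto simp: dyadic_weight_def)
 have "snd z <= r * 2 ^ fst z" if "snd z < r"
 proof -
  have "1 <= (2::real) ^ fst z" by simp
  hence "r * 1 <= r * 2 ^ fst z" using r by (intro mult_left_mono) auto
  thus ?thesis using that by simp
 qed
 thus "dyadic_weight r z <= 1" using r by (auto simp: dyadic_weight_def divide_le_eq)
qed

lemma borel_measurable_count_space_pair:
 assumes "!!j. (%t. f (j, t)) \<in> Borel"
 shows "f \<in> borel_measurable (count_space (UNIV :: nat set) \<Otimes>\<^sub>M (lborel :: real measure))"
 using assms by (intro measurable_pair_measure_countable1) auto

lemma short_G_measurable:
 assumes [measurable]: "u \<in> Borel"
 shows "dyadic_weight r \<in> borel_measurable (count_space UNIV \<Otimes>\<^sub>M lborel)"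
  "(%z. quot_incr q u (snd z) (fst z) * (ennreal (1 / snd z) * indicator {r / 2..<r} (snd z))) \<in> borel_measurable (count_space UNIV \<Otimes>\<^sub>M lborel)"
 by (rule borel_measurable_count_space_pair, unfold dyadic_weight_def quot_incr_def fst_conv snd_conv, measurable)+

lemma quot_incr_sums:
 assumes u: "u \<in> Borel" and q: "1 <= q" and t: "0 < t"
 shows "0 <= x ==> x < 1 ==> ennreal (1 - x) * (\<Sum>k. ennreal (x ^ k) * (ennreal ((t / 2 ^ k) powr (- q)) * U_fun q u (t / 2 ^ k)))
   = (\<Sum>j. ennreal (x ^ j) * quot_incr q u t j)"
  and "U_sup q u t = (\<Sum>j. quot_incr q u t j)"
proof -
 let ?f = "%k::nat. ennreal ((t / 2 ^ k) powr (- q)) * U_fun q u (t / 2 ^ k)"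
 have mono: "incseq ?f"
 proof (rule incseq_SucI)
  fix k
  have "?f k <= ennreal ((t / 2 ^ k) powr (- q)) * (ennreal (2 powr q) * U_fun q u (t / 2 ^ Suc k))"
   using U_fun_double [OF u q, of "t / 2 ^ Suc k"] by (intro mult_left_mono) simp_all
  also have "... = ennreal ((t / 2 ^ k) powr (- q) * 2 powr q) * U_fun q u (t / 2 ^ Suc k)"
   by (simp add: ennreal_mult' mult.assoc)
  also have "(t / 2 ^ k) powr (- q) * 2 powr q = (t / 2 ^ Suc k) powr (- q)"
   using t by (simp add: powr_divide powr_minus powr_mult)
  finally show "?f k <= ?f (Suc k)" .
 qed
 from geometric_average_eq(1) [OF mono] geometric_average_eq(3) [OF mono, of 0]
 show "0 <= x ==> x < 1 ==> ennreal (1 - x) * (\<Sum>k. ennreal (x ^ k) * ?f k) = (\<Sum>j. ennreal (x ^ j) * quot_incr q u t j)"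
  and "U_sup q u t = (\<Sum>j. quot_incr q u t j)"
  by (simp_all add: quot_incr_def U_sup_def)
qed

lemma short_G_eq:
 assumes [measurable]: "u \<in> Borel" and r: "0 < r"
 shows "short_G q u r a = (NN t. (\<Sum>j. ennreal ((2 powr (- a)) ^ j) * quot_incr q u t j) * (ennreal ((t / r) powr a / t) * indicator {r / 2..<r} t))"
proof -
 let ?f = "%z. ennreal (dyadic_weight r z powr a) * (quot_incr q u (snd z) (fst z) * (ennreal (1 / snd z) * indicator {r / 2..<r} (snd z)))"
 have [measurable]: "(%t. quot_incr q u t j) \<in> Borel" for j
  unfolding quot_incr_def by measurable
 have "short_G q u r a = (\<integral>\<^sup>+j. (NN t. ?f (j, t)) \<partial>count_space UNIV)"
  unfolding short_G_def
 proof (rule lborel.nn_integral_fst [symmetric])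
  note [measurable] = short_G_measurable [OF assms(1)]
  show "?f \<in> borel_measurable (count_space UNIV \<Otimes>\<^sub>M lborel)" by measurable
 qed
 also have "... = (\<Sum>j. (NN t. ?f (j, t)))"
  by (rule nn_integral_count_space_nat)
 also have "... = (\<Sum>j. (NN t. ennreal ((2 powr (- a)) ^ j) * quot_incr q u t j * (ennreal ((t / r) powr a / t) * indicator {r / 2..<r} t)))"
 proof (intro suminf_cong nn_integral_cong)
  fix j :: nat and t :: real
  show "?f (j, t) = ennreal ((2 powr (- a)) ^ j) * quot_incr q u t j * (ennreal ((t / r) powr a / t) * indicator {r / 2..<r} t)"
  proof (cases "r / 2 <= t & t < r")
   case True
   hence t: "0 < t" using r by linarith
   have "(t / (r * 2 ^ j)) powr a = (2 powr (- a)) ^ j * (t / r) powr a"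
    using t r by (simp add: powr_divide powr_mult powr_realpow [symmetric] powr_powr powr_minus_divide mult.commute)
   hence "ennreal ((t / (r * 2 ^ j)) powr a) * ennreal (1 / t) = ennreal ((2 powr (- a)) ^ j) * ennreal ((t / r) powr a / t)"
    using t by (simp add: ennreal_mult' [symmetric])
   note eq = this
   have "ennreal ((t / (r * 2 ^ j)) powr a) * (quot_incr q u t j * ennreal (1 / t)) = (ennreal ((t / (r * 2 ^ j)) powr a) * ennreal (1 / t)) * quot_incr q u t j"
    by (simp only: mult_ac)
   also have "... = ennreal ((2 powr (- a)) ^ j) * quot_incr q u t j * ennreal ((t / r) powr a / t)"
    unfolding eq by (simp only: mult_ac)
   finally show ?thesis using True by (simp add: dyadic_weight_def)
  qed (auto simp: indicator_def)
 qed
 also have "... = (NN t. (\<Sum>j. ennreal ((2 powr (- a)) ^ j) * quot_incr q u t j * (ennreal ((t / r) powr a / t) * indicator {r / 2..<r} t)))"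
  by (rule nn_integral_suminf [symmetric]) measurable
 also have "... = (NN t. (\<Sum>j. ennreal ((2 powr (- a)) ^ j) * quot_incr q u t j) * (ennreal ((t / r) powr a / t) * indicator {r / 2..<r} t))"
  by simp
 finally show ?thesis .
qed

lemma short_G_0:
 assumes "u \<in> Borel" "1 <= q" "0 < r"
 shows "short_G q u r 0 = (NN t. U_sup q u t * (ennreal (1 / t) * indicator {r / 2..<r} t))"
 unfolding short_G_eq [OF assms(1,3)] using assms
 by (intro nn_integral_cong) (auto simp: indicator_def quot_incr_sums(2))

text \<open>The dyadic intervals partition \<open>(0, r)\<close>, and each of them is scaled to the
  outermost one.\<close>

lemma nn_integral_dyadic_decomposition:
 fixes H :: "real => ennreal"
 assumes [measurable]: "H \<in> Borel" and r: "0 < r"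
 shows "(NN t. H t * indicator {0<..<r} t) = (NN t. (\<Sum>k. ennreal (1 / 2 ^ k) * H (t / 2 ^ k)) * indicator {r / 2..<r} t)"
proof -
 let ?A = "%k::nat. {r / 2 ^ Suc k..<r / 2 ^ k}"
 have dec: "r / 2 ^ l <= r / 2 ^ k" if "k <= l" for k l :: nat
  using r that by (intro divide_left_mono) (auto intro: power_increasing)
 have disj: "disjoint_family ?A"
  unfolding disjoint_family_on_def
 proof (intro ballI impI)
  fix k l :: nat assume "k ~= l"
  then consider "Suc k <= l" | "Suc l <= k" by linarith
  thus "?A k \<inter> ?A l = {}"
   using dec [of "Suc k" l] dec [of "Suc l" k] by cases auto
 qed
 have un: "(\<Union>k. ?A k) = {0<..<r}"
 proof (intro set_eqI iffI)
  fix t assume "t \<in> (\<Union>k. ?A k)"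
  then obtain k where "r / 2 ^ Suc k <= t" "t < r / 2 ^ k" by auto
  moreover have "0 < r / 2 ^ Suc k" using r by simp
  ultimately show "t \<in> {0<..<r}" using dec [of 0 k] by simp
 next
  fix t assume t: "t \<in> {0<..<r}"
  have "(%k. r / 2 ^ k) ----> 0"
   by (rule LIMSEQ_divide_realpow_zero) simp
  hence "\<forall>\<^sub>F k in sequentially. r / 2 ^ k < t" using t by (intro order_tendstoD) auto
  hence ex: "\<exists>k. r / 2 ^ k <= t" by (meson eventually_happens' less_imp_le sequentially_bot)
  \<comment> \<open>The left end of the dyadic interval of \<open>t\<close>; it is not 0 because
    \<open>t < r\<close>.\<close>
  define k where "k = (LEAST k. r / 2 ^ k <= t)"
  have k: "r / 2 ^ k <= t" unfolding k_def by (rule LeastI_ex [OF ex])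
  hence "k ~= 0" using t by (intro notI) simp
  then obtain l where l: "k = Suc l" by (cases k) auto
  hence "\<not> r / 2 ^ l <= t" using not_less_Least [of l "%k. r / 2 ^ k <= t"] by (simp add: k_def)
  thus "t \<in> (\<Union>k. ?A k)" using k l by (intro UN_I [of l]) auto
 qed
 have "(NN t. H t * indicator {0<..<r} t) = (\<Sum>k. (NN t. H t * indicator (?A k) t))"
  unfolding un [symmetric] by (rule nn_integral_disjoint_family [OF _ _ disj]) auto
 also have "... = (\<Sum>k. (NN t. ennreal (1 / 2 ^ k) * H (t / 2 ^ k) * indicator {r / 2..<r} t))"
 proof (intro suminf_cong)
  fix k :: nat
  have "(NN t. H t * indicator (?A k) t)
    = ennreal (\<bar>1 / 2 ^ k\<bar> ^ DIM(real)) * (NN t. H ((1 / 2 ^ k) *\<^sub>R t) * indicator (?A k) ((1 / 2 ^ k) *\<^sub>R t))"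
   by (rule nn_integral_lborel_scale) auto
  also have "... = ennreal (1 / 2 ^ k) * (NN t. H (t / 2 ^ k) * indicator {r / 2..<r} t)"
  proof -
   have "H ((1 / 2 ^ k) *\<^sub>R t) * indicator (?A k) ((1 / 2 ^ k) *\<^sub>R t) = H (t / 2 ^ k) * indicator {r / 2..<r} t" for t
    by (auto simp: indicator_def field_simps)
   thus ?thesis by simp
  qed
  also have "... = (NN t. ennreal (1 / 2 ^ k) * (H (t / 2 ^ k) * indicator {r / 2..<r} t))"
   by (rule nn_integral_cmult [symmetric]) measurable
  finally show "(NN t. H t * indicator (?A k) t) = (NN t. ennreal (1 / 2 ^ k) * H (t / 2 ^ k) * indicator {r / 2..<r} t)"
   by (simp add: mult.assoc)
 qed
 also have "... = (NN t. (\<Sum>k. ennreal (1 / 2 ^ k) * H (t / 2 ^ k) * indicator {r / 2..<r} t))"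
  by (rule nn_integral_suminf [symmetric]) measurable
 finally show ?thesis by simp
qed

text \<open>Continuous at 0, the value there being the reciprocal of the derivative of
  \<open>2 powr a\<close>.\<close>

definition kappa :: "real => real" where
 "kappa a = (if a = 0 then 1 / ln 2 else a / (2 powr a - 1))"

lemma powr_2_minus_1_ge: "(a::real) * ln 2 <= 2 powr a - 1"
proof -
 have "1 + a * ln 2 <= exp (a * ln 2)" by (rule exp_ge_add_one_self)
 moreover have "2 powr a = exp (a * ln 2)" by (simp add: powr_def)
 ultimately show ?thesis by linarith
qed

lemma kappa_pos: "0 <= a ==> 0 < kappa a"
 using powr_2_minus_1_ge [of a] by (auto simp: kappa_def intro!: divide_pos_pos order_less_le_trans [of 0 "a * ln 2"])

lemma convex_on_powr_2: "convex_on UNIV (%x. 2 powr x :: real)"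
 by (rule convex_on_realI [where f' = "%x. 2 powr x * ln 2"])
  (auto intro!: derivative_eq_intros mult_right_mono simp: field_simps)

text \<open>\<open>1 / kappa\<close> is the slope of the chord of the convex function
  \<open>2 powr x\<close> from 0 to \<open>a\<close>, and such slopes increase. At 0 the chord is
  replaced by the tangent.\<close>

lemma kappa_antimono:
 assumes "0 <= b" "b <= a" shows "kappa a <= kappa b"
proof (cases "b = 0")
 case True
 have "a / (2 powr a - 1) <= 1 / ln 2" if "a ~= 0"
 proof -
  have "0 < a" using that assms True by simp
  hence "0 < a * ln 2" by simp
  hence "a / (2 powr a - 1) <= a / (a * ln 2)"
   using powr_2_minus_1_ge [of a] \<open>0 < a\<close> by (intro divide_left_mono mult_pos_pos) (linarith | simp)+
  thus ?thesis using that by simp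
 qed
 thus ?thesis using True by (auto simp: kappa_def)
next
 case False
 hence b: "0 < b" "0 < a" using assms by auto
 have "2 powr ((1 - b / a) * 0 + (b / a) * a) <= (1 - b / a) * 2 powr 0 + (b / a) * 2 powr a"
  using convex_onD [OF convex_on_powr_2, of "b / a" 0 a] b assms by simp
 hence "2 powr b - 1 <= (b / a) * (2 powr a - 1)" using b by (simp add: algebra_simps)
 hence "a * (2 powr b - 1) <= b * (2 powr a - 1)" using b by (simp add: field_simps)
 moreover have "0 < 2 powr b - 1" "0 < 2 powr a - 1"
  using powr_2_minus_1_ge [of a] powr_2_minus_1_ge [of b] b by (auto intro: order_less_le_trans [of 0 "_ * ln 2"])
 ultimately show ?thesis using b by (simp add: kappa_def divide_le_eq le_divide_eq mult.commute)
qed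

lemma isCont_kappa: "isCont kappa a"
proof (cases "a = 0")
 case True
 have "((%x. 2 powr x) has_real_derivative ln 2) (at 0)"
  by (auto intro!: derivative_eq_intros)
 hence "((%x. (2 powr x - 1) / x) ---> ln 2) (at (0::real))"
  by (simp add: has_field_derivative_iff)
 from tendsto_inverse [OF this] have "((%x. x / (2 powr x - 1)) ---> 1 / ln 2) (at (0::real))"
  by (simp add: inverse_eq_divide)
 hence "(kappa ---> 1 / ln 2) (at 0)"
  by (rule Lim_transform_eventually) (auto simp: kappa_def eventually_at_filter)
 hence "(kappa ---> kappa 0) (at 0)" by (simp add: kappa_def)
 thus ?thesis using True by (simp add: isCont_def)
next
 case False
 have "\<forall>\<^sub>F x in nhds a. x ~= 0" using False by (rule t1_space_nhds)
 hence "\<forall>\<^sub>F x in nhds a. kappa x = x / (2 powr x - 1)"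
  by eventually_elim (simp add: kappa_def)
 moreover have "2 powr a - 1 ~= 0" using False by (simp add: powr_eq_one_iff_gen)
 hence "isCont (%x. x / (2 powr x - 1)) a" by (intro continuous_intros) auto
 ultimately show ?thesis by (subst isCont_cong)
qed

definition short_F :: "real => ('a::euclidean_space => real) => real => real => ennreal" where
 "short_F q u r a = ennreal (1 / q) * (ennreal (kappa a) * short_G q u r a)"

text \<open>Scaling the \<open>k\<close>-th dyadic interval to the outermost one produces the factor
  \<open>x ^ k\<close> with \<open>x = 2 powr (- a)\<close> in front of the quotient
  \<open>U(t) / t^q\<close> at scale \<open>t / 2 ^ k\<close>; \<open>geometric_average_eq\<close>
  then turns the quotients into their increments.\<close>

lemma short_range_eq:
 assumes [measurable]: "u \<in> Borel" and q: "1 <= q" and r: "0 < r" and s: "s < 1"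
 shows "short_range (ennreal q) s u r = rpow (short_F q u r ((1 - s) * q)) (1 / q)"
proof -
 define a where "a = (1 - s) * q"
 have a: "0 < a" using q s by (simp add: a_def)
 define x where "x = 2 powr (- a)"
 have x: "0 < x" "x < 1" using a by (auto simp: x_def powr_less_one)
 \<comment> \<open>The \<open>q\<close>-th power of the prefactor in the definition of the
   short-range term.\<close>
 define c where "c = (1 - s) / (2 * r) powr a"
 have c: "0 < c" using s r by (simp add: c_def)
 have "c powr (1 / q) = (1 - s) powr (1 / q) / (2 * r) powr (1 - s)"
  using s r q by (simp add: c_def powr_divide powr_powr a_def)
 hence 1: "short_range (ennreal q) s u r = rpow (ennreal c * U_integral s (ennreal q) u {0<..<r}) (1 / q)"
  using s q c by (simp add: short_range_def recip_ennreal rpow_cmult)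
 let ?H = "%t. U_fun q u t / ennreal (t powr (1 + s * q))"
 let ?f = "%t k. ennreal ((t / 2 ^ k) powr (- q)) * U_fun q u (t / 2 ^ k)"
 let ?G = "%t. (\<Sum>j. ennreal (x ^ j) * quot_incr q u t j) * (ennreal (t powr (a - 1)) * indicator {r / 2..<r} t)"
 have [measurable]: "(%t. quot_incr q u t j) \<in> Borel" for j
  unfolding quot_incr_def by measurable
 have "U_integral s (ennreal q) u {0<..<r} = (NN t. ?H t * indicator {0<..<r} t)"
  using q by (simp add: U_integral_def)
 also have "... = (NN t. (\<Sum>k. ennreal (1 / 2 ^ k) * ?H (t / 2 ^ k)) * indicator {r / 2..<r} t)"
  by (rule nn_integral_dyadic_decomposition [OF _ r]) measurable
 also have "... = (NN t. ennreal (1 / (1 - x)) * ?G t)"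
 proof (rule nn_integral_cong)
  fix t :: real
  show "(\<Sum>k. ennreal (1 / 2 ^ k) * ?H (t / 2 ^ k)) * indicator {r / 2..<r} t
    = ennreal (1 / (1 - x)) * ?G t"
  proof (cases "r / 2 <= t & t < r")
   case True
   hence t: "0 < t" using r by linarith
   have "ennreal (1 / 2 ^ k) * ?H (t / 2 ^ k) = ennreal (x ^ k) * ?f t k * ennreal (t powr (a - 1))" for k
   proof -
    have tk: "0 < t / 2 ^ k" using t by simp
    have "1 / 2 ^ k * (t / 2 ^ k) powr (- (1 + s * q)) = x ^ k * (t / 2 ^ k) powr (- q) * t powr (a - 1)"
    proof -
     have "(t / 2 ^ k) powr (- (1 + s * q)) = (t / 2 ^ k) powr (- q) * (t / 2 ^ k) powr (a - 1)"
      unfolding powr_add [symmetric] by (simp add: a_def algebra_simps)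
     also have "(t / 2 ^ k) powr (a - 1) = t powr (a - 1) * (x ^ k * 2 ^ k)"
     proof -
      have "(t / 2 ^ k) powr (a - 1) = t powr (a - 1) * 2 powr (real k - real k * a)"
       using t by (simp add: powr_divide powr_realpow [symmetric] powr_powr powr_diff right_diff_distrib)
      also have "2 powr (real k - real k * a) = x ^ k * 2 ^ k"
       by (simp add: x_def powr_realpow [symmetric] powr_powr powr_add [symmetric] mult.commute)
      finally show ?thesis .
     qed
     finally show ?thesis by simp
    qed
    hence "ennreal (1 / 2 ^ k) * ennreal ((t / 2 ^ k) powr (- (1 + s * q))) = ennreal (x ^ k) * ennreal ((t / 2 ^ k) powr (- q)) * ennreal (t powr (a - 1))"
     using x by (simp add: ennreal_mult' [symmetric] less_imp_le)
    thus ?thesis unfolding divide_ennreal_powr [OF tk] by (simp add: mult_ac) (metis mult.assoc mult.commute)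
   qed
   hence "(\<Sum>k. ennreal (1 / 2 ^ k) * ?H (t / 2 ^ k)) = (\<Sum>k. ennreal (x ^ k) * ?f t k) * ennreal (t powr (a - 1))"
    by simp
   moreover have "(\<Sum>k. ennreal (x ^ k) * ?f t k) = ennreal (1 / (1 - x)) * (\<Sum>j. ennreal (x ^ j) * quot_incr q u t j)"
   proof -
    have "ennreal (1 / (1 - x)) * (ennreal (1 - x) * (\<Sum>k. ennreal (x ^ k) * ?f t k)) = (ennreal (1 / (1 - x)) * ennreal (1 - x)) * (\<Sum>k. ennreal (x ^ k) * ?f t k)"
     by (simp only: mult.assoc)
    also have "ennreal (1 / (1 - x)) * ennreal (1 - x) = 1"
     using x by (simp add: ennreal_mult' [symmetric])
    finally show ?thesis using quot_incr_sums(1) [OF assms(1) q t, of x] x by simp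
   qed
   ultimately show ?thesis using True by (simp add: mult.assoc)
  qed (auto simp: indicator_def)
 qed
 finally have "ennreal c * U_integral s (ennreal q) u {0<..<r} = ennreal c * (NN t. ennreal (1 / (1 - x)) * ?G t)"
  by simp
 also have "... = (NN t. ennreal c * (ennreal (1 / (1 - x)) * ?G t))"
  by (rule nn_integral_cmult [symmetric]) measurable
 also have "... = (NN t. ennreal (1 / q * kappa a) * ((\<Sum>j. ennreal ((2 powr (- a)) ^ j) * quot_incr q u t j) * (ennreal ((t / r) powr a / t) * indicator {r / 2..<r} t)))"
 proof (rule nn_integral_cong)
  fix t :: real
  show "ennreal c * (ennreal (1 / (1 - x)) * ?G t)
   = ennreal (1 / q * kappa a) * ((\<Sum>j. ennreal ((2 powr (- a)) ^ j) * quot_incr q u t j) * (ennreal ((t / r) powr a / t) * indicator {r / 2..<r} t))"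
  proof (cases "r / 2 <= t & t < r")
   case True
   hence t: "0 < t" using r by linarith
   have pos: "0 < 2 powr a - 1" using powr_2_minus_1_ge [of a] a by (auto intro: order_less_le_trans [of 0 "a * ln 2"])
   have "1 - x = (2 powr a - 1) / 2 powr a" by (simp add: x_def powr_minus_divide diff_divide_distrib)
   hence "c * (1 / (1 - x)) = (a / q) / ((2 powr a - 1) * r powr a)"
    using r q pos by (simp add: c_def powr_mult a_def)
   also have "... * t powr (a - 1) = 1 / q * kappa a * ((t / r) powr a / t)"
    using a t r by (simp add: kappa_def powr_divide powr_diff)
   finally have "c * (1 / (1 - x)) * t powr (a - 1) = 1 / q * kappa a * ((t / r) powr a / t)" .
   moreover have "ennreal c * ennreal (1 / (1 - x)) * ennreal (t powr (a - 1)) = ennreal (c * (1 / (1 - x)) * t powr (a - 1))"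
   proof -
    have "ennreal c * ennreal (1 / (1 - x)) = ennreal (c * (1 / (1 - x)))"
     using c by (intro ennreal_mult' [symmetric]) simp
    moreover have "... * ennreal (t powr (a - 1)) = ennreal (c * (1 / (1 - x)) * t powr (a - 1))"
     using c x by (intro ennreal_mult' [symmetric]) simp
    ultimately show ?thesis by (simp only:)
   qed
   moreover have "ennreal (1 / q * kappa a) * ennreal ((t / r) powr a / t) = ennreal (1 / q * kappa a * ((t / r) powr a / t))"
    using q kappa_pos [of a] a by (subst ennreal_mult') simp_all
   ultimately have "ennreal c * ennreal (1 / (1 - x)) * ennreal (t powr (a - 1)) = ennreal (1 / q * kappa a) * ennreal ((t / r) powr a / t)"
    by (simp only:)
   note eq = this
   let ?S = "\<Sum>j. ennreal (x ^ j) * quot_incr q u t j"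
   have "ennreal c * (ennreal (1 / (1 - x)) * (?S * ennreal (t powr (a - 1)))) = (ennreal c * ennreal (1 / (1 - x)) * ennreal (t powr (a - 1))) * ?S"
    by (simp only: mult_ac)
   also have "... = ennreal (1 / q * kappa a) * (?S * ennreal ((t / r) powr a / t))"
    unfolding eq by (simp only: mult_ac)
   finally show ?thesis using True by (simp add: x_def [symmetric])
  qed (auto simp: indicator_def)
 qed
 also have "... = ennreal (1 / q * kappa a) * short_G q u r a"
  unfolding short_G_eq [OF assms(1) r] by (rule nn_integral_cmult) measurable
 also have "... = short_F q u r a"
  unfolding short_F_def mult.assoc [symmetric] using q by (subst ennreal_mult') simp_all
 finally show ?thesis unfolding 1 a_def by simp
qed

lemma short_range_1_eq:
 assumes "u \<in> Borel" and "1 <= q"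
  and "(NN x. apow q (u x)) < \<infinity>" and "0 < r"
  and "\<not> (q = 1 & u \<in> BV_space - sobolev_space1 1)"
 shows "short_range (ennreal q) 1 u r = rpow (short_F q u r 0) (1 / q)"
 unfolding short_range_def short_F_def short_G_0 [OF assms(1,2,4)] kappa_def
 using sobolev_seminorm_1_eq_U_sup [OF assms] by simp

lemma short_F_antimono:
 assumes "0 <= b" "b <= a" "0 < r"
 shows "short_F q u r a <= short_F q u r b"
proof -
 have "short_G q u r a <= short_G q u r b"
  unfolding short_G_def using dyadic_weight_bounds [OF assms(3)] assms
  by (intro nn_integral_mono mult_right_mono ennreal_leI powr_mono') (auto simp: less_imp_le)
 thus ?thesis unfolding short_F_def
  using kappa_antimono [OF assms(1,2)] by (intro mult_left_mono mult_mono ennreal_leI) auto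
qed

lemma short_F_right:
 assumes "u \<in> Borel" "1 <= q" "0 < r" "0 <= a"
 shows "(short_F q u r ---> short_F q u r a) (at_right a)"
proof -
 have "(short_G q u r ---> short_G q u r a) (at_right a)"
  unfolding short_G_def using dyadic_weight_bounds [OF assms(3)]
  by (intro powr_Lim_nn_integral_right short_G_measurable [OF assms(1)]) auto
 moreover have "((%a. ennreal (kappa a)) ---> ennreal (kappa a)) (at_right a)"
  using isCont_kappa [of a] by (intro tendsto_ennrealI) (simp add: isCont_def filterlim_at_split)
 ultimately show ?thesis unfolding short_F_def
  using assms kappa_pos [of a] by (intro tendsto_mult_ennreal_pos tendsto_const) auto
qed

lemma short_F_left:
 assumes "u \<in> Borel" "1 <= q" "0 < r" "0 <= b" "b < a" "short_F q u r b < \<infinity>"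
 shows "(short_F q u r ---> short_F q u r a) (at_left a)"
proof -
 have "short_G q u r b < \<infinity>"
  using assms kappa_pos [of b] by (auto simp: short_F_def ennreal_mult_less_top)
 hence "(short_G q u r ---> short_G q u r a) (at_left a)"
  unfolding short_G_def using dyadic_weight_bounds [OF assms(3)]
  by (intro powr_Lim_nn_integral_left short_G_measurable [OF assms(1)]) (use \<open>b < a\<close> in auto)
 moreover have "((%a. ennreal (kappa a)) ---> ennreal (kappa a)) (at_left a)"
  using isCont_kappa [of a] by (intro tendsto_ennrealI) (simp add: isCont_def filterlim_at_split)
 ultimately show ?thesis unfolding short_F_def
  using assms kappa_pos [of a] by (intro tendsto_mult_ennreal_pos tendsto_const) auto
qed

text \<open>The point \<open>b\<close> of \<open>D\<close> on the side considered is handed to the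
  hypotheses: for right limits of the short-range term it supplies a finite value to dominate
  with.\<close>

lemma continuous_on_one_sided:
 fixes f :: "real => 'b::topological_space"
 assumes left: "!!s b. s \<in> D ==> b \<in> D ==> b < s ==> (f ---> f s) (at_left s)"
  and right: "!!s b. s \<in> D ==> b \<in> D ==> s < b ==> (f ---> f s) (at_right s)"
 shows "continuous_on D f"
 unfolding continuous_on_def
proof
 fix s assume s: "s \<in> D"
 have l: "(f ---> f s) (at s within D \<inter> {..<s})"
 proof (cases "D \<inter> {..<s} = {}")
  case False
  hence "(f ---> f s) (at_left s)" using left s by auto
  thus ?thesis by (rule tendsto_within_subset) auto
 qed simp
 have r: "(f ---> f s) (at s within D \<inter> {s<..})"
 proof (cases "D \<inter> {s<..} = {}")
  case False
  hence "(f ---> f s) (at_right s)" using right s by auto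
  thus ?thesis by (rule tendsto_within_subset) auto
 qed simp
 have "(f ---> f s) (at s within ((D \<inter> {..<s}) \<union> (D \<inter> {s<..})))"
  using l r by (simp add: at_within_union filterlim_sup)
 moreover have "at s within D = at s within ((D \<inter> {..<s}) \<union> (D \<inter> {s<..}))"
  by (rule at_within_nhd [of s UNIV]) auto
 ultimately show "(f ---> f s) (at s within D)" by simp
qed

lemma filterlim_mult_right_at_left:
 fixes q :: real assumes "0 < q"
 shows "filterlim (%\<tau>. \<tau> * q) (at_left (s * q)) (at_left s)" "filterlim (%\<tau>. \<tau> * q) (at_right (s * q)) (at_right s)"
  "filterlim (%\<tau>. (1 - \<tau>) * q) (at_right ((1 - s) * q)) (at_left s)" "filterlim (%\<tau>. (1 - \<tau>) * q) (at_left ((1 - s) * q)) (at_right s)"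
 using assms unfolding filterlim_at
 by (auto intro!: tendsto_intros simp: eventually_at_filter)

lemma ennreal_top_cases:
 fixes p :: ennreal
 assumes "1 <= p" obtains "p = \<infinity>" | q where "1 <= q" "p = ennreal q"
 using assms by (cases p) auto

lemma short_range_exceptional:
 assumes "u \<in> BV_space - sobolev_space1 1" shows "short_range 1 1 u r = \<infinity>"
 using assms by (simp add: short_range_def sobolev_seminorm_def Let_def recip_def)

lemma short_range_finite_exponent:
 assumes u: "u \<in> Borel" and q: "1 <= q"
  and Lq: "(NN x. apow q (u x)) < \<infinity>" and r: "0 < r"
 shows "continuous_on {s \<in> {0..1}. short_range (ennreal q) s u r < \<infinity>} (%s. short_range (ennreal q) s u r)"
  and "s \<in> {0<..1} ==> \<not> (q = 1 & s = 1 & u \<in> BV_space - sobolev_space1 1) ==>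
   ((%\<tau>. short_range (ennreal q) \<tau> u r) ---> short_range (ennreal q) s u r) (at_left s)"
  and "0 <= \<eta> ==> \<eta> < s ==> s <= 1 ==> short_range (ennreal q) \<eta> u r <= short_range (ennreal q) s u r"
proof -
 let ?L = "%s. short_range (ennreal q) s u r" and ?h = "%s. rpow (short_F q u r ((1 - s) * q)) (1 / q)"
 have q0: "0 < q" using q by simp
 have eq: "?L s = ?h s" if "s <= 1" "\<not> (q = 1 & s = 1 & u \<in> BV_space - sobolev_space1 1)" for s
  using that short_range_eq [OF u q r, of s] short_range_1_eq [OF u q Lq r] by (cases "s = 1") auto
 have exc: "?L s = \<infinity>" if "q = 1 & s = 1 & u \<in> BV_space - sobolev_space1 1" for s
  using that short_range_exceptional [of u r] by simp
 have left: "(?L ---> ?L s) (at_left s)"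
  if s: "s \<in> {0<..1}" "\<not> (q = 1 & s = 1 & u \<in> BV_space - sobolev_space1 1)" for s
 proof -
  \<comment> \<open>Left limits in \<open>s\<close> are right limits in
    \<open>a = (1 - s) * q\<close>, where monotone convergence applies.\<close>
  have "((%s. short_F q u r ((1 - s) * q)) ---> short_F q u r ((1 - s) * q)) (at_left s)"
   by (rule filterlim_compose [OF short_F_right filterlim_mult_right_at_left(3)]) (use s u q r in auto)
  hence "(?h ---> ?h s) (at_left s)" using q0 by (intro tendsto_rpow) auto
  moreover have "\<forall>\<^sub>F \<tau> in at_left s. ?h \<tau> = ?L \<tau>"
   using s by (auto simp: eventually_at_filter intro!: always_eventually eq [symmetric])
  ultimately have "(?L ---> ?h s) (at_left s)" by (rule Lim_transform_eventually)
  thus ?thesis using eq [OF _ s(2)] s by simp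
 qed
 show "s \<in> {0<..1} ==> \<not> (q = 1 & s = 1 & u \<in> BV_space - sobolev_space1 1) ==> (?L ---> ?L s) (at_left s)" by (rule left)
 have mono: "?L \<eta> <= ?L s" if "0 <= \<eta>" "\<eta> < s" "s <= 1" for \<eta> s
 proof (cases "q = 1 & s = 1 & u \<in> BV_space - sobolev_space1 1")
  case True thus ?thesis using exc [of s] by simp
 next
  case False
  have "?h \<eta> <= ?h s"
   using that q0 r by (intro rpow_mono short_F_antimono mult_right_mono) auto
  thus ?thesis using that False eq [of \<eta>] eq [of s] by simp
 qed
 thus "0 <= \<eta> ==> \<eta> < s ==> s <= 1 ==> ?L \<eta> <= ?L s" .
 show "continuous_on {s \<in> {0..1}. ?L s < \<infinity>} ?L"
 proof (rule continuous_on_one_sided)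
  fix s b assume *: "s \<in> {s \<in> {0..1}. ?L s < \<infinity>}" "b \<in> {s \<in> {0..1}. ?L s < \<infinity>}"
  hence ne: "\<not> (q = 1 & s = 1 & u \<in> BV_space - sobolev_space1 1)" "\<not> (q = 1 & b = 1 & u \<in> BV_space - sobolev_space1 1)"
   using exc [of s] exc [of b] by (force, force)
  show "(?L ---> ?L s) (at_left s)" if "b < s" using * that by (intro left ne) auto
  show "(?L ---> ?L s) (at_right s)" if "s < b"
  proof -
   \<comment> \<open>The point \<open>b\<close> beyond \<open>s\<close> has the smaller parameter,
     and its finite value dominates those in between.\<close>
   have "short_F q u r ((1 - b) * q) < \<infinity>"
    using * eq [OF _ ne(2)] by (simp add: rpow_less_top_iff)
   hence "((%s. short_F q u r ((1 - s) * q)) ---> short_F q u r ((1 - s) * q)) (at_right s)"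
    by (intro filterlim_compose [OF short_F_left [OF u q r, of "(1 - b) * q"] filterlim_mult_right_at_left(4)]) (use * that q0 in auto)
   hence "(?h ---> ?h s) (at_right s)" using q0 by (intro tendsto_rpow) auto
   moreover have "\<forall>\<^sub>F \<tau> in at_right s. ?h \<tau> = ?L \<tau>"
    unfolding eventually_at_right_field using that * by (intro exI [of _ b]) (auto intro!: eq [symmetric])
   ultimately have "(?L ---> ?h s) (at_right s)" by (rule Lim_transform_eventually)
   thus ?thesis using eq [OF _ ne(1)] * by simp
  qed
 qed
qed

section \<open>Long-range interactions\<close>

text \<open>The Pareto law on \<open>(r, \<infinity>)\<close> is the image of the exponential law
  under \<open>r * exp (x / b)\<close>. This couples all exponents on one probability space: for
  fixed \<open>x\<close> the radius decreases as \<open>b\<close> grows.\<close>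

lemma nn_integral_pareto:
 fixes f :: "real => ennreal"
 assumes [measurable]: "f \<in> Borel" and b: "0 < b" and r: "0 < r"
 shows "(NN t. f t * (ennreal (b * r powr b * t powr (- 1 - b)) * indicator {r<..} t))
  = (NN x. f (r * exp (x / b)) * (ennreal (exp (- x)) * indicator {0<..} x))"
proof -
 define g where "g = (%t. f t * (ennreal (b * r powr b * t powr (- 1 - b)) * indicator {r<..} t))"
 have [measurable]: "g \<in> Borel" unfolding g_def by measurable
 have "(NN t. g t) = (\<integral>\<^sup>+t\<in>{0<..}. g t \<partial>lborel)"
  using r by (intro nn_integral_cong) (auto simp: g_def indicator_def)
 also have "... = (NN y. g (exp y) * ennreal (exp y))"
  by (rule nn_integral_exp_substitution) measurable
 also have "... = (NN y. g (exp (y + ln r)) * ennreal (exp (y + ln r)))"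
  by (rule nn_integral_lborel_shift [symmetric]) measurable
 also have "... = ennreal (\<bar>1 / b\<bar> ^ DIM(real)) * (NN x. g (exp ((1 / b) *\<^sub>R x + ln r)) * ennreal (exp ((1 / b) *\<^sub>R x + ln r)))"
  by (rule nn_integral_lborel_scale) (use b in auto)
 also have "... = (NN x. ennreal (1 / b) * (g (exp ((1 / b) *\<^sub>R x + ln r)) * ennreal (exp ((1 / b) *\<^sub>R x + ln r))))"
  using b by (subst nn_integral_cmult) auto
 also have "... = (NN x. f (r * exp (x / b)) * (ennreal (exp (- x)) * indicator {0<..} x))"
 proof (rule nn_integral_cong)
  fix x :: real
  define t where "t = r * exp (x / b)"
  have t: "exp ((1 / b) *\<^sub>R x + ln r) = t" "0 < t" using r by (auto simp: t_def exp_add)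
  have ind: "indicator {r<..} t = (indicator {0<..} x :: ennreal)" using r b by (auto simp: t_def indicator_def zero_less_divide_iff)
  have "t powr (- 1 - b) * t = t powr (- b)" using t by (simp add: powr_diff powr_minus field_simps)
  moreover have "t powr (- b) = r powr (- b) * exp (- x)"
   using r b by (simp add: t_def powr_mult powr_def [of "exp _"])
  moreover have "r powr b * r powr (- b) = 1" using r by (simp add: powr_minus)
  ultimately have "1 / b * (b * r powr b * t powr (- 1 - b)) * t = exp (- x)"
   using b by (simp add: mult.assoc)
  hence "ennreal (exp (- x)) = ennreal (1 / b) * ennreal (b * r powr b * t powr (- 1 - b)) * ennreal t"
   using b t r by (simp add: ennreal_mult' [symmetric])
  thus "ennreal (1 / b) * (g (exp ((1 / b) *\<^sub>R x + ln r)) * ennreal (exp ((1 / b) *\<^sub>R x + ln r))) = f (r * exp (x / b)) * (ennreal (exp (- x)) * indicator {0<..} x)"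
   unfolding t(1) g_def ind t_def [symmetric] by (simp only: mult_ac)
 qed
 finally show ?thesis by (simp add: g_def)
qed

lemma nn_integral_exp_tail: "(NN x. ennreal (exp (- x)) * indicator {0<..} x) = 1"
proof -
 have "(NN x. 1 * (ennreal (1 * 1 powr 1 * x powr (- 1 - 1)) * indicator {1<..} x)) = (NN x. 1 * (ennreal (exp (- x)) * indicator {0<..} x))"
  by (rule nn_integral_pareto) auto
 moreover have "(NN x. 1 * (ennreal (1 * 1 powr 1 * x powr (- 1 - 1)) * indicator {1<..} x)) = (NN x. ennreal (x powr (- 1 - 1)) * indicator {1..} x)"
  by (rule nn_integral_cong_AE, rule eventually_mono [OF AE_lborel_singleton [of 1]]) (auto simp: indicator_def)
 ultimately show ?thesis using nn_integral_powr_tail [of 1 1] by simp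
qed

text \<open>The value at \<open>b = 0\<close> is the limit of \<open>U\<close> at infinity, where
  the mass of the Pareto law escapes; it corresponds to the seminorm of order 0.\<close>

definition long_V :: "real => ('a::euclidean_space => real) => real => real => ennreal" where
 "long_V q u r b = (if b = 0 then ennreal (2 * sphere_area DIM('a)) * (NN x. apow q (u x))
  else (NN t. U_fun q u t * (ennreal (b * r powr b * t powr (- 1 - b)) * indicator {r<..} t)))"

lemma long_V_pos:
 assumes "u \<in> Borel" "0 < b" "0 < r"
 shows "long_V q u r b = (NN x. U_fun q u (r * exp (x / b)) * (ennreal (exp (- x)) * indicator {0<..} x))"
 using assms by (simp add: long_V_def nn_integral_pareto)

lemma U_integral_eq:
 assumes "0 < q" "!!t. t \<in> I ==> 0 < t"
 shows "U_integral s (ennreal q) u I = (NN t. U_fun q u t * (ennreal (t powr (- 1 - s * q)) * indicator I t))"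
proof -
 have "U_fun q u t / ennreal (t powr (1 + s * q)) * indicator I t = U_fun q u t * (ennreal (t powr (- 1 - s * q)) * indicator I t)" for t
  using assms(2) [of t] divide_ennreal_powr [of t "U_fun q u t" "1 + s * q"] by (cases "t \<in> I") (auto simp: algebra_simps)
 thus ?thesis using assms(1) by (simp add: U_integral_def)
qed

lemma rpow_cmult_1q:
 assumes "0 < q" "0 <= s" "0 < r"
 shows "ennreal (s powr (1 / q) * r powr s) * rpow y (1 / q) = rpow (ennreal (1 / q) * (ennreal (s * q * r powr (s * q)) * y)) (1 / q)"
proof -
 have "ennreal (1 / q) * (ennreal (s * q * r powr (s * q)) * y) = ennreal (s * r powr (s * q)) * y"
  unfolding mult.assoc [symmetric] using assms by (subst ennreal_mult' [symmetric]) simp_all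
 moreover have "(s * r powr (s * q)) powr (1 / q) = s powr (1 / q) * r powr s"
  using assms by (simp add: powr_mult powr_powr)
 ultimately show ?thesis using assms by (simp add: rpow_cmult)
qed

lemma long_range_eq:
 fixes u :: "'a::euclidean_space => real"
 assumes [measurable]: "u \<in> Borel" and q: "1 <= q" and r: "0 < r" and s: "0 <= s"
 shows "long_range (ennreal q) s u r = rpow (ennreal (1 / q) * long_V q u r (s * q)) (1 / q)"
proof (cases "s = 0")
 case True
 have "ennreal (1 / q) * long_V q u r 0 = ennreal (2 * sphere_area DIM('a) / q) * (NN x. apow q (u x))"
  unfolding long_V_def using q by (simp add: mult.assoc [symmetric] ennreal_mult' [symmetric])
 thus ?thesis using True q by (simp add: long_range_def sobolev_seminorm_def Let_def recip_ennreal rpow_Lp_norm nn_integral_completion)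
next
 case False
 have "ennreal (s * q * r powr (s * q)) * U_integral s (ennreal q) u {r<..} = long_V q u r (s * q)"
 proof -
  have "U_integral s (ennreal q) u {r<..} = (NN t. U_fun q u t * (ennreal (t powr (- 1 - s * q)) * indicator {r<..} t))"
   using q r by (intro U_integral_eq) auto
  hence "ennreal (s * q * r powr (s * q)) * U_integral s (ennreal q) u {r<..}
    = (NN t. ennreal (s * q * r powr (s * q)) * (U_fun q u t * (ennreal (t powr (- 1 - s * q)) * indicator {r<..} t)))"
   by (simp add: nn_integral_cmult)
  also have "... = (NN t. U_fun q u t * (ennreal (s * q * r powr (s * q) * t powr (- 1 - s * q)) * indicator {r<..} t))"
   using s q by (intro nn_integral_cong) (simp add: ennreal_mult' mult_ac)
  finally show ?thesis using False q by (simp add: long_V_def)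
 qed
 thus ?thesis using False q s r
  by (simp add: long_range_def recip_ennreal rpow_cmult_1q)
qed

lemma U_fun_le_long_V:
 fixes u :: "'a::euclidean_space => real"
 assumes "u \<in> Borel" "1 <= q"
 shows "U_fun q u t <= ennreal (2 powr q) * long_V q u r 0"
proof -
 have "ennreal (2 powr q * sphere_area DIM('a)) <= ennreal (2 powr q * (2 * sphere_area DIM('a)))"
  using sphere_area_pos [of "DIM('a)"] by (intro ennreal_leI) simp
 hence "ennreal (2 powr q * sphere_area DIM('a)) * (NN x. apow q (u x)) <= ennreal (2 powr q) * long_V q u r 0"
  unfolding long_V_def by (simp add: mult.assoc [symmetric] ennreal_mult' [symmetric] mult_right_mono)
 thus ?thesis using U_fun_le [OF assms, of t] by (rule order_trans [rotated])
qed

lemma long_V_finite: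
 fixes u :: "'a::euclidean_space => real"
 assumes [measurable]: "u \<in> Borel" and q: "1 <= q" and r: "0 < r"
  and Lq: "(NN x. apow q (u x)) < \<infinity>" and b: "0 <= b"
 shows "long_V q u r b <= ennreal (2 powr q) * long_V q u r 0" "long_V q u r b < \<infinity>"
proof -
 note le = U_fun_le_long_V [OF assms(1) q]
 show *: "long_V q u r b <= ennreal (2 powr q) * long_V q u r 0"
 proof (cases "b = 0")
  case True
  have "1 * long_V q u r 0 <= ennreal (2 powr q) * long_V q u r 0"
   using q ge_one_powr_ge_zero [of 2 q] by (intro mult_right_mono) (auto simp: ennreal_leI simp flip: ennreal_1)
  thus ?thesis using True by simp
 next
  case False
  hence b': "0 < b" using b by simp
  have "long_V q u r b <= (NN x. ennreal (2 powr q) * long_V q u r 0 * (ennreal (exp (- x)) * indicator {0<..} x))"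
   unfolding long_V_pos [OF assms(1) b' r] by (intro nn_integral_mono mult_right_mono le) simp
  also have "... = ennreal (2 powr q) * long_V q u r 0"
   by (subst nn_integral_cmult) (simp_all add: nn_integral_exp_tail)
  finally show ?thesis .
 qed
 have "long_V q u r 0 < \<infinity>" using Lq by (simp add: long_V_def ennreal_mult_less_top)
 thus "long_V q u r b < \<infinity>" using le_less_trans [OF *] by (simp add: ennreal_mult_less_top)
qed

text \<open>For \<open>b > 0\<close> this is \<open>b\<close> times the integral of a power of
  \<open>r / t\<close>. At \<open>b = 0\<close> the coupling is used instead: the radii
  \<open>r * exp (x / b)\<close> tend to infinity for each \<open>x > 0\<close>, and the uniform
  bound on \<open>U\<close> dominates.\<close>

lemma long_V_continuous:
 fixes u :: "'a::euclidean_space => real"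
 assumes [measurable]: "u \<in> Borel" and q: "1 <= q" and r: "0 < r"
  and Lq: "(NN x. apow q (u x)) < \<infinity>"
 shows "0 < b ==> (long_V q u r ---> long_V q u r b) (at_left b)"
  and "0 <= b ==> (long_V q u r ---> long_V q u r b) (at_right b)"
proof -
 define w where "w = (%t. if r < t then r / t else 1)"
 define f where "f = (%t. U_fun q u t * (ennreal (1 / t) * indicator {r<..} t))"
 let ?g = "%b. NN t. ennreal (w t powr b) * f t"
 have [measurable]: "w \<in> borel_measurable lborel" "f \<in> borel_measurable lborel"
  unfolding w_def f_def by measurable
 have w: "0 < w t" "w t <= 1" for t using r by (auto simp: w_def)
 have eq: "long_V q u r b = ennreal b * ?g b" if b: "0 < b" for b
 proof -
  have "long_V q u r b = (NN t. ennreal b * (ennreal (w t powr b) * f t))"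
   unfolding long_V_def using b
  proof (simp, intro nn_integral_cong)
   fix t
   show "U_fun q u t * (ennreal (b * r powr b * t powr (- 1 - b)) * indicator {r<..} t) = ennreal b * (ennreal (w t powr b) * f t)"
   proof (cases "r < t")
    case True
    hence "b * r powr b * t powr (- 1 - b) = b * (w t powr b * (1 / t))"
     using r by (simp add: w_def powr_divide powr_diff powr_minus_divide)
    hence "ennreal (b * r powr b * t powr (- 1 - b)) = ennreal b * (ennreal (w t powr b) * ennreal (1 / t))"
     using b by (simp only: ennreal_mult' less_imp_le powr_ge_zero)
    thus ?thesis by (simp add: f_def mult_ac)
   qed (simp add: f_def)
  qed
  also have "... = ennreal b * ?g b"
   by (rule nn_integral_cmult) measurable
  finally show ?thesis .
 qed
 have lim: "((%b. ennreal b * ?g b) ---> long_V q u r b) (at_left b)"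
   "((%b. ennreal b * ?g b) ---> long_V q u r b) (at_right b)" if b: "0 < b" for b
 proof -
  \<comment> \<open>Finiteness at half the exponent gives the majorant for left limits.\<close>
  have "ennreal (b / 2) * ?g (b / 2) < \<infinity>"
   using long_V_finite(2) [OF assms(1) q r Lq, of "b / 2"] eq [of "b / 2"] b by simp
  hence fin: "?g (b / 2) < \<infinity>"
   using b by (auto simp: ennreal_mult_less_top)
  show "((%b. ennreal b * ?g b) ---> long_V q u r b) (at_left b)"
   unfolding eq [OF b] using b by (intro tendsto_mult_ennreal_pos powr_Lim_nn_integral_left [where b = "b / 2"] w fin tendsto_intros) auto
  show "((%b. ennreal b * ?g b) ---> long_V q u r b) (at_right b)"
   unfolding eq [OF b] using b by (intro tendsto_mult_ennreal_pos powr_Lim_nn_integral_right w tendsto_intros) auto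
 qed
 show "(long_V q u r ---> long_V q u r b) (at_left b)" if b: "0 < b"
 proof (rule Lim_transform_eventually [OF lim(1) [OF b]])
  have "\<forall>\<^sub>F x in at_left b. 0 < x" using b by (rule eventually_at_left_real [THEN eventually_mono]) auto
  thus "\<forall>\<^sub>F x in at_left b. ennreal x * ?g x = long_V q u r x"
   by eventually_elim (simp add: eq)
 qed
 show "(long_V q u r ---> long_V q u r b) (at_right b)" if b: "0 <= b"
 proof (cases "b = 0")
  case False
  hence b': "0 < b" using b by simp
  show ?thesis
  proof (rule Lim_transform_eventually [OF lim(2) [OF b']])
   show "\<forall>\<^sub>F x in at_right b. ennreal x * ?g x = long_V q u r x"
    using b' by (auto simp: eventually_at_filter eq intro!: always_eventually)
  qed
 next
  case True
  let ?e = "%x. ennreal (exp (- x)) * indicator {0<..} (x::real)"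
  have "(long_V q u r ---> long_V q u r 0) (at_right 0)"
   unfolding tendsto_at_iff_sequentially
  proof (intro allI impI)
   fix X :: "nat => real" assume "\<forall>i. X i \<in> {0<..} - {0}" and X0: "X ----> 0"
   hence X: "0 < X i" for i by auto
   have "(%i. NN x. U_fun q u (r * exp (x / X i)) * ?e x) ----> (NN x. long_V q u r 0 * ?e x)"
   proof (rule nn_integral_dominated_convergence [where w = "%x. ennreal (2 powr q) * long_V q u r 0 * ?e x"])
    have "(NN x. ennreal (2 powr q) * long_V q u r 0 * ?e x) = ennreal (2 powr q) * long_V q u r 0"
     by (subst nn_integral_cmult) (simp_all add: nn_integral_exp_tail)
    also have "... < \<infinity>" using long_V_finite(2) [OF assms(1) q r Lq, of 0] by (simp add: ennreal_mult_less_top)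
    finally show "(NN x. ennreal (2 powr q) * long_V q u r 0 * ?e x) < \<infinity>" .
    show "!!j. AE x in lborel. U_fun q u (r * exp (x / X j)) * ?e x <= ennreal (2 powr q) * long_V q u r 0 * ?e x"
     by (intro AE_I2 mult_right_mono U_fun_le_long_V assms q) simp
    show "AE x in lborel. (%i. U_fun q u (r * exp (x / X i)) * ?e x) ----> long_V q u r 0 * ?e x"
    proof (rule AE_I2)
     fix x :: real
     show "(%i. U_fun q u (r * exp (x / X i)) * ?e x) ----> long_V q u r 0 * ?e x"
     proof (cases "0 < x")
      case True
      have "filterlim (%i. x / X i) at_top sequentially"
       unfolding divide_inverse using X0 X True
       by (intro filterlim_tendsto_pos_mult_at_top [OF tendsto_const] filterlim_inverse_at_top) auto
      hence "filterlim (%i. r * exp (x / X i)) at_top sequentially"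
       using r by (intro filterlim_tendsto_pos_mult_at_top [OF tendsto_const] filterlim_compose [OF exp_at_top])
      hence "(%i. U_fun q u (r * exp (x / X i))) ----> long_V q u r 0"
       using filterlim_compose [OF U_fun_at_top [OF assms(1) q Lq]] by (simp add: long_V_def)
      from tendsto_mult_ennreal_pos [OF tendsto_const this, of "exp (- x)"] show ?thesis
       using True by (simp add: mult.commute)
     qed simp
    qed
   qed measurable
   also have "(NN x. long_V q u r 0 * ?e x) = long_V q u r 0"
    by (subst nn_integral_cmult) (simp_all add: nn_integral_exp_tail)
   finally show "(long_V q u r \<circ> X) ----> long_V q u r 0"
    by (simp add: comp_def long_V_pos [OF assms(1) X r])
  qed
  thus ?thesis using True by simp
 qed
qed

text \<open>The coupling compares the radii for \<open>a\<close> and \<open>b\<close> pointwise, and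
  \<open>U\<close> is increasing up to the factor \<open>2 powr q\<close>.\<close>

lemma long_V_almost_decreasing:
 fixes u :: "'a::euclidean_space => real"
 assumes u: "u \<in> Borel" and q: "1 <= q" and r: "0 < r"
  and Lq: "(NN x. apow q (u x)) < \<infinity>"
  and dim: "2 <= DIM('a)" and b: "0 < b" "b < a"
 shows "long_V q u r a <= ennreal (2 powr q) * long_V q u r b"
proof -
 note [measurable] = u
 have a: "0 < a" using b by simp
 have "long_V q u r a <= (NN x. ennreal (2 powr q) * (U_fun q u (r * exp (x / b)) * (ennreal (exp (- x)) * indicator {0<..} x)))"
  unfolding long_V_pos [OF u a r]
 proof (rule nn_integral_mono)
  fix x :: real
  show "U_fun q u (r * exp (x / a)) * (ennreal (exp (- x)) * indicator {0<..} x) <= ennreal (2 powr q) * (U_fun q u (r * exp (x / b)) * (ennreal (exp (- x)) * indicator {0<..} x))"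
  proof (cases "0 < x")
   case True
   hence "x / a <= x / b" using b by (intro divide_left_mono) auto
   hence "U_fun q u (r * exp (x / a)) <= ennreal (2 powr q) * U_fun q u (r * exp (x / b))"
    using r by (intro U_fun_almost_increasing [OF dim u q Lq]) auto
   thus ?thesis unfolding mult.assoc [symmetric] by (intro mult_right_mono) auto
  qed simp
 qed
 also have "... = ennreal (2 powr q) * long_V q u r b"
  unfolding long_V_pos [OF u b(1) r] by (rule nn_integral_cmult) measurable
 finally show ?thesis .
qed

text \<open>Each \<open>s\<close> in \<open>(0, t]\<close> splits \<open>\<tau>\<close> into
  \<open>s\<close> and \<open>\<tau> - s\<close>. Integrating over \<open>s\<close>, the values at
  \<open>s\<close>, at \<open>\<tau> - s\<close> and at \<open>s - \<tau>\<close> each contribute at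
  most the integral of \<open>U\<close>, and
  \<open>3 * 2 powr (q - 1) <= 2 powr (q + 1)\<close>.\<close>

lemma U_fun_le_mean:
 assumes [measurable]: "u \<in> Borel" and q: "1 <= q" and t: "0 < \<tau>" "\<tau> <= t"
 shows "ennreal t * U_fun q u \<tau> <= ennreal (2 powr (q + 1)) * (NN z. U_fun q u z * indicator {0<..t} z)"
proof -
 let ?U = "U_fun q u" and ?J = "NN z. U_fun q u z * indicator {0<..t} z"
 have "ennreal t * ?U \<tau> = (NN s. ?U \<tau> * indicator {0<..t} s)"
  using t by (subst nn_integral_cmult_indicator) (simp_all add: mult.commute)
 also have "... <= (NN s. ennreal (2 powr (q - 1)) * (?U s * indicator {0<..t} s + (?U (s - \<tau>) * indicator {0<..t} (s - \<tau>) + ?U (\<tau> - s) * indicator {0<..t} (\<tau> - s))))"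
 proof (rule nn_integral_mono_AE, rule eventually_mono [OF AE_lborel_singleton [of \<tau>]])
  fix s :: real assume "s ~= \<tau>"
  show "?U \<tau> * indicator {0<..t} s <= ennreal (2 powr (q - 1)) * (?U s * indicator {0<..t} s + (?U (s - \<tau>) * indicator {0<..t} (s - \<tau>) + ?U (\<tau> - s) * indicator {0<..t} (\<tau> - s)))"
  proof (cases "0 < s & s <= t")
   case True
   have "?U \<tau> <= ennreal (2 powr (q - 1)) * (?U s + ?U \<bar>\<tau> - s\<bar>)"
    using U_fun_diff_le [OF assms(1) q, of s "\<tau> - s"] t True by simp
   also have "... <= ennreal (2 powr (q - 1)) * (?U s + (?U (s - \<tau>) * indicator {0<..t} (s - \<tau>) + ?U (\<tau> - s) * indicator {0<..t} (\<tau> - s)))"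
    using True t \<open>s \<noteq> \<tau>\<close> by (intro mult_left_mono add_left_mono) (auto simp: indicator_def abs_real_def)
   finally show ?thesis using True by simp
  qed (auto simp: indicator_def)
 qed
 also have "... = ennreal (2 powr (q - 1)) * (?J + ((NN s. ?U (s - \<tau>) * indicator {0<..t} (s - \<tau>)) + (NN s. ?U (\<tau> - s) * indicator {0<..t} (\<tau> - s))))"
  by (simp add: nn_integral_cmult nn_integral_add)
 also have "(NN s. ?U (s - \<tau>) * indicator {0<..t} (s - \<tau>)) = ?J"
  using nn_integral_lborel_shift [of "%z. ?U z * indicator {0<..t} z" "- \<tau>"] by simp
 also have "(NN s. ?U (\<tau> - s) * indicator {0<..t} (\<tau> - s)) = ?J"
  by (subst nn_integral_real_affine [where c = "-1" and t = \<tau>]) auto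
 also have "ennreal (2 powr (q - 1)) * (?J + (?J + ?J)) <= ennreal (2 powr (q + 1)) * ?J"
 proof -
  have "2 powr (q - 1) * 3 <= 2 powr (q + 1)" by (simp add: powr_add powr_diff)
  hence "ennreal (2 powr (q - 1) * 3) * ?J <= ennreal (2 powr (q + 1)) * ?J" by (intro mult_right_mono ennreal_leI) auto
  moreover have "?J + (?J + ?J) = ennreal 3 * ?J"
   by (metis (no_types, lifting) add.assoc distrib_right mult_1 one_add_one numeral_plus_one semiring_norm(3) add.commute ennreal_numeral numeral_One one_plus_numeral semiring_norm(2) zero_le_numeral)
  ultimately show ?thesis by (simp add: ennreal_mult' mult.assoc)
 qed
 finally show ?thesis .
qed

text \<open>Under the coupling the radius for \<open>a\<close> is at most the radius
  \<open>t\<close> for \<open>b\<close>, so \<open>U\<close> there is bounded by its mean over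
  \<open>(0, t]\<close>. After Fubini the integral of \<open>t powr (- 2 - b)\<close> over
  \<open>t >= z\<close> is at most \<open>z powr (- 1 - b)\<close>. The factor
  \<open>2 powr (q + 1)\<close> becomes \<open>2 powr (1 + 1 / q)\<close> under the root.\<close>

lemma long_V_le_full:
 assumes [measurable]: "u \<in> Borel" and q: "1 <= q" and r: "0 < r" and b: "0 < b" "b < a"
 shows "long_V q u r a <= ennreal (2 powr (q + 1)) * (ennreal (b * r powr b) * (NN z. U_fun q u z * (ennreal (z powr (- 1 - b)) * indicator {0<..} z)))"
proof -
 let ?U = "U_fun q u"
 have a: "0 < a" using b by simp
 let ?J = "%t. NN z. ?U z * indicator {0<..t} z"
 let ?I = "%t. ennreal (2 powr (q + 1)) * (ennreal (1 / t) * ?J t)"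
 let ?w = "%t z. (if 0 < z & z <= t & r < t then 1 else 0) * ennreal (t powr (- 1 - (1 + b)))"
 let ?R = "%t. ennreal (b * r powr b * t powr (- 1 - b)) * indicator {r<..} t"
 let ?c = "ennreal (2 powr (q + 1))" and ?d = "ennreal (b * r powr b)"
 have J_meas [measurable]: "?J \<in> Borel"
 proof -
  have "(%t. NN z. ?U z * (if 0 < z & z <= t then 1 else 0)) \<in> Borel" by measurable
  moreover have "(if 0 < z & z <= t then 1 else 0 :: ennreal) = indicator {0<..t} z" for z t :: real by (simp add: indicator_def)
  ultimately show ?thesis by simp
 qed
 have "long_V q u r a <= (NN x. ?I (r * exp (x / b)) * (ennreal (exp (- x)) * indicator {0<..} x))"
  unfolding long_V_pos [OF assms(1) a r]
 proof (rule nn_integral_mono)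
  fix x :: real
  show "?U (r * exp (x / a)) * (ennreal (exp (- x)) * indicator {0<..} x) <= ?I (r * exp (x / b)) * (ennreal (exp (- x)) * indicator {0<..} x)"
  proof (cases "0 < x")
   case True
   let ?t = "r * exp (x / b)"
   have t: "0 < ?t" using r by simp
   have "x / a <= x / b" using b True by (intro divide_left_mono) auto
   hence "ennreal ?t * ?U (r * exp (x / a)) <= ?c * ?J ?t"
    using r by (intro U_fun_le_mean [OF assms(1) q]) auto
   hence "ennreal (1 / ?t) * (ennreal ?t * ?U (r * exp (x / a))) <= ennreal (1 / ?t) * (?c * ?J ?t)"
    by (rule mult_left_mono) simp
   moreover have "ennreal (1 / ?t) * (ennreal ?t * ?U (r * exp (x / a))) = ?U (r * exp (x / a))"
    unfolding mult.assoc [symmetric] using t by (subst ennreal_mult' [symmetric]) (auto simp: field_simps)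
   ultimately have "?U (r * exp (x / a)) <= ?I ?t" by (simp only: mult.left_commute)
   thus ?thesis by (rule mult_right_mono) simp
  qed simp
 qed
 also have "... = (NN t. ?I t * (?R t))"
  by (rule nn_integral_pareto [symmetric]) (use b r in auto)
 also have "... = (NN t. NN z. ?c * (?d * (?U z * (?w t z))))"
 proof (rule nn_integral_cong)
  fix t :: real
  have "(NN z. ?c * (?d * (?U z * (?w t z))))
   = (NN z. ?c * (?d * (indicator {r<..} t * ennreal (t powr (- 1 - (1 + b))))) * (?U z * indicator {0<..t} z))"
   by (intro nn_integral_cong) (auto simp: indicator_def mult_ac)
  also have "... = ?c * (?d * (indicator {r<..} t * ennreal (t powr (- 1 - (1 + b))))) * ?J t"
   by (rule nn_integral_cmult) measurable
  also have "... = ?I t * (?R t)"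
  proof (cases "r < t")
   case True
   hence "t powr (- 1 - (1 + b)) = 1 / t * t powr (- 1 - b)"
   proof -
    have "t powr (- 1 + (- 1 - b)) = t powr (- 1) * t powr (- 1 - b)" by (rule powr_add)
    moreover have "- 1 - (1 + b) = - 1 + (- 1 - b)" by simp
    moreover have "t powr (- 1) = 1 / t" using r True by (simp add: powr_minus_divide)
    ultimately show ?thesis by (simp only:)
   qed
   hence e: "?d * ennreal (t powr (- 1 - (1 + b))) = ennreal (1 / t) * ennreal (b * r powr b * t powr (- 1 - b))"
    using b True r by (simp add: ennreal_mult' [symmetric] mult_ac)
   have "?c * (?d * (indicator {r<..} t * ennreal (t powr (- 1 - (1 + b))))) * ?J t
    = ?c * ((?d * ennreal (t powr (- 1 - (1 + b)))) * (indicator {r<..} t * ?J t))"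
    by (simp only: mult_ac)
   also have "... = ?I t * (?R t)"
    unfolding e by (simp only: mult_ac)
   finally show ?thesis .
  qed simp
  finally show "?I t * (?R t)
   = (NN z. ?c * (?d * (?U z * (?w t z))))" by simp
 qed
 also have "... = (NN z. NN t. ?c * (?d * (?U z * (?w t z))))"
  by (rule lborel_pair.Fubini') measurable
 also have "... <= (NN z. ?c * (?d * (?U z * (ennreal (z powr (- 1 - b)) * indicator {0<..} z))))"
 proof (rule nn_integral_mono)
  fix z :: real
  have "(NN t. ?c * (?d * (?U z * (?w t z))))
   = ?c * (?d * (?U z * (NN t. ?w t z)))"
   by (simp add: nn_integral_cmult)
  also have "... <= ?c * (?d * (?U z * (ennreal (z powr (- 1 - b)) * indicator {0<..} z)))"
  proof (intro mult_left_mono)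
   show "(NN t. ?w t z) <= ennreal (z powr (- 1 - b)) * indicator {0<..} z"
   proof (cases "0 < z")
    case True
    have "(NN t. ?w t z) <= (NN t. ennreal (t powr (- 1 - (1 + b))) * indicator {z..} t)"
     by (intro nn_integral_mono) (auto simp: indicator_def)
    also have "... = ennreal (z powr (- (1 + b)) / (1 + b))"
     by (rule nn_integral_powr_tail) (use b True in auto)
    also have "... <= ennreal (z powr (- 1 - b))"
    proof (rule ennreal_leI)
     have "z powr (- (1 + b)) / (1 + b) <= z powr (- (1 + b)) / 1" using b by (intro divide_left_mono) auto
     thus "z powr (- (1 + b)) / (1 + b) <= z powr (- 1 - b)" by (simp add: algebra_simps)
    qed
    finally show ?thesis using True by simp
   qed simp
  qed simp_all
  finally show "(NN t. ?c * (?d * (?U z * (?w t z)))) <= ..." .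
 qed
 also have "... = ?c * (?d * (NN z. ?U z * (ennreal (z powr (- 1 - b)) * indicator {0<..} z)))"
  by (simp add: nn_integral_cmult)
 finally show ?thesis .
qed

section \<open>The Gagliardo double integral as an integral of U\<close>

lemma sigma_finite_lebesgue: "sigma_finite_measure (lebesgue :: 'a::euclidean_space measure)"
proof
 from lborel.sigma_finite_countable obtain A :: "'a set set"
  where A: "countable A & A \<subseteq> sets lborel & \<Union>A = space lborel & (\<forall>a\<in>A. emeasure lborel a ~= \<infinity>)" ..
 have "A \<subseteq> sets lebesgue" using A sets_completionI_sets by (metis subset_iff)
 moreover have "\<forall>a\<in>A. emeasure lebesgue a ~= \<infinity>"
 proof
  fix a assume "a \<in> A"
  hence "a \<in> sets lborel" "emeasure lborel a ~= \<infinity>" using A by blast+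
  thus "emeasure lebesgue a ~= \<infinity>" by simp
 qed
 ultimately show "\<exists>A :: 'a set set. countable A & A \<subseteq> sets lebesgue & \<Union>A = space lebesgue & (\<forall>a\<in>A. emeasure lebesgue a ~= \<infinity>)"
  using A by (intro exI [of _ A]) simp
qed

interpretation lebesgue: sigma_finite_measure "lebesgue :: 'a::euclidean_space measure"
 by (rule sigma_finite_lebesgue)

lemma measurable_lebesgue_pair:
 assumes "F \<in> Borel2"
 shows "F \<in> borel_measurable ((lebesgue :: 'a::euclidean_space measure) \<Otimes>\<^sub>M (lebesgue :: 'b::euclidean_space measure))"
proof -
 have "(%z. (fst z, snd z)) \<in> measurable ((lebesgue :: 'a measure) \<Otimes>\<^sub>M (lebesgue :: 'b measure)) (borel \<Otimes>\<^sub>M borel)"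
  by (intro measurable_Pair measurable_compose [OF measurable_fst] measurable_compose [OF measurable_snd]) (rule measurable_completion, simp)+
 from measurable_compose [OF this assms] show ?thesis by simp
qed

lemma nn_integral_lebesgue_pair:
 fixes F :: "'a::euclidean_space \<times> 'b::euclidean_space => ennreal"
 assumes [measurable]: "F \<in> Borel2"
 shows "(\<integral>\<^sup>+z. F z \<partial>lebesgue2) = (NN x. NN y. F (x, y))"
proof -
 have "(\<integral>\<^sup>+z. F z \<partial>lebesgue2) = (\<integral>\<^sup>+x. \<integral>\<^sup>+y. F (x, y) \<partial>lebesgue \<partial>lebesgue)"
  by (rule lebesgue.nn_integral_fst [symmetric]) (rule measurable_lebesgue_pair, measurable)
 also have "... = (NN x. NN y. F (x, y))"
  by (simp add: nn_integral_completion)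
 finally show ?thesis .
qed

text \<open>Polar coordinates for \<open>h = y - x\<close>: the Jacobian
  \<open>t powr (d - 1)\<close> against \<open>t powr (- d - b)\<close> leaves
  \<open>t powr (- 1 - b)\<close>.\<close>

lemma gagliardo_integral_eq:
 fixes u :: "'a::euclidean_space => real"
 assumes [measurable]: "u \<in> Borel"
 shows "(\<integral>\<^sup>+(x, y). ennreal (\<bar>u x - u y\<bar> powr q / norm (x - y) powr (real DIM('a) + b)) \<partial>lebesgue2)
  = (NN t. U_fun q u t * (ennreal (t powr (- 1 - b)) * indicator {0<..} t))"
proof -
 let ?d = "real DIM('a)"
 let ?g = "%x h. ennreal (\<bar>u x - u (h + x)\<bar> powr q / norm (x - (h + x)) powr (?d + b))"
 let ?G = "%t. SS \<omega>. shift_diff q u (t *\<^sub>R \<omega>) * ennreal (norm (t *\<^sub>R \<omega>) powr (- (?d + b)))"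
 have "(\<integral>\<^sup>+(x, y). ennreal (\<bar>u x - u y\<bar> powr q / norm (x - y) powr (?d + b)) \<partial>lebesgue2)
  = (NN x. NN y. ennreal (\<bar>u x - u y\<bar> powr q / norm (x - y) powr (?d + b)))"
  by (subst nn_integral_lebesgue_pair) (auto simp: split_beta')
 also have "... = (NN x. NN h. ?g x h)"
 proof (rule nn_integral_cong)
  fix x
  show "(NN y. ennreal (\<bar>u x - u y\<bar> powr q / norm (x - y) powr (?d + b))) = (NN h. ?g x h)"
   by (rule nn_integral_lborel_shift [symmetric]) measurable
 qed
 also have "... = (NN h. NN x. ?g x h)"
  by (rule lborel_pair.Fubini') measurable
 also have "... = (NN h. shift_diff q u h * ennreal (norm h powr (- (?d + b))))"
 proof (rule nn_integral_cong)
  fix h :: 'a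
  have "(NN x. ?g x h)
   = (NN x. apow q (u (x + h) - u x) * ennreal (norm h powr (- (?d + b))))"
  proof (rule nn_integral_cong)
   fix x
   have "\<bar>u x - u (h + x)\<bar> powr q / norm (x - (h + x)) powr (?d + b) = \<bar>u (x + h) - u x\<bar> powr q * norm h powr (- (?d + b))"
    unfolding powr_minus divide_inverse by (simp add: abs_minus_commute add.commute)
   thus "?g x h = apow q (u (x + h) - u x) * ennreal (norm h powr (- (?d + b)))"
    by (simp only: ennreal_mult' [symmetric] powr_ge_zero)
  qed
  also have "... = shift_diff q u h * ennreal (norm h powr (- (?d + b)))"
   unfolding shift_diff_def by (rule nn_integral_multc) measurable
  finally show "(NN x. ?g x h) = shift_diff q u h * ennreal (norm h powr (- (?d + b)))" .
 qed
 also have "... = (\<integral>\<^sup>+t\<in>{0<..}. ennreal (t powr (?d - 1)) * ?G t \<partial>lborel)"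
  by (rule nn_integral_polar) measurable
 also have "... = (NN t. U_fun q u t * (ennreal (t powr (- 1 - b)) * indicator {0<..} t))"
 proof (rule nn_integral_cong)
  fix t :: real
  show "ennreal (t powr (?d - 1)) * ?G t * indicator {0<..} t
   = U_fun q u t * (ennreal (t powr (- 1 - b)) * indicator {0<..} t)"
  proof (cases "0 < t")
   case True
   have "?G t
    = (SS \<omega>. shift_diff q u (t *\<^sub>R \<omega>) * ennreal (t powr (- (?d + b))))"
    by (rule nn_integral_cong_AE, rule eventually_mono [OF norm_sphere_AE]) (use True in simp)
   also have "... = U_fun q u t * ennreal (t powr (- (?d + b)))"
    unfolding U_fun_eq by (rule nn_integral_multc) measurable
   finally have "ennreal (t powr (?d - 1)) * ?G t
    = U_fun q u t * (ennreal (t powr (?d - 1)) * ennreal (t powr (- (?d + b))))" by (simp only: mult_ac)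
   also have "ennreal (t powr (?d - 1)) * ennreal (t powr (- (?d + b))) = ennreal (t powr (- 1 - b))"
    by (simp add: ennreal_mult' [symmetric] powr_add [symmetric])
   finally show ?thesis using True by simp
  qed simp
 qed
 finally show ?thesis .
qed

lemma sobolev_seminorm_fractional:
 assumes [measurable]: "u \<in> Borel" and q: "1 <= q" and s: "0 < s" "s < 1" and r: "0 < r"
 shows "ennreal (2 powr (1 + 1 / q) * s powr (1 / q) * r powr s) * rpow (U_integral s (ennreal q) u {0<..}) (1 / q)
  = ennreal (2 powr (1 + 1 / q) * r powr s * (1 - s) powr (- (1 / q))) * sobolev_seminorm s (ennreal q) u"
proof -
 have I: "U_integral s (ennreal q) u {0<..} = (NN t. U_fun q u t * (ennreal (t powr (- 1 - s * q)) * indicator {0<..} t))"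
  using q by (intro U_integral_eq) auto
 have "sobolev_seminorm s (ennreal q) u = ennreal ((s * (1 - s)) powr (1 / q)) * rpow (U_integral s (ennreal q) u {0<..}) (1 / q)"
  using s q by (simp add: sobolev_seminorm_def Let_def recip_ennreal gagliardo_integral_eq I rpow_cmult)
 moreover have "2 powr (1 + 1 / q) * r powr s * (1 - s) powr (- (1 / q)) * (s * (1 - s)) powr (1 / q) = 2 powr (1 + 1 / q) * s powr (1 / q) * r powr s"
  using s by (simp add: powr_mult powr_minus)
 moreover have "ennreal (2 powr (1 + 1 / q) * r powr s * (1 - s) powr (- (1 / q))) * ennreal ((s * (1 - s)) powr (1 / q))
   = ennreal (2 powr (1 + 1 / q) * r powr s * (1 - s) powr (- (1 / q)) * (s * (1 - s)) powr (1 / q))"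
  by (rule ennreal_mult' [symmetric]) simp
 ultimately show ?thesis by (simp only: mult.assoc [symmetric])
qed

section \<open>The quadratic case\<close>

text \<open>The second moment is the squared mean plus the variance, and the variance is the least
  mean square deviation from a constant.\<close>

lemma variance_le:
 fixes W :: "'b => real"
 assumes P: "prob_space P" and [measurable]: "W \<in> borel_measurable P" and fin: "(\<integral>\<^sup>+z. ennreal ((W z)\<^sup>2) \<partial>P) < \<infinity>"
 shows "(\<integral>\<^sup>+z. ennreal ((W z)\<^sup>2) \<partial>P) <= ennreal ((\<integral>z. W z \<partial>P)\<^sup>2) + (\<integral>\<^sup>+z. ennreal ((W z - c)\<^sup>2) \<partial>P)"
proof -
 interpret prob_space P by (rule P)
 have int2: "integrable P (%z. (W z)\<^sup>2)" using fin by (intro integrableI_nonneg) auto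
 have int1: "integrable P W"
  by (rule square_integrable_imp_integrable [OF _ int2]) measurable
 let ?m = "\<integral>z. W z \<partial>P"
 have intc: "integrable P (%z. (W z - c)\<^sup>2)"
  unfolding power2_diff using int1 int2 by auto
 have "(\<integral>z. (W z - c)\<^sup>2 \<partial>P) = (\<integral>z. (W z)\<^sup>2 \<partial>P) + c\<^sup>2 - 2 * ?m * c"
  unfolding power2_diff using int1 int2 by (simp add: prob_space)
 hence "(\<integral>z. (W z)\<^sup>2 \<partial>P) = (\<integral>z. (W z - c)\<^sup>2 \<partial>P) - (?m - c)\<^sup>2 + ?m\<^sup>2"
  by (simp add: power2_diff)
 hence "(\<integral>z. (W z)\<^sup>2 \<partial>P) <= ?m\<^sup>2 + (\<integral>z. (W z - c)\<^sup>2 \<partial>P)" by simp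
 hence "ennreal (\<integral>z. (W z)\<^sup>2 \<partial>P) <= ennreal (?m\<^sup>2) + ennreal (\<integral>z. (W z - c)\<^sup>2 \<partial>P)"
  by (simp add: ennreal_plus [symmetric] del: ennreal_plus)
 thus ?thesis using int2 intc by (simp add: nn_integral_eq_integral)
qed

definition pareto :: "real => real => real" where
 "pareto b z = (if 1 < z then b * z powr (- 1 - b) else 0)"

lemma borel_measurable_pareto [measurable]: "pareto b \<in> Borel"
 unfolding pareto_def [abs_def] by measurable

lemma pareto_nonneg: "0 < b ==> 0 <= pareto b z"
 by (simp add: pareto_def)

lemma nn_integral_pareto_eq_1:
 assumes "0 < b" shows "(NN z. ennreal (pareto b z)) = 1"
proof -
 have "(NN z. ennreal (pareto b z)) = (NN t. 1 * (ennreal (b * 1 powr b * t powr (- 1 - b)) * indicator {1<..} t))"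
  by (intro nn_integral_cong) (auto simp: pareto_def)
 also have "... = 1" using assms by (subst nn_integral_pareto) (simp_all add: nn_integral_exp_tail)
 finally show ?thesis .
qed

text \<open>For \<open>z > 2\<close> the shifted density is the larger one, by a factor of at most
  \<open>2 powr (1 + b)\<close>; for \<open>z <= 2\<close> it vanishes. Hence the \<open>L^1\<close>
  distance is twice the mass of \<open>(1, 2]\<close>, which is of order \<open>b\<close>.\<close>

lemma pareto_shift_diff:
 assumes b: "0 < b"
 shows "\<bar>pareto b (z - 1) - pareto b z\<bar> <= (2 powr (1 + b) - 1) * pareto b z"
  and "(NN z. ennreal \<bar>pareto b (z - 1) - pareto b z\<bar>) <= ennreal (2 * (1 - 2 powr (- b)))"
proof -
 let ?f = "pareto b"
 have "1 powr (1 + b) <= 2 powr (1 + b)" "2 powr 1 <= 2 powr (1 + b)" using b powr_mono2 [of "1 + b" 1 2] powr_mono [of 1 "1 + b" 2] by auto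
 hence two: "2 <= 2 powr (1 + b)" by simp
 have mono: "?f z <= ?f (z - 1)" if "2 < z" for z
  using that b powr_mono2' [of "- 1 - b" "z - 1" z] by (simp add: pareto_def)
 have low: "?f (z - 1) = 0" if "z <= 2" for z using that by (simp add: pareto_def)
 show "\<bar>?f (z - 1) - ?f z\<bar> <= (2 powr (1 + b) - 1) * ?f z"
 proof (cases "2 < z")
  case True
  have "(z - 1) powr (- 1 - b) <= (z / 2) powr (- 1 - b)" using True b by (intro powr_mono2') auto
  also have "... = 2 powr (1 + b) * z powr (- 1 - b)"
  proof -
   have "(z / 2) powr (- 1 - b) = z powr (- 1 - b) / 2 powr (- (1 + b))" using True by (simp add: powr_divide)
   also have "... = 2 powr (1 + b) * z powr (- 1 - b)" by (subst powr_minus_divide) simp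
   finally show ?thesis .
  qed
  finally have "?f (z - 1) <= 2 powr (1 + b) * ?f z"
   using True b by (simp add: pareto_def mult.left_commute mult_left_mono)
  thus ?thesis using mono [OF True] by (simp add: algebra_simps)
 next
  case False
  have "1 * ?f z <= (2 powr (1 + b) - 1) * ?f z" using two pareto_nonneg [OF b] by (intro mult_right_mono) auto
  thus ?thesis using low [of z] False pareto_nonneg [OF b, of z] by simp
 qed
 have tail: "(NN z. ennreal (?f z) * indicator {2<..} z) = ennreal (2 powr (- b))"
 proof -
  have "(NN z. ennreal (?f z) * indicator {2<..} z) = (NN t. ennreal (2 powr (- b)) * (1 * (ennreal (b * 2 powr b * t powr (- 1 - b)) * indicator {2<..} t)))"
  proof (intro nn_integral_cong)
   fix z :: real
   have "2 powr (- b) * (b * 2 powr b * z powr (- 1 - b)) = b * z powr (- 1 - b)" by (simp add: powr_minus)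
   hence "ennreal (2 powr (- b)) * ennreal (b * 2 powr b * z powr (- 1 - b)) = ennreal (b * z powr (- 1 - b))"
    by (simp only: ennreal_mult' [symmetric] powr_ge_zero)
   thus "ennreal (?f z) * indicator {2<..} z = ennreal (2 powr (- b)) * (1 * (ennreal (b * 2 powr b * z powr (- 1 - b)) * indicator {2<..} z))"
    by (cases "2 < z") (simp_all add: pareto_def)
  qed
  also have "... = ennreal (2 powr (- b)) * (NN t. 1 * (ennreal (b * 2 powr b * t powr (- 1 - b)) * indicator {2<..} t))"
   by (rule nn_integral_cmult) measurable
  also have "(NN t. 1 * (ennreal (b * 2 powr b * t powr (- 1 - b)) * indicator {2<..} t)) = 1"
   using b by (subst nn_integral_pareto) (simp_all add: nn_integral_exp_tail)
  finally show ?thesis by simp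
 qed
 have "(NN z. ennreal \<bar>?f (z - 1) - ?f z\<bar>) + 2 * (NN z. ennreal (?f z) * indicator {2<..} z)
   = (NN z. ennreal \<bar>?f (z - 1) - ?f z\<bar> + 2 * (ennreal (?f z) * indicator {2<..} z))"
  by (simp add: nn_integral_add nn_integral_cmult)
 also have "... = (NN z. ennreal (?f (z - 1)) + ennreal (?f z))"
 proof (intro nn_integral_cong)
  fix z
  show "ennreal \<bar>?f (z - 1) - ?f z\<bar> + 2 * (ennreal (?f z) * indicator {2<..} z) = ennreal (?f (z - 1)) + ennreal (?f z)"
  proof (cases "2 < z")
   case True
   have "\<bar>?f (z - 1) - ?f z\<bar> + 2 * ?f z = ?f (z - 1) + ?f z" using mono [OF True] by simp
   hence "ennreal \<bar>?f (z - 1) - ?f z\<bar> + ennreal (2 * ?f z) = ennreal (?f (z - 1)) + ennreal (?f z)"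
    using pareto_nonneg [OF b] by (simp add: ennreal_plus [symmetric] del: ennreal_plus)
   thus ?thesis using True by (simp add: ennreal_mult')
  next
   case False
   thus ?thesis using low [of z] pareto_nonneg [OF b, of z] by simp
  qed
 qed
 also have "... = (NN z. ennreal (?f (z - 1))) + (NN z. ennreal (?f z))"
  by (rule nn_integral_add) auto
 also have "(NN z. ennreal (?f (z - 1))) = (NN z. ennreal (?f z))"
  using nn_integral_lborel_shift [of "%z. ennreal (?f z)" "- 1"] by simp
 finally have eq: "(NN z. ennreal \<bar>?f (z - 1) - ?f z\<bar>) + 2 * ennreal (2 powr (- b)) = 1 + 1"
  by (simp only: tail nn_integral_pareto_eq_1 [OF b])
 have "2 powr (- b) <= 2 powr 0" using b by (intro powr_mono) auto
 hence "ennreal (2 * (1 - 2 powr (- b))) + 2 * ennreal (2 powr (- b)) = 1 + 1"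
  by (simp add: ennreal_mult' [symmetric] ennreal_plus [symmetric] del: ennreal_plus flip: ennreal_numeral ennreal_1)
 with eq have "2 * ennreal (2 powr (- b)) + (NN z. ennreal \<bar>?f (z - 1) - ?f z\<bar>) = 2 * ennreal (2 powr (- b)) + ennreal (2 * (1 - 2 powr (- b)))"
  by (simp only: add.commute)
 thus "(NN z. ennreal \<bar>?f (z - 1) - ?f z\<bar>) <= ennreal (2 * (1 - 2 powr (- b)))"
  by (simp add: ennreal_add_left_cancel ennreal_mult_eq_top_iff)
qed

text \<open>The weight is split evenly, one factor \<open>sqrt |g|\<close> to each side.\<close>

lemma nn_integral_Cauchy_Schwarz_weight:
 fixes g k :: "real => real"
 assumes [measurable]: "g \<in> Borel" "k \<in> Borel"
  and G: "(NN z. ennreal \<bar>g z\<bar>) <= ennreal G" "0 <= G"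
 shows "ennreal ((LL z. g z * k z)\<^sup>2) <= ennreal G * (NN z. ennreal (\<bar>g z\<bar> * (k z)\<^sup>2))"
proof (cases "integrable lborel (%z. g z * k z)")
 case True
 let ?f = "%z. ennreal (sqrt \<bar>g z\<bar>)" and ?h = "%z. ennreal (sqrt \<bar>g z\<bar> * \<bar>k z\<bar>)"
 have sq: "?f z * ?h z = ennreal \<bar>g z * k z\<bar>" "(?f z)\<^sup>2 = ennreal \<bar>g z\<bar>" "(?h z)\<^sup>2 = ennreal (\<bar>g z\<bar> * (k z)\<^sup>2)" for z
  by (simp_all add: ennreal_mult' [symmetric] ennreal_power power_mult_distrib abs_mult mult.assoc [symmetric])
 have "ennreal \<bar>LL z. g z * k z\<bar> <= (NN z. ?f z * ?h z)"
  using integral_norm_bound_ennreal [OF True] by (simp add: sq)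
 hence "(ennreal \<bar>LL z. g z * k z\<bar>)\<^sup>2 <= (NN z. ?f z * ?h z)\<^sup>2" by (rule power_mono) simp
 also have "... <= (NN z. (?f z)\<^sup>2) * (NN z. (?h z)\<^sup>2)" by (rule Cauchy_Schwarz_nn_integral) auto
 also have "... <= ennreal G * (NN z. ennreal (\<bar>g z\<bar> * (k z)\<^sup>2))"
  unfolding sq by (rule mult_right_mono [OF G(1)]) simp
 finally show ?thesis by (simp add: ennreal_power)
qed (simp add: not_integrable_integral_eq)

text \<open>\<open>u\<close> is translated by \<open>z *\<^sub>R h\<close> with \<open>z\<close>
  Pareto distributed. The increment \<open>W\<close> of the translate has the same integrated square
  for every \<open>z\<close>. Its mean is an integral against the difference of the density and its
  shift, hence small with \<open>b\<close>. Its variance is at most the mean square deviation from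
  the increment of \<open>u\<close> itself, which costs a factor 2 for each of the two end points, 4
  in total.\<close>

lemma shift_diff_2_le_pareto:
 fixes u :: "'a::euclidean_space => real"
 assumes [measurable]: "u \<in> Borel"
  and L2: "(NN x. apow 2 (u x)) < \<infinity>" and b: "0 < b"
 shows "shift_diff 2 u h <= ennreal (4 + 2 * (1 - 2 powr (- b)) * (2 powr (1 + b) - 1))
  * (NN z. ennreal (pareto b z) * shift_diff 2 u (z *\<^sub>R h))"
proof -
 let ?f = "pareto b" and ?G = "2 * (1 - 2 powr (- b))" and ?H = "2 powr (1 + b) - 1"
 define P where "P = density lborel (%z. ennreal (?f z))"
 have sets_P [measurable_cong]: "sets P = sets borel" by (simp add: P_def)
 have P: "prob_space P"
  using nn_integral_pareto_eq_1 [OF b] by (intro prob_spaceI) (simp add: P_def emeasure_density)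
 interpret P: prob_space P by (rule P)
 have int_P: "(\<integral>\<^sup>+z. F z \<partial>P) = (NN z. ennreal (?f z) * F z)" if [measurable]: "F \<in> Borel" for F
  unfolding P_def by (rule nn_integral_density) measurable
 have GH: "0 <= ?G" "0 <= ?H"
 proof -
  have "2 powr (- b) <= 2 powr 0" using b by (intro powr_mono) auto
  thus "0 <= ?G" by simp
  have "2 powr 0 <= 2 powr (1 + b)" using b by (intro powr_mono) auto
  thus "0 <= ?H" by simp
 qed
 let ?M = "NN z. ennreal (?f z) * shift_diff 2 u (z *\<^sub>R h)"
 define X where "X = (%x z. u (x + z *\<^sub>R h))"
 have [measurable]: "(%z. X x z) \<in> Borel" "(%z. X (fst z) (snd z)) \<in> Borel2" for x
  unfolding X_def by measurable
 have fubini: "(NN x. \<integral>\<^sup>+z. F x z \<partial>P) = (NN z. ennreal (?f z) * (NN x. F x z))"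
  if [measurable]: "(%z. F (fst z) (snd z)) \<in> Borel2" for F :: "'a => real => ennreal"
 proof -
  have [measurable]: "F x \<in> Borel" for x
   using measurable_Pair2 [OF that, of x] by simp
  have [measurable]: "(%x. F x z) \<in> Borel" for z
   using measurable_Pair1 [OF that, of z] by simp
  have [measurable]: "(%z. F (snd z) (fst z)) \<in> Borel2"
   using measurable_compose [OF measurable_pair_swap' that] by (simp add: split_beta')
  have "(NN x. \<integral>\<^sup>+z. F x z \<partial>P) = (NN x. NN z. ennreal (?f z) * F x z)"
   by (intro nn_integral_cong int_P) measurable
  also have "... = (NN z. NN x. ennreal (?f z) * F x z)"
   by (rule lborel_pair.Fubini') measurable
  also have "... = (NN z. ennreal (?f z) * (NN x. F x z))"
   by (intro nn_integral_cong nn_integral_cmult) measurable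
  finally show ?thesis .
 qed
 have sq: "(apow 2 y) = ennreal (y\<^sup>2)" for y :: real by (simp add: powr_numeral)
 have fin1: "(NN x. \<integral>\<^sup>+z. ennreal ((X (x + c) z)\<^sup>2) \<partial>P) < \<infinity>" for c
 proof -
  have "(NN x. \<integral>\<^sup>+z. ennreal ((X (x + c) z)\<^sup>2) \<partial>P) = (NN z. ennreal (?f z) * (NN x. ennreal ((X (x + c) z)\<^sup>2)))"
   by (rule fubini) (unfold X_def, measurable)
  also have "... = (NN z. ennreal (?f z) * (NN x. apow 2 (u x)))"
  proof (rule nn_integral_cong)
   fix z
   have "(NN x. ennreal ((X (x + c) z)\<^sup>2)) = (NN x. apow 2 (u x))"
    using nn_integral_lborel_shift [of "%x. apow 2 (u x)" "c + z *\<^sub>R h"] by (simp add: X_def sq add.assoc)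
   thus "ennreal (?f z) * (NN x. ennreal ((X (x + c) z)\<^sup>2)) = ennreal (?f z) * (NN x. apow 2 (u x))"
    by (simp only:)
  qed
  also have "... = 1 * (NN x. apow 2 (u x))"
   by (subst nn_integral_multc) (simp_all add: nn_integral_pareto_eq_1 [OF b])
  finally show ?thesis using L2 by simp
 qed
 \<comment> \<open>Variances need square integrability in \<open>z\<close>; it holds at almost every
   \<open>x\<close>, as seen by interchanging the integrals and using translation
   invariance.\<close>
 have AE_fin: "AE x in lborel. (\<integral>\<^sup>+z. ennreal ((X (x + c) z)\<^sup>2) \<partial>P) ~= \<infinity>" for c
 proof (rule nn_integral_PInf_AE)
  have "(%x. NN z. ennreal (?f z) * ennreal ((X (x + c) z)\<^sup>2)) \<in> borel_measurable lborel"
   unfolding X_def by measurable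
  moreover have "(\<integral>\<^sup>+z. ennreal ((X (x + c) z)\<^sup>2) \<partial>P) = (NN z. ennreal (?f z) * ennreal ((X (x + c) z)\<^sup>2))" for x
   by (rule int_P) measurable
  ultimately show "(%x. \<integral>\<^sup>+z. ennreal ((X (x + c) z)\<^sup>2) \<partial>P) \<in> borel_measurable lborel" by simp
  show "(NN x. \<integral>\<^sup>+z. ennreal ((X (x + c) z)\<^sup>2) \<partial>P) ~= \<infinity>"
   using fin1 [of c] by (simp only: less_top)
 qed
 define I where "I = (%x. \<integral>\<^sup>+z. ennreal ((X x z - u x)\<^sup>2) \<partial>P)"
 have I_eq: "I x = (NN z. ennreal (?f z) * ennreal ((X x z - u x)\<^sup>2))" for x
  unfolding I_def by (rule int_P) measurable
 have I_meas [measurable]: "I \<in> Borel"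
  unfolding I_eq [abs_def] X_def by measurable
 have I_int: "(NN x. I x) = ?M"
  unfolding I_def by (subst fubini) (simp_all add: X_def shift_diff_def sq)
 have point: "(\<integral>\<^sup>+z. ennreal ((X (x + h) z - X x z)\<^sup>2) \<partial>P) <= ennreal (?G * ?H) * I x + 2 * (I (x + h) + I x)"
  if fx: "(\<integral>\<^sup>+z. ennreal ((X (x + 0) z)\<^sup>2) \<partial>P) ~= \<infinity>" "(\<integral>\<^sup>+z. ennreal ((X (x + h) z)\<^sup>2) \<partial>P) ~= \<infinity>" for x
 proof -
  let ?W = "%z. X (x + h) z - X x z"
  have sq_int: "integrable P (%z. (X x z)\<^sup>2)" "integrable P (%z. (X (x + h) z)\<^sup>2)"
   using fx by (auto intro!: integrableI_nonneg simp: less_top)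
  have int: "integrable P (%z. X x z)" "integrable P (%z. X (x + h) z)"
   using sq_int by (auto intro!: P.square_integrable_imp_integrable)
  have "(\<integral>\<^sup>+z. ennreal ((?W z)\<^sup>2) \<partial>P) <= (\<integral>\<^sup>+z. ennreal (2 * (X (x + h) z)\<^sup>2 + 2 * (X x z)\<^sup>2) \<partial>P)"
   by (intro nn_integral_mono ennreal_leI) (smt (verit) sum_squares_bound power2_diff power2_sum zero_le_power2)
  also have "... = ennreal (\<integral>z. 2 * (X (x + h) z)\<^sup>2 + 2 * (X x z)\<^sup>2 \<partial>P)"
   using sq_int by (intro nn_integral_eq_integral) auto
  finally have W_fin: "(\<integral>\<^sup>+z. ennreal ((?W z)\<^sup>2) \<partial>P) < \<infinity>" by (rule le_less_trans) simp
  have "(\<integral>\<^sup>+z. ennreal ((?W z)\<^sup>2) \<partial>P) <= ennreal ((\<integral>z. ?W z \<partial>P)\<^sup>2) + (\<integral>\<^sup>+z. ennreal ((?W z - (u (x + h) - u x))\<^sup>2) \<partial>P)"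
   by (rule variance_le [OF P _ W_fin]) measurable
  also have "... <= ennreal (?G * ?H) * I x + 2 * (I (x + h) + I x)"
  \<comment> \<open>With the centre \<open>u (x + h) - u x\<close>, the deviation of
    \<open>W\<close> is the difference of the deviations at \<open>x + h\<close> and at
    \<open>x\<close>.\<close>
  proof (rule add_mono)
   have "(\<integral>\<^sup>+z. ennreal ((?W z - (u (x + h) - u x))\<^sup>2) \<partial>P) <= (\<integral>\<^sup>+z. 2 * (ennreal ((X (x + h) z - u (x + h))\<^sup>2) + ennreal ((X x z - u x)\<^sup>2)) \<partial>P)"
   proof (intro nn_integral_mono)
    fix z
    have "(?W z - (u (x + h) - u x))\<^sup>2 <= 2 * ((X (x + h) z - u (x + h))\<^sup>2 + (X x z - u x)\<^sup>2)"
     using zero_le_power2 [of "(X (x + h) z - u (x + h)) + (X x z - u x)"] by (simp add: power2_eq_square algebra_simps)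
    hence "ennreal ((?W z - (u (x + h) - u x))\<^sup>2) <= ennreal (2 * ((X (x + h) z - u (x + h))\<^sup>2 + (X x z - u x)\<^sup>2))" by (rule ennreal_leI)
    thus "ennreal ((?W z - (u (x + h) - u x))\<^sup>2) <= 2 * (ennreal ((X (x + h) z - u (x + h))\<^sup>2) + ennreal ((X x z - u x)\<^sup>2))"
     by (simp add: ennreal_mult')
   qed
   also have "... = 2 * (I (x + h) + I x)"
    unfolding I_def by (simp add: nn_integral_cmult nn_integral_add)
   finally show "(\<integral>\<^sup>+z. ennreal ((?W z - (u (x + h) - u x))\<^sup>2) \<partial>P) <= 2 * (I (x + h) + I x)" .
  next
   let ?k = "%z. X x z - u x"
   let ?g = "%z. ?f (z - 1) - ?f z"
   \<comment> \<open>Shifting \<open>x\<close> by \<open>h\<close> means shifting \<open>z\<close>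
     by 1, and this shift is passed on to the density. The constant \<open>u x\<close> may be
     subtracted because the density and its shift have equal mass.\<close>
   have X_shift: "X (x + h) z = X x (z + 1)" for z by (simp add: X_def scaleR_left_distrib ac_simps)
   have int1: "integrable lborel (%z. ?f z * ?k z)"
   proof -
    have "integrable P ?k" using int(1) by simp
    thus ?thesis unfolding P_def by (subst (asm) integrable_density) (auto simp: pareto_nonneg b)
   qed
   have int2: "integrable lborel (%z. ?f z * (X x (z + 1) - u x))"
   proof -
    have "integrable P (%z. X x (z + 1) - u x)" using int(2) unfolding X_shift by simp
    thus ?thesis unfolding P_def by (subst (asm) integrable_density) (auto simp: pareto_nonneg b)
   qed
   have int2': "integrable lborel (%z. ?f (z - 1) * ?k z)" "(LL z. ?f (z - 1) * ?k z) = (LL z. ?f z * (X x (z + 1) - u x))"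
    using int2 lborel_integrable_real_affine_iff [of 1 "%z. ?f (z - 1) * ?k z" 1] lborel_integral_real_affine [of 1 "%z. ?f (z - 1) * ?k z" 1]
    by (simp_all add: add.commute)
   have "(\<integral>z. ?W z \<partial>P) = (LL z. ?f z * ?W z)"
    unfolding P_def by (subst integral_density) (auto simp: pareto_nonneg b)
   also have "... = (LL z. ?f z * (X x (z + 1) - u x) - ?f z * ?k z)"
    by (intro Bochner_Integration.integral_cong refl) (simp add: X_shift right_diff_distrib)
   also have "... = (LL z. ?f z * (X x (z + 1) - u x)) - (LL z. ?f z * ?k z)"
    by (rule Bochner_Integration.integral_diff [OF int2 int1])
   also have "... = (LL z. ?f (z - 1) * ?k z - ?f z * ?k z)"
    unfolding int2'(2) [symmetric] by (rule Bochner_Integration.integral_diff [OF int2'(1) int1, symmetric])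
   also have "... = (LL z. ?g z * ?k z)" by (simp add: left_diff_distrib)
   finally have "ennreal ((\<integral>z. ?W z \<partial>P)\<^sup>2) = ennreal ((LL z. ?g z * ?k z)\<^sup>2)" by simp
   also have "... <= ennreal ?G * (NN z. ennreal (\<bar>?g z\<bar> * (?k z)\<^sup>2))"
    by (rule nn_integral_Cauchy_Schwarz_weight [OF _ _ pareto_shift_diff(2) [OF b] GH(1)]) measurable
   also have "... <= ennreal ?G * (NN z. ennreal ?H * (ennreal (?f z) * ennreal ((?k z)\<^sup>2)))"
   proof (intro mult_left_mono nn_integral_mono)
    fix z
    have "\<bar>?g z\<bar> * (?k z)\<^sup>2 <= ?H * (?f z * (?k z)\<^sup>2)"
     using mult_right_mono [OF pareto_shift_diff(1) [OF b, of z], of "(?k z)\<^sup>2"] by (simp add: mult.assoc)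
    hence "ennreal (\<bar>?g z\<bar> * (?k z)\<^sup>2) <= ennreal (?H * (?f z * (?k z)\<^sup>2))" by (rule ennreal_leI)
    thus "ennreal (\<bar>?g z\<bar> * (?k z)\<^sup>2) <= ennreal ?H * (ennreal (?f z) * ennreal ((?k z)\<^sup>2))"
     using GH pareto_nonneg [OF b, of z] by (simp add: ennreal_mult')
   qed simp
   also have "... = ennreal ?G * (ennreal ?H * I x)"
    unfolding I_eq by (subst nn_integral_cmult) simp_all
   also have "... = ennreal (?G * ?H) * I x"
    using GH by (simp add: ennreal_mult' mult.assoc)
   finally show "ennreal ((\<integral>z. ?W z \<partial>P)\<^sup>2) <= ennreal (?G * ?H) * I x" .
  qed
  finally show ?thesis .
 qed
 have "shift_diff 2 u h = (NN z. ennreal (?f z) * shift_diff 2 u h)"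
  by (subst nn_integral_multc) (simp_all add: nn_integral_pareto_eq_1 [OF b])
 also have "... = (NN z. ennreal (?f z) * (NN x. ennreal ((X (x + h) z - X x z)\<^sup>2)))"
 proof (rule nn_integral_cong)
  fix z
  have "shift_diff 2 u h = (NN x. ennreal ((X (x + h) z - X x z)\<^sup>2))"
   unfolding shift_diff_def using nn_integral_lborel_shift [of "%x. apow 2 (u (x + h) - u x)" "z *\<^sub>R h"]
   by (simp add: X_def sq ac_simps)
  thus "ennreal (?f z) * shift_diff 2 u h = ennreal (?f z) * (NN x. ennreal ((X (x + h) z - X x z)\<^sup>2))"
   by (simp only:)
 qed
 also have "... = (NN x. \<integral>\<^sup>+z. ennreal ((X (x + h) z - X x z)\<^sup>2) \<partial>P)"
  by (rule fubini [symmetric]) (unfold X_def, measurable)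
 also have "... <= (NN x. ennreal (?G * ?H) * I x + 2 * (I (x + h) + I x))"
  by (rule nn_integral_mono_AE) (use AE_fin [of 0] AE_fin [of h] in eventually_elim, rule point)
 also have "... = ennreal (?G * ?H) * ?M + 2 * ((NN x. I (x + h)) + ?M)"
  by (simp add: nn_integral_add nn_integral_cmult I_int)
 also have "(NN x. I (x + h)) = ?M"
  by (simp add: nn_integral_lborel_shift I_int)
 also have "ennreal (?G * ?H) * ?M + 2 * (?M + ?M) = (ennreal (?G * ?H) + 4) * ?M"
  by (simp add: distrib_right flip: mult_2)
 also have "ennreal (?G * ?H) + 4 = ennreal (4 + ?G * ?H)"
  using GH by (simp add: add.commute)
 finally show ?thesis by simp
qed

text \<open>Chords of the convex functions \<open>2 powr b\<close> and \<open>2 powr (- b)\<close>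
  over \<open>[0, 2]\<close>; the expression equals
  \<open>4 * 2 powr b - 6 + 2 * 2 powr (- b)\<close> and vanishes at 0.\<close>

lemma pareto_constant_le:
 fixes b :: real
 assumes "0 < b" "b <= 2"
 shows "2 * (1 - 2 powr (- b)) * (2 powr (1 + b) - 1) <= 6 * b"
proof -
 have 1: "2 powr b <= (1 - b / 2) * 1 + (b / 2) * (4::real)"
  using convex_onD [OF convex_on_powr_2, of "b / 2" 0 2] assms by simp
 have 2: "2 powr (- b) <= (1 - b / 2) * 1 + (b / 2) * (1 / 4::real)"
  using convex_onD [OF convex_on_powr_2, of "b / 2" 0 "- 2"] assms by (simp add: powr_minus_divide)
 have "2 powr (- b) * 2 powr b = 1" by (simp add: powr_minus)
 hence "2 * (1 - 2 powr (- b)) * (2 powr (1 + b) - 1) = 4 * 2 powr b - 6 + 2 * 2 powr (- b)"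
  by (simp add: powr_add algebra_simps)
 thus ?thesis using 1 2 assms by (simp add: algebra_simps)
qed

lemma U_fun_2_le_pareto:
 fixes u :: "'a::euclidean_space => real"
 assumes [measurable]: "u \<in> Borel"
  and L2: "(NN x. apow 2 (u x)) < \<infinity>" and b: "0 < b"
 shows "U_fun 2 u t <= ennreal (4 + 2 * (1 - 2 powr (- b)) * (2 powr (1 + b) - 1))
  * (NN z. ennreal (pareto b z) * U_fun 2 u (z * t))"
proof -
 let ?C = "4 + 2 * (1 - 2 powr (- b)) * (2 powr (1 + b) - 1)"
 have sets: "sets (lborel \<Otimes>\<^sub>M sphere_measure) = sets (borel \<Otimes>\<^sub>M (borel :: 'a measure))"
  by (intro sets_pair_measure_cong) simp_all
 have "U_fun 2 u t <= (SS \<omega>. ennreal ?C * (NN z. ennreal (pareto b z) * shift_diff 2 u ((z * t) *\<^sub>R \<omega>)))"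
  unfolding U_fun_eq
 proof (rule nn_integral_mono)
  fix \<omega> :: 'a
  show "shift_diff 2 u (t *\<^sub>R \<omega>) <= ennreal ?C * (NN z. ennreal (pareto b z) * shift_diff 2 u ((z * t) *\<^sub>R \<omega>))"
   using shift_diff_2_le_pareto [OF assms, of "t *\<^sub>R \<omega>"] by (simp only: scaleR_scaleR)
 qed
 also have "... = ennreal ?C * (SS \<omega>. NN z. ennreal (pareto b z) * shift_diff 2 u ((z * t) *\<^sub>R \<omega>))"
  by (rule nn_integral_cmult) measurable
 also have "(\<integral>\<^sup>+\<omega>. (NN z. ennreal (pareto b z) * shift_diff 2 u ((z * t) *\<^sub>R \<omega>)) \<partial>(sphere_measure :: 'a measure))
   = (NN z. SS \<omega>. ennreal (pareto b z) * shift_diff 2 u ((z * t) *\<^sub>R \<omega>))"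
  by (rule lborel_sphere.Fubini') (simp add: measurable_cong_sets [OF sets refl])
 also have "... = (NN z. ennreal (pareto b z) * U_fun 2 u (z * t))"
  unfolding U_fun_eq by (intro nn_integral_cong nn_integral_cmult) measurable
 finally show ?thesis .
qed

text \<open>\<open>K\<close> is the density at \<open>y\<close> of the product of independent Pareto
  variables, of exponent \<open>a\<close> on \<open>(r, \<infinity>)\<close> and \<open>b\<close> on
  \<open>(1, \<infinity>)\<close>. In logarithmic coordinates this is the convolution of two
  exponential laws, a difference of exponentials, and solving for one of them gives the mixture
  identity.\<close>

lemma pareto_product:
 fixes a b r y :: real
 assumes b: "0 < b" "b < a" and r: "0 < r"
 defines "K \<equiv> (NN t. ennreal (a * r powr a * t powr (- 1 - a)) * indicator {r<..} t * (ennreal (1 / t) * ennreal (pareto b (y / t))))"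
 shows "ennreal (a - b) * K + ennreal b * (ennreal (a * r powr a * y powr (- 1 - a)) * indicator {r<..} y)
  = ennreal a * (ennreal (b * r powr b * y powr (- 1 - b)) * indicator {r<..} y)"
proof (cases "r < y")
 case False
 have "K = (\<integral>\<^sup>+t. 0 \<partial>(lborel :: real measure))"
  unfolding K_def using r False by (intro nn_integral_cong) (auto simp: indicator_def pareto_def divide_le_eq less_divide_eq)
 thus ?thesis using False by simp
next
 case True
 define D where "D = a * b * r powr a * y powr (- 1 - b)"
 have D: "0 <= D" using b by (simp add: D_def)
 have "K = (NN t. ennreal (D * t powr (b - a - 1)) * indicator {r..y} t)"
  unfolding K_def
 proof (rule nn_integral_cong_AE, use AE_lborel_singleton [of r] AE_lborel_singleton [of y] in eventually_elim)
  fix t assume t: "t ~= r" "t ~= y"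
  show "ennreal (a * r powr a * t powr (- 1 - a)) * indicator {r<..} t * (ennreal (1 / t) * ennreal (pareto b (y / t))) = ennreal (D * t powr (b - a - 1)) * indicator {r..y} t"
  proof (cases "r < t & t < y")
   case True
   hence t0: "0 < t" using r by simp
   have "t powr (- 1 - a) * (1 / t * t powr (1 + b)) = t powr (b - a - 1)"
   proof -
    have "1 / t = t powr (- 1)" using t0 by (simp add: powr_minus_divide)
    hence "t powr (- 1 - a) * (1 / t * t powr (1 + b)) = t powr ((- 1 - a) + (- 1 + (1 + b)))" by (simp only: powr_add)
    also have "(- 1 - a) + (- 1 + (1 + b)) = b - a - 1" by simp
    finally show ?thesis .
   qed
   moreover have "pareto b (y / t) = b * (y powr (- 1 - b) * t powr (1 + b))"
   proof -
    have "(y / t) powr (- 1 - b) = y powr (- 1 - b) / t powr (- (1 + b))" using t0 True r by (simp add: powr_divide)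
    also have "... = y powr (- 1 - b) * t powr (1 + b)" by (simp only: powr_minus divide_inverse inverse_inverse_eq)
    finally show ?thesis using True t0 by (simp add: pareto_def)
   qed
   moreover have "a * r powr a * t powr (- 1 - a) * (1 / t * (b * (y powr (- 1 - b) * t powr (1 + b)))) = D * (t powr (- 1 - a) * (1 / t * t powr (1 + b)))"
    unfolding D_def by (simp only: mult_ac)
   ultimately have "a * r powr a * t powr (- 1 - a) * (1 / t * pareto b (y / t)) = D * t powr (b - a - 1)"
    by (simp only:)
   hence "ennreal (a * r powr a * t powr (- 1 - a)) * (ennreal (1 / t) * ennreal (pareto b (y / t))) = ennreal (D * t powr (b - a - 1))"
    using t0 b by (simp add: ennreal_mult' [symmetric])
   thus ?thesis using True by simp
  next
   case False
   thus ?thesis using t r by (auto simp: indicator_def pareto_def less_divide_eq)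
  qed
 qed
 also have "... = ennreal (- D * y powr (b - a) / (a - b) - (- D * r powr (b - a) / (a - b)))"
 proof -
  have deriv: "((%t. - D * t powr (b - a) / (a - b)) has_real_derivative D * t powr (b - a - 1)) (at t)" if "r <= t" for t
  proof -
  have "0 < t" using r that by simp
  from DERIV_cmult [OF has_real_derivative_powr [OF this, of "b - a"], of "- D / (a - b)"]
  have "((%t. - D * t powr (b - a) / (a - b)) has_real_derivative (- D / (a - b)) * ((b - a) * t powr (b - a - 1))) (at t)"
   by simp
  moreover have "(- D / (a - b)) * (b - a) = D"
  proof -
   define e where "e = a - b"
   have "b - a = - e" "e ~= 0" using b by (auto simp: e_def)
   thus ?thesis by (simp add: e_def [symmetric])
  qed
  ultimately show ?thesis by (metis mult.assoc)
  qed
  show ?thesis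
  proof (rule nn_integral_FTC_Icc [where F = "%t. - D * t powr (b - a) / (a - b)"])
   fix t assume "t \<in> {r..y}"
   thus "((%t. - D * t powr (b - a) / (a - b)) has_real_derivative D * t powr (b - a - 1)) (at t)"
    by (intro deriv) simp
   show "0 <= D * t powr (b - a - 1)" using D by simp
  next
   show "r <= y" using True by simp
   show "(%t. D * t powr (b - a - 1)) \<in> Borel" by measurable
  qed
 qed
 finally have K: "K = ennreal ((D * r powr (b - a) - D * y powr (b - a)) / (a - b))" by (simp add: diff_divide_distrib)
 have "y powr (b - a) <= r powr (b - a)" using True r b by (intro powr_mono2') auto
 hence mono: "D * y powr (b - a) <= D * r powr (b - a)" using D by (rule mult_left_mono)
 have "ennreal (a - b) * K = ennreal (D * r powr (b - a) - D * y powr (b - a))"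
  unfolding K using b mono by (subst ennreal_mult' [symmetric]) auto
 moreover have "D * r powr (b - a) = a * (b * r powr b * y powr (- 1 - b))"
  using r by (simp add: D_def powr_diff)
 moreover have "D * y powr (b - a) = b * (a * r powr a * y powr (- 1 - a))"
 proof -
  have "y powr (- 1 - b) * y powr (b - a) = y powr (- 1 - a)" unfolding powr_add [symmetric] by simp
  thus ?thesis by (simp add: D_def mult.assoc)
 qed
 ultimately have "ennreal (a - b) * K + ennreal (b * (a * r powr a * y powr (- 1 - a))) = ennreal (a * (b * r powr b * y powr (- 1 - b)))"
  using mono b by (simp add: ennreal_plus [symmetric] del: ennreal_plus)
 thus ?thesis using True b by (simp add: ennreal_mult')
qed

text \<open>Inserting the pointwise Pareto bound into the average with exponent \<open>a\<close>
  gives at most \<open>4 + c\<close> times the average \<open>Q\<close> over the product law, and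
  \<open>pareto_product\<close> expresses \<open>Q\<close> through the averages at \<open>b\<close>
  and at \<open>a\<close>. Solving for the latter leaves the constant 4.\<close>

lemma long_V_2:
 assumes [measurable]: "u \<in> Borel"
  and L2: "(NN x. apow 2 (u x)) < \<infinity>" and r: "0 < r" and b: "0 < b" "b < a" "a <= 2"
 shows "long_V 2 u r a <= 4 * long_V 2 u r b"
proof -
 let ?U = "U_fun 2 u"
 define c where "c = 2 * (1 - 2 powr (- b)) * (2 powr (1 + b) - 1)"
 have c: "c <= 6 * b" "0 <= c"
 proof -
  show "c <= 6 * b" unfolding c_def using b by (intro pareto_constant_le) auto
  have "2 powr (- b) <= 2 powr 0" "2 powr 0 <= 2 powr (1 + b)" using b by (intro powr_mono; simp)+
  thus "0 <= c" by (simp add: c_def)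
 qed
 let ?\<rho> = "%a t. ennreal (a * r powr a * t powr (- 1 - a)) * indicator {r<..} t"
 let ?m = "%t y. ennreal (1 / t) * ennreal (pareto b (y / t))"
 define K where "K = (%y. NN t. ?\<rho> a t * ?m t y)"
 have [measurable]: "K \<in> Borel" unfolding K_def by measurable
 define Q where "Q = (NN y. ?U y * K y)"
 have V: "long_V 2 u r a = (NN t. ?U t * ?\<rho> a t)" "long_V 2 u r b = (NN t. ?U t * ?\<rho> b t)"
  using b by (simp_all add: long_V_def)
 have "long_V 2 u r a <= (NN t. ennreal (4 + c) * (NN y. ?\<rho> a t * ?m t y * ?U y))"
  unfolding V(1)
 proof (rule nn_integral_mono)
  fix t :: real
  show "?U t * ?\<rho> a t <= ennreal (4 + c) * (NN y. ?\<rho> a t * ?m t y * ?U y)"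
  proof (cases "r < t")
   case True
   hence t: "0 < t" using r by simp
   have "(NN z. ennreal (pareto b z) * ?U (z * t)) = ennreal (\<bar>1 / t\<bar> ^ DIM(real)) * (NN y. ennreal (pareto b ((1 / t) *\<^sub>R y)) * ?U ((1 / t) *\<^sub>R y * t))"
    by (rule nn_integral_lborel_scale) (use t in auto)
   also have "... = ennreal (1 / t) * (NN y. ennreal (pareto b (y / t)) * ?U y)"
    using t by simp
   finally have "?U t <= ennreal (4 + c) * (ennreal (1 / t) * (NN y. ennreal (pareto b (y / t)) * ?U y))"
    using U_fun_2_le_pareto [OF assms(1) L2 b(1), of t] by (simp add: c_def)
   hence "?U t * ?\<rho> a t <= ennreal (4 + c) * (ennreal (1 / t) * (NN y. ennreal (pareto b (y / t)) * ?U y)) * ?\<rho> a t"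
    by (rule mult_right_mono) simp
   also have "... = ennreal (4 + c) * ((?\<rho> a t * ennreal (1 / t)) * (NN y. ennreal (pareto b (y / t)) * ?U y))"
    by (simp only: mult_ac)
   also have "(?\<rho> a t * ennreal (1 / t)) * (NN y. ennreal (pareto b (y / t)) * ?U y) = (NN y. (?\<rho> a t * ennreal (1 / t)) * (ennreal (pareto b (y / t)) * ?U y))"
    by (rule nn_integral_cmult [symmetric]) measurable
   finally show ?thesis by (simp only: mult.assoc)
  qed simp
 qed
 also have "... = ennreal (4 + c) * (NN t. NN y. ?\<rho> a t * ?m t y * ?U y)"
  by (rule nn_integral_cmult) measurable
 also have "(NN t. NN y. ?\<rho> a t * ?m t y * ?U y)
   = (NN y. NN t. ?\<rho> a t * ?m t y * ?U y)"
  by (rule lborel_pair.Fubini') measurable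
 also have "... = Q"
  unfolding Q_def
 proof (rule nn_integral_cong)
  fix y
  have "(NN t. ?\<rho> a t * ?m t y * ?U y) = K y * ?U y"
   unfolding K_def by (rule nn_integral_multc) measurable
  thus "(NN t. ?\<rho> a t * ?m t y * ?U y) = ?U y * K y" by (simp only: mult.commute)
 qed
 finally have 1: "long_V 2 u r a <= ennreal (4 + c) * Q" .
 have "ennreal (a - b) * Q + ennreal b * long_V 2 u r a = (NN y. ennreal (a - b) * (?U y * K y) + ennreal b * (?U y * ?\<rho> a y))"
  unfolding V(1) Q_def by (simp add: nn_integral_add nn_integral_cmult)
 also have "... = (NN y. ennreal a * (?U y * ?\<rho> b y))"
 proof (rule nn_integral_cong)
  fix y
  have "ennreal (a - b) * (?U y * K y) + ennreal b * (?U y * ?\<rho> a y) = ?U y * (ennreal (a - b) * K y + ennreal b * ?\<rho> a y)"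
   by (simp add: distrib_left mult_ac)
  also have "ennreal (a - b) * K y + ennreal b * ?\<rho> a y = ennreal a * ?\<rho> b y"
   unfolding K_def by (rule pareto_product) (use b r in auto)
  finally show "ennreal (a - b) * (?U y * K y) + ennreal b * (?U y * ?\<rho> a y) = ennreal a * (?U y * ?\<rho> b y)"
   by (simp only: mult.left_commute)
 qed
 also have "... = ennreal a * long_V 2 u r b"
  unfolding V(2) by (rule nn_integral_cmult) measurable
 finally have 2: "ennreal (a - b) * Q + ennreal b * long_V 2 u r a = ennreal a * long_V 2 u r b" .
 have fin: "long_V 2 u r a < \<infinity>" "long_V 2 u r b < \<infinity>" using long_V_finite(2) [OF assms(1) _ r L2] b by auto
 have "ennreal (a - b) * Q <= ennreal a * long_V 2 u r b" unfolding 2 [symmetric] by simp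
 also have "... < \<infinity>" using fin by (simp add: ennreal_mult_less_top)
 finally have "Q < \<infinity>" using b by (auto simp: ennreal_mult_less_top)
 then obtain qq va vb where reals: "Q = ennreal qq" "long_V 2 u r a = ennreal va" "long_V 2 u r b = ennreal vb" "0 <= qq" "0 <= va" "0 <= vb"
  using fin by (cases Q; cases "long_V 2 u r a"; cases "long_V 2 u r b") auto
 have "va <= (4 + c) * qq" using 1 reals c by (simp add: ennreal_mult' [symmetric] del: ennreal_plus)
 moreover have "(a - b) * qq + b * va = a * vb"
  using 2 reals b by (simp add: ennreal_mult' [symmetric] ennreal_plus [symmetric] del: ennreal_plus)
 ultimately have "(a - b) * va <= (a - b) * ((4 + c) * qq)" "(a - b) * qq = a * vb - b * va"
  using b by (auto intro: mult_left_mono)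
 moreover have "(a - b) * ((4 + c) * qq) = (4 + c) * ((a - b) * qq)" by (rule mult.left_commute)
 ultimately have "(a - b) * va <= (4 + c) * (a * vb - b * va)"
  by (simp only:)
 hence "(a - b + (4 + c) * b) * va <= (4 + c) * a * vb" by (simp add: algebra_simps)
 \<comment> \<open>The term \<open>c * a\<close> is at most \<open>12 * b\<close>, because
   \<open>c <= 6 * b\<close> and \<open>a <= 2\<close>; this is exactly the surplus
   \<open>4 * (4 * b - b)\<close> on the right.\<close>
 also have "... <= 4 * (a - b + (4 + c) * b) * vb"
 proof (rule mult_right_mono)
  have "c * a <= (6 * b) * 2" using c b by (intro mult_mono) auto
  moreover have "0 <= c * b" using c b by simp
  ultimately show "(4 + c) * a <= 4 * (a - b + (4 + c) * b)" by (simp add: algebra_simps)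
 qed (rule reals)
 finally have "(a - b + (4 + c) * b) * va <= (a - b + (4 + c) * b) * (4 * vb)" by (simp only: mult_ac)
 moreover have "0 < a - b + (4 + c) * b" using b c by (intro add_pos_nonneg) auto
 ultimately have "va <= 4 * vb" by (simp only: mult_le_cancel_left_pos)
 hence "ennreal va <= ennreal (4 * vb)" by (rule ennreal_leI)
 thus ?thesis unfolding reals by (simp add: ennreal_mult')
qed

lemma long_range_finite_exponent:
 fixes u :: "'a::euclidean_space => real"
 assumes u: "u \<in> Borel" and q: "1 <= q"
  and Lq: "(NN x. apow q (u x)) < \<infinity>" and r: "0 < r"
 shows "continuous_on {0..1} (%s. long_range (ennreal q) s u r)"
  and "0 <= \<sigma> ==> \<sigma> < \<eta> ==> \<eta> <= 1 ==> 2 <= DIM('a) \<or> \<sigma> = 0 \<or> q = 2 ==>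
   long_range (ennreal q) \<eta> u r <= 2 * long_range (ennreal q) \<sigma> u r"
  and "0 < \<sigma> ==> \<sigma> < \<eta> ==> \<eta> <= 1 ==> long_range (ennreal q) \<eta> u r
   <= ennreal (2 powr (1 + 1 / q) * \<sigma> powr (1 / q) * r powr \<sigma>) * rpow (U_integral \<sigma> (ennreal q) u {0<..}) (1 / q)"
proof -
 have q0: "0 < q" using q by simp
 let ?h = "%s. rpow (ennreal (1 / q) * long_V q u r (s * q)) (1 / q)"
 let ?T = "%s. long_range (ennreal q) s u r"
 have eq: "?T s = ?h s" if "0 <= s" for s by (rule long_range_eq [OF u q r that])
 have lim: "(?h ---> ?h s) F" if "((%s. long_V q u r (s * q)) ---> long_V q u r (s * q)) F" for s F
  using that q0 by (intro tendsto_rpow tendsto_mult_ennreal_pos tendsto_const) auto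
 show "continuous_on {0..1} ?T"
 proof (rule continuous_on_one_sided)
  fix s b :: real assume s: "s \<in> {0..1}" "b \<in> {0..1}"
  show "(?T ---> ?T s) (at_left s)" if "b < s"
  proof -
   have s0: "0 < s" using s that by simp
   have "(?h ---> ?h s) (at_left s)"
    by (rule lim, rule filterlim_compose [OF long_V_continuous(1) [OF u q r Lq] filterlim_mult_right_at_left(1) [OF q0]]) (use s0 q0 in simp)
   moreover have "\<forall>\<^sub>F \<tau> in at_left s. ?h \<tau> = ?T \<tau>"
    using eventually_at_left_real [OF s0] by eventually_elim (simp add: eq)
   ultimately have "(?T ---> ?h s) (at_left s)" by (rule Lim_transform_eventually)
   thus ?thesis using eq [of s] s by simp
  qed
  show "(?T ---> ?T s) (at_right s)"
  proof -
   have "(?h ---> ?h s) (at_right s)"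
    by (rule lim, rule filterlim_compose [OF long_V_continuous(2) [OF u q r Lq] filterlim_mult_right_at_left(2) [OF q0]]) (use s q0 in simp)
   moreover have "\<forall>\<^sub>F \<tau> in at_right s. ?h \<tau> = ?T \<tau>"
    using s by (auto simp: eventually_at_filter eq intro!: always_eventually)
   ultimately have "(?T ---> ?h s) (at_right s)" by (rule Lim_transform_eventually)
   thus ?thesis using eq [of s] s by simp
  qed
 qed
 show "?T \<eta> <= 2 * ?T \<sigma>" if "0 <= \<sigma>" "\<sigma> < \<eta>" "\<eta> <= 1" "2 <= DIM('a) \<or> \<sigma> = 0 \<or> q = 2"
 proof -
  have lt: "\<sigma> * q < \<eta> * q" using that q0 by simp
  have "long_V q u r (\<eta> * q) <= ennreal (2 powr q) * long_V q u r (\<sigma> * q)"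
  proof (cases "\<sigma> = 0")
   case True
   thus ?thesis using long_V_finite(1) [OF u q r Lq, of "\<eta> * q"] that q0 by simp
  next
   case False
   hence \<sigma>: "0 < \<sigma> * q" using that q0 by simp
   show ?thesis
   proof (cases "2 <= DIM('a)")
    case True
    thus ?thesis using lt \<sigma> by (intro long_V_almost_decreasing [OF u q r Lq])
   next
    case dim: False
    hence q2: "q = 2" using that False by simp
    have "long_V 2 u r (\<eta> * 2) <= 4 * long_V 2 u r (\<sigma> * 2)"
     using that \<sigma> lt Lq unfolding q2 by (intro long_V_2 [OF u _ r]) auto
    thus ?thesis by (simp add: q2)
   qed
  qed
  hence "?h \<eta> <= rpow (ennreal (1 / q) * (ennreal (2 powr q) * long_V q u r (\<sigma> * q))) (1 / q)"
   using q0 by (intro rpow_mono mult_left_mono) auto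
  also have "... = rpow (ennreal (2 powr q) * (ennreal (1 / q) * long_V q u r (\<sigma> * q))) (1 / q)"
   by (simp only: mult.left_commute)
  also have "... = 2 * ?h \<sigma>"
   using q0 by (subst rpow_cmult) (auto simp: powr_powr)
  finally show ?thesis using eq [of \<eta>] eq [of \<sigma>] that by simp
 qed
 show "?T \<eta> <= ennreal (2 powr (1 + 1 / q) * \<sigma> powr (1 / q) * r powr \<sigma>) * rpow (U_integral \<sigma> (ennreal q) u {0<..}) (1 / q)"
  if "0 < \<sigma>" "\<sigma> < \<eta>" "\<eta> <= 1"
 proof -
  let ?I = "U_integral \<sigma> (ennreal q) u {0<..}"
  have I: "?I = (NN t. U_fun q u t * (ennreal (t powr (- 1 - \<sigma> * q)) * indicator {0<..} t))"
   using q0 by (intro U_integral_eq) auto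
  have "long_V q u r (\<eta> * q) <= ennreal (2 powr (q + 1)) * (ennreal (\<sigma> * q * r powr (\<sigma> * q)) * ?I)"
   unfolding I by (rule long_V_le_full [OF u q r]) (use that q0 in auto)
  hence "?h \<eta> <= rpow (ennreal (1 / q) * (ennreal (2 powr (q + 1)) * (ennreal (\<sigma> * q * r powr (\<sigma> * q)) * ?I))) (1 / q)"
   using q0 by (intro rpow_mono mult_left_mono) auto
  also have "ennreal (1 / q) * (ennreal (2 powr (q + 1)) * (ennreal (\<sigma> * q * r powr (\<sigma> * q)) * ?I)) = ennreal (2 powr (q + 1)) * (ennreal (1 / q) * (ennreal (\<sigma> * q * r powr (\<sigma> * q)) * ?I))"
   by (simp only: mult.left_commute)
  also have "rpow ... (1 / q) = ennreal ((2 powr (q + 1)) powr (1 / q)) * (ennreal (\<sigma> powr (1 / q) * r powr \<sigma>) * rpow ?I (1 / q))"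
   using q0 that r by (simp only: rpow_cmult_1q rpow_cmult less_imp_le powr_ge_zero zero_less_divide_1_iff)
  also have "(2 powr (q + 1)) powr (1 / q) = 2 powr (1 + 1 / q)"
   using q0 by (simp add: powr_powr field_simps)
  also have "ennreal (2 powr (1 + 1 / q)) * (ennreal (\<sigma> powr (1 / q) * r powr \<sigma>) * rpow ?I (1 / q)) = ennreal (2 powr (1 + 1 / q) * \<sigma> powr (1 / q) * r powr \<sigma>) * rpow ?I (1 / q)"
   by (simp add: mult.assoc [symmetric] ennreal_mult' [symmetric])
  finally show ?thesis using eq [of \<eta>] that by simp
 qed
qed

section \<open>Infinite exponent\<close>

lemma AE_lebesgue_iff: "(AE x in lebesgue. P x) \<longleftrightarrow> (AE x in lborel. P x)"
 by (rule AE_completion_iff)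

lemma esssup_le_iff:
 fixes f :: "'b => ennreal"
 assumes "f \<in> borel_measurable M"
 shows "esssup M f <= c \<longleftrightarrow> (AE x in M. f x <= c)"
proof
 assume *: "esssup M f <= c"
 show "AE x in M. f x <= c" using esssup_AE [of f M] by eventually_elim (use * in order)
qed (rule esssup_I [OF assms])

lemma esssup_powr_antimono:
 fixes D w :: "'b => real"
 assumes [measurable]: "D \<in> borel_measurable M" "w \<in> borel_measurable M"
  and D: "!!z. 0 <= D z" and w: "!!z. 0 < w z" "!!z. w z <= 1" and "b <= a"
 shows "esssup M (%z. ennreal (D z * w z powr a)) <= esssup M (%z. ennreal (D z * w z powr b))"
proof (rule esssup_mono)
 fix z
 have "w z powr a <= w z powr b" using w [of z] \<open>b \<le> a\<close> by (intro powr_mono') auto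
 thus "ennreal (D z * w z powr a) <= ennreal (D z * w z powr b)" using D by (intro ennreal_leI mult_left_mono)
qed measurable

text \<open>The values increase as the exponent decreases to \<open>c\<close>. If they stayed below
  \<open>l\<close>, the bound would hold almost everywhere for the countably many exponents
  \<open>c + 1 / (n + 1)\<close> at once, and hence at \<open>c\<close>.\<close>

lemma esssup_powr_right:
 fixes D w :: "'b => real"
 assumes [measurable]: "D \<in> borel_measurable M" "w \<in> borel_measurable M"
  and D: "!!z. 0 <= D z" and w: "!!z. 0 < w z" "!!z. w z <= 1"
 shows "((%a. esssup M (%z. ennreal (D z * w z powr a))) ---> esssup M (%z. ennreal (D z * w z powr c))) (at_right c)"
proof (rule order_tendstoI)
 let ?S = "%a. esssup M (%z. ennreal (D z * w z powr a))"
 note mono = esssup_powr_antimono [OF assms]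
 show "\<forall>\<^sub>F a in at_right c. ?S a < v" if "?S c < v" for v
  using that by (auto simp: eventually_at_filter intro!: always_eventually le_less_trans [OF mono that])
 fix l assume l: "l < ?S c"
 have "\<exists>n. l < ?S (c + 1 / real (Suc n))"
 proof (rule ccontr)
  assume "\<not> ?thesis"
  hence "!!n. AE z in M. ennreal (D z * w z powr (c + 1 / real (Suc n))) <= l"
   by (subst esssup_le_iff [symmetric]) (auto simp: not_less)
  hence "AE z in M. \<forall>n. ennreal (D z * w z powr (c + 1 / real (Suc n))) <= l" by (simp add: AE_all_countable)
  hence "AE z in M. ennreal (D z * w z powr c) <= l"
  proof eventually_elim
   case (elim z)
   have "(%n. 1 / real (Suc n)) ----> 0"
    using LIMSEQ_inverse_real_of_nat by (simp only: inverse_eq_divide)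
   from tendsto_add [OF tendsto_const this, of c] have "(%n. c + 1 / real (Suc n)) ----> c" by (simp only: add_0_right)
   from tendsto_powr [OF tendsto_const this, of "w z"] w(1) [of z]
   have "(%n. w z powr (c + 1 / real (Suc n))) ----> w z powr c" by (simp only: less_imp_neq [THEN not_sym] not_False_eq_True)
   from tendsto_ennrealI [OF tendsto_mult [OF tendsto_const this]]
   have "(%n. ennreal (D z * w z powr (c + 1 / real (Suc n)))) ----> ennreal (D z * w z powr c)" .
   from LIMSEQ_le_const2 [OF this] show ?case using elim by blast
  qed
  hence "?S c <= l" by (intro esssup_I) auto
  with l show False by simp
 qed
 then obtain n where n: "l < ?S (c + 1 / real (Suc n))" ..
 have "\<forall>\<^sub>F a in at_right c. a \<in> {c<..<c + 1 / real (Suc n)}" by (rule eventually_at_right_real) simp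
 thus "\<forall>\<^sub>F a in at_right c. l < ?S a"
  by eventually_elim (rule less_le_trans [OF n mono], simp)
qed

text \<open>Interpolation between the exponents \<open>b\<close> and \<open>c\<close>: with
  \<open>\<theta>\<close> the share of \<open>b\<close> in \<open>a\<close>, the essential supremum
  at \<open>a\<close> is at most \<open>B powr \<theta> * C powr (1 - \<theta>)\<close>, which tends
  to \<open>C\<close> as \<open>\<theta>\<close> tends to 0. If \<open>C = 0\<close> then
  \<open>D\<close> vanishes almost everywhere.\<close>

lemma esssup_powr_left:
 fixes D w :: "'b => real"
 assumes [measurable]: "D \<in> borel_measurable M" "w \<in> borel_measurable M"
  and D: "!!z. 0 <= D z" and w: "!!z. 0 < w z" "!!z. w z <= 1"
  and b: "b < c" "esssup M (%z. ennreal (D z * w z powr b)) < \<infinity>"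
 shows "((%a. esssup M (%z. ennreal (D z * w z powr a))) ---> esssup M (%z. ennreal (D z * w z powr c))) (at_left c)"
proof -
 let ?S = "%a. esssup M (%z. ennreal (D z * w z powr a))"
 note mono = esssup_powr_antimono [OF assms(1-5)]
 have lower: "\<forall>\<^sub>F a in at_left c. ?S c <= ?S a"
  by (auto simp: eventually_at_filter intro!: always_eventually mono)
 have near: "\<forall>\<^sub>F a in at_left c. a \<in> {b<..<c}" using b(1) by (rule eventually_at_left_real)
 show ?thesis
 proof (cases "?S c = 0")
  case True
  hence "AE z in M. ennreal (D z * w z powr c) <= 0" by (subst esssup_le_iff [symmetric]) auto
  hence zero: "AE z in M. D z = 0"
  proof eventually_elim
   case (elim z)
   hence "D z * w z powr c <= 0" by (simp add: ennreal_eq_0_iff)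
   thus ?case using D [of z] w(1) [of z] by (simp add: mult_le_0_iff)
  qed
  have "?S a = 0" for a
  proof -
   have "?S a <= 0" by (intro esssup_I) (use zero in \<open>auto elim: eventually_mono\<close>)
   thus ?thesis by simp
  qed
  thus ?thesis by simp
 next
  case False
  have "?S c <= ?S b" using b(1) by (intro mono) simp
  with b(2) False obtain B C where BC: "?S b = ennreal B" "?S c = ennreal C" "0 < C" "C <= B"
   by (cases "?S b"; cases "?S c") (auto simp: top_unique)
  define \<theta> where "\<theta> = (%a. (c - a) / (c - b))"
  have upper: "\<forall>\<^sub>F a in at_left c. ?S a <= ennreal (B powr \<theta> a * C powr (1 - \<theta> a))"
   using near
  proof eventually_elim
   case (elim a)
   hence \<theta>: "0 < \<theta> a" "\<theta> a < 1" using b(1) by (auto simp: \<theta>_def divide_less_eq)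
   have "\<theta> a * (c - b) = c - a" using b(1) by (simp add: \<theta>_def)
   hence a_eq: "a = \<theta> a * b + (1 - \<theta> a) * c" by (simp add: algebra_simps)
   have "AE z in M. ennreal (D z * w z powr b) <= ennreal B" "AE z in M. ennreal (D z * w z powr c) <= ennreal C"
    unfolding BC(1,2) [symmetric] by (rule esssup_AE)+
   hence "AE z in M. ennreal (D z * w z powr a) <= ennreal (B powr \<theta> a * C powr (1 - \<theta> a))"
   proof eventually_elim
    case (elim z)
    hence le: "D z * w z powr b <= B" "D z * w z powr c <= C" using BC by (simp_all add: ennreal_le_iff)
    have w_eq: "w z powr a = (w z powr b) powr \<theta> a * (w z powr c) powr (1 - \<theta> a)"
     by (subst a_eq) (simp add: powr_powr powr_add mult.commute)
    have D_eq: "D z = D z powr \<theta> a * D z powr (1 - \<theta> a)"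
     using D [of z] by (simp add: powr_add [symmetric])
    have r: "(D z * w z powr b) powr \<theta> a = D z powr \<theta> a * (w z powr b) powr \<theta> a"
      "(D z * w z powr c) powr (1 - \<theta> a) = D z powr (1 - \<theta> a) * (w z powr c) powr (1 - \<theta> a)"
     using D [of z] by (simp_all add: powr_mult)
    have "D z * w z powr a = (D z powr \<theta> a * D z powr (1 - \<theta> a)) * ((w z powr b) powr \<theta> a * (w z powr c) powr (1 - \<theta> a))"
     by (simp only: w_eq D_eq [symmetric])
    also have "... = (D z * w z powr b) powr \<theta> a * (D z * w z powr c) powr (1 - \<theta> a)"
     by (simp only: r mult_ac)
    also have "... <= B powr \<theta> a * C powr (1 - \<theta> a)"
     using le \<theta> D [of z] by (intro mult_mono powr_mono2) auto
    finally show ?case by (rule ennreal_leI)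
   qed
   thus ?case by (intro esssup_I) auto
  qed
  have "(\<theta> ---> (c - c) / (c - b)) (at_left c)" unfolding \<theta>_def using b(1) by (intro tendsto_intros) auto
  hence "(\<theta> ---> 0) (at_left c)" by simp
  hence "((%a. ennreal (B powr \<theta> a * C powr (1 - \<theta> a))) ---> ennreal (B powr 0 * C powr (1 - 0))) (at_left c)"
   using BC by (intro tendsto_intros tendsto_ennrealI) auto
  hence lim: "((%a. ennreal (B powr \<theta> a * C powr (1 - \<theta> a))) ---> ?S c) (at_left c)" using BC by simp
  show ?thesis by (rule tendsto_sandwich [OF lower upper tendsto_const lim])
 qed
qed

text \<open>With \<open>y = x + h\<close>, statements about almost all pairs become statements about
  increments along almost every \<open>h\<close>.\<close>

lemma AE_lebesgue_pair_iff:
 fixes P :: "'a::euclidean_space \<times> 'a => bool"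
 assumes [measurable]: "Measurable.pred (borel \<Otimes>\<^sub>M borel) P"
 shows "(AE z in lebesgue2. P z) \<longleftrightarrow> (AE h in lborel. AE x in lborel. P (x, x + h))"
proof -
 let ?f = "%z. if P z then 0 else 1 :: ennreal"
 have f [measurable]: "?f \<in> Borel2" by measurable
 have "(\<integral>\<^sup>+z. ?f z \<partial>lebesgue2) = (NN x. NN y. ?f (x, y))"
  by (rule nn_integral_lebesgue_pair) measurable
 also have "... = (NN x. NN h. ?f (x, x + h))"
 proof (rule nn_integral_cong)
  fix x
  have "(%y. ?f (x, y)) \<in> Borel" by measurable
  from nn_integral_lborel_shift [OF this, of x] show "(NN y. ?f (x, y)) = (NN h. ?f (x, x + h))"
   by (simp only: add.commute)
 qed
 also have "... = (NN h. NN x. ?f (x, x + h))"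
  by (rule lborel_pair.Fubini') measurable
 finally have eq: "(\<integral>\<^sup>+z. ?f z \<partial>lebesgue2) = (NN h. NN x. ?f (x, x + h))" .
 have "(AE z in lebesgue2. P z) \<longleftrightarrow> (AE z in lebesgue2. ?f z = 0)" by simp
 also have "... \<longleftrightarrow> (\<integral>\<^sup>+z. ?f z \<partial>lebesgue2) = 0"
  by (rule nn_integral_0_iff_AE [symmetric]) (rule measurable_lebesgue_pair [OF f])
 also have "... \<longleftrightarrow> (AE h in lborel. (NN x. ?f (x, x + h)) = 0)"
  unfolding eq by (rule nn_integral_0_iff_AE) measurable
 also have "... \<longleftrightarrow> (AE h in lborel. AE x in lborel. ?f (x, x + h) = 0)"
  by (subst nn_integral_0_iff_AE) auto
 finally show ?thesis by simp
qed

lemma holder_sup_le_iff: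
 fixes u :: "'a::euclidean_space => real"
 assumes [measurable]: "u \<in> Borel" and A [measurable]: "A \<in> sets (borel \<Otimes>\<^sub>M borel)"
 shows "holder_sup s u A <= c \<longleftrightarrow> (AE h in lborel. AE x in lborel. (x, x + h) \<in> A --> ennreal (\<bar>u x - u (x + h)\<bar> / norm h powr s) <= c)"
proof -
 let ?f = "%z. ennreal (\<bar>u (fst z) - u (snd z)\<bar> / norm (fst z - snd z) powr s)"
 have f: "?f \<in> borel_measurable lebesgue2" by (rule measurable_lebesgue_pair) measurable
 have "A = {z. z \<in> A}" by simp
 have "indicator A \<in> borel_measurable ((lebesgue :: 'a measure) \<Otimes>\<^sub>M (lebesgue :: 'a measure))"
  by (rule measurable_lebesgue_pair) measurable
 hence A': "A \<in> sets ((lebesgue :: 'a measure) \<Otimes>\<^sub>M lebesgue)" by (subst (asm) borel_measurable_indicator_iff) (simp add: space_pair_measure)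
 have "holder_sup s u A <= c \<longleftrightarrow> (AE z in restrict_space lebesgue2 A. ?f z <= c)"
  unfolding holder_sup_def split_beta' by (rule esssup_le_iff) (rule measurable_restrict_space1 [OF f])
 also have "... \<longleftrightarrow> (AE z in lebesgue2. z \<in> A --> ?f z <= c)"
  using A' by (intro AE_restrict_space_iff) (auto simp: space_pair_measure)
 also have "... \<longleftrightarrow> (AE h in lborel. AE x in lborel. (x, x + h) \<in> A --> ?f (x, x + h) <= c)"
  by (rule AE_lebesgue_pair_iff) measurable
 finally show ?thesis by (simp only: fst_conv snd_conv diff_add_cancel norm_minus_cancel) (simp add: norm_minus_commute)
qed

lemma sets_pair_norm [measurable]:
 "{(x, y). 0 < norm (x - y) & norm (x - y) <= r} \<in> sets (borel \<Otimes>\<^sub>M (borel :: 'a::euclidean_space measure))"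
 "{(x, y). norm (x - y) \<ge> r} \<in> sets (borel \<Otimes>\<^sub>M (borel :: 'a::euclidean_space measure))"
 "{(x, y). x ~= y} \<in> sets (borel \<Otimes>\<^sub>M (borel :: 'a::euclidean_space measure))"
proof -
 let ?M = "borel \<Otimes>\<^sub>M (borel :: 'a measure)"
 have "{z \<in> space ?M. 0 < norm (fst z - snd z) & norm (fst z - snd z) <= r} \<in> sets ?M"
  "{z \<in> space ?M. norm (fst z - snd z) \<ge> r} \<in> sets ?M"
  "{z \<in> space ?M. 0 < norm (fst z - snd z)} \<in> sets ?M"
  by measurable
 thus "{(x, y). 0 < norm (x - y) & norm (x - y) <= r} \<in> sets ?M"
  "{(x, y). norm (x - y) \<ge> r} \<in> sets ?M"
  "{(x, y). x ~= y} \<in> sets ?M"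
  by (simp_all add: split_beta' space_pair_measure)
qed

section \<open>Lipschitz bounds and bounded weak gradients\<close>

lemma holder_sup_lipschitz_iff:
 assumes [measurable]: "u \<in> Borel" and l: "0 <= l"
 shows "holder_sup 1 u {(x, y). 0 < norm (x - y) & norm (x - y) <= r} <= ennreal l
  \<longleftrightarrow> (AE h in lborel. norm h <= r --> (AE x in lborel. \<bar>u (x + h) - u x\<bar> <= l * norm h))"
proof -
 have eq: "((x, x + h) \<in> {(x, y). 0 < norm (x - y) & norm (x - y) <= r} --> ennreal (\<bar>u x - u (x + h)\<bar> / norm h powr 1) <= ennreal l)
  \<longleftrightarrow> (norm h <= r --> \<bar>u (x + h) - u x\<bar> <= l * norm h)" for x h
  using l by (cases "h = 0") (auto simp: ennreal_le_iff divide_le_eq abs_minus_commute norm_minus_commute)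
 show ?thesis
  unfolding holder_sup_le_iff [OF assms(1) sets_pair_norm(1)] eq
  by (intro arg_cong [where f = "%P. almost_everywhere lborel P"] ext) auto
qed

lemma loc_int_bounded:
 fixes u :: "'a::euclidean_space => real"
 assumes [measurable]: "u \<in> Borel" and bd: "AE x in lborel. \<bar>u x\<bar> <= C"
 shows "loc_int u"
proof -
 have "integrable lborel (%x. indicator (cball 0 R) x *\<^sub>R u x)" for R
 proof (rule Bochner_Integration.integrable_bound)
  show "integrable lborel (%x :: 'a. indicator (cball 0 R) x *\<^sub>R C)"
   using emeasure_lborel_cball_finite [of 0 R] by (intro integrable_scaleR_left) (simp add: integrable_indicator_iff)
  show "AE x in lborel. norm (indicator (cball 0 R) x *\<^sub>R u x) <= norm (indicator (cball 0 R) x *\<^sub>R C)"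
   using bd by eventually_elim (auto simp: indicator_def)
 qed measurable
 thus ?thesis by (simp add: loc_int_def)
qed

text \<open>The bound is known for almost every vector only. Scaled copies of the exceptional null
  set are null, and countably many of them are used.\<close>

lemma AE_lipschitz_dyadic:
 fixes u :: "'a::euclidean_space => real"
 assumes lip: "AE h in lborel. norm h <= r --> (AE x in lborel. \<bar>u (x + h) - u x\<bar> <= l * norm h)"
 shows "AE h in lborel. norm h <= r --> (\<forall>n::nat. AE x in lborel. \<bar>2 ^ n * (u (x + (1 / 2 ^ n) *\<^sub>R h) - u x)\<bar> <= l * norm h)"
proof -
 have "AE h in lborel. norm ((1 / 2 ^ n) *\<^sub>R h) <= r --> (AE x in lborel. \<bar>u (x + (1 / 2 ^ n) *\<^sub>R h) - u x\<bar> <= l * norm ((1 / 2 ^ n) *\<^sub>R h))" for n :: nat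
  using AE_lborel_scale [OF lip, of "1 / 2 ^ n"] by simp
 hence "AE h in lborel. \<forall>n::nat. norm ((1 / 2 ^ n) *\<^sub>R h) <= r --> (AE x in lborel. \<bar>u (x + (1 / 2 ^ n) *\<^sub>R h) - u x\<bar> <= l * norm ((1 / 2 ^ n) *\<^sub>R h))"
  by (simp only: AE_all_countable) blast
 thus ?thesis
 proof eventually_elim
  case (elim h)
  show ?case
  proof (intro impI allI)
   fix n :: nat assume h: "norm h <= r"
   have "1 * norm h <= 2 ^ n * norm h" by (intro mult_right_mono) simp_all
   hence "norm ((1 / 2 ^ n) *\<^sub>R h) <= norm h" by (simp add: divide_le_eq mult.commute)
   hence "AE x in lborel. \<bar>u (x + (1 / 2 ^ n) *\<^sub>R h) - u x\<bar> <= l * norm ((1 / 2 ^ n) *\<^sub>R h)" using elim h by force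
   thus "AE x in lborel. \<bar>2 ^ n * (u (x + (1 / 2 ^ n) *\<^sub>R h) - u x)\<bar> <= l * norm h"
   proof eventually_elim
    case (elim x)
    hence "2 ^ n * \<bar>u (x + (1 / 2 ^ n) *\<^sub>R h) - u x\<bar> <= 2 ^ n * (l * norm ((1 / 2 ^ n) *\<^sub>R h))" by (intro mult_left_mono) auto
    thus ?case by (simp add: abs_mult)
   qed
  qed
 qed
qed

text \<open>The directions with essentially bounded dyadic difference quotients satisfy the
  hypotheses of \<open>annulus_group\<close>, so weak derivatives exist along every vector, the
  basis vectors in particular.\<close>

lemma lipschitz_imp_weak_gradient:
 fixes u :: "'a::euclidean_space => real"
 assumes u: "loc_int u" and r: "0 < r"
  and lip: "AE h in lborel. norm h <= r --> (AE x in lborel. \<bar>u (x + h) - u x\<bar> <= l * norm h)"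
 shows "\<exists>g. weak_gradient u g"
proof -
 let ?V = "%h. \<exists>C. \<forall>n::nat. AE x in lborel. \<bar>2 ^ n * (u (x + (1 / 2 ^ n) *\<^sub>R h) - u x)\<bar> <= C"
 have V: "?V h" for h
 proof (rule annulus_group [where V = ?V and r = r])
  fix h k :: 'a assume "?V h" "?V k"
  then obtain C D where "\<forall>n::nat. AE x in lborel. \<bar>2 ^ n * (u (x + (1 / 2 ^ n) *\<^sub>R h) - u x)\<bar> <= C"
   "\<forall>n::nat. AE x in lborel. \<bar>2 ^ n * (u (x + (1 / 2 ^ n) *\<^sub>R k) - u x)\<bar> <= D" by (elim exE)
  note CD = this [THEN spec]
  have "AE x in lborel. \<bar>2 ^ n * (u (x + (1 / 2 ^ n) *\<^sub>R (h - k)) - u x)\<bar> <= C + D" for n :: nat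
   using AE_lborel_shift [OF CD(1) [of n], of "- ((1 / 2 ^ n) *\<^sub>R k)"] AE_lborel_shift [OF CD(2) [of n], of "- ((1 / 2 ^ n) *\<^sub>R k)"]
  proof eventually_elim
   case (elim x)
   let ?y = "x + - ((1 / 2 ^ n) *\<^sub>R k)"
   have "?y + (1 / 2 ^ n) *\<^sub>R h = x + (1 / 2 ^ n) *\<^sub>R (h - k)" "?y + (1 / 2 ^ n) *\<^sub>R k = x"
    by (simp_all add: scaleR_diff_right)
   with elim have "\<bar>2 ^ n * (u (x + (1 / 2 ^ n) *\<^sub>R (h - k)) - u ?y)\<bar> <= C" "\<bar>2 ^ n * (u x - u ?y)\<bar> <= D" by (simp_all only:)
   thus ?case by (simp add: right_diff_distrib)
  qed
  thus "?V (h - k)" by blast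
 next
  fix h :: 'a assume "?V h"
  then obtain C where "\<forall>n::nat. AE x in lborel. \<bar>2 ^ n * (u (x + (1 / 2 ^ n) *\<^sub>R h) - u x)\<bar> <= C" ..
  note C = this [THEN spec]
  have "AE x in lborel. \<bar>2 ^ n * (u (x + (1 / 2 ^ n) *\<^sub>R (2 *\<^sub>R h)) - u x)\<bar> <= C + C" for n :: nat
   using AE_lborel_shift [OF C [of n], of "(1 / 2 ^ n) *\<^sub>R h"] C [of n]
  proof eventually_elim
   case (elim x)
   have "x + (1 / 2 ^ n) *\<^sub>R h + (1 / 2 ^ n) *\<^sub>R h = x + (1 / 2 ^ n) *\<^sub>R (2 *\<^sub>R h)"
    by (simp add: scaleR_2 scaleR_add_right)
   with elim show ?case by (simp only: right_diff_distrib)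
  qed
  thus "?V (2 *\<^sub>R h)" by blast
 next
  show "AE h in lborel. r / 2 < norm h & norm h < r --> ?V h"
   using AE_lipschitz_dyadic [OF lip] by eventually_elim force
 qed (rule r)
 have "\<exists>v. weak_dir u h v" for h
 proof -
  obtain C where "!!n::nat. AE x in lborel. \<bar>2 ^ n * (u (x + (1 / 2 ^ n) *\<^sub>R h) - u x)\<bar> <= C" using V [of h] by blast
  thus ?thesis by (rule weak_dir_exists_bounded [OF u])
 qed
 then obtain v where "!!h. weak_dir u h (v h)" by metis
 thus ?thesis using weak_dir_imp_weak_gradient [of u v] by blast
qed

text \<open>If \<open>norm v > l\<close>, the inequality fails at a short multiple of
  \<open>v\<close> and, by continuity, on a ball around it, which has positive measure.\<close>

lemma norm_le_of_AE_inner: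
 fixes v :: "'a::euclidean_space"
 assumes ae: "AE h in lborel. norm h <= r --> \<bar>v \<bullet> h\<bar> <= l * norm h" and r: "0 < r" and l: "0 <= l"
 shows "norm v <= l"
proof (rule ccontr)
 assume "\<not> norm v <= l"
 hence lt: "l < norm v" by simp
 hence v: "0 < norm v" using l by linarith
 let ?h = "(r / 2 / norm v) *\<^sub>R v"
 have "continuous_on UNIV (%h. \<bar>v \<bullet> h\<bar> - l * norm h)" by (intro continuous_intros)
 moreover have "continuous_on UNIV (%h :: 'a. r - norm h)" by (intro continuous_intros)
 ultimately have "open {h. 0 < \<bar>v \<bullet> h\<bar> - l * norm h}" "open {h :: 'a. 0 < r - norm h}"
  by (auto intro!: open_Collect_less continuous_intros)
 hence op: "open ({h. 0 < \<bar>v \<bullet> h\<bar> - l * norm h} \<inter> {h :: 'a. 0 < r - norm h})" (is "open ?O") by (rule open_Int)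
 have "v \<bullet> ?h = r / 2 * norm v" using v by (simp add: dot_square_norm power2_eq_square)
 hence "?h \<in> ?O" using v r lt by (simp add: mult.commute)
 with op obtain e where e: "0 < e" "ball ?h e \<subseteq> ?O" by (meson open_contains_ball)
 have "AE h in lborel. h \<notin> ball ?h e"
  using ae
 proof eventually_elim
  case (elim h)
  hence "h \<notin> ?O" by auto
  thus ?case using e(2) by blast
 qed
 hence "emeasure lborel (ball ?h e) = 0" by (subst (asm) AE_iff_null_sets [symmetric]) auto
 thus False using e(1) unit_ball_vol_pos [of "real DIM('a)"] by (simp add: emeasure_ball)
qed

text \<open>For almost every \<open>h\<close> the component of the gradient along \<open>h\<close>
  is a limit of difference quotients, hence bounded at almost every \<open>x\<close>. Exchanging the
  two quantifiers yields, at almost every \<open>x\<close>, a bound for almost every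
  direction.\<close>

lemma weak_gradient_lipschitz_bound:
 fixes u :: "'a::euclidean_space => real"
 assumes u: "loc_int u" and r: "0 < r" and l: "0 <= l" and g: "weak_gradient u g"
  and lip: "AE h in lborel. norm h <= r --> (AE x in lborel. \<bar>u (x + h) - u x\<bar> <= l * norm h)"
 shows "AE x in lborel. norm (g x) <= l"
proof -
 obtain g' where [measurable]: "g' \<in> Borel" and g': "AE x in lborel. g x = g' x" "!!h. weak_dir u h (%x. g' x \<bullet> h)"
  using weak_gradient_imp_weak_dir [OF u g] by blast
 have "AE h in lborel. AE x in lborel. norm h <= r --> \<bar>g' x \<bullet> h\<bar> <= l * norm h"
  using AE_lipschitz_dyadic [OF lip]
 proof eventually_elim
  case (elim h)
  show ?case
  proof (cases "norm h <= r")
   case True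
   have all: "AE x in lborel. \<forall>n::nat. \<bar>2 ^ n * (u (x + (1 / 2 ^ n) *\<^sub>R h) - u x)\<bar> <= l * norm h"
    using elim True by (simp only: AE_all_countable) blast
   have "AE x in lborel. norm x <= real R --> \<bar>g' x \<bullet> h\<bar> <= l * norm h" for R :: nat
   proof -
    obtain k :: "nat => nat" where "AE x in lborel. norm x <= real R --> (%n. 2 ^ k n * (u (x + (1 / 2 ^ k n) *\<^sub>R h) - u x)) ----> g' x \<bullet> h"
     using weak_dir_subseq [OF g'(2), of "real R" h] by blast
    with all show ?thesis
    proof eventually_elim
     case (elim x)
     show ?case
     proof
      assume "norm x <= real R"
      hence "(%n. \<bar>2 ^ k n * (u (x + (1 / 2 ^ k n) *\<^sub>R h) - u x)\<bar>) ----> \<bar>g' x \<bullet> h\<bar>"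
       using elim by (intro tendsto_rabs) blast
      thus "\<bar>g' x \<bullet> h\<bar> <= l * norm h" using elim(1) by (intro LIMSEQ_le_const2) auto
     qed
    qed
   qed
   hence "AE x in lborel. \<forall>R::nat. norm x <= real R --> \<bar>g' x \<bullet> h\<bar> <= l * norm h" by (simp only: AE_all_countable) blast
   thus ?thesis by eventually_elim (use real_arch_simple in blast)
  qed simp
 qed
 moreover have "Measurable.pred (borel \<Otimes>\<^sub>M borel) (%z :: 'a \<times> 'a. norm (fst z) <= r --> \<bar>g' (snd z) \<bullet> fst z\<bar> <= l * norm (fst z))" by measurable
 ultimately have "AE x in lborel. AE h in lborel. norm h <= r --> \<bar>g' x \<bullet> h\<bar> <= l * norm h"
  by (subst lborel_pair.AE_commute [symmetric]) (auto simp: pred_def space_pair_measure)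
 with g'(1) show ?thesis
  by eventually_elim (simp add: norm_le_of_AE_inner [OF _ r l])
qed

text \<open>The increment is a mean of the gradient over a segment. For almost every
  \<open>x\<close> the segment meets the null set of large gradient only in a set of length
  0.\<close>

lemma weak_gradient_bounded_imp_lipschitz:
 assumes u: "loc_int u" and l: "0 <= l" and g: "weak_gradient u g" and bd: "AE x in lborel. norm (g x) <= l"
 shows "AE x in lborel. \<bar>u (x + h) - u x\<bar> <= l * norm h"
proof -
 obtain g' where [measurable]: "g' \<in> Borel" and g': "AE x in lborel. g x = g' x" "!!h. weak_dir u h (%x. g' x \<bullet> h)"
  using weak_gradient_imp_weak_dir [OF u g] by blast
 let ?f = "%x. if norm (g' x) <= l then 0 else 1 :: ennreal"
 have [measurable]: "?f \<in> Borel" by measurable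
 have "AE x in lborel. ?f x = 0" using bd g'(1) by eventually_elim simp
 hence "(NN x. ?f x) = 0" by (subst nn_integral_0_iff_AE) auto
 hence "(NN x. NN \<tau>. indicator {0..1::real} \<tau> * ?f (x + \<tau> *\<^sub>R h)) = 0"
  by (subst nn_integral_line_shift) auto
 hence "AE x in lborel. (NN \<tau>. indicator {0..1::real} \<tau> * ?f (x + \<tau> *\<^sub>R h)) = 0"
  by (subst (asm) nn_integral_0_iff_AE) measurable
 with weak_dir_line_mean [OF g'(2) [of h]] show ?thesis
 proof eventually_elim
  case (elim x)
  have "AE \<tau> in lborel. indicator {0..1::real} \<tau> * ?f (x + \<tau> *\<^sub>R h) = 0"
   using elim(2) by (subst (asm) nn_integral_0_iff_AE) measurable
  hence "AE \<tau> in lborel. indicator {0..1::real} \<tau> * ennreal \<bar>g' (x + \<tau> *\<^sub>R h) \<bullet> h\<bar> <= ennreal (l * norm h) * indicator {0..1::real} \<tau>"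
  proof eventually_elim
   case (elim \<tau>)
   show ?case
   proof (cases "\<tau> \<in> {0..1}")
    case True
    hence "norm (g' (x + \<tau> *\<^sub>R h)) <= l" using elim by (auto split: if_splits)
    hence "\<bar>g' (x + \<tau> *\<^sub>R h) \<bullet> h\<bar> <= l * norm h"
     by (rule order_trans [OF Cauchy_Schwarz_ineq2 mult_right_mono]) simp
    thus ?thesis using True by (simp add: ennreal_leI)
   qed simp
  qed
  hence "(NN \<tau>. indicator {0..1::real} \<tau> * ennreal \<bar>g' (x + \<tau> *\<^sub>R h) \<bullet> h\<bar>) <= (NN \<tau>. ennreal (l * norm h) * indicator {0..1::real} \<tau>)"
   by (rule nn_integral_mono_AE)
  also have "... = ennreal (l * norm h)" by (subst nn_integral_cmult_indicator) simp_all
  finally have "ennreal \<bar>line_mean h (%x. g' x \<bullet> h) x\<bar> <= ennreal (l * norm h)"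
   by (rule order_trans [OF abs_line_mean_le])
  thus ?case unfolding elim(1) using l by (subst (asm) ennreal_le_iff) auto
 qed
qed

lemma Lp_norm_infinity_le_iff:
 fixes f :: "'a::euclidean_space => 'b::euclidean_space"
 assumes "f \<in> borel_measurable lebesgue" "0 <= l"
 shows "Lp_norm \<infinity> f <= ennreal l \<longleftrightarrow> (AE x in lborel. norm (f x) <= l)"
proof -
 have "(%x. ennreal (norm (f x))) \<in> borel_measurable lebesgue" using assms(1) by measurable
 thus ?thesis using assms(2) by (simp add: Lp_norm_def esssup_le_iff AE_lebesgue_iff)
qed

text \<open>Increments of length at most \<open>r\<close> already bound the gradient, and the
  gradient bounds increments of every length; so the seminorm is the value at \<open>s = 1\<close>
  of the expression that defines the short-range term.\<close>

lemma sobolev_seminorm_1_infinity: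
 assumes [measurable]: "u \<in> Borel" and fin: "Lp_norm \<infinity> u < \<infinity>" and r: "0 < r"
 shows "sobolev_seminorm 1 \<infinity> u = holder_sup 1 u {(x, y). 0 < norm (x - y) & norm (x - y) <= r}" (is "?L = ?\<Lambda>")
proof (rule antisym)
 have meas: "u \<in> borel_measurable lebesgue" by (rule measurable_completion) simp
 obtain C where C: "0 <= C" "Lp_norm \<infinity> u = ennreal C" using fin by (cases "Lp_norm \<infinity> u") auto
 hence "AE x in lborel. \<bar>u x\<bar> <= C" using Lp_norm_infinity_le_iff [OF meas C(1)] by simp
 hence loc: "loc_int u" by (rule loc_int_bounded [OF assms(1)])
 have L: "?L = (if u \<in> sobolev_space1 \<infinity> then Lp_norm \<infinity> (weak_grad u) else \<infinity>)" by (simp add: sobolev_seminorm_def Let_def)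
 show "?L <= ?\<Lambda>"
 proof (cases ?\<Lambda>)
  case (real l)
  hence lip: "AE h in lborel. norm h <= r --> (AE x in lborel. \<bar>u (x + h) - u x\<bar> <= l * norm h)"
   using holder_sup_lipschitz_iff [OF assms(1), of l r] by simp
  obtain g where "weak_gradient u g" using lipschitz_imp_weak_gradient [OF loc r lip] by blast
  hence wg: "weak_gradient u (weak_grad u)" unfolding weak_grad_def by (rule someI [of "weak_gradient u"])
  have le: "Lp_norm \<infinity> (weak_grad u) <= ennreal l"
   by (subst Lp_norm_infinity_le_iff [OF weak_gradient_measurable [OF wg]])
    (use real weak_gradient_lipschitz_bound [OF loc r _ wg lip] in auto)
  have "weak_grad u \<in> Lp_space \<infinity>"
   using le weak_gradient_measurable [OF wg] le_less_trans [OF le] by (simp add: Lp_space_def)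
  moreover have "u \<in> Lp_space \<infinity>" using meas fin by (simp add: Lp_space_def)
  ultimately have "u \<in> sobolev_space1 \<infinity>" unfolding sobolev_space1_def using wg by blast
  thus ?thesis using L le real by simp
 qed simp
 show "?\<Lambda> <= ?L"
 proof (cases "u \<in> sobolev_space1 \<infinity> & Lp_norm \<infinity> (weak_grad u) < \<infinity>")
  case True
  hence wg: "weak_gradient u (weak_grad u)"
   unfolding sobolev_space1_def weak_grad_def by (auto intro: someI [of "weak_gradient u"])
  obtain l where l: "0 <= l" "Lp_norm \<infinity> (weak_grad u) = ennreal l" using True by (cases "Lp_norm \<infinity> (weak_grad u)") auto
  hence bd: "AE x in lborel. norm (weak_grad u x) <= l"
   using Lp_norm_infinity_le_iff [OF weak_gradient_measurable [OF wg] l(1)] by simp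
  have "?\<Lambda> <= ennreal l"
   unfolding holder_sup_lipschitz_iff [OF assms(1) l(1)]
   by (intro AE_I2 impI weak_gradient_bounded_imp_lipschitz [OF loc l(1) wg bd])
  thus ?thesis using L True l by simp
 next
  case False
  hence "?L = \<infinity>" using L by (auto simp: less_top[symmetric])
  thus ?thesis by simp
 qed
qed

section \<open>The two interactions for infinite exponent\<close>

lemma eventually_at_left_all: "(!!x. x < s ==> P x) ==> eventually P (at_left (s::real))"
 by (auto simp: eventually_at_filter intro!: always_eventually)

lemma eventually_at_right_all: "(!!x. s < x ==> P x) ==> eventually P (at_right (s::real))"
 by (auto simp: eventually_at_filter intro!: always_eventually)

lemma esssup_cmult_ennreal:
 fixes f :: "'b => ennreal"
 assumes [measurable]: "f \<in> borel_measurable M" and c: "0 < c"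
 shows "esssup M (%z. ennreal c * f z) = ennreal c * esssup M f"
proof (rule antisym)
 show "esssup M (%z. ennreal c * f z) <= ennreal c * esssup M f"
 proof (rule esssup_I)
  show "AE z in M. ennreal c * f z <= ennreal c * esssup M f"
   using esssup_AE [of f M] by eventually_elim (rule mult_left_mono, auto)
 qed measurable
 have inv: "ennreal (1 / c) * ennreal c = 1" "ennreal c * ennreal (1 / c) = 1" using c by (simp_all add: ennreal_mult' [symmetric])
 have "esssup M f <= ennreal (1 / c) * esssup M (%z. ennreal c * f z)"
 proof (rule esssup_I)
  show "AE z in M. f z <= ennreal (1 / c) * esssup M (%z. ennreal c * f z)"
   using esssup_AE [of "%z. ennreal c * f z" M]
  proof eventually_elim
   case (elim z)
   hence "ennreal (1 / c) * (ennreal c * f z) <= ennreal (1 / c) * esssup M (%z. ennreal c * f z)" by (rule mult_left_mono) simp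
   thus ?case by (simp only: mult.assoc [symmetric] inv mult_1)
  qed
 qed measurable
 hence "ennreal c * esssup M f <= ennreal c * (ennreal (1 / c) * esssup M (%z. ennreal c * f z))" by (rule mult_left_mono) simp
 thus "ennreal c * esssup M f <= esssup M (%z. ennreal c * f z)" by (simp only: mult.assoc [symmetric] inv mult_1)
qed

lemma holder_sup_eq_esssup:
 fixes u :: "'a::euclidean_space => real" and D w :: "'a \<times> 'a => real"
 assumes [measurable]: "u \<in> Borel" "D \<in> Borel2" "w \<in> Borel2"
  and c: "0 < c" and eq: "!!x y. (x, y) \<in> A ==> \<bar>u x - u y\<bar> / norm (x - y) powr s = c * (D (x, y) * w (x, y) powr a)"
 shows "holder_sup s u A = ennreal c * esssup (restrict_space lebesgue2 A) (%z. ennreal (D z * w z powr a))"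
proof -
 let ?M = "restrict_space lebesgue2 A :: ('a \<times> 'a) measure"
 have f1: "(%z. ennreal (\<bar>u (fst z) - u (snd z)\<bar> / norm (fst z - snd z) powr s)) \<in> borel_measurable ?M"
  by (rule measurable_restrict_space1, rule measurable_lebesgue_pair) measurable
 have f2: "(%z. ennreal (D z * w z powr a)) \<in> borel_measurable ?M"
  by (rule measurable_restrict_space1, rule measurable_lebesgue_pair) measurable
 have "holder_sup s u A = esssup ?M (%z. ennreal c * ennreal (D z * w z powr a))"
  unfolding holder_sup_def split_beta'
 proof (rule esssup_AE_cong [OF f1])
  show "(%z. ennreal c * ennreal (D z * w z powr a)) \<in> borel_measurable ?M" using f2 by measurable
  show "AE z in ?M. ennreal (\<bar>u (fst z) - u (snd z)\<bar> / norm (fst z - snd z) powr s) = ennreal c * ennreal (D z * w z powr a)"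
  proof (rule AE_I2)
   fix z assume "z \<in> space ?M"
   hence "(fst z, snd z) \<in> A" by (simp add: space_restrict_space)
   from eq [OF this] show "ennreal (\<bar>u (fst z) - u (snd z)\<bar> / norm (fst z - snd z) powr s) = ennreal c * ennreal (D z * w z powr a)"
    using c by (simp add: ennreal_mult')
  qed
 qed
 also have "... = ennreal c * esssup ?M (%z. ennreal (D z * w z powr a))" by (rule esssup_cmult_ennreal [OF f2 c])
 finally show ?thesis .
qed

lemma short_range_infinity:
 fixes u :: "'a::euclidean_space => real"
 assumes [measurable]: "u \<in> Borel" and fin: "Lp_norm \<infinity> u < \<infinity>" and r: "0 < r"
 shows "continuous_on {s \<in> {0..1}. short_range \<infinity> s u r < \<infinity>} (%s. short_range \<infinity> s u r)"
  and "s \<in> {0<..1} ==> ((%\<tau>. short_range \<infinity> \<tau> u r) ---> short_range \<infinity> s u r) (at_left s)"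
  and "0 <= \<eta> ==> \<eta> < s ==> s <= 1 ==> short_range \<infinity> \<eta> u r <= short_range \<infinity> s u r"
  and "0 <= \<eta> ==> \<eta> < s ==> s <= 1 ==>
   ennreal (2 powr (- \<eta>)) * short_range \<infinity> \<eta> u r <= ennreal (2 powr (- s)) * short_range \<infinity> s u r"
proof -
 let ?A = "{(x, y). 0 < norm (x - y) & norm (x - y) <= r} :: ('a \<times> 'a) set"
 let ?M = "restrict_space lebesgue2 ?A :: ('a \<times> 'a) measure"
 \<comment> \<open>On the set considered, the quotient of order \<open>s\<close> is
   \<open>r powr (1 - s)\<close> times \<open>D\<close> times the power \<open>1 - s\<close> of the
   weight \<open>w <= 1\<close>; outside \<open>w\<close> is 1, to keep it in
   \<open>(0, 1]\<close>.\<close>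
 define D where "D = (%z. \<bar>u (fst z) - u (snd z)\<bar> / norm (fst z - snd z))"
 define w where "w = (%z :: 'a \<times> 'a. if 0 < norm (fst z - snd z) & norm (fst z - snd z) <= r then norm (fst z - snd z) / r else 1)"
 have Dw [measurable]: "D \<in> Borel2" "w \<in> Borel2"
  unfolding D_def w_def by measurable
 note meas = Dw [THEN measurable_lebesgue_pair, THEN measurable_restrict_space1, of ?A]
 have D: "0 <= D z" for z by (simp add: D_def)
 have w: "0 < w z" "w z <= 1" for z using r by (auto simp: w_def)
 define S where "S = (%a. esssup ?M (%z. ennreal (D z * w z powr a)))"
 let ?L = "%s. short_range \<infinity> s u r" and ?h = "%s. ennreal (2 powr (- (1 - s))) * S (1 - s)"
 have H: "holder_sup s u ?A = ennreal (r powr (1 - s)) * S (1 - s)" for s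
  unfolding S_def
 proof (rule holder_sup_eq_esssup)
  fix x y :: 'a assume "(x, y) \<in> ?A"
  hence n: "0 < norm (x - y)" "norm (x - y) <= r" by auto
  have "w (x, y) powr (1 - s) = norm (x - y) powr (1 - s) / r powr (1 - s)" using n r by (simp add: w_def powr_divide)
  hence "r powr (1 - s) * (D (x, y) * w (x, y) powr (1 - s)) = \<bar>u x - u y\<bar> / norm (x - y) * norm (x - y) powr (1 - s)"
   using r by (simp add: D_def)
  also have "... = \<bar>u x - u y\<bar> / norm (x - y) powr s" using n by (simp add: powr_diff)
  finally show "\<bar>u x - u y\<bar> / norm (x - y) powr s = r powr (1 - s) * (D (x, y) * w (x, y) powr (1 - s))" by simp
 qed (use r in auto)
 have eq: "?L s = ?h s" if "s <= 1" for s
 proof (cases "s = 1")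
  case True
  thus ?thesis using sobolev_seminorm_1_infinity [OF assms] H [of 1] r by (simp add: short_range_def)
 next
  case False
  have "(2 * r) powr (- (1 - s)) * r powr (1 - s) = 2 powr (- (1 - s))"
   using r by (simp add: powr_mult powr_add [symmetric])
  hence "ennreal ((2 * r) powr (- (1 - s))) * ennreal (r powr (1 - s)) = ennreal (2 powr (- (1 - s)))"
   by (simp only: ennreal_mult' [symmetric] powr_ge_zero)
  thus ?thesis using False unfolding short_range_def H by (simp add: mult.assoc [symmetric])
 qed
 have S_mono: "S a <= S b" if "b <= a" for a b
  unfolding S_def by (rule esssup_powr_antimono [OF meas D w that])
 have S_right: "(S ---> S c) (at_right c)" for c
  using esssup_powr_right [OF meas D w, of c] unfolding S_def .
 have S_left: "(S ---> S c) (at_left c)" if "b < c" "S b < \<infinity>" for b c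
  using esssup_powr_left [OF meas D w that(1)] that(2) unfolding S_def .
 have hlim: "(?h ---> ?h s) F" if "((%s. S (1 - s)) ---> S (1 - s)) F" "((%s. s) ---> s) F" for s F
  using that by (intro tendsto_mult_ennreal_pos tendsto_ennrealI tendsto_intros) auto
 have left: "(?L ---> ?L s) (at_left s)" if "s <= 1" for s
 proof -
  have "(?h ---> ?h s) (at_left s)"
   using filterlim_mult_right_at_left(3) [of 1 s] by (intro hlim filterlim_compose [OF S_right]) simp_all
  moreover have "\<forall>\<^sub>F \<tau> in at_left s. ?h \<tau> = ?L \<tau>"
   by (rule eventually_at_left_all) (rule eq [symmetric], use that in linarith)
  ultimately have "(?L ---> ?h s) (at_left s)" by (rule Lim_transform_eventually)
  thus ?thesis using eq [OF that] by simp
 qed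
 thus "s \<in> {0<..1} ==> (?L ---> ?L s) (at_left s)" by simp
 show "?L \<eta> <= ?L s" if "0 <= \<eta>" "\<eta> < s" "s <= 1"
 proof -
  have "?h \<eta> <= ?h s" using that by (intro mult_mono S_mono ennreal_leI powr_mono) auto
  thus ?thesis using eq [of \<eta>] eq [of s] that by simp
 qed
 \<comment> \<open>\<open>2 powr (- s)\<close> times the short-range term is half of
   \<open>S (1 - s)\<close>, so the better estimate is the plain monotonicity of
   \<open>S\<close>.\<close>
 show "ennreal (2 powr (- \<eta>)) * ?L \<eta> <= ennreal (2 powr (- s)) * ?L s" if "0 <= \<eta>" "\<eta> < s" "s <= 1"
 proof -
  have "ennreal (2 powr (- s)) * ?h s = ennreal (1 / 2) * S (1 - s)" for s
  proof -
   have "2 powr (- s) * 2 powr (- (1 - s)) = (1 / 2 :: real)" unfolding powr_add [symmetric] by (simp add: powr_minus_divide)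
   hence "ennreal (2 powr (- s)) * ennreal (2 powr (- (1 - s))) = ennreal (1 / 2)"
    by (simp only: ennreal_mult' [symmetric] powr_ge_zero)
   thus ?thesis by (simp only: mult.assoc [symmetric])
  qed
  moreover have "ennreal (1 / 2) * S (1 - \<eta>) <= ennreal (1 / 2) * S (1 - s)"
   using that by (intro mult_left_mono S_mono) auto
  ultimately show ?thesis using eq [of \<eta>] eq [of s] that by simp
 qed
 show "continuous_on {s \<in> {0..1}. ?L s < \<infinity>} ?L"
 proof (rule continuous_on_one_sided)
  fix s b assume *: "s \<in> {s \<in> {0..1}. ?L s < \<infinity>}" "b \<in> {s \<in> {0..1}. ?L s < \<infinity>}"
  show "(?L ---> ?L s) (at_left s)" using * by (intro left) auto
  show "(?L ---> ?L s) (at_right s)" if "s < b"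
  proof -
   have "S (1 - b) < \<infinity>" using * eq [of b] by (auto simp: ennreal_mult_less_top)
   hence "(?h ---> ?h s) (at_right s)"
    using filterlim_mult_right_at_left(4) [of 1 s] that
    by (intro hlim filterlim_compose [OF S_left [of "1 - b"]]) simp_all
   moreover have "\<forall>\<^sub>F \<tau> in at_right s. ?h \<tau> = ?L \<tau>"
    unfolding eventually_at_right_field using that * by (intro exI [of _ b] conjI allI impI eq [symmetric]) auto
   ultimately have "(?L ---> ?h s) (at_right s)" by (rule Lim_transform_eventually)
   thus ?thesis using eq [of s] * by simp
  qed
 qed
qed

lemma holder_sup_mono:
 assumes u: "u \<in> Borel" and A: "A \<in> sets (borel \<Otimes>\<^sub>M borel)" "B \<in> sets (borel \<Otimes>\<^sub>M borel)" "A \<subseteq> B"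
 shows "holder_sup s u A <= holder_sup s u B"
proof -
 have "AE h in lborel. AE x in lborel. (x, x + h) \<in> B --> ennreal (\<bar>u x - u (x + h)\<bar> / norm h powr s) <= holder_sup s u B"
  by (subst holder_sup_le_iff [OF u A(2), symmetric]) simp
 hence "AE h in lborel. AE x in lborel. (x, x + h) \<in> A --> ennreal (\<bar>u x - u (x + h)\<bar> / norm h powr s) <= holder_sup s u B"
 proof eventually_elim
  case (elim h)
  thus ?case by eventually_elim (use A(3) in blast)
 qed
 thus ?thesis by (subst holder_sup_le_iff [OF u A(1)])
qed

lemma long_range_infinity_le:
 fixes u :: "'a::euclidean_space => real"
 assumes [measurable]: "u \<in> Borel" and fin: "Lp_norm \<infinity> u < \<infinity>" and r: "0 < r" and s: "0 < s"
 shows "long_range \<infinity> s u r <= 2 * Lp_norm \<infinity> u"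
proof -
 have meas: "u \<in> borel_measurable lebesgue" by (rule measurable_completion) simp
 obtain C where C: "0 <= C" "Lp_norm \<infinity> u = ennreal C" using fin by (cases "Lp_norm \<infinity> u") auto
 have ae: "AE x in lborel. \<bar>u x\<bar> <= C" using Lp_norm_infinity_le_iff [OF meas C(1)] C(2) by simp
 have "holder_sup s u {(x, y). norm (x - y) \<ge> r} <= ennreal (2 * C / r powr s)"
  unfolding holder_sup_le_iff [OF assms(1) sets_pair_norm(2)]
 proof (rule AE_I2)
  fix h :: 'a
  show "AE x in lborel. (x, x + h) \<in> {(x, y). norm (x - y) \<ge> r} --> ennreal (\<bar>u x - u (x + h)\<bar> / norm h powr s) <= ennreal (2 * C / r powr s)"
   using ae AE_lborel_shift [OF ae, of h]
  proof eventually_elim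
   case (elim x)
   show ?case
   proof
    assume "(x, x + h) \<in> {(x, y). norm (x - y) \<ge> r}"
    hence h: "r <= norm h" by (simp add: norm_minus_commute)
    hence "r powr s <= norm h powr s" using r s by (intro powr_mono2) auto
    moreover have "0 < r powr s" using r by simp
    moreover have "\<bar>u x - u (x + h)\<bar> <= 2 * C" using elim by linarith
    ultimately show "ennreal (\<bar>u x - u (x + h)\<bar> / norm h powr s) <= ennreal (2 * C / r powr s)"
     using C(1) by (intro ennreal_leI frac_le) auto
   qed
  qed
 qed
 hence "ennreal (r powr s) * holder_sup s u {(x, y). norm (x - y) \<ge> r} <= ennreal (r powr s) * ennreal (2 * C / r powr s)"
  by (rule mult_left_mono) simp
 also have "... = ennreal (2 * C)" using r by (simp add: ennreal_mult' [symmetric])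
 also have "... = 2 * Lp_norm \<infinity> u" unfolding C(2) using C(1) by (simp add: ennreal_mult')
 finally show ?thesis using s by (simp add: long_range_def)
qed

lemma long_range_infinity:
 fixes u :: "'a::euclidean_space => real"
 assumes [measurable]: "u \<in> Borel" and fin: "Lp_norm \<infinity> u < \<infinity>" and r: "0 < r"
 shows "continuous_on {0<..1} (%s. long_range \<infinity> s u r)"
  and "0 <= \<sigma> ==> \<sigma> < \<eta> ==> \<eta> <= 1 ==> long_range \<infinity> \<eta> u r <= 2 * long_range \<infinity> \<sigma> u r"
  and "0 <= \<sigma> ==> \<sigma> < \<eta> ==> \<eta> <= 1 ==> long_range \<infinity> \<eta> u r <= ennreal (2 * r powr \<sigma>) * sobolev_seminorm \<sigma> \<infinity> u"
proof -
 let ?A = "{(x, y). norm (x - y) \<ge> r} :: ('a \<times> 'a) set"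
 let ?M = "restrict_space lebesgue2 ?A :: ('a \<times> 'a) measure"
 \<comment> \<open>Here \<open>w\<close> is \<open>r\<close> divided by the distance, at most 1 on
   the set, so that the long-range term is \<open>S s\<close> without any prefactor.\<close>
 define D where "D = (%z. \<bar>u (fst z) - u (snd z)\<bar>)"
 define w where "w = (%z :: 'a \<times> 'a. if r <= norm (fst z - snd z) then r / norm (fst z - snd z) else 1)"
 have Dw [measurable]: "D \<in> Borel2" "w \<in> Borel2"
  unfolding D_def w_def by measurable
 note meas = Dw [THEN measurable_lebesgue_pair, THEN measurable_restrict_space1, of ?A]
 have D: "0 <= D z" for z by (simp add: D_def)
 have w: "0 < w z" "w z <= 1" for z
  using r less_le_trans [OF r, of "norm (fst z - snd z)"] by (auto simp: w_def divide_le_eq)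
 define S where "S = (%a. esssup ?M (%z. ennreal (D z * w z powr a)))"
 let ?T = "%s. long_range \<infinity> s u r"
 have H: "holder_sup s u ?A = ennreal (r powr (- s)) * S s" for s
  unfolding S_def
 proof (rule holder_sup_eq_esssup)
  fix x y :: 'a assume "(x, y) \<in> ?A"
  hence n: "r <= norm (x - y)" by auto
  have "w (x, y) powr s = r powr s / norm (x - y) powr s" using n r by (simp add: w_def powr_divide)
  thus "\<bar>u x - u y\<bar> / norm (x - y) powr s = r powr (- s) * (D (x, y) * w (x, y) powr s)"
   using r by (simp add: D_def powr_minus)
 qed (use r in auto)
 have eq: "?T s = S s" if "0 < s" for s
 proof -
  have "ennreal (r powr s) * ennreal (r powr (- s)) = 1" using r by (simp add: ennreal_mult' [symmetric] powr_minus)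
  thus ?thesis using that unfolding long_range_def H by (simp add: mult.assoc [symmetric])
 qed
 have S_mono: "S a <= S b" if "b <= a" for a b
  unfolding S_def by (rule esssup_powr_antimono [OF meas D w that])
 show "continuous_on {0<..1} ?T"
 proof (rule continuous_on_one_sided)
  fix s b :: real assume *: "s \<in> {0<..1}" "b \<in> {0<..1}"
  have s0: "0 < s" using * by simp
  \<comment> \<open>The left limit needs a finite value at a smaller exponent; for
    \<open>s > 0\<close> the bound by twice the norm of \<open>u\<close> provides it.\<close>
  have "S (s / 2) < \<infinity>"
  proof -
   have "S (s / 2) <= 2 * Lp_norm \<infinity> u" using long_range_infinity_le [OF assms, of "s / 2"] eq [of "s / 2"] * by simp
   also have "... < \<infinity>" using fin by (simp add: ennreal_mult_less_top)
   finally show ?thesis .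
  qed
  hence "(S ---> S s) (at_left s)"
   using esssup_powr_left [OF meas D w, of "s / 2" s] * unfolding S_def by simp
  moreover have "\<forall>\<^sub>F \<tau> in at_left s. S \<tau> = ?T \<tau>"
   using eventually_at_left_real [OF s0] by (rule eventually_mono) (rule eq [symmetric], simp)
  ultimately have "(?T ---> S s) (at_left s)" by (rule Lim_transform_eventually)
  thus "(?T ---> ?T s) (at_left s)" using eq [OF s0] by simp
  have "(S ---> S s) (at_right s)" using esssup_powr_right [OF meas D w, of s] unfolding S_def .
  moreover have "\<forall>\<^sub>F \<tau> in at_right s. S \<tau> = ?T \<tau>"
   by (rule eventually_at_right_all) (rule eq [symmetric], use s0 in linarith)
  ultimately have "(?T ---> S s) (at_right s)" by (rule Lim_transform_eventually)
  thus "(?T ---> ?T s) (at_right s)" using eq [OF s0] by simp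
 qed
 have T0: "?T 0 = Lp_norm \<infinity> u" by (simp add: long_range_def sobolev_seminorm_def Let_def)
 show C: "?T \<eta> <= 2 * ?T \<sigma>" if "0 <= \<sigma>" "\<sigma> < \<eta>" "\<eta> <= 1" for \<sigma> \<eta>
 proof (cases "\<sigma> = 0")
  case True
  thus ?thesis using long_range_infinity_le [OF assms, of \<eta>] that T0 by simp
 next
  case False
  hence "1 * ?T \<eta> <= 2 * ?T \<sigma>" using eq [of \<sigma>] eq [of \<eta>] S_mono [of \<sigma> \<eta>] that by (intro mult_mono) auto
  thus ?thesis by simp
 qed
 show "?T \<eta> <= ennreal (2 * r powr \<sigma>) * sobolev_seminorm \<sigma> \<infinity> u" if "0 <= \<sigma>" "\<sigma> < \<eta>" "\<eta> <= 1"
 proof (cases "\<sigma> = 0")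
  case True
  thus ?thesis using C [OF that] r by (simp add: long_range_def)
 next
  case False
  have "holder_sup \<sigma> u ?A <= holder_sup \<sigma> u {(x, y). x ~= y}"
   by (rule holder_sup_mono [OF assms(1) sets_pair_norm(2,3)]) (use r in auto)
  hence "2 * (ennreal (r powr \<sigma>) * holder_sup \<sigma> u ?A) <= 2 * (ennreal (r powr \<sigma>) * sobolev_seminorm \<sigma> \<infinity> u)"
   using False that by (intro mult_left_mono) (auto simp: sobolev_seminorm_def Let_def)
  hence "2 * ?T \<sigma> <= ennreal (2 * r powr \<sigma>) * sobolev_seminorm \<sigma> \<infinity> u"
   using False by (simp add: long_range_def ennreal_mult' mult.assoc)
  thus ?thesis using C [OF that] by (rule order_trans [rotated])
 qed
qed

lemma AE_lebesgue_pair_both: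
 fixes P :: "'a::euclidean_space => bool"
 assumes "AE x in lborel. P x"
 shows "AE z in lebesgue2. P (fst z) & P (snd z)"
proof -
 obtain N where N: "N \<in> null_sets lborel" "{x. \<not> P x} \<subseteq> N"
  using assms by (auto simp: eventually_ae_filter)
 hence [measurable]: "N \<in> sets borel" by auto
 have ae: "AE x in lborel. x \<notin> N" using N(1) by (rule AE_not_in)
 have "AE x in lborel. x \<notin> N & x + h \<notin> N" for h
  using ae AE_lborel_shift [OF ae, of h] by eventually_elim simp
 hence "AE z in lebesgue2. fst z \<notin> N & snd z \<notin> N"
  by (subst AE_lebesgue_pair_iff) auto
 thus ?thesis by eventually_elim (use N(2) in auto)
qed

section \<open>Independence of the representative\<close>

context
 fixes u u' :: "'a::euclidean_space => real"
 assumes meas [measurable]: "u \<in> borel_measurable lebesgue" "u' \<in> borel_measurable lebesgue"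
  and ae: "AE x in lborel. u x = u' x"
begin

private lemma ae_lebesgue: "AE x in lebesgue. u x = u' x"
 using ae by (simp add: AE_lebesgue_iff)

private lemma Lp_norm_AE: "Lp_norm p u = Lp_norm p u'"
proof -
 have "esssup lebesgue (%x. ennreal (norm (u x))) = esssup lebesgue (%x. ennreal (norm (u' x)))"
 proof (rule esssup_AE_cong)
  show "AE x in lebesgue. ennreal (norm (u x)) = ennreal (norm (u' x))" using ae_lebesgue by eventually_elim simp
 qed measurable
 moreover have "(\<integral>\<^sup>+x. ennreal (norm (u x) powr enn2real p) \<partial>lebesgue) = (\<integral>\<^sup>+x. ennreal (norm (u' x) powr enn2real p) \<partial>lebesgue)"
  by (rule nn_integral_cong_AE) (use ae_lebesgue in eventually_elim, simp)
 ultimately show ?thesis by (simp add: Lp_norm_def)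
qed

private lemma Lp_space_AE: "u \<in> Lp_space p \<longleftrightarrow> u' \<in> Lp_space p"
 using meas by (simp add: Lp_space_def Lp_norm_AE)

private lemma test_integral_AE:
 assumes "test_function \<phi>"
 shows "(LINT x|lebesgue. u x * frechet_derivative \<phi> (at x) i) = (LINT x|lebesgue. u' x * frechet_derivative \<phi> (at x) i)"
proof -
 have "dir_deriv i \<phi> \<in> borel_measurable lborel" using test_function_measurable(2) [OF assms] by simp
 hence [measurable]: "dir_deriv i \<phi> \<in> borel_measurable lebesgue" by (rule measurable_completion)
 show ?thesis unfolding dir_deriv_def [symmetric]
 proof (rule integral_cong_AE)
  show "AE x in lebesgue. u x * dir_deriv i \<phi> x = u' x * dir_deriv i \<phi> x" using ae_lebesgue by eventually_elim simp
 qed measurable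
qed

text \<open>Equality of the two predicates makes the choice in \<open>weak_grad\<close> the same
  function for both representatives.\<close>

private lemma weak_gradient_AE: "weak_gradient u = weak_gradient u'"
 by (intro ext) (auto simp: weak_gradient_def test_integral_AE)

private lemma sobolev_space1_AE: "u \<in> sobolev_space1 p \<longleftrightarrow> u' \<in> sobolev_space1 p"
 by (simp add: sobolev_space1_def Lp_space_AE weak_gradient_AE)

private lemma BV_space_AE: "u \<in> BV_space \<longleftrightarrow> u' \<in> BV_space"
 unfolding BV_space_def mem_Collect_eq Lp_space_AE
 by (intro arg_cong2 [where f = "(\<and>)"] refl arg_cong [where f = Ex] ext) (auto simp: test_integral_AE)

private lemma pair_measurable:
 assumes [measurable]: "v \<in> borel_measurable lebesgue"
 shows "(%z :: 'a \<times> 'a. ennreal (\<bar>v (fst z) - v (snd z)\<bar> powr q / norm (fst z - snd z) powr s)) \<in> borel_measurable lebesgue2"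
  "(%z :: 'a \<times> 'a. ennreal (\<bar>v (fst z) - v (snd z)\<bar> / norm (fst z - snd z) powr s)) \<in> borel_measurable lebesgue2"
proof -
 have [measurable]: "(%z :: 'a \<times> 'a. norm (fst z - snd z) powr s) \<in> borel_measurable lebesgue2"
  by (rule measurable_lebesgue_pair) measurable
 show "(%z :: 'a \<times> 'a. ennreal (\<bar>v (fst z) - v (snd z)\<bar> powr q / norm (fst z - snd z) powr s)) \<in> borel_measurable lebesgue2"
  "(%z :: 'a \<times> 'a. ennreal (\<bar>v (fst z) - v (snd z)\<bar> / norm (fst z - snd z) powr s)) \<in> borel_measurable lebesgue2"
  by measurable
qed

private lemma holder_sup_AE:
 assumes "A \<in> sets (borel \<Otimes>\<^sub>M borel)"
 shows "holder_sup s u A = holder_sup s u' A"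
proof -
 have "indicator A \<in> borel_measurable ((lebesgue :: 'a measure) \<Otimes>\<^sub>M (lebesgue :: 'a measure))"
  by (rule measurable_lebesgue_pair) (use assms in measurable)
 hence A: "A \<in> sets ((lebesgue :: 'a measure) \<Otimes>\<^sub>M lebesgue)" by (subst (asm) borel_measurable_indicator_iff) (simp add: space_pair_measure)
 show ?thesis
  unfolding holder_sup_def split_beta'
 proof (rule esssup_AE_cong)
  show "AE z in restrict_space lebesgue2 A. ennreal (\<bar>u (fst z) - u (snd z)\<bar> / norm (fst z - snd z) powr s) = ennreal (\<bar>u' (fst z) - u' (snd z)\<bar> / norm (fst z - snd z) powr s)"
   using A by (subst AE_restrict_space_iff) (auto simp: space_pair_measure intro: eventually_mono [OF AE_lebesgue_pair_both [OF ae]])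
 qed (rule measurable_restrict_space1, rule pair_measurable, rule meas)+
qed

private lemma sobolev_seminorm_AE: "sobolev_seminorm s p u = sobolev_seminorm s p u'"
proof -
 have gagliardo: "(\<integral>\<^sup>+(x, y). ennreal (\<bar>u x - u y\<bar> powr q / norm (x - y) powr c) \<partial>lebesgue2)
   = (\<integral>\<^sup>+(x, y). ennreal (\<bar>u' x - u' y\<bar> powr q / norm (x - y) powr c) \<partial>lebesgue2)" for q c
  unfolding split_beta' by (rule nn_integral_cong_AE, rule eventually_mono [OF AE_lebesgue_pair_both [OF ae]]) simp
 have "weak_grad u = weak_grad u'" by (simp add: weak_grad_def weak_gradient_AE)
 thus ?thesis
  unfolding sobolev_seminorm_def Let_def Lp_norm_AE sobolev_space1_AE holder_sup_AE [OF sets_pair_norm(3)] gagliardo by (simp only:)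
qed

private lemma U_fun_AE: "U_fun q u t = U_fun q u' t"
proof -
 have "(\<integral>\<^sup>+x. apow q (u (x + h) - u x) \<partial>lebesgue) = (\<integral>\<^sup>+x. apow q (u' (x + h) - u' x) \<partial>lebesgue)" for h
 proof (rule nn_integral_cong_AE)
  show "AE x in lebesgue. (apow q (u (x + h) - u x)) = apow q (u' (x + h) - u' x)"
   unfolding AE_lebesgue_iff using ae AE_lborel_shift [OF ae, of h] by eventually_elim simp
 qed
 thus ?thesis by (simp add: U_fun_def)
qed

private lemma U_integral_AE: "U_integral s p u I = U_integral s p u' I"
 by (simp add: U_integral_def U_fun_AE)

lemma interactions_AE:
 "short_range p s u r = short_range p s u' r" "long_range p s u r = long_range p s u' r"
 "sobolev_seminorm s p u = sobolev_seminorm s p u'" "U_integral s p u I = U_integral s p u' I"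
 "u \<in> Lp_space p \<longleftrightarrow> u' \<in> Lp_space p" "u \<in> BV_space - sobolev_space1 1 \<longleftrightarrow> u' \<in> BV_space - sobolev_space1 1"
 unfolding short_range_def long_range_def sobolev_seminorm_AE U_integral_AE holder_sup_AE [OF sets_pair_norm(1)] holder_sup_AE [OF sets_pair_norm(2)]
 by (rule refl | simp add: Lp_space_AE BV_space_AE sobolev_space1_AE)+

end

theorem theorem1p3:
  fixes u :: "'a::euclidean_space \<Rightarrow> real" and p :: ennreal and r :: real
  assumes "1 \<le> p" and "u \<in> Lp_space p" and "0 < r"
  (* (A) As a [0,\<infinity>]-valued map the short-range term is left-continuous, and it is continuous
     where it is finite. Right-continuity fails at s < 1 if the value is finite at s but infinite
     to the right of s; left-continuity fails at s = 1 for p = 1 and u in BV but not in W^{1,1}.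
     (B) For p = \<infinity> and u a nonzero constant, continuity of the long-range term fails at s = 0. *)
  shows
    "(continuous_on {s \<in> {0..1}. short_range p s u r < \<infinity>} (\<lambda>s. short_range p s u r) \<and>
      (\<forall>s\<in>{0<..1}. \<not> (p = 1 \<and> s = 1 \<and> u \<in> BV_space - sobolev_space1 1) \<longrightarrow>
         ((\<lambda>\<tau>. short_range p \<tau> u r) \<longlongrightarrow> short_range p s u r) (at_left s)) \<and>
      (\<forall>\<eta> s. 0 \<le> \<eta> \<and> \<eta> < s \<and> s \<le> 1 \<longrightarrow>
         short_range p \<eta> u r \<le> short_range p s u r \<and>
         (p = \<infinity> \<longrightarrow>
           ennreal (2 powr (- \<eta>)) * short_range \<infinity> \<eta> u r \<le>
           ennreal (2 powr (- s)) * short_range \<infinity> s u r)))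
     \<and>
     (continuous_on (if p = \<infinity> then {0<..1} else {0..1}) (\<lambda>s. long_range p s u r) \<and>
      (\<forall>\<sigma> \<eta>. 0 \<le> \<sigma> \<and> \<sigma> < \<eta> \<and> \<eta> \<le> 1 \<longrightarrow>
         long_range p \<eta> u r \<le>
           ennreal (2 powr (1 + recip p) * r powr \<sigma> * (1 - \<sigma>) powr (- recip p)) *
           sobolev_seminorm \<sigma> p u \<and>
         (0 < \<sigma> \<and> p < \<infinity> \<longrightarrow>
           long_range p \<eta> u r \<le>
             ennreal (2 powr (1 + recip p) * \<sigma> powr recip p * r powr \<sigma>) *
             rpow (U_integral \<sigma> p u {0<..}) (recip p) \<and>
           ennreal (2 powr (1 + recip p) * \<sigma> powr recip p * r powr \<sigma>) *
             rpow (U_integral \<sigma> p u {0<..}) (recip p) =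
           ennreal (2 powr (1 + recip p) * r powr \<sigma> * (1 - \<sigma>) powr (- recip p)) *
             sobolev_seminorm \<sigma> p u)))
     \<and>
     (\<forall>\<sigma> \<eta>. 0 \<le> \<sigma> \<and> \<sigma> < \<eta> \<and> \<eta> \<le> 1 \<and>
         (2 \<le> DIM('a) \<or> \<sigma> = 0 \<or> p = 2 \<or> p = \<infinity>) \<longrightarrow>
         long_range p \<eta> u r \<le> 2 * long_range p \<sigma> u r)"
proof -
 have meas: "u \<in> borel_measurable lebesgue" using assms(2) by (simp add: Lp_space_def)
 \<comment> \<open>The definitions involve only Lebesgue measurable functions up to null sets, so a
   Borel representative may replace \<open>u\<close> in every quantity of the statement.\<close>
 from borel_version [OF meas] obtain v where v [measurable]: "v \<in> Borel" and uv: "AE x in lborel. u x = v x" by blast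
 have "v \<in> borel_measurable lebesgue" by (rule measurable_completion) (use v in simp)
 note eq = interactions_AE [OF meas this uv]
 have Lp: "v \<in> Lp_space p" using assms(2) eq(5) by blast
 note r = assms(3)
 from assms(1) show ?thesis
 proof (cases rule: ennreal_top_cases)
  case 1
  have fin: "Lp_norm \<infinity> v < \<infinity>" using Lp by (simp add: 1 Lp_space_def)
  have recip: "recip top = 0" by (simp add: recip_def)
  note sr = short_range_infinity [OF v fin r] and lr = long_range_infinity [OF v fin r]
  have B: "long_range \<infinity> \<eta> v r <= ennreal (2 powr (1 + recip \<infinity>) * r powr \<sigma> * (1 - \<sigma>) powr (- recip \<infinity>)) * sobolev_seminorm \<sigma> \<infinity> v"
   if "0 <= \<sigma> & \<sigma> < \<eta> & \<eta> <= 1" for \<sigma> \<eta>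
   using lr(3) [of \<sigma> \<eta>] that by (simp add: recip)
  show ?thesis
   unfolding 1 eq by (intro conjI ballI allI impI) (use sr lr(1,2) B in auto)
 next
  case (2 q)
  have q0: "0 < q" using 2 by simp
  have N: "(NN x. apow q (v x)) < \<infinity>"
   using Lp q0 unfolding 2 by (simp add: Lp_space_def Lp_norm_ennreal rpow_less_top_iff nn_integral_completion)
  have recip: "recip p = 1 / q" unfolding 2 by (rule recip_ennreal [OF q0])
  have p_eq: "p = 1 \<longleftrightarrow> q = 1" "p = 2 \<longleftrightarrow> q = 2" "p ~= \<infinity>" "p < \<infinity>"
   using q0 unfolding 2 by (auto simp: ennreal_eq_1 simp flip: ennreal_numeral)
  note sr = short_range_finite_exponent [OF v 2(1) N r, folded 2(2)]
   and lr = long_range_finite_exponent [OF v 2(1) N r, folded 2(2) recip]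
  have id: "ennreal (2 powr (1 + recip p) * \<sigma> powr recip p * r powr \<sigma>) * rpow (U_integral \<sigma> p v {0<..}) (recip p)
    = ennreal (2 powr (1 + recip p) * r powr \<sigma> * (1 - \<sigma>) powr (- recip p)) * sobolev_seminorm \<sigma> p v"
   if "0 < \<sigma>" "\<sigma> < 1" for \<sigma>
   using sobolev_seminorm_fractional [OF v 2(1) that r] unfolding recip 2(2) [symmetric] .
  have B: "long_range p \<eta> v r <= ennreal (2 powr (1 + recip p) * r powr \<sigma> * (1 - \<sigma>) powr (- recip p)) * sobolev_seminorm \<sigma> p v"
   if "0 <= \<sigma>" "\<sigma> < \<eta>" "\<eta> <= 1" for \<sigma> \<eta>
  proof (cases "\<sigma> = 0")
   case True
   \<comment> \<open>For \<open>\<sigma> = 0\<close> the estimate (B) follows from (C), whose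
     constant 2 is at most \<open>2 powr (1 + recip p)\<close>.\<close>
   have "2 powr 1 <= 2 powr (1 + recip p)" using q0 recip by (intro powr_mono) auto
   hence "ennreal 2 <= ennreal (2 powr (1 + recip p))" by (intro ennreal_leI) simp
   hence "2 * long_range p 0 v r <= ennreal (2 powr (1 + recip p)) * long_range p 0 v r"
    by (intro mult_right_mono) auto
   thus ?thesis using lr(2) [of 0 \<eta>] that True r by (simp add: long_range_def)
  next
   case False
   thus ?thesis using lr(3) [of \<sigma> \<eta>] id [of \<sigma>] that by simp
  qed
  show ?thesis
   unfolding eq
  proof (intro conjI ballI allI impI)
   show "continuous_on (if p = \<infinity> then {0<..1} else {0..1}) (%s. long_range p s v r)" using lr(1) p_eq by simp
   fix \<sigma> \<eta> :: real assume "0 <= \<sigma> & \<sigma> < \<eta> & \<eta> <= 1 & (2 <= DIM('a) \<or> \<sigma> = 0 \<or> p = 2 \<or> p = \<infinity>)"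
   thus "long_range p \<eta> v r <= 2 * long_range p \<sigma> v r" using lr(2) [of \<sigma> \<eta>] p_eq by auto
  qed (use sr lr(3) B id p_eq in auto)
 qed
qed

end
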